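(* Let $u\in\mathcal L^{1,2,1-}$. Then for all $t\in[0,T]$ the process $s\mapsto u_s1_{[0,t]}(s)$ belongs to $\mathrm{Dom}_1\,\delta^-$, and $$\int_0^t u_s\,\mathrm d^-W_s=\int_0^t u_s\,\mathrm dW_s+\int_0^t (D^-u)_s\,\mathrm ds .$$
   Context: Fix $T>0$. $W=\{W_t\}_{0\le t\le T}$ is a standard Brownian motion on $(\Omega,\mathcal F_T,\{\mathcal F_t\}_{0\le t\le T},\mathbb P)$, where $\{\mathcal F_t\}$ is the $\mathbb P$-augmentation of the filtration generated by $W$. $D$ is the Malliavin derivative, $D^{1,2}(\Omega)$ the usual Malliavin–Sobolev space, and $\delta$ the Skorohod integral (the adjoint of $D:L^2(\Omega)\to L^2(\Omega\times[0,T])$). $\mathcal L^{1,2}:=D^{1,2}(\Omega;L^2([0,T]))\cong L^2([0,T];D^{1,2}(\Omega))$. For $u\in\mathcal L^{1,2}$, $\int_0^tu_s\,\mathrm dW_s:=\delta(u1_{[0,t]})$. For $q\in[1,2]$, a process $u\in\mathcal L^{1,2}$ belongs to $\mathcal L^{1,2,q-}$ if there is a (unique) process $D^-u\in L^q(\Omega\times[0,T])$ with $$\lim_{\varepsilon\to0^+}\int_0^T\sup_{(s-\varepsilon)\vee0\le t<s}\mathbb E\big(|D_su_t-(D^-u)_s|^q\big)\,\mathrm ds=0 .$$ Forward integral: for $u\in L^2(\Omega\times[0,T])$, $$\int_0^Tu_t\,\mathrm d^-W_t:=\lim_{\varepsilon\to0^+}\varepsilon^{-1}\int_0^Tu_t\,(W_{(t+\varepsilon)\wedge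 T}-W_t)\,\mathrm dt$$ if the limit exists in probability; then $u\in\mathrm{Dom}\,\delta^-$. If the limit exists also in $L^p(\Omega)$, one writes $u\in\mathrm{Dom}_p\,\delta^-$. $\int_0^tu_s\,\mathrm d^-W_s$ denotes the forward integral of $u1_{[0,t]}$. *)

theory Defs
  imports "HOL-Probability.Probability"
begin

section \<open>Lebesgue spaces and modes of convergence\<close>

text \<open>
  Elements of Lebesgue spaces are represented by measurable functions; nothing below depends on
  the choice of a representative. Random functions carry their time arguments first, so the space
  \<open>\<Omega> \<times> [0,T]\<close> is rendered as \<open>[0,T] \<times> \<Omega>\<close>.
\<close>

definition Lp :: "real \<Rightarrow> 'b measure \<Rightarrow> ('b \<Rightarrow> real) set" where
  "Lp p N = {f \<in> borel_measurable N. integrable N (\<lambda>x. \<bar>f x\<bar> powr p)}"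

definition tendsto_Lp ::
    "real \<Rightarrow> 'b measure \<Rightarrow> ('i \<Rightarrow> 'b \<Rightarrow> real) \<Rightarrow> ('b \<Rightarrow> real) \<Rightarrow> 'i filter \<Rightarrow> bool" where
  "tendsto_Lp p N X Y F \<longleftrightarrow>
     ((\<lambda>i. \<integral>\<^sup>+x. ennreal (\<bar>X i x - Y x\<bar> powr p) \<partial>N) \<longlongrightarrow> 0) F"

definition tendsto_prob ::
    "'a measure \<Rightarrow> ('i \<Rightarrow> 'a \<Rightarrow> real) \<Rightarrow> ('a \<Rightarrow> real) \<Rightarrow> 'i filter \<Rightarrow> bool" where
  "tendsto_prob M X Y F \<longleftrightarrow>
     (\<forall>c>0. ((\<lambda>i. measure M {\<omega> \<in> space M. c < \<bar>X i \<omega> - Y \<omega>\<bar>}) \<longlongrightarrow> 0) F)"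

definition time_measure :: "real \<Rightarrow> real measure" where
  "time_measure T = restrict_space lborel {0..T}"

definition process_measure :: "real \<Rightarrow> 'a measure \<Rightarrow> (real \<times> 'a) measure" where
  "process_measure T M = time_measure T \<Otimes>\<^sub>M M"


section \<open>Brownian motion and its augmented filtration\<close>

definition natural_filtration :: "'a measure \<Rightarrow> (real \<Rightarrow> 'a \<Rightarrow> real) \<Rightarrow> real \<Rightarrow> 'a measure" where
  "natural_filtration M W t =
     sigma (space M) {W s -` B \<inter> space M | s B. s \<in> {0..t} \<and> B \<in> sets borel}"

text \<open>The sets added are all subsets of null events of the natural \<open>\<sigma>\<close>-algebra at time \<open>T\<close>.\<close>

definition augmented_filtration ::
    "real \<Rightarrow> 'a measure \<Rightarrow> (real \<Rightarrow> 'a \<Rightarrow> real) \<Rightarrow> real \<Rightarrow> 'a measure" where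
  "augmented_filtration T M W t =
     sigma (space M) (sets (natural_filtration M W t) \<union>
       {N. \<exists>G \<in> sets (natural_filtration M W T). emeasure M G = 0 \<and> N \<subseteq> G})"

definition standard_brownian_motion ::
    "real \<Rightarrow> 'a measure \<Rightarrow> (real \<Rightarrow> 'a measure) \<Rightarrow> (real \<Rightarrow> 'a \<Rightarrow> real) \<Rightarrow> bool" where
  "standard_brownian_motion T M \<F> W \<longleftrightarrow>
     prob_space M \<and>
     (\<forall>t\<in>{0..T}. subalgebra M (\<F> t) \<and> W t \<in> borel_measurable (\<F> t)) \<and>
     (AE \<omega> in M. W 0 \<omega> = 0) \<and>
     (AE \<omega> in M. continuous_on {0..T} (\<lambda>t. W t \<omega>)) \<and>
     (\<forall>s t. 0 \<le> s \<and> s < t \<and> t \<le> T \<longrightarrow>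
        distributed M lborel (\<lambda>\<omega>. W t \<omega> - W s \<omega>) (normal_density 0 (sqrt (t - s))) \<and>
        prob_space.indep_set M (sets (\<F> s))
          {(\<lambda>\<omega>. W t \<omega> - W s \<omega>) -` B \<inter> space M | B. B \<in> sets borel})"

definition brownian_setting :: "real \<Rightarrow> 'a measure \<Rightarrow> (real \<Rightarrow> 'a \<Rightarrow> real) \<Rightarrow> bool" where
  "brownian_setting T M W \<longleftrightarrow>
     0 < T \<and>
     sets M = sets (augmented_filtration T M W T) \<and>
     standard_brownian_motion T M (augmented_filtration T M W) W"

text \<open>
  A triple \<open>(a, s, t)\<close> in the list stands for the step \<open>a 1\<^bsub>(s,t]\<^esub>\<close>. The Wiener integral \<open>W(h)\<close> of
  \<open>h \<in> L\<^sup>2([0,T])\<close> is the \<open>L\<^sup>2\<close>-limit of the integrals of approximating step functions.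
\<close>

definition step_function :: "(real \<times> real \<times> real) list \<Rightarrow> real \<Rightarrow> real" where
  "step_function xs r = (\<Sum>(a, s, t)\<leftarrow>xs. a * indicator {s<..t} r)"

definition step_integral ::
    "(real \<Rightarrow> 'a \<Rightarrow> real) \<Rightarrow> (real \<times> real \<times> real) list \<Rightarrow> 'a \<Rightarrow> real" where
  "step_integral W xs \<omega> = (\<Sum>(a, s, t)\<leftarrow>xs. a * (W t \<omega> - W s \<omega>))"

definition wiener_integral ::
    "real \<Rightarrow> 'a measure \<Rightarrow> (real \<Rightarrow> 'a \<Rightarrow> real) \<Rightarrow> (real \<Rightarrow> real) \<Rightarrow> ('a \<Rightarrow> real) \<Rightarrow> bool" where
  "wiener_integral T M W h X \<longleftrightarrow>
     h \<in> Lp 2 (time_measure T) \<and> X \<in> Lp 2 M \<and>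
     (\<exists>xs :: nat \<Rightarrow> (real \<times> real \<times> real) list.
        (\<forall>n. \<forall>(a, s, t)\<in>set (xs n). 0 \<le> s \<and> s \<le> t \<and> t \<le> T) \<and>
        tendsto_Lp 2 (time_measure T) (\<lambda>n. step_function (xs n)) h sequentially \<and>
        tendsto_Lp 2 M (\<lambda>n. step_integral W (xs n)) X sequentially)"


section \<open>Malliavin derivative and Skorohod integral\<close>

text \<open>
  Functions on \<open>\<real>\<^sup>n\<close>, for a dimension \<open>n\<close> that is not fixed, are rendered as functions of sequences
  depending on the first \<open>n\<close> entries only. The type \<open>nat \<Rightarrow> real\<close> carries the product topology, for
  which such a function is continuous iff it is continuous on \<open>\<real>\<^sup>n\<close>.
\<close>

definition partial_deriv :: "nat \<Rightarrow> ((nat \<Rightarrow> real) \<Rightarrow> real) \<Rightarrow> (nat \<Rightarrow> real) \<Rightarrow> real" where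
  "partial_deriv i f x = deriv (\<lambda>y. f (x(i := y))) (x i)"

text \<open>\<open>C\<^sub>b\<^sup>\<infinity>(\<real>\<^sup>n)\<close>: the list \<open>js\<close> gives the variables of an iterated partial derivative.\<close>

definition Cb_infinity :: "nat \<Rightarrow> ((nat \<Rightarrow> real) \<Rightarrow> real) set" where
  "Cb_infinity n = {f.
     (\<forall>x y. (\<forall>i<n. x i = y i) \<longrightarrow> f x = f y) \<and>
     (\<forall>js. set js \<subseteq> {..<n} \<longrightarrow>
        bounded (range (foldr partial_deriv js f)) \<and>
        continuous_on UNIV (foldr partial_deriv js f) \<and>
        (\<forall>i<n. \<forall>x. (\<lambda>y. foldr partial_deriv js f (x(i := y))) field_differentiable at (x i)))}"

text \<open>
  The operators are given by their graphs, since derivatives and integrals are determined only up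
  to null sets: \<open>smooth_deriv T M W F DF\<close> says that \<open>F = f(W(h\<^sub>1), \<dots>, W(h\<^sub>n))\<close> and
  \<open>D\<^sub>s F = \<Sum>\<^sub>i \<partial>\<^sub>i f(W(h\<^sub>1), \<dots>, W(h\<^sub>n)) h\<^sub>i(s)\<close>; the graph of the Malliavin derivative, with domain
  \<open>D\<^sup>1\<^sup>,\<^sup>2(\<Omega>)\<close>, is the closure in \<open>L\<^sup>2(\<Omega>) \<times> L\<^sup>2(\<Omega> \<times> [0,T])\<close>.
\<close>

definition smooth_deriv ::
    "real \<Rightarrow> 'a measure \<Rightarrow> (real \<Rightarrow> 'a \<Rightarrow> real) \<Rightarrow> ('a \<Rightarrow> real) \<Rightarrow> (real \<Rightarrow> 'a \<Rightarrow> real) \<Rightarrow> bool" where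
  "smooth_deriv T M W F DF \<longleftrightarrow>
     (\<exists>n f h X. f \<in> Cb_infinity n \<and> (\<forall>i<n. wiener_integral T M W (h i) (X i)) \<and>
        F = (\<lambda>\<omega>. f (\<lambda>i. X i \<omega>)) \<and>
        DF = (\<lambda>s \<omega>. \<Sum>i<n. partial_deriv i f (\<lambda>k. X k \<omega>) * h i s))"

definition malliavin_deriv ::
    "real \<Rightarrow> 'a measure \<Rightarrow> (real \<Rightarrow> 'a \<Rightarrow> real) \<Rightarrow> ('a \<Rightarrow> real) \<Rightarrow> (real \<Rightarrow> 'a \<Rightarrow> real) \<Rightarrow> bool" where
  "malliavin_deriv T M W F DF \<longleftrightarrow>
     F \<in> Lp 2 M \<and> case_prod DF \<in> Lp 2 (process_measure T M) \<and>
     (\<exists>G DG. (\<forall>n::nat. smooth_deriv T M W (G n) (DG n)) \<and>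
        tendsto_Lp 2 M G F sequentially \<and>
        tendsto_Lp 2 (process_measure T M) (\<lambda>n. case_prod (DG n)) (case_prod DF) sequentially)"

text \<open>\<open>\<delta>\<close> is the adjoint of the Malliavin derivative.\<close>

definition is_skorohod_integral ::
    "real \<Rightarrow> 'a measure \<Rightarrow> (real \<Rightarrow> 'a \<Rightarrow> real) \<Rightarrow> (real \<Rightarrow> 'a \<Rightarrow> real) \<Rightarrow> ('a \<Rightarrow> real) \<Rightarrow> bool" where
  "is_skorohod_integral T M W u X \<longleftrightarrow>
     case_prod u \<in> Lp 2 (process_measure T M) \<and> X \<in> Lp 2 M \<and>
     (\<forall>F DF. malliavin_deriv T M W F DF \<longrightarrow>
        (\<integral>\<omega>. F \<omega> * X \<omega> \<partial>M) = (\<integral>(s, \<omega>). DF s \<omega> * u s \<omega> \<partial>process_measure T M))"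

definition Dom_skorohod ::
    "real \<Rightarrow> 'a measure \<Rightarrow> (real \<Rightarrow> 'a \<Rightarrow> real) \<Rightarrow> (real \<Rightarrow> 'a \<Rightarrow> real) set" where
  "Dom_skorohod T M W = {u. \<exists>X. is_skorohod_integral T M W u X}"

definition skorohod_integral ::
    "real \<Rightarrow> 'a measure \<Rightarrow> (real \<Rightarrow> 'a \<Rightarrow> real) \<Rightarrow> (real \<Rightarrow> 'a \<Rightarrow> real) \<Rightarrow> 'a \<Rightarrow> real" where
  "skorohod_integral T M W u = (SOME X. is_skorohod_integral T M W u X)"

text \<open>
  The derivative of \<open>L\<^sup>2([0,T])\<close>-valued random variables, with domain \<open>D\<^sup>1\<^sup>,\<^sup>2(\<Omega>; L\<^sup>2([0,T]))\<close>, is the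
  closure of \<open>\<Sum>\<^sub>j F\<^sub>j g\<^sub>j \<mapsto> \<Sum>\<^sub>j DF\<^sub>j \<otimes> g\<^sub>j\<close>. In \<open>Du s t \<omega>\<close> the first argument is the time of
  differentiation, so that \<open>Du s t\<close> is \<open>D\<^sub>s u\<^sub>t\<close>.
\<close>

definition smooth_process_deriv ::
    "real \<Rightarrow> 'a measure \<Rightarrow> (real \<Rightarrow> 'a \<Rightarrow> real) \<Rightarrow> (real \<Rightarrow> 'a \<Rightarrow> real) \<Rightarrow>
      (real \<Rightarrow> real \<Rightarrow> 'a \<Rightarrow> real) \<Rightarrow> bool" where
  "smooth_process_deriv T M W u Du \<longleftrightarrow>
     (\<exists>(m::nat) F DF g.
        (\<forall>j<m. smooth_deriv T M W (F j) (DF j) \<and> g j \<in> Lp 2 (time_measure T)) \<and>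
        u = (\<lambda>t \<omega>. \<Sum>j<m. F j \<omega> * g j t) \<and>
        Du = (\<lambda>s t \<omega>. \<Sum>j<m. DF j s \<omega> * g j t))"

definition process_deriv ::
    "real \<Rightarrow> 'a measure \<Rightarrow> (real \<Rightarrow> 'a \<Rightarrow> real) \<Rightarrow> (real \<Rightarrow> 'a \<Rightarrow> real) \<Rightarrow>
      (real \<Rightarrow> real \<Rightarrow> 'a \<Rightarrow> real) \<Rightarrow> bool" where
  "process_deriv T M W u Du \<longleftrightarrow>
     case_prod u \<in> Lp 2 (process_measure T M) \<and>
     (\<lambda>(s, t, \<omega>). Du s t \<omega>) \<in> Lp 2 (time_measure T \<Otimes>\<^sub>M process_measure T M) \<and>
     (\<exists>v Dv. (\<forall>n::nat. smooth_process_deriv T M W (v n) (Dv n)) \<and>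
        tendsto_Lp 2 (process_measure T M) (\<lambda>n. case_prod (v n)) (case_prod u) sequentially \<and>
        tendsto_Lp 2 (time_measure T \<Otimes>\<^sub>M process_measure T M)
          (\<lambda>n (s, t, \<omega>). Dv n s t \<omega>) (\<lambda>(s, t, \<omega>). Du s t \<omega>) sequentially)"

definition L12 ::
    "real \<Rightarrow> 'a measure \<Rightarrow> (real \<Rightarrow> 'a \<Rightarrow> real) \<Rightarrow> (real \<Rightarrow> 'a \<Rightarrow> real) set" where
  "L12 T M W = {u. \<exists>Du. process_deriv T M W u Du}"


section \<open>The one-sided trace and the forward integral\<close>

text \<open>
  \<open>is_D_minus T M W q u Dm\<close> says that \<open>Dm\<close> is \<open>D\<^sup>-u\<close>. The process \<open>Du\<close> is determined only up to a
  null set of \<open>(s, t, \<omega>)\<close>, whereas the supremum over \<open>t\<close> depends on the representative; the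
  condition is that it holds for some representative. The supremum over the empty set, occurring
  for \<open>s = 0\<close> only, is \<open>0\<close>.
\<close>

definition is_D_minus ::
    "real \<Rightarrow> 'a measure \<Rightarrow> (real \<Rightarrow> 'a \<Rightarrow> real) \<Rightarrow> real \<Rightarrow> (real \<Rightarrow> 'a \<Rightarrow> real) \<Rightarrow>
      (real \<Rightarrow> 'a \<Rightarrow> real) \<Rightarrow> bool" where
  "is_D_minus T M W q u Dm \<longleftrightarrow>
     case_prod Dm \<in> Lp q (process_measure T M) \<and>
     (\<exists>Du. process_deriv T M W u Du \<and>
        ((\<lambda>\<epsilon>. \<integral>\<^sup>+s. (SUP t\<in>{max (s - \<epsilon>) 0..<s}.
              \<integral>\<^sup>+\<omega>. ennreal (\<bar>Du s t \<omega> - Dm s \<omega>\<bar> powr q) \<partial>M) \<partial>time_measure T)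
          \<longlongrightarrow> 0) (at_right 0))"

definition L12_minus ::
    "real \<Rightarrow> 'a measure \<Rightarrow> (real \<Rightarrow> 'a \<Rightarrow> real) \<Rightarrow> real \<Rightarrow> (real \<Rightarrow> 'a \<Rightarrow> real) set" where
  "L12_minus T M W q = {u \<in> L12 T M W. \<exists>Dm. is_D_minus T M W q u Dm}"

definition forward_approx ::
    "real \<Rightarrow> (real \<Rightarrow> 'a \<Rightarrow> real) \<Rightarrow> (real \<Rightarrow> 'a \<Rightarrow> real) \<Rightarrow> real \<Rightarrow> 'a \<Rightarrow> real" where
  "forward_approx T W u \<epsilon> \<omega> =
     inverse \<epsilon> * (LBINT t:{0..T}. u t \<omega> * (W (min (t + \<epsilon>) T) \<omega> - W t \<omega>))"

definition is_forward_integral ::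
    "real \<Rightarrow> 'a measure \<Rightarrow> (real \<Rightarrow> 'a \<Rightarrow> real) \<Rightarrow> (real \<Rightarrow> 'a \<Rightarrow> real) \<Rightarrow> ('a \<Rightarrow> real) \<Rightarrow> bool" where
  "is_forward_integral T M W u Y \<longleftrightarrow>
     case_prod u \<in> Lp 2 (process_measure T M) \<and> Y \<in> borel_measurable M \<and>
     tendsto_prob M (forward_approx T W u) Y (at_right 0)"

definition forward_integral ::
    "real \<Rightarrow> 'a measure \<Rightarrow> (real \<Rightarrow> 'a \<Rightarrow> real) \<Rightarrow> (real \<Rightarrow> 'a \<Rightarrow> real) \<Rightarrow> 'a \<Rightarrow> real" where
  "forward_integral T M W u = (SOME Y. is_forward_integral T M W u Y)"

definition Dom_forward ::
    "real \<Rightarrow> 'a measure \<Rightarrow> (real \<Rightarrow> 'a \<Rightarrow> real) \<Rightarrow> real \<Rightarrow> (real \<Rightarrow> 'a \<Rightarrow> real) set" where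
  "Dom_forward T M W p = {u. \<exists>Y. is_forward_integral T M W u Y \<and> Y \<in> Lp p M \<and>
     tendsto_Lp p M (forward_approx T W u) Y (at_right 0)}"

definition cutoff :: "(real \<Rightarrow> 'a \<Rightarrow> real) \<Rightarrow> real \<Rightarrow> real \<Rightarrow> 'a \<Rightarrow> real" where
  "cutoff u t s \<omega> = u s \<omega> * indicator {0..t} s"

end

theory Submission
  imports Defs "HOL-Computational_Algebra.Polynomial"
begin

text \<open>
  For a process \<open>v = \<Sum>\<^sub>j F\<^sub>j g\<^sub>j\<close> with smooth \<open>F\<^sub>j\<close> and deterministic \<open>g\<^sub>j\<close>, the Skorohod integral is
  explicit: \<open>\<delta>(v) = \<Sum>\<^sub>j (F\<^sub>j W(g\<^sub>j) - \<langle>DF\<^sub>j, g\<^sub>j\<rangle>)\<close>, by Gaussian integration by parts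
  (\<open>gaussian_ibp\<close>). Averaging \<open>v\<close> over the window \<open>[s - \<epsilon>, s)\<close> before \<open>s\<close> replaces \<open>W(g\<^sub>j)\<close> by
  \<open>\<epsilon>\<^sup>-\<^sup>1 \<integral> g\<^sub>j(t) (W(t + \<epsilon>) - W(t)) dt\<close>, a stochastic Fubini theorem (\<open>wiener_pairing\<close>). Therefore
  the forward approximation of \<open>v\<close> at \<open>\<epsilon>\<close> equals \<open>\<delta>(avg v)\<close> plus the averaged trace
  \<open>\<integral> \<epsilon>\<^sup>-\<^sup>1 \<integral>\<^bsub>[s-\<epsilon>,s)\<^esub> D\<^sub>s v\<^sub>t dt ds\<close> (\<open>smooth_skorohod_avg\<close>).

  The first summand extends to \<open>u\<close> in \<open>L\<^sup>1\<^sup>,\<^sup>2\<close>. Integrating by parts twice and using the symmetry of second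
  derivatives gives \<open>\<parallel>\<delta>(v)\<parallel>\<^sup>2 \<le> \<parallel>v\<parallel>\<^sup>2 + \<parallel>Dv\<parallel>\<^sup>2\<close> (\<open>smooth_skorohod_bound\<close>), and averaging is a
  contraction in \<open>L\<^sup>2\<close>. So the difference of forward approximation and averaged trace is controlled by the
  norm of \<open>L\<^sup>1\<^sup>,\<^sup>2\<close> uniformly in \<open>\<epsilon>\<close>, and by density of smooth processes it tends to \<open>\<delta>(u)\<close> in
  \<open>L\<^sup>1(\<Omega>)\<close> (\<open>skorohod_correction\<close>).

  The averaged trace samples \<open>D\<^sub>s u\<^sub>t\<close> just before \<open>s\<close>, where the definition of \<open>D\<^sup>-u\<close> controls its distance
  from \<open>(D\<^sup>-u)\<^sub>s\<close> uniformly in \<open>t\<close>. It tends to the integral of \<open>D\<^sup>-u\<close> in \<open>L\<^sup>1(\<Omega>)\<close>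
  (\<open>trace_error\<close>). A cut-off of \<open>u\<close> at time \<open>t\<close> multiplies \<open>D\<^sub>s u\<^sub>r\<close> by an indicator in \<open>r\<close>, which is
  constant on the window unless \<open>t\<close> lies in it.

  It remains to identify the integrals chosen by the definitions. The Skorohod integral is unique almost
  surely because smooth functionals are total (\<open>smooth_functionals_total\<close>). Limits in probability are
  unique for measurable random variables, and the forward approximations are measurable because the
  augmented space is complete (\<open>subset_null_measurable\<close>).
\<close>

section \<open>Square-integrable functions and mean-square convergence\<close>

lemma Lp2_iff: "f \<in> Lp 2 N \<longleftrightarrow> f \<in> borel_measurable N \<and> integrable N (\<lambda>x. (f x)\<^sup>2)"
proof -
  have "\<bar>y\<bar> powr 2 = y\<^sup>2" for y :: real
    by (cases "y = 0") (simp_all add: powr_numeral)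
  then show ?thesis by (simp add: Lp_def)
qed

lemma Lp2_measurable [measurable_dest]: "f \<in> Lp 2 N \<Longrightarrow> f \<in> borel_measurable N"
  by (simp add: Lp2_iff)

lemma Lp2_square: "f \<in> Lp 2 N \<Longrightarrow> integrable N (\<lambda>x. (f x)\<^sup>2)"
  by (simp add: Lp2_iff)

lemma Lp2_mult_integrable:
  assumes f: "f \<in> Lp 2 N" and g: "g \<in> Lp 2 N"
  shows "integrable N (\<lambda>x. f x * g x)"
proof (rule Bochner_Integration.integrable_bound)
  show "integrable N (\<lambda>x. (f x)\<^sup>2 + (g x)\<^sup>2)"
    using f g by (simp add: Lp2_iff)
  show "(\<lambda>x. f x * g x) \<in> borel_measurable N" using f g by measurable
  have "\<bar>a * b\<bar> \<le> a\<^sup>2 + b\<^sup>2" for a b :: real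
  proof -
    have "2 * (\<bar>a\<bar> * \<bar>b\<bar>) \<le> a\<^sup>2 + b\<^sup>2"
      using sum_squares_bound[of "\<bar>a\<bar>" "\<bar>b\<bar>"] by simp
    moreover have "0 \<le> \<bar>a\<bar> * \<bar>b\<bar>" by simp
    ultimately show ?thesis unfolding abs_mult by linarith
  qed
  then show "AE x in N. norm (f x * g x) \<le> norm ((f x)\<^sup>2 + (g x)\<^sup>2)" by simp
qed

lemma Lp2_zero [simp]: "(\<lambda>x. 0) \<in> Lp 2 N"
  by (simp add: Lp2_iff)

lemma Lp2_cmult:
  assumes "f \<in> Lp 2 N" shows "(\<lambda>x. c * f x) \<in> Lp 2 N"
  using assms by (auto simp: Lp2_iff power_mult_distrib)

lemma Lp2_add:
  assumes f: "f \<in> Lp 2 N" and g: "g \<in> Lp 2 N"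
  shows "(\<lambda>x. f x + g x) \<in> Lp 2 N"
  using Lp2_mult_integrable[OF f g] f g by (auto simp: Lp2_iff power2_sum mult.assoc)

lemma Lp2_diff:
  assumes f: "f \<in> Lp 2 N" and g: "g \<in> Lp 2 N"
  shows "(\<lambda>x. f x - g x) \<in> Lp 2 N"
  using Lp2_add[OF f Lp2_cmult[OF g, of "-1"]] by simp

lemma Lp2_sum:
  assumes "\<And>i. i \<in> I \<Longrightarrow> f i \<in> Lp 2 N"
  shows "(\<lambda>x. \<Sum>i\<in>I. f i x) \<in> Lp 2 N"
  using assms by (induction I rule: infinite_finite_induct) (auto intro: Lp2_add)

lemma Lp2_bounded_mult:
  assumes f: "f \<in> Lp 2 N" and b: "b \<in> borel_measurable N" "\<And>x. x \<in> space N \<Longrightarrow> \<bar>b x\<bar> \<le> B"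
  shows "(\<lambda>x. b x * f x) \<in> Lp 2 N"
proof -
  have "integrable N (\<lambda>x. (b x * f x)\<^sup>2)"
  proof (rule Bochner_Integration.integrable_bound)
    show "integrable N (\<lambda>x. B\<^sup>2 * (f x)\<^sup>2)" using f by (simp add: Lp2_iff)
    show "(\<lambda>x. (b x * f x)\<^sup>2) \<in> borel_measurable N" using f b by measurable
    show "AE x in N. norm ((b x * f x)\<^sup>2) \<le> norm (B\<^sup>2 * (f x)\<^sup>2)"
    proof (rule AE_I2)
      fix x assume "x \<in> space N"
      then have "\<bar>b x\<bar> ^ 2 \<le> B\<^sup>2" using b(2) by (intro power_mono) auto
      then show "norm ((b x * f x)\<^sup>2) \<le> norm (B\<^sup>2 * (f x)\<^sup>2)"
        by (simp add: power_mult_distrib mult_right_mono)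
    qed
  qed
  then show ?thesis using f b by (auto simp: Lp2_iff)
qed

lemma Lp2_cong_AE:
  assumes "f \<in> Lp 2 N" "g \<in> borel_measurable N" "AE x in N. f x = g x"
  shows "g \<in> Lp 2 N"
proof -
  have "integrable N (\<lambda>x. (g x)\<^sup>2) \<longleftrightarrow> integrable N (\<lambda>x. (f x)\<^sup>2)"
    using assms by (intro integrable_cong_AE) (auto simp: Lp2_iff)
  then show ?thesis using assms by (auto simp: Lp2_iff)
qed

definition norm2 :: "'b measure \<Rightarrow> ('b \<Rightarrow> real) \<Rightarrow> real" where
  "norm2 N f = sqrt (\<integral>x. (f x)\<^sup>2 \<partial>N)"

lemma norm2_nonneg [simp]: "0 \<le> norm2 N f"
  by (simp add: norm2_def)

lemma norm2_square: "(norm2 N f)\<^sup>2 = (\<integral>x. (f x)\<^sup>2 \<partial>N)"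
  by (simp add: norm2_def)

lemma norm2_cmult: "norm2 N (\<lambda>x. c * f x) = \<bar>c\<bar> * norm2 N f"
  by (simp add: norm2_def power_mult_distrib real_sqrt_mult)

lemma norm2_minus: "norm2 N (\<lambda>x. f x - g x) = norm2 N (\<lambda>x. g x - f x)"
  by (simp add: norm2_def power2_commute)

lemma norm2_cong_AE:
  assumes "AE x in N. f x = g x" "f \<in> borel_measurable N" "g \<in> borel_measurable N"
  shows "norm2 N f = norm2 N g"
proof -
  have "(\<integral>x. (f x)\<^sup>2 \<partial>N) = (\<integral>x. (g x)\<^sup>2 \<partial>N)"
    using assms by (intro integral_cong_AE) auto
  then show ?thesis by (simp add: norm2_def)
qed

lemma norm2_cauchy_schwarz_abs:
  assumes f: "f \<in> Lp 2 N" and g: "g \<in> Lp 2 N"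
  shows "(\<integral>x. \<bar>f x * g x\<bar> \<partial>N) \<le> norm2 N f * norm2 N g"
proof -
  have [measurable]: "f \<in> borel_measurable N" "g \<in> borel_measurable N" using f g by measurable
  have *: "(\<integral>\<^sup>+x. ennreal \<bar>h x\<bar> ^ 2 \<partial>N) = ennreal ((norm2 N h)\<^sup>2)" if "h \<in> Lp 2 N" for h
  proof -
    have "(\<integral>\<^sup>+x. ennreal \<bar>h x\<bar> ^ 2 \<partial>N) = (\<integral>\<^sup>+x. ennreal ((h x)\<^sup>2) \<partial>N)"
      by (simp add: ennreal_power)
    also have "\<dots> = ennreal (\<integral>x. (h x)\<^sup>2 \<partial>N)"
      using that by (intro nn_integral_eq_integral) (auto simp: Lp2_iff)
    finally show ?thesis by (simp add: norm2_square)
  qed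
  have "(\<integral>\<^sup>+x. ennreal \<bar>f x\<bar> * ennreal \<bar>g x\<bar> \<partial>N)
      = (\<integral>\<^sup>+x. ennreal \<bar>f x * g x\<bar> \<partial>N)"
    by (simp add: ennreal_mult abs_mult)
  also have "\<dots> = ennreal (\<integral>x. \<bar>f x * g x\<bar> \<partial>N)"
    using Lp2_mult_integrable[OF f g] by (intro nn_integral_eq_integral) auto
  finally have "ennreal (\<integral>x. \<bar>f x * g x\<bar> \<partial>N) ^ 2
      \<le> ennreal ((norm2 N f)\<^sup>2) * ennreal ((norm2 N g)\<^sup>2)"
    using Cauchy_Schwarz_nn_integral[of "\<lambda>x. ennreal \<bar>f x\<bar>" N "\<lambda>x. ennreal \<bar>g x\<bar>"]
    by (simp add: *[OF f] *[OF g])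
  then have "ennreal ((\<integral>x. \<bar>f x * g x\<bar> \<partial>N) ^ 2) \<le> ennreal ((norm2 N f * norm2 N g)\<^sup>2)"
    by (simp add: ennreal_power ennreal_mult power_mult_distrib)
  then have "(\<integral>x. \<bar>f x * g x\<bar> \<partial>N) ^ 2 \<le> (norm2 N f * norm2 N g)\<^sup>2"
    by (subst (asm) ennreal_le_iff) auto
  then show ?thesis by (rule power2_le_imp_le) simp
qed

lemma norm2_cauchy_schwarz:
  assumes f: "f \<in> Lp 2 N" and g: "g \<in> Lp 2 N"
  shows "\<bar>\<integral>x. f x * g x \<partial>N\<bar> \<le> norm2 N f * norm2 N g"
  using norm2_cauchy_schwarz_abs[OF assms] integral_abs_bound[of N "\<lambda>x. f x * g x"] by linarith

lemma norm2_triangle: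
  assumes f: "f \<in> Lp 2 N" and g: "g \<in> Lp 2 N"
  shows "norm2 N (\<lambda>x. f x + g x) \<le> norm2 N f + norm2 N g"
proof (rule power2_le_imp_le)
  have "(norm2 N (\<lambda>x. f x + g x))\<^sup>2
      = (\<integral>x. (f x)\<^sup>2 + (g x)\<^sup>2 + 2 * (f x * g x) \<partial>N)"
    by (simp add: norm2_square power2_sum mult.assoc)
  also have "\<dots> = (\<integral>x. (f x)\<^sup>2 \<partial>N) + (\<integral>x. (g x)\<^sup>2 \<partial>N) + 2 * (\<integral>x. f x * g x \<partial>N)"
    using Lp2_mult_integrable[OF f g] f g by (simp add: Lp2_iff)
  also have "\<dots> \<le> (norm2 N f)\<^sup>2 + (norm2 N g)\<^sup>2 + 2 * (norm2 N f * norm2 N g)"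
    using norm2_cauchy_schwarz[OF f g] by (simp add: norm2_square)
  finally show "(norm2 N (\<lambda>x. f x + g x))\<^sup>2 \<le> (norm2 N f + norm2 N g)\<^sup>2"
    by (simp add: power2_sum mult.assoc)
qed simp

lemma norm2_triangle_diff:
  assumes f: "f \<in> Lp 2 N" and g: "g \<in> Lp 2 N"
  shows "norm2 N (\<lambda>x. f x - g x) \<le> norm2 N f + norm2 N g"
  using norm2_triangle[OF f Lp2_cmult[OF g, of "-1"]] norm2_cmult[of N "-1" g] by simp

lemma norm2_triangle3:
  assumes "f \<in> Lp 2 N" "g \<in> Lp 2 N" "h \<in> Lp 2 N"
  shows "norm2 N (\<lambda>x. f x - h x) \<le> norm2 N (\<lambda>x. f x - g x) + norm2 N (\<lambda>x. g x - h x)"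
  using norm2_triangle[OF Lp2_diff[OF assms(1,2)] Lp2_diff[OF assms(2,3)]] by simp

definition conv2 ::
    "'b measure \<Rightarrow> ('i \<Rightarrow> 'b \<Rightarrow> real) \<Rightarrow> ('b \<Rightarrow> real) \<Rightarrow> 'i filter \<Rightarrow> bool" where
  "conv2 N X Y F \<longleftrightarrow> (\<forall>i. X i \<in> Lp 2 N) \<and> Y \<in> Lp 2 N \<and>
     ((\<lambda>i. norm2 N (\<lambda>x. X i x - Y x)) \<longlongrightarrow> 0) F"

lemma conv2D:
  assumes "conv2 N X Y F"
  shows "X i \<in> Lp 2 N" "Y \<in> Lp 2 N" "((\<lambda>i. norm2 N (\<lambda>x. X i x - Y x)) \<longlongrightarrow> 0) F"
  using assms by (auto simp: conv2_def)

lemma tendsto_Lp2_iff: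
  assumes "\<And>i. X i \<in> Lp 2 N" "Y \<in> Lp 2 N"
  shows "tendsto_Lp 2 N X Y F \<longleftrightarrow> conv2 N X Y F"
proof -
  have p: "\<bar>y\<bar> powr 2 = y\<^sup>2" for y :: real
    by (cases "y = 0") (simp_all add: powr_numeral)
  have "(\<integral>\<^sup>+x. ennreal (\<bar>X i x - Y x\<bar> powr 2) \<partial>N) = ennreal ((norm2 N (\<lambda>x. X i x - Y x))\<^sup>2)" for i
    unfolding norm2_square p
    using Lp2_diff[OF assms(1)[of i] assms(2)] by (intro nn_integral_eq_integral) (auto simp: Lp2_iff)
  then have "tendsto_Lp 2 N X Y F \<longleftrightarrow> ((\<lambda>i. ennreal ((norm2 N (\<lambda>x. X i x - Y x))\<^sup>2)) \<longlongrightarrow> ennreal 0) F"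
    by (simp add: tendsto_Lp_def)
  also have "\<dots> \<longleftrightarrow> ((\<lambda>i. (norm2 N (\<lambda>x. X i x - Y x))\<^sup>2) \<longlongrightarrow> 0) F"
    by (rule tendsto_ennreal_iff) auto
  also have "\<dots> \<longleftrightarrow> ((\<lambda>i. norm2 N (\<lambda>x. X i x - Y x)) \<longlongrightarrow> 0) F"
  proof
    assume "((\<lambda>i. (norm2 N (\<lambda>x. X i x - Y x))\<^sup>2) \<longlongrightarrow> 0) F"
    from tendsto_real_sqrt[OF this] show "((\<lambda>i. norm2 N (\<lambda>x. X i x - Y x)) \<longlongrightarrow> 0) F" by simp
  next
    assume "((\<lambda>i. norm2 N (\<lambda>x. X i x - Y x)) \<longlongrightarrow> 0) F"
    from tendsto_power[OF this, of 2] show "((\<lambda>i. (norm2 N (\<lambda>x. X i x - Y x))\<^sup>2) \<longlongrightarrow> 0) F" by simp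
  qed
  finally show ?thesis using assms by (simp add: conv2_def)
qed

lemma conv2_const: "Y \<in> Lp 2 N \<Longrightarrow> conv2 N (\<lambda>_. Y) Y F"
  by (simp add: conv2_def norm2_def)

lemma conv2_bound:
  assumes "\<And>i. X i \<in> Lp 2 N" "Y \<in> Lp 2 N" "(r \<longlongrightarrow> 0) F"
    "\<And>i. norm2 N (\<lambda>x. X i x - Y x) \<le> r i"
  shows "conv2 N X Y F"
proof -
  have "((\<lambda>i. norm2 N (\<lambda>x. X i x - Y x)) \<longlongrightarrow> 0) F"
    by (rule tendsto_sandwich[OF _ _ tendsto_const assms(3)]) (use assms in auto)
  then show ?thesis using assms by (simp add: conv2_def)
qed

lemma conv2_add:
  assumes "conv2 N X Y F" "conv2 N X' Y' F"
  shows "conv2 N (\<lambda>i x. X i x + X' i x) (\<lambda>x. Y x + Y' x) F"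
proof (rule conv2_bound)
  note a = conv2D[OF assms(1)] and b = conv2D[OF assms(2)]
  show "(\<lambda>x. X i x + X' i x) \<in> Lp 2 N" for i using a b by (intro Lp2_add)
  show "(\<lambda>x. Y x + Y' x) \<in> Lp 2 N" using a b by (intro Lp2_add)
  show "((\<lambda>i. norm2 N (\<lambda>x. X i x - Y x) + norm2 N (\<lambda>x. X' i x - Y' x)) \<longlongrightarrow> 0) F"
    using tendsto_add[OF a(3) b(3)] by simp
  show "norm2 N (\<lambda>x. X i x + X' i x - (Y x + Y' x))
      \<le> norm2 N (\<lambda>x. X i x - Y x) + norm2 N (\<lambda>x. X' i x - Y' x)" for i
    using norm2_triangle[OF Lp2_diff[OF a(1)[of i] a(2)] Lp2_diff[OF b(1)[of i] b(2)]]
    by (simp add: algebra_simps)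
qed

lemma conv2_cmult:
  assumes "conv2 N X Y F"
  shows "conv2 N (\<lambda>i x. c * X i x) (\<lambda>x. c * Y x) F"
proof -
  note a = conv2D[OF assms(1)]
  have "norm2 N (\<lambda>x. c * X i x - c * Y x) = \<bar>c\<bar> * norm2 N (\<lambda>x. X i x - Y x)" for i
    unfolding norm2_cmult[symmetric] by (simp add: algebra_simps)
  then show ?thesis using a tendsto_mult[OF tendsto_const[of "\<bar>c\<bar>"] a(3)]
    by (auto simp: conv2_def intro: Lp2_cmult)
qed

lemma conv2_diff:
  assumes "conv2 N X Y F" "conv2 N X' Y' F"
  shows "conv2 N (\<lambda>i x. X i x - X' i x) (\<lambda>x. Y x - Y' x) F"
  using conv2_add[OF assms(1) conv2_cmult[OF assms(2), of "-1"]] by simp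

lemma conv2_norm:
  assumes "conv2 N X Y F" shows "((\<lambda>i. norm2 N (X i)) \<longlongrightarrow> norm2 N Y) F"
proof (rule Lim_transform)
  note a = conv2D[OF assms]
  show "((\<lambda>i. norm2 N Y) \<longlongrightarrow> norm2 N Y) F" by simp
  have *: "\<bar>norm2 N Y - norm2 N (X i)\<bar> \<le> norm2 N (\<lambda>x. X i x - Y x)" for i
  proof -
    have "norm2 N (X i) \<le> norm2 N (\<lambda>x. X i x - Y x) + norm2 N Y"
      using norm2_triangle[OF Lp2_diff[OF a(1,2)] a(2), of i] by simp
    moreover have "norm2 N Y \<le> norm2 N (X i) + norm2 N (\<lambda>x. X i x - Y x)"
      using norm2_triangle_diff[OF a(1) Lp2_diff[OF a(1,2)], of i i] by simp
    ultimately show ?thesis by linarith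
  qed
  have "norm (norm2 N (X i) - norm2 N Y) \<le> norm2 N (\<lambda>x. X i x - Y x)" for i
    using *[of i] by simp
  then show "((\<lambda>i. norm2 N (X i) - norm2 N Y) \<longlongrightarrow> 0) F"
    by (intro Lim_null_comparison[OF always_eventually a(3)]) simp
qed

lemma conv2_inner:
  assumes "conv2 N X Y F" "conv2 N X' Y' F"
  shows "((\<lambda>i. \<integral>x. X i x * X' i x \<partial>N) \<longlongrightarrow> (\<integral>x. Y x * Y' x \<partial>N)) F"
proof -
  note a = conv2D[OF assms(1)] and b = conv2D[OF assms(2)]
  have polar: "(\<integral>x. f x * g x \<partial>N)
      = ((norm2 N (\<lambda>x. f x + g x))\<^sup>2 - (norm2 N (\<lambda>x. f x - g x))\<^sup>2) / 4"
    if "f \<in> Lp 2 N" "g \<in> Lp 2 N" for f g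
  proof -
    have "(\<integral>x. (f x + g x)\<^sup>2 \<partial>N) - (\<integral>x. (f x - g x)\<^sup>2 \<partial>N) = (\<integral>x. (f x + g x)\<^sup>2 - (f x - g x)\<^sup>2 \<partial>N)"
      using Lp2_add[OF that] Lp2_diff[OF that] by (simp add: Lp2_iff)
    also have "\<dots> = (\<integral>x. 4 * (f x * g x) \<partial>N)"
      by (intro Bochner_Integration.integral_cong) (auto simp: power2_eq_square algebra_simps)
    finally show ?thesis by (simp add: norm2_square)
  qed
  have "((\<lambda>i. ((norm2 N (\<lambda>x. X i x + X' i x))\<^sup>2 - (norm2 N (\<lambda>x. X i x - X' i x))\<^sup>2) / 4) \<longlongrightarrow>
     ((norm2 N (\<lambda>x. Y x + Y' x))\<^sup>2 - (norm2 N (\<lambda>x. Y x - Y' x))\<^sup>2) / 4) F"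
    by (intro tendsto_divide tendsto_diff tendsto_power tendsto_const
        conv2_norm[OF conv2_add[OF assms]] conv2_norm[OF conv2_diff[OF assms]]) simp
  then show ?thesis by (simp only: polar[OF a(1) b(1)] polar[OF a(2) b(2)])
qed

lemma norm2_eq_0_AE:
  assumes "f \<in> Lp 2 N" "norm2 N f = 0" shows "AE x in N. f x = 0"
proof -
  have "(\<integral>x. (f x)\<^sup>2 \<partial>N) = 0" using assms(2) by (simp add: norm2_def)
  then have "AE x in N. (f x)\<^sup>2 = 0"
    using assms(1) by (subst (asm) integral_nonneg_eq_0_iff_AE) (auto simp: Lp2_iff)
  then show ?thesis by simp
qed

lemma conv2_subseq:
  assumes "conv2 N X Y sequentially" "strict_mono r"
  shows "conv2 N (\<lambda>i. X (r i)) Y sequentially"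
  using conv2D[OF assms(1)] LIMSEQ_subseq_LIMSEQ[OF conv2D(3)[OF assms(1)] assms(2)]
  by (auto simp: conv2_def o_def)

text \<open>
  Mean-square convergence gives almost sure convergence along a subsequence only; summing the
  squared errors yields one subsequence that serves finitely many sequences at once, as needed for
  a function of several random variables.
\<close>

lemma conv2_AE_subseq:
  fixes n :: nat
  assumes "\<And>k. k < n \<Longrightarrow> conv2 N (X k) (Y k) sequentially"
  shows "\<exists>r. strict_mono r \<and> (AE x in N. \<forall>k<n. (\<lambda>i. X k (r i) x) \<longlonglongrightarrow> Y k x)"
proof -
  define S where "S i x = (\<Sum>k<n. (X k i x - Y k x)\<^sup>2)" for i x
  have i: "integrable N (\<lambda>x. (X k i x - Y k x)\<^sup>2)" if "k < n" for k i
    using conv2D[OF assms[OF that]] by (intro Lp2_square Lp2_diff)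
  have "(\<integral>x. norm (S i x) \<partial>N) = (\<Sum>k<n. (norm2 N (\<lambda>x. X k i x - Y k x))\<^sup>2)" for i
  proof -
    have "norm (S i x) = S i x" for x unfolding S_def by (simp add: sum_nonneg)
    then show ?thesis using i by (simp add: S_def norm2_square)
  qed
  moreover have "(\<lambda>i. \<Sum>k<n. (norm2 N (\<lambda>x. X k i x - Y k x))\<^sup>2) \<longlonglongrightarrow> (\<Sum>k<n. 0\<^sup>2)"
    by (intro tendsto_sum tendsto_power conv2D(3)[OF assms]) auto
  ultimately have "\<exists>r::nat\<Rightarrow>nat. strict_mono r \<and> (AE x in N. (\<lambda>i. S (r i) x) \<longlonglongrightarrow> 0)"
    by (intro tendsto_L1_AE_subseq) (auto simp: S_def intro!: Bochner_Integration.integrable_sum i)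
  then obtain r :: "nat \<Rightarrow> nat" where r: "strict_mono r" "AE x in N. (\<lambda>i. S (r i) x) \<longlonglongrightarrow> 0" by auto
  have *: "(\<lambda>i. X k (r i) x) \<longlonglongrightarrow> Y k x" if l: "(\<lambda>i. S (r i) x) \<longlonglongrightarrow> 0" and k: "k < n" for x k
  proof -
    have "(X k i x - Y k x)\<^sup>2 \<le> S i x" for i
      unfolding S_def using k by (intro member_le_sum) auto
    then have "(\<lambda>i. (X k (r i) x - Y k x)\<^sup>2) \<longlonglongrightarrow> 0"
      by (intro tendsto_sandwich[OF _ _ tendsto_const l]) auto
    from tendsto_real_sqrt[OF this] have "(\<lambda>i. \<bar>X k (r i) x - Y k x\<bar>) \<longlonglongrightarrow> 0" by simp
    then show ?thesis by (simp add: LIM_zero_iff tendsto_rabs_zero_iff)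
  qed
  from r(2) have "AE x in N. \<forall>k<n. (\<lambda>i. X k (r i) x) \<longlonglongrightarrow> Y k x"
    by eventually_elim (blast intro: *)
  with r(1) show ?thesis by blast
qed

text \<open>
  The Riesz--Fischer argument: along a subsequence with increments of norm at most \<open>4 ^ -n\<close> the
  functions converge almost everywhere, and Fatou's lemma turns the Cauchy property into
  convergence to the pointwise limit.
\<close>

lemma conv2_complete:
  fixes X :: "nat \<Rightarrow> 'b \<Rightarrow> real"
  assumes X: "\<And>i. X i \<in> Lp 2 N"
    and cauchy: "\<And>e. e > 0 \<Longrightarrow> \<exists>m. \<forall>i\<ge>m. \<forall>j\<ge>m. norm2 N (\<lambda>x. X i x - X j x) < e"
  shows "\<exists>Y. conv2 N X Y sequentially"
proof -
  have [measurable]: "X i \<in> borel_measurable N" for i using X by measurable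
  have "\<exists>r. \<forall>n. (\<forall>i\<ge>r n. \<forall>j\<ge>r n. norm2 N (\<lambda>x. X i x - X j x) < (1/4)^n) \<and> r n < (r (Suc n) :: nat)"
  proof (rule dependent_nat_choice)
    show "\<exists>m. \<forall>i\<ge>m. \<forall>j\<ge>m. norm2 N (\<lambda>x. X i x - X j x) < (1 / 4) ^ 0" using cauchy[of 1] by simp
    fix k :: nat and n :: nat
    obtain m where m: "\<forall>i\<ge>m. \<forall>j\<ge>m. norm2 N (\<lambda>x. X i x - X j x) < (1 / 4) ^ Suc n"
      using cauchy[of "(1/4)^Suc n"] by auto
    show "\<exists>y. (\<forall>i\<ge>y. \<forall>j\<ge>y. norm2 N (\<lambda>x. X i x - X j x) < (1 / 4) ^ Suc n) \<and> k < y"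
      using m by (intro exI[of _ "max m (Suc k)"]) auto
  qed
  then obtain r where r: "\<And>n i j. i \<ge> r n \<Longrightarrow> j \<ge> r n \<Longrightarrow> norm2 N (\<lambda>x. X i x - X j x) < (1/4)^n"
    and rS: "\<And>n. r n < r (Suc n)" by blast
  from rS have mono: "strict_mono r" by (simp add: strict_mono_Suc_iff)
  define d where "d n x = X (r (Suc n)) x - X (r n) x" for n x
  have dL: "d n \<in> Lp 2 N" for n unfolding d_def using X by (intro Lp2_diff)
  have [measurable]: "d n \<in> borel_measurable N" for n using dL by measurable
  have dn: "(\<integral>x. (d n x)\<^sup>2 \<partial>N) \<le> (1/16)^n" for n
  proof -
    have "norm2 N (d n) \<le> (1/4)^n"
      unfolding d_def using r[OF less_imp_le[OF rS] order_refl] by (rule less_imp_le)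
    then have "(norm2 N (d n))\<^sup>2 \<le> ((1/4)^n)\<^sup>2" by (intro power_mono) auto
    moreover have "((1/4::real)^n)\<^sup>2 = (1/16)^n"
      unfolding power2_eq_square power_mult_distrib[symmetric] by simp
    ultimately show ?thesis by (simp add: norm2_square)
  qed
  \<comment> \<open>the squared increments have integrals at most \<open>16 ^ -n\<close>; with the weights \<open>4 ^ n\<close> they are
    still summable, and a finite sum at \<open>x\<close> forces \<open>d n x\<close> to be of order \<open>2 ^ -n\<close>\<close>
  have "(\<integral>\<^sup>+x. (\<Sum>n. ennreal (4^n * (d n x)\<^sup>2)) \<partial>N) = (\<Sum>n. \<integral>\<^sup>+x. ennreal (4^n * (d n x)\<^sup>2) \<partial>N)"
    by (intro nn_integral_suminf) measurable
  also have "\<dots> \<le> (\<Sum>n. ennreal ((1/4)^n))"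
  proof (intro suminf_le)
    fix n
    have "(\<integral>\<^sup>+x. ennreal (4^n * (d n x)\<^sup>2) \<partial>N) = ennreal (\<integral>x. 4^n * (d n x)\<^sup>2 \<partial>N)"
      using Lp2_square[OF dL[of n]] by (intro nn_integral_eq_integral) auto
    also have "(\<integral>x. 4^n * (d n x)\<^sup>2 \<partial>N) \<le> 4^n * (1/16)^n"
      using dn[of n] by simp
    also have "(4::real)^n * (1/16)^n = (1/4)^n"
      unfolding power_mult_distrib[symmetric] by simp
    finally show "(\<integral>\<^sup>+x. ennreal (4^n * (d n x)\<^sup>2) \<partial>N) \<le> ennreal ((1/4)^n)"
      by (simp add: ennreal_leI)
  qed auto
  also have "\<dots> < \<infinity>"
    by (subst suminf_ennreal2) (auto intro: summable_geometric)
  finally have "AE x in N. (\<Sum>n. ennreal (4^n * (d n x)\<^sup>2)) \<noteq> \<infinity>"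
    by (intro nn_integral_PInf_AE) simp_all
  then have conv: "AE x in N. convergent (\<lambda>n. X (r n) x)"
  proof (rule AE_mp, intro AE_I2 impI)
    fix x assume fin: "(\<Sum>n. ennreal (4^n * (d n x)\<^sup>2)) \<noteq> \<infinity>"
    define S where "S = (\<Sum>n. ennreal (4^n * (d n x)\<^sup>2))"
    define B where "B = enn2real S"
    have "S < top" using fin by (simp add: S_def less_top)
    then have B: "B \<ge> 0" "S = ennreal B" by (simp_all add: B_def)
    have le: "norm (d n x) \<le> sqrt B * (1/2)^n" for n
    proof -
      have "(\<Sum>m\<in>{n}. ennreal (4^m * (d m x)\<^sup>2)) \<le> S"
        unfolding S_def by (rule sum_le_suminf) auto
      then have "ennreal (4^n * (d n x)\<^sup>2) \<le> ennreal B" by (simp only: sum.insert B(2)) simp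
      then have "4^n * (d n x)\<^sup>2 \<le> B" using B(1) by (simp only: ennreal_le_iff)
      then have "sqrt (4^n * (d n x)\<^sup>2) \<le> sqrt B" by simp
      moreover have "sqrt (4^n * (d n x)\<^sup>2) = 2^n * \<bar>d n x\<bar>"
        by (simp add: real_sqrt_mult real_sqrt_power[of 4])
      ultimately have "2^n * \<bar>d n x\<bar> \<le> sqrt B" by simp
      then have "\<bar>d n x\<bar> \<le> sqrt B / 2^n" by (simp add: pos_le_divide_eq mult.commute)
      then show ?thesis by (simp add: power_one_over)
    qed
    have "summable (\<lambda>n. d n x)"
      by (rule summable_comparison_test'[OF _ le]) (intro summable_mult summable_geometric, simp)
    then have "convergent (\<lambda>n. \<Sum>i<n. d i x)" by (simp add: summable_iff_convergent)
    then have "convergent (\<lambda>n. X (r n) x - X (r 0) x)"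
      by (simp add: d_def sum_lessThan_telescope[of "\<lambda>n. X (r n) x"])
    then show "convergent (\<lambda>n. X (r n) x)"
      by (simp add: convergent_diff_const_right_iff)
  qed
  define Y where "Y x = lim (\<lambda>n. X (r n) x)" for x
  have Y: "AE x in N. (\<lambda>n. X (r n) x) \<longlonglongrightarrow> Y x"
    using conv by (rule AE_mp) (auto simp: Y_def convergent_LIMSEQ_iff)
  have [measurable]: "Y \<in> borel_measurable N" unfolding Y_def by measurable
  have fatou: "(\<integral>\<^sup>+x. ennreal ((X i x - Y x)\<^sup>2) \<partial>N) \<le> ennreal (((1/4)^n)\<^sup>2)" if i: "i \<ge> r n" for i n
  proof -
    have "(\<integral>\<^sup>+x. ennreal ((X i x - Y x)\<^sup>2) \<partial>N)
        = (\<integral>\<^sup>+x. liminf (\<lambda>k. ennreal ((X i x - X (r k) x)\<^sup>2)) \<partial>N)"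
    proof (rule nn_integral_cong_AE, use Y in eventually_elim)
      case (elim x)
      have "(\<lambda>k. ennreal ((X i x - X (r k) x)\<^sup>2)) \<longlonglongrightarrow> ennreal ((X i x - Y x)\<^sup>2)"
        by (intro tendsto_ennrealI tendsto_intros elim)
      from lim_imp_Liminf[OF trivial_limit_sequentially this] show ?case by simp
    qed
    also have "\<dots> \<le> liminf (\<lambda>k. \<integral>\<^sup>+x. ennreal ((X i x - X (r k) x)\<^sup>2) \<partial>N)"
      by (intro nn_integral_liminf) measurable
    also have "\<dots> \<le> ennreal (((1/4)^n)\<^sup>2)"
    proof (rule Liminf_le)
      show "\<forall>\<^sub>F k in sequentially. (\<integral>\<^sup>+x. ennreal ((X i x - X (r k) x)\<^sup>2) \<partial>N) \<le> ennreal (((1/4)^n)\<^sup>2)"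
        using eventually_ge_at_top[of n]
      proof eventually_elim
        case (elim k)
        have "(\<integral>\<^sup>+x. ennreal ((X i x - X (r k) x)\<^sup>2) \<partial>N) = ennreal ((norm2 N (\<lambda>x. X i x - X (r k) x))\<^sup>2)"
          unfolding norm2_square
          by (intro nn_integral_eq_integral Lp2_square Lp2_diff X) auto
        also have "\<dots> \<le> ennreal (((1/4)^n)\<^sup>2)"
          using strict_mono_less_eq[OF mono] elim i
          by (intro ennreal_leI power_mono less_imp_le[OF r]) auto
        finally show ?case .
      qed
    qed simp
    finally show ?thesis .
  qed
  have XY: "(\<lambda>x. X i x - Y x) \<in> Lp 2 N" if "i \<ge> r n" for i n
  proof -
    have "(\<integral>\<^sup>+x. ennreal ((X i x - Y x)\<^sup>2) \<partial>N) < \<infinity>"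
      using fatou[OF that] by (rule le_less_trans) simp
    then have "integrable N (\<lambda>x. (X i x - Y x)\<^sup>2)"
      by (intro integrableI_nonneg) auto
    then show ?thesis by (simp add: Lp2_iff)
  qed
  have YL: "Y \<in> Lp 2 N"
    using Lp2_diff[OF X[of "r 0"] XY[of 0 "r 0"]] by simp
  have nle: "norm2 N (\<lambda>x. X i x - Y x) \<le> (1/4)^n" if "i \<ge> r n" for i n
  proof -
    have "ennreal (\<integral>x. (X i x - Y x)\<^sup>2 \<partial>N) = (\<integral>\<^sup>+x. ennreal ((X i x - Y x)\<^sup>2) \<partial>N)"
      using Lp2_square[OF XY[OF that]] by (intro nn_integral_eq_integral[symmetric]) auto
    also have "\<dots> \<le> ennreal (((1/4)^n)\<^sup>2)" by (rule fatou[OF that])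
    finally have "(norm2 N (\<lambda>x. X i x - Y x))\<^sup>2 \<le> ((1/4)^n)\<^sup>2"
      by (subst (asm) ennreal_le_iff) (auto simp: norm2_square)
    then show ?thesis by (rule power2_le_imp_le) simp
  qed
  have "(\<lambda>i. norm2 N (\<lambda>x. X i x - Y x)) \<longlonglongrightarrow> 0"
  proof (rule LIMSEQ_I)
    fix e :: real assume "e > 0"
    then obtain n where "(1/4::real)^n < e" using real_arch_pow_inv[of e "1/4"] by auto
    then show "\<exists>m. \<forall>i\<ge>m. norm (norm2 N (\<lambda>x. X i x - Y x) - 0) < e"
      using nle[of n] by (intro exI[of _ "r n"]) fastforce
  qed
  then show ?thesis using X YL by (intro exI[of _ Y]) (simp add: conv2_def)
qed

lemma conv2_Cauchy:
  assumes "conv2 N X Y sequentially" "e > 0"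
  shows "\<exists>m. \<forall>i\<ge>m. \<forall>j\<ge>m. norm2 N (\<lambda>x. X i x - X j x) < e"
proof -
  note a = conv2D[OF assms(1)]
  obtain m where m: "\<And>i. i \<ge> m \<Longrightarrow> norm2 N (\<lambda>x. X i x - Y x) < e/2"
    using LIMSEQ_D[OF a(3), of "e/2"] assms(2) by auto
  show ?thesis
  proof (intro exI[of _ m] allI impI)
    fix i j assume ij: "i \<ge> m" "j \<ge> m"
    show "norm2 N (\<lambda>x. X i x - X j x) < e"
      using norm2_triangle3[OF a(1) a(2) a(1), of i j] m[OF ij(1)] m[OF ij(2)]
        norm2_minus[of N "X j" Y] by linarith
  qed
qed

lemma conv2_dominated:
  assumes X[measurable]: "\<And>i. X i \<in> borel_measurable N" and B: "B \<in> Lp 2 N"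
    and bound: "\<And>i. AE x in N. \<bar>X i x\<bar> \<le> B x"
    and lim: "AE x in N. (\<lambda>i. X i x) \<longlonglongrightarrow> Y x" and Y[measurable]: "Y \<in> borel_measurable N"
  shows "conv2 N X Y sequentially"
proof -
  have in_Lp2: "f \<in> Lp 2 N" if [measurable]: "f \<in> borel_measurable N" and "AE x in N. \<bar>f x\<bar> \<le> B x" for f
  proof -
    have "integrable N (\<lambda>x. (f x)\<^sup>2)"
    proof (rule Bochner_Integration.integrable_bound[OF Lp2_square[OF B]])
      show "AE x in N. norm ((f x)\<^sup>2) \<le> norm ((B x)\<^sup>2)"
        using that(2) by eventually_elim (simp add: abs_le_square_iff[symmetric])
    qed measurable
    then show ?thesis by (simp add: Lp2_iff)
  qed
  have XL: "X i \<in> Lp 2 N" for i using bound by (intro in_Lp2) auto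
  have "AE x in N. \<forall>i. \<bar>X i x\<bar> \<le> B x" using bound by (simp add: AE_all_countable)
  with lim have Yb: "AE x in N. \<bar>Y x\<bar> \<le> B x"
  proof eventually_elim
    case (elim x)
    show ?case by (rule LIMSEQ_le_const2[OF tendsto_rabs[OF elim(1)]]) (use elim(2) in auto)
  qed
  then have YL: "Y \<in> Lp 2 N" by (intro in_Lp2) auto
  have [measurable]: "B \<in> borel_measurable N" using B by measurable
  have "(\<lambda>i. \<integral>x. (X i x - Y x)\<^sup>2 \<partial>N) \<longlonglongrightarrow> (\<integral>x. 0 \<partial>N)"
  proof (rule integral_dominated_convergence)
    show "integrable N (\<lambda>x. 4 * (B x)\<^sup>2)" using Lp2_square[OF B] by simp
    show "AE x in N. (\<lambda>i. (X i x - Y x)\<^sup>2) \<longlonglongrightarrow> 0"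
      using lim
    proof eventually_elim
      case (elim x)
      from tendsto_power[OF tendsto_diff[OF elim tendsto_const[of "Y x"]], of 2] show ?case by simp
    qed
    show "AE x in N. norm ((X i x - Y x)\<^sup>2) \<le> 4 * (B x)\<^sup>2" for i
      using bound[of i] Yb
    proof eventually_elim
      case (elim x)
      have "\<bar>X i x - Y x\<bar> \<le> 2 * B x" using elim by linarith
      then have "\<bar>X i x - Y x\<bar>\<^sup>2 \<le> (2 * B x)\<^sup>2" by (intro power_mono) auto
      then show ?case by (simp add: power_mult_distrib)
    qed
  qed measurable
  from tendsto_real_sqrt[OF this] show ?thesis using XL YL by (simp add: conv2_def norm2_def)
qed

section \<open>Density of step functions\<close>

definition valid_steps :: "real \<Rightarrow> (real \<times> real \<times> real) list \<Rightarrow> bool" where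
  "valid_steps T xs \<longleftrightarrow> (\<forall>(a, s, t)\<in>set xs. 0 \<le> s \<and> s \<le> t \<and> t \<le> T)"

definition scale_steps :: "real \<Rightarrow> (real \<times> real \<times> real) list \<Rightarrow> (real \<times> real \<times> real) list" where
  "scale_steps c xs = map (\<lambda>(a, s, t). (c * a, s, t)) xs"

lemma valid_steps_Nil [simp]: "valid_steps T []"
  by (simp add: valid_steps_def)

lemma valid_steps_Cons [simp]:
  "valid_steps T ((a, s, t) # xs) \<longleftrightarrow> (0 \<le> s \<and> s \<le> t \<and> t \<le> T) \<and> valid_steps T xs"
  by (simp add: valid_steps_def)

lemma valid_steps_append [simp]: "valid_steps T (xs @ ys) \<longleftrightarrow> valid_steps T xs \<and> valid_steps T ys"
  by (simp add: valid_steps_def ball_Un)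

lemma valid_steps_scale [simp]: "valid_steps T (scale_steps c xs) \<longleftrightarrow> valid_steps T xs"
  by (induction xs) (auto simp: scale_steps_def)

lemma step_function_simps [simp]:
  "step_function [] r = 0"
  "step_function ((a, s, t) # xs) r = a * indicator {s<..t} r + step_function xs r"
  "step_function (xs @ ys) r = step_function xs r + step_function ys r"
  "step_function (scale_steps c xs) r = c * step_function xs r"
  by (simp_all add: step_function_def)
    (induction xs; auto simp: scale_steps_def algebra_simps)

lemma step_integral_simps [simp]:
  "step_integral W [] \<omega> = 0"
  "step_integral W ((a, s, t) # xs) \<omega> = a * (W t \<omega> - W s \<omega>) + step_integral W xs \<omega>"
  "step_integral W (xs @ ys) \<omega> = step_integral W xs \<omega> + step_integral W ys \<omega>"
  "step_integral W (scale_steps c xs) \<omega> = c * step_integral W xs \<omega>"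
  by (simp_all add: step_integral_def)
    (induction xs; auto simp: scale_steps_def algebra_simps)

lemma space_time [simp]: "space (time_measure T) = {0..T}"
  by (simp add: time_measure_def space_restrict_space)

lemma time_measurable_borel:
  "f \<in> borel_measurable borel \<Longrightarrow> f \<in> borel_measurable (time_measure T)"
  unfolding time_measure_def by (rule measurable_restrict_space1) simp

lemma step_function_time_measurable [measurable]:
  "step_function xs \<in> borel_measurable (time_measure T)"
proof (rule time_measurable_borel)
  have "step_function xs = (\<lambda>r. \<Sum>x\<leftarrow>xs. (case x of (a, s, t) \<Rightarrow> a * indicator {s<..t} r))"
    by (simp add: step_function_def fun_eq_iff)
  also have "\<dots> \<in> borel_measurable borel"
    by (induction xs) (auto simp: case_prod_beta)
  finally show "step_function xs \<in> borel_measurable borel" .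
qed

lemma finite_measure_time: "finite_measure (time_measure T)"
  by (rule finite_measureI)
    (simp add: time_measure_def emeasure_restrict_space emeasure_lborel_Icc_eq space_restrict_space)

lemma bounded_time_Lp2:
  assumes "f \<in> borel_measurable (time_measure T)" "\<And>s. s \<in> {0..T} \<Longrightarrow> \<bar>f s\<bar> \<le> B"
  shows "f \<in> Lp 2 (time_measure T)"
proof -
  interpret finite_measure "time_measure T" by (rule finite_measure_time)
  have "(\<lambda>_. 1) \<in> Lp 2 (time_measure T)" by (simp add: Lp2_iff)
  from Lp2_bounded_mult[OF this assms(1), of B] assms(2) show ?thesis by simp
qed

lemma indicator_time_Lp2 [simp]:
  "A \<in> sets borel \<Longrightarrow> (indicator A :: real \<Rightarrow> real) \<in> Lp 2 (time_measure T)"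
  by (rule bounded_time_Lp2[where B=1])
    (auto intro!: time_measurable_borel split: split_indicator)

lemma step_function_Lp2 [simp]: "step_function xs \<in> Lp 2 (time_measure T)"
proof (induction xs)
  case (Cons x xs)
  obtain a s t where x: "x = (a, s, t)" by (cases x)
  have "step_function (x # xs) = (\<lambda>r. a * indicator {s<..t} r + step_function xs r)"
    by (simp add: x fun_eq_iff)
  then show ?case using Cons by (simp add: Lp2_add Lp2_cmult)
qed (simp add: Lp2_iff step_function_def)

lemma time_integral:
  "(\<integral>s. f s \<partial>time_measure T) = (LBINT s:{0..T}. f s)" for f :: "real \<Rightarrow> real"
  unfolding time_measure_def by (subst integral_restrict_space) (auto simp: set_lebesgue_integral_def)

lemma integral_indicator_time:
  assumes "0 \<le> s" "s \<le> t" "t \<le> T" "0 \<le> s'" "s' \<le> t'" "t' \<le> T"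
  shows "(\<integral>r. indicator {s<..t} r * indicator {s'<..t'} r \<partial>time_measure T)
     = min t t' - min t s' - min s t' + min s s'"
proof -
  have "(\<integral>r. indicator {s<..t} r * indicator {s'<..t'} r \<partial>time_measure T)
      = (\<integral>r. indicator {max s s'<..min t t'} r \<partial>lborel :: real)"
    unfolding time_integral set_lebesgue_integral_def
    using assms by (intro Bochner_Integration.integral_cong) (auto split: split_indicator)
  also have "\<dots> = measure lborel {max s s'<..min t t'}" by simp
  also have "\<dots> = max 0 (min t t' - max s s')"
  proof (cases "max s s' \<le> min t t'")
    case False
    then have *: "{max s s'<..min t t'} = {}" by auto
    have "max 0 (min t t' - max s s') = 0" using False by (intro max_absorb1) linarith
    then show ?thesis unfolding * by simp
  next
    case True
    then show ?thesis by (subst measure_lborel_Ioc) simp_all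
  qed
  also have "\<dots> = min t t' - min t s' - min s t' + min s s'"
    using assms by (auto simp: min_def max_def)
  finally show ?thesis .
qed

text \<open>
  Membership in the closure of the step functions in \<open>L\<^sup>2([0,T])\<close>; the closure properties below
  reduce \<open>steps_dense\<close> to indicators of half-lines.
\<close>

definition step_dense :: "real \<Rightarrow> (real \<Rightarrow> real) \<Rightarrow> bool" where
  "step_dense T g \<longleftrightarrow> g \<in> Lp 2 (time_measure T) \<and>
     (\<forall>e>0. \<exists>xs. valid_steps T xs \<and> norm2 (time_measure T) (\<lambda>r. g r - step_function xs r) < e)"

lemma step_dense_add:
  assumes "step_dense T f" "step_dense T g" shows "step_dense T (\<lambda>x. f x + g x)"
  unfolding step_dense_def
proof (intro conjI allI impI)
  show "(\<lambda>x. f x + g x) \<in> Lp 2 (time_measure T)" using assms by (auto simp: step_dense_def intro: Lp2_add)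
  fix e :: real assume "e > 0"
  then obtain xs ys where xs: "valid_steps T xs" "norm2 (time_measure T) (\<lambda>r. f r - step_function xs r) < e/2"
    and ys: "valid_steps T ys" "norm2 (time_measure T) (\<lambda>r. g r - step_function ys r) < e/2"
    using assms unfolding step_dense_def by (meson half_gt_zero)
  have "norm2 (time_measure T) (\<lambda>r. (f r - step_function xs r) + (g r - step_function ys r)) < e"
    using norm2_triangle[of "\<lambda>r. f r - step_function xs r" "time_measure T" "\<lambda>r. g r - step_function ys r"]
      assms xs ys by (auto simp: step_dense_def Lp2_diff)
  then have "norm2 (time_measure T) (\<lambda>r. f r + g r - step_function (xs @ ys) r) < e"
    by (simp add: algebra_simps)
  then show "\<exists>xs. valid_steps T xs \<and> norm2 (time_measure T) (\<lambda>r. f r + g r - step_function xs r) < e"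
    using xs ys by (intro exI[of _ "xs @ ys"]) simp
qed

lemma step_dense_cmult:
  assumes "step_dense T f" shows "step_dense T (\<lambda>x. c * f x)"
  unfolding step_dense_def
proof (intro conjI allI impI)
  show "(\<lambda>x. c * f x) \<in> Lp 2 (time_measure T)" using assms by (auto simp: step_dense_def intro: Lp2_cmult)
  fix e :: real assume "e > 0"
  then have "e / (\<bar>c\<bar> + 1) > 0" by simp
  then obtain xs where xs: "valid_steps T xs" "norm2 (time_measure T) (\<lambda>r. f r - step_function xs r) < e / (\<bar>c\<bar> + 1)"
    using assms unfolding step_dense_def by meson
  have "norm2 (time_measure T) (\<lambda>r. c * f r - step_function (scale_steps c xs) r)
      = \<bar>c\<bar> * norm2 (time_measure T) (\<lambda>r. f r - step_function xs r)"
    unfolding norm2_cmult[symmetric] by (simp add: algebra_simps)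
  also have "\<dots> \<le> (\<bar>c\<bar> + 1) * norm2 (time_measure T) (\<lambda>r. f r - step_function xs r)"
    by (intro mult_right_mono) auto
  also have "\<dots> < e" using xs(2) by (simp add: pos_less_divide_eq mult.commute)
  finally show "\<exists>xs. valid_steps T xs \<and> norm2 (time_measure T) (\<lambda>r. c * f r - step_function xs r) < e"
    using xs by (intro exI[of _ "scale_steps c xs"]) simp
qed

lemma step_dense_sum:
  assumes "\<And>i. i \<in> I \<Longrightarrow> step_dense T (f i)" "finite I"
  shows "step_dense T (\<lambda>x. \<Sum>i\<in>I. f i x)"
  using assms(2,1)
proof (induction I rule: finite_induct)
  case empty
  have "norm2 (time_measure T) (\<lambda>r. 0 - step_function [] r) = 0" by (simp add: norm2_def)
  then show ?case by (auto simp: step_dense_def intro!: exI[of _ "[]"] simp del: step_function_simps)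
qed (auto intro: step_dense_add)

lemma step_dense_limit:
  assumes "\<And>i. step_dense T (f i)" "conv2 (time_measure T) f g sequentially"
  shows "step_dense T g"
  unfolding step_dense_def
proof (intro conjI allI impI)
  note c = conv2D[OF assms(2)]
  show "g \<in> Lp 2 (time_measure T)" by (rule c)
  fix e :: real assume "e > 0"
  then obtain i where i: "norm2 (time_measure T) (\<lambda>x. f i x - g x) < e / 2"
    using LIMSEQ_D[OF c(3), of "e/2"] by auto
  have "\<exists>xs. valid_steps T xs \<and> norm2 (time_measure T) (\<lambda>r. f i r - step_function xs r) < e / 2"
    using assms(1)[of i] half_gt_zero[OF \<open>e > 0\<close>] unfolding step_dense_def by blast
  then obtain xs where xs: "valid_steps T xs" "norm2 (time_measure T) (\<lambda>r. f i r - step_function xs r) < e / 2"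
    by blast
  have "norm2 (time_measure T) (\<lambda>r. g r - step_function xs r) < e"
    using norm2_triangle3[OF c(2) c(1)[of i] step_function_Lp2, of xs] i xs
      norm2_minus[of "time_measure T" g "f i"] by linarith
  then show "\<exists>xs. valid_steps T xs \<and> norm2 (time_measure T) (\<lambda>r. g r - step_function xs r) < e"
    using xs by blast
qed

lemma step_dense_cong_AE:
  assumes "step_dense T f" "AE x in time_measure T. f x = g x" "g \<in> borel_measurable (time_measure T)"
  shows "step_dense T g"
proof (rule step_dense_limit[of T "\<lambda>_. f"])
  have f: "f \<in> Lp 2 (time_measure T)" using assms(1) by (simp add: step_dense_def)
  have g: "g \<in> Lp 2 (time_measure T)" by (rule Lp2_cong_AE[OF f assms(3,2)])
  have "norm2 (time_measure T) (\<lambda>x. f x - g x) = norm2 (time_measure T) (\<lambda>x. 0)"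
    using assms(2) Lp2_measurable[OF f] assms(3)
    by (intro norm2_cong_AE) (auto elim: eventually_mono)
  then have "norm2 (time_measure T) (\<lambda>x. f x - g x) = 0" by (simp add: norm2_def)
  then show "conv2 (time_measure T) (\<lambda>_. f) g sequentially" using f g by (simp add: conv2_def)
qed (rule assms)

lemma step_dense_interval:
  assumes "0 \<le> s" "s \<le> t" "t \<le> T"
  shows "step_dense T (indicator {s<..t})"
proof -
  have "norm2 (time_measure T) (\<lambda>r. indicator {s<..t} r - step_function [(1,s,t)] r) = 0"
    by (simp add: norm2_def)
  then show ?thesis using assms unfolding step_dense_def
    by (auto intro!: exI[of _ "[(1,s,t)]"] simp del: step_function_simps)
qed

lemma AE_time_not_eq: "AE x in time_measure T. x \<noteq> c"
  unfolding time_measure_def by (subst AE_restrict_space_iff) (auto intro: AE_mp[OF AE_lborel_singleton])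

lemma step_dense_indicator:
  assumes T: "0 < T" and "A \<in> sets borel"
  shows "step_dense T (indicator A)"
proof -
  have one: "step_dense T (indicator UNIV)"
    by (rule step_dense_cong_AE[OF step_dense_interval[of 0 T T]])
      (use T AE_time_not_eq[of 0 T] AE_space[of "time_measure T"] in \<open>auto elim!: eventually_elim2 intro: time_measurable_borel split: split_indicator\<close>)
  have A: "A \<in> sigma_sets UNIV (range (\<lambda>a::real. {..a}))"
    using assms(2) unfolding borel_eq_atMost by (simp add: sets_measure_of)
  have "Int_stable (range (\<lambda>a::real. {..a}))"
  proof (rule Int_stableI)
    fix a b assume "a \<in> range (\<lambda>a::real. {..a})" "b \<in> range (\<lambda>a::real. {..a})"
    then obtain x y where "a = {..x}" "b = {..y}" by auto
    then have "a \<inter> b = {..min x y}" by auto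
    then show "a \<inter> b \<in> range (\<lambda>a::real. {..a})" by blast
  qed
  moreover have "range (\<lambda>a::real. {..a}) \<subseteq> Pow UNIV" by simp
  ultimately show ?thesis using A
  proof (induction rule: sigma_sets_induct_disjoint)
    case (basic A)
    then obtain a where A: "A = {..a}" by auto
    \<comment> \<open>on \<open>[0,T]\<close> the half-line \<open>(-\<infinity>,a]\<close> is \<open>(0,b]\<close> up to the point \<open>0\<close>\<close>
    define b where "b = min T (max a 0)"
    have "step_dense T (indicator {0<..b})" using T by (intro step_dense_interval) (auto simp: b_def)
    then show ?case
    proof (rule step_dense_cong_AE)
      show "AE x in time_measure T. indicator {0<..b} x = (indicator A x :: real)"
        using AE_time_not_eq[of 0 T] AE_space[of "time_measure T"]
        by eventually_elim (auto simp: A b_def split: split_indicator)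
    qed (auto simp: A intro: time_measurable_borel)
  next
    case empty
    show ?case using step_dense_sum[of "{}" T "\<lambda>_ _. 0"] by simp
  next
    case (compl A)
    then have "step_dense T (\<lambda>x. indicator UNIV x + (-1) * indicator A x)"
      using one by (intro step_dense_add step_dense_cmult)
    then show ?case by (rule back_subst[of "step_dense T"]) (auto simp: fun_eq_iff split: split_indicator)
  next
    case (union A)
    have A[measurable]: "A i \<in> sets borel" for i
      using union(2) by (auto simp: borel_eq_atMost sets_measure_of)
    show ?case
    proof (rule step_dense_limit)
      show "step_dense T (\<lambda>x. \<Sum>i<n. indicator (A i) x)" for n
        using union by (intro step_dense_sum) auto
      have eq: "(\<Sum>i<n. indicator (A i) x) = (indicator (\<Union>i<n. A i) x :: real)" for n x
        by (rule indicator_UN_disjoint[symmetric]) (use union(1) in \<open>auto simp: disjoint_family_on_def\<close>)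
      show "conv2 (time_measure T) (\<lambda>n x. \<Sum>i<n. indicator (A i) x) (indicator (\<Union> (range A))) sequentially"
        unfolding eq
      proof (rule conv2_dominated)
        show "(indicator UNIV :: real \<Rightarrow> real) \<in> Lp 2 (time_measure T)"
          by (rule indicator_time_Lp2) simp
        show "AE x in time_measure T. (\<lambda>i. indicator (\<Union> (A ` {..<i})) x :: real) \<longlonglongrightarrow> indicator (\<Union> (range A)) x"
          by (simp add: LIMSEQ_indicator_UN)
      qed (auto intro!: time_measurable_borel split: split_indicator)
    qed
  qed
qed

text \<open>
  Simple functions are dominated by \<open>2 \<bar>g\<bar>\<close> and converge pointwise, and each of them is a
  combination of indicators.
\<close>

lemma steps_dense:
  assumes T: "0 < T" and g: "g \<in> Lp 2 (time_measure T)"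
  shows "step_dense T g"
proof -
  have [measurable]: "g \<in> borel_measurable (time_measure T)" using g by measurable
  obtain F where F: "\<And>i. simple_function (time_measure T) (F i)"
    "\<And>x. x \<in> space (time_measure T) \<Longrightarrow> (\<lambda>i. F i x) \<longlonglongrightarrow> g x"
    "\<And>i x. x \<in> space (time_measure T) \<Longrightarrow> dist (F i x) 0 \<le> 2 * dist (g x) 0"
    using borel_measurable_implies_sequence_metric[of g "time_measure T" 0]
    by (elim meta_impE exE conjE) (measurable, blast)
  have [measurable]: "F i \<in> borel_measurable (time_measure T)" for i
    using F(1) by (rule borel_measurable_simple_function)
  have sets: "step_dense T (indicator A)" if "A \<in> sets (time_measure T)" for A
  proof -
    have "A \<in> sets borel"
      using that by (simp add: time_measure_def sets_restrict_space_iff)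
    then show ?thesis using T by (intro step_dense_indicator)
  qed
  have simple: "step_dense T (F i)" for i
  proof (rule step_dense_cong_AE)
    show "step_dense T (\<lambda>x. \<Sum>y\<in>F i ` space (time_measure T). y * indicator (F i -` {y} \<inter> space (time_measure T)) x)"
      using simple_functionD[OF F(1)] by (intro step_dense_sum step_dense_cmult sets) auto
    show "AE x in time_measure T. (\<Sum>y\<in>F i ` space (time_measure T). y * indicator (F i -` {y} \<inter> space (time_measure T)) x) = F i x"
    proof (rule AE_I2)
      fix x assume x: "x \<in> space (time_measure T)"
      have "(\<Sum>y\<in>F i ` space (time_measure T). y * indicator (F i -` {y} \<inter> space (time_measure T)) x)
          = (\<Sum>y\<in>F i ` space (time_measure T). if y = F i x then y else 0)"
        using x by (intro sum.cong) auto
      then show "(\<Sum>y\<in>F i ` space (time_measure T). y * indicator (F i -` {y} \<inter> space (time_measure T)) x) = F i x"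
        using x simple_functionD(1)[OF F(1)[of i]] by (simp add: sum.delta')
    qed
  qed measurable
  show ?thesis
  proof (rule step_dense_limit[OF simple conv2_dominated])
    show "(\<lambda>x. 2 * \<bar>g x\<bar>) \<in> Lp 2 (time_measure T)"
      using g by (intro Lp2_cmult) (auto simp: Lp2_iff)
    show "AE x in time_measure T. (\<lambda>i. F i x) \<longlonglongrightarrow> g x" using F(2) by (intro AE_I2)
  qed (use F(3) in auto)
qed

lemma step_sequence:
  assumes T: "0 < T" and g: "g \<in> Lp 2 (time_measure T)"
  shows "\<exists>xs. (\<forall>n. valid_steps T (xs n)) \<and> conv2 (time_measure T) (\<lambda>n. step_function (xs n)) g sequentially"
proof -
  have "\<exists>xs. valid_steps T xs \<and> norm2 (time_measure T) (\<lambda>r. g r - step_function xs r) < inverse (real (Suc n))" for n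
    using steps_dense[OF assms] unfolding step_dense_def by simp
  then obtain xs where xs: "\<And>n. valid_steps T (xs n)"
    "\<And>n. norm2 (time_measure T) (\<lambda>r. g r - step_function (xs n) r) < inverse (real (Suc n))" by metis
  have "conv2 (time_measure T) (\<lambda>n. step_function (xs n)) g sequentially"
    by (rule conv2_bound[OF _ g LIMSEQ_inverse_real_of_nat])
      (use xs(2) in \<open>auto simp: norm2_minus[of _ _ g] intro: less_imp_le\<close>)
  with xs(1) show ?thesis by blast
qed

section \<open>Wiener integrals\<close>

locale brownian =
  fixes T :: real and M :: "'a measure" and W :: "real \<Rightarrow> 'a \<Rightarrow> real"
  assumes setting: "brownian_setting T M W"
begin

abbreviation "\<F> \<equiv> augmented_filtration T M W"
abbreviation "\<mu> \<equiv> time_measure T"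
abbreviation "Q \<equiv> process_measure T M"
abbreviation "wiener \<equiv> wiener_integral T M W"

lemma T_pos: "0 < T" and sets_M: "sets M = sets (\<F> T)"
  and brownian_motion: "standard_brownian_motion T M \<F> W"
  using setting by (auto simp: brownian_setting_def)

sublocale prob_space M
  using brownian_motion by (simp add: standard_brownian_motion_def)

lemma Lp2_const [simp]: "(\<lambda>_. c) \<in> Lp 2 M"
  by (simp add: Lp2_iff)

lemma Lp2_integrable: "X \<in> Lp 2 M \<Longrightarrow> integrable M X"
  using Lp2_mult_integrable[of X M "\<lambda>_. 1"] by simp

lemma subalgebra_filtration: "t \<in> {0..T} \<Longrightarrow> subalgebra M (\<F> t)"
  and W_adapted: "t \<in> {0..T} \<Longrightarrow> W t \<in> borel_measurable (\<F> t)"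
  and W_zero: "AE \<omega> in M. W 0 \<omega> = 0"
  and W_continuous: "AE \<omega> in M. continuous_on {0..T} (\<lambda>t. W t \<omega>)"
  using brownian_motion by (auto simp: standard_brownian_motion_def)

lemma increment_normal:
  "0 \<le> s \<Longrightarrow> s < t \<Longrightarrow> t \<le> T \<Longrightarrow>
    distributed M lborel (\<lambda>\<omega>. W t \<omega> - W s \<omega>) (normal_density 0 (sqrt (t - s)))"
  and increment_indep:
  "0 \<le> s \<Longrightarrow> s < t \<Longrightarrow> t \<le> T \<Longrightarrow>
    indep_set (sets (\<F> s)) {(\<lambda>\<omega>. W t \<omega> - W s \<omega>) -` B \<inter> space M | B. B \<in> sets borel}"
  using brownian_motion by (simp_all add: standard_brownian_motion_def)

lemma W_measurable [measurable]: "t \<in> {0..T} \<Longrightarrow> W t \<in> borel_measurable M"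
  by (rule measurable_from_subalg[OF subalgebra_filtration W_adapted])

lemma generators_filtration:
  "sets (natural_filtration M W t) \<union> {N. \<exists>G \<in> sets (natural_filtration M W T). emeasure M G = 0 \<and> N \<subseteq> G}
    \<subseteq> Pow (space M)"
proof -
  have "space (natural_filtration M W t) = space M" for t
    unfolding natural_filtration_def by (rule space_measure_of) auto
  then have "sets (natural_filtration M W t) \<subseteq> Pow (space M)" for t
    using sets.space_closed[of "natural_filtration M W t"] by simp
  then show ?thesis by blast
qed

lemma space_filtration [simp]: "space (\<F> t) = space M"
  unfolding augmented_filtration_def by (rule space_measure_of[OF generators_filtration])

lemma sets_filtration:
  "sets (\<F> t) = sigma_sets (space M) (sets (natural_filtration M W t) \<union>
     {N. \<exists>G \<in> sets (natural_filtration M W T). emeasure M G = 0 \<and> N \<subseteq> G})"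
  unfolding augmented_filtration_def by (rule sets_measure_of[OF generators_filtration])

lemma sets_natural_filtration:
  "sets (natural_filtration M W t) = sigma_sets (space M) {W s -` B \<inter> space M | s B. s \<in> {0..t} \<and> B \<in> sets borel}"
  unfolding natural_filtration_def by (rule sets_measure_of) auto

lemma filtration_mono:
  assumes "s \<le> t" shows "sets (\<F> s) \<subseteq> sets (\<F> t)"
proof -
  have "sets (natural_filtration M W s) \<subseteq> sets (natural_filtration M W t)"
  proof -
    have "{W r -` B \<inter> space M |r B. r \<in> {0..s} \<and> B \<in> sets borel}
        \<subseteq> {W r -` B \<inter> space M |r B. r \<in> {0..t} \<and> B \<in> sets borel}"
      using assms by force
    then show ?thesis unfolding sets_natural_filtration by (rule sigma_sets_mono')
  qed
  then show ?thesis unfolding sets_filtration by (intro sigma_sets_mono') blast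
qed

lemma W_filtration:
  assumes "0 \<le> s" "s \<le> t" "t \<le> T" shows "W s \<in> borel_measurable (\<F> t)"
  using measurable_mono[of borel borel "\<F> s" "\<F> t"] filtration_mono[OF assms(2)] W_adapted[of s] assms
  by auto

lemma increment_moments:
  assumes "0 \<le> s" "s \<le> t" "t \<le> T"
  shows "(\<lambda>\<omega>. W t \<omega> - W s \<omega>) \<in> Lp 2 M" "expectation (\<lambda>\<omega>. W t \<omega> - W s \<omega>) = 0"
    "expectation (\<lambda>\<omega>. (W t \<omega> - W s \<omega>)\<^sup>2) = t - s"
proof -
  have m[measurable]: "W t \<in> borel_measurable M" "W s \<in> borel_measurable M" using assms by auto
  have "(\<lambda>\<omega>. W t \<omega> - W s \<omega>) \<in> Lp 2 M \<and> expectation (\<lambda>\<omega>. W t \<omega> - W s \<omega>) = 0 \<and>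
    expectation (\<lambda>\<omega>. (W t \<omega> - W s \<omega>)\<^sup>2) = t - s"
  proof (cases "s = t")
    case True
    then show ?thesis by simp
  next
    case False
    then have st: "s < t" using assms by simp
    note d = increment_normal[OF assms(1) st assms(3)]
    have "integrable lborel (\<lambda>x. normal_density 0 (sqrt (t - s)) x * x\<^sup>2)"
      using integrable_normal_moment[of "sqrt (t - s)" 0 2] st by simp
    then have "integrable M (\<lambda>\<omega>. (W t \<omega> - W s \<omega>)\<^sup>2)"
      using distributed_integrable[OF d, of "\<lambda>x. x\<^sup>2"] by simp
    moreover have e: "expectation (\<lambda>\<omega>. W t \<omega> - W s \<omega>) = 0"
      using normal_distributed_expectation[OF _ d] st by simp
    moreover have "expectation (\<lambda>\<omega>. (W t \<omega> - W s \<omega>)\<^sup>2) = t - s"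
      using normal_distributed_variance[OF _ d] e st by simp
    ultimately show ?thesis by (simp add: Lp2_iff)
  qed
  then show "(\<lambda>\<omega>. W t \<omega> - W s \<omega>) \<in> Lp 2 M" "expectation (\<lambda>\<omega>. W t \<omega> - W s \<omega>) = 0"
    "expectation (\<lambda>\<omega>. (W t \<omega> - W s \<omega>)\<^sup>2) = t - s" by auto
qed

text \<open>
  The Brownian motion is given with independence of events; in this form it applies to random
  variables.
\<close>

lemma indep_increment:
  assumes "0 \<le> s" "s < t" "t \<le> T" and Z: "Z \<in> borel_measurable (\<F> s)"
  shows "indep_var borel Z borel (\<lambda>\<omega>. W t \<omega> - W s \<omega>)"
  unfolding indep_var_eq
proof (intro conjI)
  show "random_variable borel Z"
    using measurable_from_subalg[OF subalgebra_filtration Z] assms by auto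
  have [measurable]: "W t \<in> borel_measurable M" "W s \<in> borel_measurable M" using assms by auto
  show "random_variable borel (\<lambda>\<omega>. W t \<omega> - W s \<omega>)" by measurable
  have "sigma_sets (space M) {Z -` A \<inter> space M |A. A \<in> sets borel} \<subseteq> sets (\<F> s)"
    using sets.sigma_sets_subset[of "{Z -` A \<inter> space M |A. A \<in> sets borel}" "\<F> s"] measurable_sets[OF Z]
    by auto
  moreover have "sigma_sets (space M) {(\<lambda>\<omega>. W t \<omega> - W s \<omega>) -` A \<inter> space M |A. A \<in> sets borel}
     = {(\<lambda>\<omega>. W t \<omega> - W s \<omega>) -` A \<inter> space M |A. A \<in> sets borel}"
  proof -
    have e: "sigma_sets UNIV (sets borel) = sets (borel :: real measure)"
      using sets.sigma_sets_eq[of borel] by simp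
    show ?thesis
      using sigma_sets_vimage_commute[of "\<lambda>\<omega>. W t \<omega> - W s \<omega>" "space M" UNIV "sets borel"]
      unfolding e by simp
  qed
  ultimately show "indep_set (sigma_sets (space M) {Z -` A \<inter> space M |A. A \<in> sets borel})
     (sigma_sets (space M) {(\<lambda>\<omega>. W t \<omega> - W s \<omega>) -` A \<inter> space M |A. A \<in> sets borel})"
    using subalgebra_filtration[of s] assms(1-3) measurable_sets[of "\<lambda>\<omega>. W t \<omega> - W s \<omega>" M borel]
    by (intro indep_setI) (auto simp: subalgebra_def intro!: indep_setD[OF increment_indep[OF assms(1-3)]])
qed

lemma covariance_increments_from_0:
  assumes "0 \<le> s" "s \<le> t" "t \<le> T"
  shows "expectation (\<lambda>\<omega>. (W s \<omega> - W 0 \<omega>) * (W t \<omega> - W 0 \<omega>)) = s"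
proof -
  note s = increment_moments[of 0 s] and t = increment_moments[OF assms]
  have "expectation (\<lambda>\<omega>. (W s \<omega> - W 0 \<omega>) * (W t \<omega> - W s \<omega>)) = 0"
  proof (cases "s = t")
    case False
    have "W s \<in> borel_measurable (\<F> s)" "W 0 \<in> borel_measurable (\<F> s)"
      using assms by (auto intro: W_filtration)
    then have "(\<lambda>\<omega>. W s \<omega> - W 0 \<omega>) \<in> borel_measurable (\<F> s)" by measurable
    then have "indep_var borel (\<lambda>\<omega>. W s \<omega> - W 0 \<omega>) borel (\<lambda>\<omega>. W t \<omega> - W s \<omega>)"
      using False assms by (intro indep_increment) auto
    then have "expectation (\<lambda>\<omega>. (W s \<omega> - W 0 \<omega>) * (W t \<omega> - W s \<omega>))
       = expectation (\<lambda>\<omega>. W s \<omega> - W 0 \<omega>) * expectation (\<lambda>\<omega>. W t \<omega> - W s \<omega>)"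
      using assms by (intro indep_var_lebesgue_integral Lp2_integrable s t) auto
    then show ?thesis using t(2) by simp
  qed simp
  moreover have "expectation (\<lambda>\<omega>. (W s \<omega> - W 0 \<omega>) * (W t \<omega> - W 0 \<omega>))
     = expectation (\<lambda>\<omega>. (W s \<omega> - W 0 \<omega>)\<^sup>2 + (W s \<omega> - W 0 \<omega>) * (W t \<omega> - W s \<omega>))"
    by (intro Bochner_Integration.integral_cong) (auto simp: power2_eq_square algebra_simps)
  ultimately show ?thesis
    using s assms Lp2_mult_integrable[of "\<lambda>\<omega>. W s \<omega> - W 0 \<omega>" M "\<lambda>\<omega>. W t \<omega> - W s \<omega>"] t
      Lp2_square[OF s(1)] by simp
qed

lemma covariance_increments:
  assumes "0 \<le> s" "s \<le> t" "t \<le> T" "0 \<le> s'" "s' \<le> t'" "t' \<le> T"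
  shows "expectation (\<lambda>\<omega>. (W t \<omega> - W s \<omega>) * (W t' \<omega> - W s' \<omega>))
     = min t t' - min t s' - min s t' + min s s'"
proof -
  have c: "expectation (\<lambda>\<omega>. (W a \<omega> - W 0 \<omega>) * (W b \<omega> - W 0 \<omega>)) = min a b" if "0 \<le> a" "a \<le> T" "0 \<le> b" "b \<le> T" for a b
    using covariance_increments_from_0[of a b] covariance_increments_from_0[of b a] that
    by (cases "a \<le> b") (simp_all add: mult.commute)
  have i: "integrable M (\<lambda>\<omega>. (W a \<omega> - W 0 \<omega>) * (W b \<omega> - W 0 \<omega>))" if "0 \<le> a" "a \<le> T" "0 \<le> b" "b \<le> T" for a b
    using that by (intro Lp2_mult_integrable increment_moments) auto
  have "expectation (\<lambda>\<omega>. (W t \<omega> - W s \<omega>) * (W t' \<omega> - W s' \<omega>))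
    = expectation (\<lambda>\<omega>. (W t \<omega> - W 0 \<omega>) * (W t' \<omega> - W 0 \<omega>) - (W t \<omega> - W 0 \<omega>) * (W s' \<omega> - W 0 \<omega>)
        - (W s \<omega> - W 0 \<omega>) * (W t' \<omega> - W 0 \<omega>) + (W s \<omega> - W 0 \<omega>) * (W s' \<omega> - W 0 \<omega>))"
    by (intro Bochner_Integration.integral_cong) (auto simp: algebra_simps)
  also have "\<dots> = min t t' - min t s' - min s t' + min s s'"
    using assms i c by simp
  finally show ?thesis .
qed

lemma step_integral_Lp2 [simp]: "valid_steps T xs \<Longrightarrow> step_integral W xs \<in> Lp 2 M"
proof (induction xs)
  case Nil
  have "step_integral W [] = (\<lambda>\<omega>. 0)" by (simp add: fun_eq_iff)
  then show ?case by simp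
next
  case (Cons x xs)
  obtain a s t where x: "x = (a, s, t)" by (cases x)
  have "step_integral W (x # xs) = (\<lambda>\<omega>. a * (W t \<omega> - W s \<omega>) + step_integral W xs \<omega>)"
    by (simp add: x fun_eq_iff)
  then show ?case using Cons x by (simp add: Lp2_add Lp2_cmult increment_moments)
qed

text \<open>
  Both sides are bilinear in the lists of steps, so the claim reduces to single steps, where it
  compares the covariance of two Brownian increments with the length of the overlap of two
  intervals.
\<close>

lemma step_isometry:
  assumes "valid_steps T xs" "valid_steps T ys"
  shows "expectation (\<lambda>\<omega>. step_integral W xs \<omega> * step_integral W ys \<omega>)
    = (\<integral>r. step_function xs r * step_function ys r \<partial>\<mu>)"
  using assms(1)
proof (induction xs)
  case (Cons x xs)
  obtain a s t where x: "x = (a, s, t)" by (cases x)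
  have st: "0 \<le> s" "s \<le> t" "t \<le> T" and xs: "valid_steps T xs" using Cons.prems x by auto
  have single: "expectation (\<lambda>\<omega>. (W t \<omega> - W s \<omega>) * step_integral W ys \<omega>)
    = (\<integral>r. indicator {s<..t} r * step_function ys r \<partial>\<mu>)"
    using assms(2)
  proof (induction ys)
    case (Cons y ys)
    obtain b s' t' where y: "y = (b, s', t')" by (cases y)
    have st': "0 \<le> s'" "s' \<le> t'" "t' \<le> T" and ys: "valid_steps T ys" using Cons.prems y by auto
    have "expectation (\<lambda>\<omega>. (W t \<omega> - W s \<omega>) * step_integral W (y # ys) \<omega>)
      = expectation (\<lambda>\<omega>. b * ((W t \<omega> - W s \<omega>) * (W t' \<omega> - W s' \<omega>)) + (W t \<omega> - W s \<omega>) * step_integral W ys \<omega>)"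
      by (intro Bochner_Integration.integral_cong) (auto simp: y algebra_simps)
    also have "\<dots> = b * expectation (\<lambda>\<omega>. (W t \<omega> - W s \<omega>) * (W t' \<omega> - W s' \<omega>))
        + expectation (\<lambda>\<omega>. (W t \<omega> - W s \<omega>) * step_integral W ys \<omega>)"
      using st st' ys by (subst Bochner_Integration.integral_add)
        (auto intro!: integrable_mult_right Lp2_mult_integrable increment_moments)
    also have "\<dots> = b * (\<integral>r. indicator {s<..t} r * indicator {s'<..t'} r \<partial>\<mu>)
        + (\<integral>r. indicator {s<..t} r * step_function ys r \<partial>\<mu>)"
      using st st' ys Cons.IH by (simp add: covariance_increments integral_indicator_time)
    also have "\<dots> = (\<integral>r. b * (indicator {s<..t} r * indicator {s'<..t'} r) + indicator {s<..t} r * step_function ys r \<partial>\<mu>)"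
      by (subst Bochner_Integration.integral_add)
        (auto intro!: integrable_mult_right Lp2_mult_integrable)
    also have "\<dots> = (\<integral>r. indicator {s<..t} r * step_function (y # ys) r \<partial>\<mu>)"
      by (intro Bochner_Integration.integral_cong) (auto simp: y algebra_simps)
    finally show ?case .
  qed simp
  have "expectation (\<lambda>\<omega>. step_integral W (x # xs) \<omega> * step_integral W ys \<omega>)
    = expectation (\<lambda>\<omega>. a * ((W t \<omega> - W s \<omega>) * step_integral W ys \<omega>) + step_integral W xs \<omega> * step_integral W ys \<omega>)"
    by (intro Bochner_Integration.integral_cong) (auto simp: x algebra_simps)
  also have "\<dots> = a * expectation (\<lambda>\<omega>. (W t \<omega> - W s \<omega>) * step_integral W ys \<omega>)
      + expectation (\<lambda>\<omega>. step_integral W xs \<omega> * step_integral W ys \<omega>)"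
    using st xs assms(2) by (subst Bochner_Integration.integral_add)
      (auto intro!: integrable_mult_right Lp2_mult_integrable increment_moments)
  also have "\<dots> = a * (\<integral>r. indicator {s<..t} r * step_function ys r \<partial>\<mu>)
      + (\<integral>r. step_function xs r * step_function ys r \<partial>\<mu>)"
    using Cons.IH[OF xs] single by simp
  also have "\<dots> = (\<integral>r. a * (indicator {s<..t} r * step_function ys r) + step_function xs r * step_function ys r \<partial>\<mu>)"
    by (subst Bochner_Integration.integral_add)
      (auto intro!: integrable_mult_right Lp2_mult_integrable)
  also have "\<dots> = (\<integral>r. step_function (x # xs) r * step_function ys r \<partial>\<mu>)"
    by (intro Bochner_Integration.integral_cong) (auto simp: x algebra_simps)
  finally show ?case .
qed simp

lemma wiener_integral_iff:
  "wiener h X \<longleftrightarrow>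
    (\<exists>xs. (\<forall>n. valid_steps T (xs n)) \<and> conv2 \<mu> (\<lambda>n. step_function (xs n)) h sequentially \<and>
      conv2 M (\<lambda>n. step_integral W (xs n)) X sequentially)"
  unfolding wiener_integral_def valid_steps_def[symmetric]
proof (intro iffI; elim exE conjE)
  fix xs assume "h \<in> Lp 2 \<mu>" "X \<in> Lp 2 M" "\<forall>n. valid_steps T (xs n)"
    "tendsto_Lp 2 \<mu> (\<lambda>n. step_function (xs n)) h sequentially"
    "tendsto_Lp 2 M (\<lambda>n. step_integral W (xs n)) X sequentially"
  then show "\<exists>xs. (\<forall>n. valid_steps T (xs n)) \<and> conv2 \<mu> (\<lambda>n. step_function (xs n)) h sequentially \<and>
      conv2 M (\<lambda>n. step_integral W (xs n)) X sequentially"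
    by (intro exI[of _ xs]) (simp add: tendsto_Lp2_iff)
next
  fix xs assume a: "\<forall>n. valid_steps T (xs n)" "conv2 \<mu> (\<lambda>n. step_function (xs n)) h sequentially"
    "conv2 M (\<lambda>n. step_integral W (xs n)) X sequentially"
  from a show "h \<in> Lp 2 \<mu> \<and> X \<in> Lp 2 M \<and>
     (\<exists>xs. (\<forall>n. valid_steps T (xs n)) \<and>
        tendsto_Lp 2 \<mu> (\<lambda>n. step_function (xs n)) h sequentially \<and>
        tendsto_Lp 2 M (\<lambda>n. step_integral W (xs n)) X sequentially)"
    using conv2D[OF a(2)] conv2D[OF a(3)]
    by (intro conjI exI[of _ xs]) (simp_all add: tendsto_Lp2_iff)
qed

lemma wiener_Lp2:
  assumes "wiener h X"
  shows "h \<in> Lp 2 \<mu>" "X \<in> Lp 2 M"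
  using assms by (auto simp: wiener_integral_def)

lemma wiener_isometry:
  assumes "wiener h X" "wiener g Y"
  shows "expectation (\<lambda>\<omega>. X \<omega> * Y \<omega>) = (\<integral>s. h s * g s \<partial>\<mu>)"
proof -
  from assms obtain xs ys where x: "\<forall>n. valid_steps T (xs n)"
      "conv2 \<mu> (\<lambda>n. step_function (xs n)) h sequentially"
      "conv2 M (\<lambda>n. step_integral W (xs n)) X sequentially"
    and y: "\<forall>n. valid_steps T (ys n)"
      "conv2 \<mu> (\<lambda>n. step_function (ys n)) g sequentially"
      "conv2 M (\<lambda>n. step_integral W (ys n)) Y sequentially"
    unfolding wiener_integral_iff by blast
  have "(\<lambda>n. expectation (\<lambda>\<omega>. step_integral W (xs n) \<omega> * step_integral W (ys n) \<omega>))
    \<longlonglongrightarrow> (\<integral>s. h s * g s \<partial>\<mu>)"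
    using conv2_inner[OF x(2) y(2)] x(1) y(1) by (simp add: step_isometry)
  then show ?thesis by (rule LIMSEQ_unique[OF conv2_inner[OF x(3) y(3)]])
qed

lemma step_norm:
  assumes "valid_steps T xs" "valid_steps T ys"
  shows "norm2 M (\<lambda>\<omega>. step_integral W xs \<omega> - step_integral W ys \<omega>)
    = norm2 \<mu> (\<lambda>r. step_function xs r - step_function ys r)"
  using step_isometry[of "xs @ scale_steps (-1) ys" "xs @ scale_steps (-1) ys"] assms
  by (simp add: norm2_def power2_eq_square)

text \<open>
  By the isometry for step functions, approximating step functions have integrals that are Cauchy
  in \<open>L\<^sup>2(\<Omega>)\<close>.
\<close>

lemma wiener_exists:
  assumes "g \<in> Lp 2 \<mu>"
  shows "\<exists>Z. wiener g Z"
proof -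
  obtain xs where xs: "\<And>n. valid_steps T (xs n)"
    "conv2 \<mu> (\<lambda>n. step_function (xs n)) g sequentially"
    using step_sequence[OF T_pos assms] by blast
  have "\<exists>Z. conv2 M (\<lambda>n. step_integral W (xs n)) Z sequentially"
    by (rule conv2_complete) (use xs(1) conv2_Cauchy[OF xs(2)] in \<open>simp_all add: step_norm\<close>)
  then show ?thesis using xs unfolding wiener_integral_iff by blast
qed

lemma wiener_step: "valid_steps T xs \<Longrightarrow> wiener (step_function xs) (step_integral W xs)"
  unfolding wiener_integral_iff by (intro exI[of _ "\<lambda>_. xs"]) (simp add: conv2_const)

lemma wiener_cong_AE:
  assumes "wiener h X" "AE \<omega> in M. X \<omega> = Y \<omega>" "Y \<in> borel_measurable M"
  shows "wiener h Y"
proof -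
  from assms(1) obtain xs where xs: "\<forall>n. valid_steps T (xs n)"
      "conv2 \<mu> (\<lambda>n. step_function (xs n)) h sequentially"
      "conv2 M (\<lambda>n. step_integral W (xs n)) X sequentially"
    unfolding wiener_integral_iff by blast
  have Y: "Y \<in> Lp 2 M" using Lp2_cong_AE[OF wiener_Lp2(2)[OF assms(1)] assms(3,2)] .
  have "norm2 M (\<lambda>\<omega>. step_integral W (xs n) \<omega> - X \<omega>) = norm2 M (\<lambda>\<omega>. step_integral W (xs n) \<omega> - Y \<omega>)" for n
    using assms(2,3) xs(1) wiener_Lp2(2)[OF assms(1)] Lp2_measurable[OF step_integral_Lp2]
    by (intro norm2_cong_AE) (auto intro!: borel_measurable_diff Lp2_measurable elim: eventually_mono)
  then have "conv2 M (\<lambda>n. step_integral W (xs n)) Y sequentially"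
    using xs(3) Y by (simp add: conv2_def)
  then show ?thesis using xs unfolding wiener_integral_iff by blast
qed

end

section \<open>Gaussian integration by parts\<close>

lemma tendsto_sequence_iff:
  fixes f :: "'b \<Rightarrow> nat \<Rightarrow> real"
  shows "(f \<longlongrightarrow> l) F \<longleftrightarrow> (\<forall>i. ((\<lambda>c. f c i) \<longlongrightarrow> l i) F)"
  using limitin_componentwise[of "\<lambda>_. euclidean" UNIV f l F]
  by (simp add: euclidean_product_topology)

text \<open>
  Integration by parts uses first derivatives only. Closure of this class under products and sums
  is seen from first partial derivatives alone.
\<close>

definition C1b :: "nat \<Rightarrow> ((nat \<Rightarrow> real) \<Rightarrow> real) set" where
  "C1b n = {f. (\<forall>x y. (\<forall>i<n. x i = y i) \<longrightarrow> f x = f y) \<and> bounded (range f) \<and> continuous_on UNIV f \<and>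
     (\<forall>i<n. bounded (range (partial_deriv i f)) \<and> continuous_on UNIV (partial_deriv i f) \<and>
        (\<forall>x. (\<lambda>y. f (x(i := y))) field_differentiable at (x i)))}"

lemma C1b_cong: "f \<in> C1b n \<Longrightarrow> (\<And>i. i < n \<Longrightarrow> x i = y i) \<Longrightarrow> f x = f y"
  by (auto simp: C1b_def)

lemma C1b_bounded: "f \<in> C1b n \<Longrightarrow> \<exists>B. \<forall>x. \<bar>f x\<bar> \<le> B"
  by (auto simp: C1b_def bounded_iff)

lemma C1b_partial_bounded: "f \<in> C1b n \<Longrightarrow> i < n \<Longrightarrow> \<exists>B. \<forall>x. \<bar>partial_deriv i f x\<bar> \<le> B"
  by (auto simp: C1b_def bounded_iff)

lemma C1b_continuous: "f \<in> C1b n \<Longrightarrow> continuous_on UNIV f"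
  and C1b_partial_continuous: "f \<in> C1b n \<Longrightarrow> i < n \<Longrightarrow> continuous_on UNIV (partial_deriv i f)"
  by (auto simp: C1b_def)

lemma C1b_partial_cong:
  assumes f: "f \<in> C1b n" and i: "i < n" and xy: "\<And>j. j < n \<Longrightarrow> x j = y j"
  shows "partial_deriv i f x = partial_deriv i f y"
proof -
  have "f (x(i := z)) = f (y(i := z))" for z
    by (rule C1b_cong[OF f]) (use xy in auto)
  then show ?thesis using xy[OF i] by (simp add: partial_deriv_def)
qed

lemma C1b_has_derivative:
  assumes f: "f \<in> C1b n" and i: "i < n"
  shows "((\<lambda>y. f (x(i := y))) has_real_derivative partial_deriv i f (x(i := z))) (at z)"
proof -
  have "(\<lambda>y. f ((x(i := z))(i := y))) field_differentiable at ((x(i := z)) i)"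
    using f i unfolding C1b_def by blast
  then have "(\<lambda>y. f (x(i := y))) field_differentiable at z" by simp
  then show ?thesis
    by (simp add: partial_deriv_def field_differentiable_derivI)
qed

text \<open>
  The increments to which the mean value theorem is applied below may have either sign; the bound
  on \<open>z\<close> makes the intermediate points converge together with the endpoints.
\<close>

lemma mvt_unordered:
  fixes g g' :: "real \<Rightarrow> real"
  assumes g: "\<And>x. (g has_real_derivative g' x) (at x)"
  shows "\<exists>z. \<bar>z - a\<bar> \<le> \<bar>b - a\<bar> \<and> g b - g a = (b - a) * g' z"
proof (cases a b rule: linorder_cases)
  case less
  then obtain z where "a < z" "z < b" "g b - g a = (b - a) * g' z" using MVT2[of a b g g'] g by blast
  then show ?thesis by (intro exI[of _ z]) auto
next
  case greater
  then obtain z where "b < z" "z < a" "g a - g b = (a - b) * g' z" using MVT2[of b a g g'] g by blast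
  then show ?thesis by (intro exI[of _ z]) (auto simp: algebra_simps)
qed auto

text \<open>
  Only separate partial derivatives of \<open>f\<close> are at hand, so the increment is telescoped over the
  coordinates and each term is treated by the one-dimensional mean value theorem; continuity of
  the partial derivatives gives the limit.
\<close>

lemma C1b_chain_rule:
  assumes f: "f \<in> C1b n"
  shows "((\<lambda>y. f (\<lambda>i. r i + a i * y)) has_real_derivative
    (\<Sum>i<n. a i * partial_deriv i f (\<lambda>i. r i + a i * y0))) (at y0)"
proof -
  define x where "x = (\<lambda>i. r i + a i * y0)"
  \<comment> \<open>\<open>p h k\<close> has moved the first \<open>k\<close> coordinates to their final position\<close>
  define p where "p h k = (\<lambda>i. if i < k then x i + a i * h else x i)" for h :: real and k :: nat
  have "\<exists>q. \<bar>q - x k\<bar> \<le> \<bar>a k * h\<bar> \<and>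
      f (p h (Suc k)) - f (p h k) = a k * h * partial_deriv k f ((p h k)(k := q))" if k: "k < n" for h k
  proof -
    have "\<exists>q. \<bar>q - x k\<bar> \<le> \<bar>(x k + a k * h) - x k\<bar> \<and>
      f ((p h k)(k := x k + a k * h)) - f ((p h k)(k := x k))
        = ((x k + a k * h) - x k) * partial_deriv k f ((p h k)(k := q))"
      by (rule mvt_unordered) (rule C1b_has_derivative[OF f k])
    moreover have "(p h k)(k := x k + a k * h) = p h (Suc k)" "(p h k)(k := x k) = p h k"
      by (auto simp: p_def fun_eq_iff less_Suc_eq)
    ultimately show ?thesis by simp
  qed
  note ex = this
  define q where "q h k = (SOME q. \<bar>q - x k\<bar> \<le> \<bar>a k * h\<bar> \<and>
      f (p h (Suc k)) - f (p h k) = a k * h * partial_deriv k f ((p h k)(k := q)))" for h k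
  have q: "\<bar>q h k - x k\<bar> \<le> \<bar>a k * h\<bar>"
    "f (p h (Suc k)) - f (p h k) = a k * h * partial_deriv k f ((p h k)(k := q h k))" if "k < n" for h k
    using someI_ex[OF ex[OF that, of h]] unfolding q_def[symmetric] by blast+
  have lim: "((\<lambda>h. \<Sum>k<n. a k * partial_deriv k f ((p h k)(k := q h k))) \<longlongrightarrow> (\<Sum>k<n. a k * partial_deriv k f x)) (at 0)"
  proof (intro tendsto_sum tendsto_mult tendsto_const)
    fix k assume "k \<in> {..<n}"
    then have k: "k < n" by simp
    have "((\<lambda>h. (p h k)(k := q h k)) \<longlongrightarrow> x) (at 0)"
      unfolding tendsto_sequence_iff
    proof
      fix i
      have "((\<lambda>h. \<bar>a i * h\<bar>) \<longlongrightarrow> \<bar>a i * 0\<bar>) (at 0)" by (intro tendsto_intros)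
      then have lim0: "((\<lambda>h. \<bar>a i * h\<bar>) \<longlongrightarrow> 0) (at 0)" by simp
      have "norm (((p h k)(k := q h k)) i - x i) \<le> \<bar>a i * h\<bar>" for h
        using q(1)[OF k, of h] by (simp add: p_def)
      then have "((\<lambda>h. ((p h k)(k := q h k)) i - x i) \<longlongrightarrow> 0) (at 0)"
        by (rule Lim_null_comparison[OF always_eventually[OF allI] lim0])
      then show "((\<lambda>h. ((p h k)(k := q h k)) i) \<longlongrightarrow> x i) (at 0)" by (simp add: LIM_zero_iff)
    qed
    then show "((\<lambda>h. partial_deriv k f ((p h k)(k := q h k))) \<longlongrightarrow> partial_deriv k f x) (at 0)"
      by (intro continuous_on_tendsto_compose[OF C1b_partial_continuous[OF f k]]) auto
  qed
  have tel: "f (p h n) - f (p h 0) = h * (\<Sum>k<n. a k * partial_deriv k f ((p h k)(k := q h k)))" for h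
    unfolding sum_lessThan_telescope[of "\<lambda>k. f (p h k)", symmetric] sum_distrib_left
    by (intro sum.cong) (auto simp: q(2) mult_ac)
  have ends: "f (p h n) = f (\<lambda>i. r i + a i * (y0 + h))" "f (p h 0) = f x" for h
  proof -
    show "f (p h n) = f (\<lambda>i. r i + a i * (y0 + h))"
      by (rule C1b_cong[OF f]) (auto simp: p_def x_def algebra_simps)
  qed (simp add: p_def)
  show ?thesis
    unfolding DERIV_def x_def[symmetric]
  proof (rule Lim_transform_eventually[OF lim])
    show "\<forall>\<^sub>F h in at 0. (\<Sum>k<n. a k * partial_deriv k f ((p h k)(k := q h k)))
        = (f (\<lambda>i. r i + a i * (y0 + h)) - f x) / h"
      unfolding eventually_at_filter by (rule always_eventually) (simp add: tel[unfolded ends])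
  qed
qed

lemma continuous_sequence_measurable:
  fixes f :: "(nat \<Rightarrow> real) \<Rightarrow> real"
  assumes f: "continuous_on UNIV f" and cong: "\<And>x y. (\<And>i. i < n \<Longrightarrow> x i = y i) \<Longrightarrow> f x = f y"
    and X: "\<And>i. i < n \<Longrightarrow> X i \<in> borel_measurable N"
  shows "(\<lambda>\<omega>. f (\<lambda>i. X i \<omega>)) \<in> borel_measurable N"
proof -
  define Y where "Y i = (if i < n then X i else (\<lambda>_. 0))" for i
  have Y[measurable]: "Y i \<in> borel_measurable N" for i using X by (simp add: Y_def)
  have "(\<lambda>\<omega> i. Y i \<omega>) \<in> measurable N (PiM UNIV (\<lambda>_. borel))"
    by (rule measurable_PiM_single') (auto simp: PiE_def)
  then have "(\<lambda>\<omega> i. Y i \<omega>) \<in> borel_measurable N"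
    by (subst measurable_cong_sets[OF refl sets_PiM_equal_borel[symmetric]])
  from measurable_compose[OF this borel_measurable_continuous_onI[OF f]]
  have "(\<lambda>\<omega>. f (\<lambda>i. Y i \<omega>)) \<in> borel_measurable N" .
  moreover have "f (\<lambda>i. Y i \<omega>) = f (\<lambda>i. X i \<omega>)" for \<omega> by (rule cong) (simp add: Y_def)
  ultimately show ?thesis by simp
qed

lemma C1b_measurable:
  assumes f: "f \<in> C1b n" and X: "\<And>i. i < n \<Longrightarrow> X i \<in> borel_measurable N"
  shows "(\<lambda>\<omega>. f (\<lambda>i. X i \<omega>)) \<in> borel_measurable N"
  by (rule continuous_sequence_measurable[OF C1b_continuous[OF f] C1b_cong[OF f] X])

lemma C1b_partial_measurable:
  assumes f: "f \<in> C1b n" and X: "\<And>i. i < n \<Longrightarrow> X i \<in> borel_measurable N" and k: "k < n"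
  shows "(\<lambda>\<omega>. partial_deriv k f (\<lambda>i. X i \<omega>)) \<in> borel_measurable N"
  by (rule continuous_sequence_measurable[OF C1b_partial_continuous[OF f k] C1b_partial_cong[OF f k] X])

lemma C1b_tendsto:
  assumes f: "f \<in> C1b n" and X: "\<And>i. i < n \<Longrightarrow> (\<lambda>m. X m i) \<longlonglongrightarrow> x i"
  shows "(\<lambda>m. f (X m)) \<longlonglongrightarrow> f x" "k < n \<Longrightarrow> (\<lambda>m. partial_deriv k f (X m)) \<longlonglongrightarrow> partial_deriv k f x"
proof -
  define Z where "Z m = (\<lambda>i. if i < n then X m i else x i)" for m
  have "Z \<longlonglongrightarrow> x" unfolding tendsto_sequence_iff Z_def
  proof
    fix i show "(\<lambda>m. if i < n then X m i else x i) \<longlonglongrightarrow> x i" using X by (cases "i < n") auto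
  qed
  then have "(\<lambda>m. f (Z m)) \<longlonglongrightarrow> f x"
    and p: "k < n \<Longrightarrow> (\<lambda>m. partial_deriv k f (Z m)) \<longlonglongrightarrow> partial_deriv k f x"
    by (auto intro!: continuous_on_tendsto_compose[OF C1b_continuous[OF f]]
        continuous_on_tendsto_compose[OF C1b_partial_continuous[OF f]])
  moreover have "f (Z m) = f (X m)" for m by (rule C1b_cong[OF f]) (simp add: Z_def)
  ultimately show "(\<lambda>m. f (X m)) \<longlonglongrightarrow> f x" by simp
  assume k: "k < n"
  have "partial_deriv k f (Z m) = partial_deriv k f (X m)" for m
    by (rule C1b_partial_cong[OF f k]) (simp add: Z_def)
  then show "(\<lambda>m. partial_deriv k f (X m)) \<longlonglongrightarrow> partial_deriv k f x" using p[OF k] by simp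
qed

lemma normal_density_tendsto_0:
  assumes \<sigma>: "0 < \<sigma>"
  shows "(\<lambda>m. normal_density 0 \<sigma> (real m)) \<longlonglongrightarrow> 0" "(\<lambda>m. normal_density 0 \<sigma> (- real m)) \<longlonglongrightarrow> 0"
proof -
  have le: "normal_density 0 \<sigma> (real m) \<le> (1 / sqrt (2 * pi * \<sigma>\<^sup>2) * (2 * \<sigma>\<^sup>2)) / real m" if False: "m \<noteq> 0" for m
  proof -
    have "real m \<le> (real m)\<^sup>2" using False by (simp add: power2_eq_square)
    then have "real m / (2 * \<sigma>\<^sup>2) \<le> (real m)\<^sup>2 / (2 * \<sigma>\<^sup>2)" using \<sigma> by (intro divide_right_mono) auto
    also have "\<dots> \<le> exp ((real m)\<^sup>2 / (2 * \<sigma>\<^sup>2))" using exp_ge_add_one_self[of "(real m)\<^sup>2 / (2 * \<sigma>\<^sup>2)"] by linarith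
    finally have "inverse (exp ((real m)\<^sup>2 / (2 * \<sigma>\<^sup>2))) \<le> inverse (real m / (2 * \<sigma>\<^sup>2))"
      using False \<sigma> by (intro le_imp_inverse_le) auto
    then have "exp (- ((real m)\<^sup>2 / (2 * \<sigma>\<^sup>2))) \<le> (2 * \<sigma>\<^sup>2) / real m" by (simp add: exp_minus)
    then have "1 / sqrt (2 * pi * \<sigma>\<^sup>2) * exp (- ((real m)\<^sup>2 / (2 * \<sigma>\<^sup>2)))
        \<le> 1 / sqrt (2 * pi * \<sigma>\<^sup>2) * ((2 * \<sigma>\<^sup>2) / real m)" by (intro mult_left_mono) auto
    then show ?thesis by (simp add: normal_density_def)
  qed
  show *: "(\<lambda>m. normal_density 0 \<sigma> (real m)) \<longlonglongrightarrow> 0"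
  proof (rule Lim_null_comparison[OF _ lim_const_over_n])
    show "\<forall>\<^sub>F m in sequentially. norm (normal_density 0 \<sigma> (real m))
        \<le> (1 / sqrt (2 * pi * \<sigma>\<^sup>2) * (2 * \<sigma>\<^sup>2)) / real m"
      using eventually_gt_at_top[of 0] by eventually_elim (use le in simp)
  qed
  then show "(\<lambda>m. normal_density 0 \<sigma> (- real m)) \<longlonglongrightarrow> 0" by (simp add: normal_density_def)
qed

text \<open>
  The density \<open>p\<close> satisfies \<open>p' = - y p / \<sigma>\<^sup>2\<close>, so the difference of the two integrands is the
  derivative of \<open>- \<sigma>\<^sup>2 p \<phi>\<close>, which vanishes at infinity.
\<close>

lemma gaussian_integration_by_parts:
  fixes \<phi> \<phi>' :: "real \<Rightarrow> real"
  assumes \<sigma>: "0 < \<sigma>" and d: "\<And>y. (\<phi> has_real_derivative \<phi>' y) (at y)" and c: "continuous_on UNIV \<phi>'"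
    and b: "\<And>y. \<bar>\<phi> y\<bar> \<le> B" and b': "\<And>y. \<bar>\<phi>' y\<bar> \<le> B'"
  shows "(\<integral>y. normal_density 0 \<sigma> y * (\<phi> y * y) \<partial>lborel) = \<sigma>\<^sup>2 * (\<integral>y. normal_density 0 \<sigma> y * \<phi>' y \<partial>lborel)"
proof -
  define p where "p = normal_density 0 \<sigma>"
  define F where "F y = - \<sigma>\<^sup>2 * (p y * \<phi> y)" for y
  define F' where "F' y = p y * (\<phi> y * y) - \<sigma>\<^sup>2 * (p y * \<phi>' y)" for y
  have \<phi>c: "continuous_on UNIV \<phi>"
    by (rule DERIV_continuous_on) (use d in \<open>auto intro: DERIV_subset\<close>)
  have [measurable]: "\<phi> \<in> borel_measurable borel" "\<phi>' \<in> borel_measurable borel" "p \<in> borel_measurable borel"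
    using \<phi>c c by (auto intro: borel_measurable_continuous_onI simp: p_def)
  have pd: "(p has_real_derivative - (y / \<sigma>\<^sup>2) * p y) (at y)" for y
    unfolding p_def normal_density_def using \<sigma>
    by (auto intro!: derivative_eq_intros simp: field_simps power2_eq_square)
  have pc: "continuous_on UNIV p"
    by (rule DERIV_continuous_on) (use pd in \<open>auto intro: DERIV_subset\<close>)
  have dF: "(F has_real_derivative F' y) (at y)" for y
    unfolding F_def F'_def using \<sigma>
    by (auto intro!: derivative_eq_intros pd d simp: field_simps power2_eq_square)
  have i1: "integrable lborel (\<lambda>y. p y * (\<phi> y * y))"
  proof (rule Bochner_Integration.integrable_bound)
    show "integrable lborel (\<lambda>y. B * (normal_density 0 \<sigma> y * \<bar>y - 0\<bar> ^ 1))"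
      using integrable_normal_moment_abs[OF \<sigma>, of 0 1] by (intro integrable_mult_right)
    show "AE y in lborel. norm (p y * (\<phi> y * y)) \<le> norm (B * (normal_density 0 \<sigma> y * \<bar>y - 0\<bar> ^ 1))"
    proof (rule AE_I2)
      fix y
      have "p y * (\<bar>\<phi> y\<bar> * \<bar>y\<bar>) \<le> p y * (\<bar>B\<bar> * \<bar>y\<bar>)"
        using b[of y] by (intro mult_left_mono mult_right_mono) (auto simp: p_def)
      then show "norm (p y * (\<phi> y * y)) \<le> norm (B * (normal_density 0 \<sigma> y * \<bar>y - 0\<bar> ^ 1))"
        by (simp add: abs_mult p_def mult_ac)
    qed
  qed measurable
  have i2: "integrable lborel (\<lambda>y. p y * \<phi>' y)"
  proof (rule Bochner_Integration.integrable_bound)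
    show "integrable lborel (\<lambda>y. B' * normal_density 0 \<sigma> y)" using \<sigma> by simp
    show "AE y in lborel. norm (p y * \<phi>' y) \<le> norm (B' * normal_density 0 \<sigma> y)"
    proof (rule AE_I2)
      fix y
      have "p y * \<bar>\<phi>' y\<bar> \<le> p y * \<bar>B'\<bar>"
        using b'[of y] by (intro mult_left_mono) (auto simp: p_def)
      then show "norm (p y * \<phi>' y) \<le> norm (B' * normal_density 0 \<sigma> y)"
        by (simp add: abs_mult p_def mult_ac)
    qed
  qed measurable
  have iF: "integrable lborel F'" unfolding F'_def using i1 i2 by simp
  have "(\<lambda>m. \<integral>y. indicator {- real m..real m} y *\<^sub>R F' y \<partial>lborel) \<longlonglongrightarrow> (\<integral>y. F' y \<partial>lborel)"
  proof (rule integral_dominated_convergence[where w = "\<lambda>y. norm (F' y)"])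
    show "AE y in lborel. (\<lambda>m. indicator {- real m..real m} y *\<^sub>R F' y) \<longlonglongrightarrow> F' y"
    proof (rule AE_I2)
      fix y
      have "\<forall>\<^sub>F m in sequentially. indicator {- real m..real m} y *\<^sub>R F' y = F' y"
        using eventually_ge_at_top[of "nat \<lceil>\<bar>y\<bar>\<rceil>"] by eventually_elim (auto simp: nat_le_iff ceiling_le_iff abs_le_iff indicator_def)
      then show "(\<lambda>m. indicator {- real m..real m} y *\<^sub>R F' y) \<longlonglongrightarrow> F' y" by (rule tendsto_eventually)
    qed
  qed (use iF in \<open>auto split: split_indicator\<close>)
  moreover have "(\<integral>y. indicator {- real m..real m} y *\<^sub>R F' y \<partial>lborel) = F (real m) - F (- real m)" for m
  proof (rule integral_FTC_atLeastAtMost)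
    show "(F has_vector_derivative F' x) (at x within {- real m..real m})" for x
      using dF[of x] by (auto simp: has_real_derivative_iff_has_vector_derivative[symmetric] intro: DERIV_subset)
    show "continuous_on {- real m..real m} F'"
      unfolding F'_def using \<phi>c c pc by (intro continuous_intros) (auto intro: continuous_on_subset)
  qed simp
  moreover have "(\<lambda>m. F (real m) - F (- real m)) \<longlonglongrightarrow> 0"
  proof (rule Lim_null_comparison[OF always_eventually])
    show "(\<lambda>m. \<sigma>\<^sup>2 * B * (p (real m) + p (- real m))) \<longlonglongrightarrow> 0"
      using tendsto_mult[OF tendsto_const tendsto_add[OF normal_density_tendsto_0[OF \<sigma>]], of "\<sigma>\<^sup>2 * B"]
      by (simp add: p_def)
    have "\<bar>F y\<bar> \<le> \<sigma>\<^sup>2 * B * p y" for y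
    proof -
      have "p y * \<bar>\<phi> y\<bar> \<le> p y * B" using b[of y] by (intro mult_left_mono) (auto simp: p_def)
      then have "\<sigma>\<^sup>2 * (p y * \<bar>\<phi> y\<bar>) \<le> \<sigma>\<^sup>2 * (p y * B)" by (rule mult_left_mono) simp
      then show ?thesis by (simp add: F_def abs_mult p_def mult_ac)
    qed
    from add_mono[OF this this]
    have "\<bar>F y\<bar> + \<bar>F z\<bar> \<le> \<sigma>\<^sup>2 * B * (p y + p z)" for y z by (simp add: algebra_simps)
    then show "\<forall>m. norm (F (real m) - F (- real m)) \<le> \<sigma>\<^sup>2 * B * (p (real m) + p (- real m))"
      unfolding real_norm_def by (intro allI order_trans[OF abs_triangle_ineq4])
  qed
  ultimately have "(\<integral>y. F' y \<partial>lborel) = 0" by (simp add: LIMSEQ_unique)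
  then show ?thesis using i1 i2 by (simp add: F'_def p_def)
qed

lemma (in prob_space) indep_var_product_law:
  assumes ind: "indep_var S Z R V" and v[measurable]: "v \<in> measurable R N"
  shows "distr M (S \<Otimes>\<^sub>M N) (\<lambda>x. (Z x, v (V x))) = distr M S Z \<Otimes>\<^sub>M distr M N (\<lambda>x. v (V x))"
proof -
  have [measurable]: "Z \<in> measurable M S" "V \<in> measurable M R"
    using ind by (auto dest: indep_var_rv1 indep_var_rv2)
  interpret VS: prob_space "distr M N (\<lambda>x. v (V x))" by (rule prob_space_distr) measurable
  have vV: "distr (distr M R V) N v = distr M N (\<lambda>x. v (V x))"
    by (subst distr_distr) (auto simp: o_def)
  have "sigma_finite_measure (distr (distr M R V) N v)"
    unfolding vV by (rule VS.sigma_finite_measure_axioms)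
  then have "distr (distr M S Z) S (\<lambda>x. x) \<Otimes>\<^sub>M distr (distr M R V) N v
    = distr (distr M S Z \<Otimes>\<^sub>M distr M R V) (S \<Otimes>\<^sub>M N) (\<lambda>(x, y). (x, v y))"
    by (intro pair_measure_distr) measurable
  also have "distr M S Z \<Otimes>\<^sub>M distr M R V = distr M (S \<Otimes>\<^sub>M R) (\<lambda>x. (Z x, V x))"
    using ind by (simp add: indep_var_distribution_eq)
  also have "distr \<dots> (S \<Otimes>\<^sub>M N) (\<lambda>(x, y). (x, v y)) = distr M (S \<Otimes>\<^sub>M N) (\<lambda>x. (Z x, v (V x)))"
    by (subst distr_distr) (auto simp: o_def)
  also have "distr (distr M S Z) S (\<lambda>x. x) = distr M S Z"
    by (subst distr_distr) (auto simp: o_def)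
  finally show ?thesis unfolding vV by simp
qed

text \<open>
  Conditionally on \<open>Z\<close> the function \<open>f\<close> depends on the Gaussian variable \<open>Y\<close> along a straight
  line, where the one-dimensional formula and the chain rule apply; Fubini's theorem for the
  product law averages over \<open>Z\<close>.
\<close>

lemma (in prob_space) gaussian_ibp_independent:
  fixes S :: "'c measure" and Y :: "'a \<Rightarrow> real"
  assumes \<sigma>: "0 < \<sigma>" and Y: "distributed M lborel Y (normal_density 0 \<sigma>)"
    and [measurable]: "Z \<in> measurable M S" "Y \<in> borel_measurable M"
    and prod: "distr M (S \<Otimes>\<^sub>M borel) (\<lambda>x. (Z x, Y x)) = distr M S Z \<Otimes>\<^sub>M distr M borel Y"
    and r[measurable]: "\<And>i. i < n \<Longrightarrow> r i \<in> borel_measurable S"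
    and f: "f \<in> C1b n"
  shows "expectation (\<lambda>\<omega>. f (\<lambda>i. r i (Z \<omega>) + a i * Y \<omega>) * Y \<omega>)
    = \<sigma>\<^sup>2 * (\<Sum>i<n. a i * expectation (\<lambda>\<omega>. partial_deriv i f (\<lambda>i. r i (Z \<omega>) + a i * Y \<omega>)))"
proof -
  obtain B where B: "\<And>x. \<bar>f x\<bar> \<le> B" using C1b_bounded[OF f] by auto
  obtain B' where B': "\<And>i x. i < n \<Longrightarrow> \<bar>partial_deriv i f x\<bar> \<le> B' i"
    using C1b_partial_bounded[OF f] by metis
  let ?f = "\<lambda>z y. f (\<lambda>i. r i z + a i * y)"
  let ?d = "\<lambda>k z y. partial_deriv k f (\<lambda>i. r i z + a i * y)"
  have fm: "(\<lambda>x. ?f (fst x) (snd x)) \<in> borel_measurable (S \<Otimes>\<^sub>M borel)"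
    by (rule C1b_measurable[OF f]) measurable
  have dm: "(\<lambda>x. ?d k (fst x) (snd x)) \<in> borel_measurable (S \<Otimes>\<^sub>M borel)" if "k < n" for k
    by (rule C1b_partial_measurable[OF f _ that]) measurable
  have Yint: "integrable M Y"
    using integrable_normal_moment_nz_1[OF \<sigma>, of 0] distributed_integrable[OF Y, of "\<lambda>x. x"] by simp
  interpret ZS: prob_space "distr M S Z" by (rule prob_space_distr) measurable
  interpret YS: prob_space "distr M borel Y" by (rule prob_space_distr) measurable
  interpret P: pair_sigma_finite "distr M S Z" "distr M borel Y" ..
  have split: "expectation (\<lambda>\<omega>. h (Z \<omega>) (Y \<omega>)) = (\<integral>z. expectation (\<lambda>\<omega>. h z (Y \<omega>)) \<partial>distr M S Z)"
    if h[measurable]: "(\<lambda>x. h (fst x) (snd x)) \<in> borel_measurable (S \<Otimes>\<^sub>M borel)"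
      and i: "integrable M (\<lambda>\<omega>. h (Z \<omega>) (Y \<omega>))" for h :: "'c \<Rightarrow> real \<Rightarrow> real"
  proof -
    have "expectation (\<lambda>\<omega>. h (Z \<omega>) (Y \<omega>)) = (\<integral>x. h (fst x) (snd x) \<partial>distr M (S \<Otimes>\<^sub>M borel) (\<lambda>x. (Z x, Y x)))"
      by (rule integral_distr[where f = "\<lambda>x. h (fst x) (snd x)" and g = "\<lambda>x. (Z x, Y x)", unfolded fst_conv snd_conv, symmetric])
        measurable
    also have "\<dots> = (\<integral>z. \<integral>y. h z y \<partial>distr M borel Y \<partial>distr M S Z)"
    proof -
      have "integrable (distr M (S \<Otimes>\<^sub>M borel) (\<lambda>x. (Z x, Y x))) (\<lambda>x. h (fst x) (snd x))"
        using integrable_distr_eq[of "\<lambda>x. (Z x, Y x)" M "S \<Otimes>\<^sub>M borel" "\<lambda>x. h (fst x) (snd x)"] i by simp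
      from P.integral_fst'[OF this[unfolded prod]] show ?thesis unfolding prod by simp
    qed
    also have "\<dots> = (\<integral>z. expectation (\<lambda>\<omega>. h z (Y \<omega>)) \<partial>distr M S Z)"
    proof (rule Bochner_Integration.integral_cong[OF refl])
      fix z assume "z \<in> space (distr M S Z)"
      then have "(\<lambda>y. h z y) \<in> borel_measurable borel"
        using measurable_compose[OF measurable_Pair1'[of z S borel] h] by simp
      then show "(\<integral>y. h z y \<partial>distr M borel Y) = expectation (\<lambda>\<omega>. h z (Y \<omega>))"
        using integral_distr[of Y M borel "h z"] by simp
    qed
    finally show ?thesis .
  qed
  have inner: "expectation (\<lambda>\<omega>. ?f z (Y \<omega>) * Y \<omega>) = \<sigma>\<^sup>2 * (\<Sum>k<n. a k * expectation (\<lambda>\<omega>. ?d k z (Y \<omega>)))" for z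
  proof -
    define \<phi>' where "\<phi>' y = (\<Sum>k<n. a k * ?d k z y)" for y
    have cont: "continuous_on UNIV (\<lambda>y. ?d k z y)" if "k < n" for k
      by (rule continuous_on_compose2[OF C1b_partial_continuous[OF f that]])
        (auto intro!: continuous_on_coordinatewise_then_product continuous_intros)
    have contf: "continuous_on UNIV (\<lambda>y. ?f z y)"
      by (rule continuous_on_compose2[OF C1b_continuous[OF f]])
        (auto intro!: continuous_on_coordinatewise_then_product continuous_intros)
    have cont': "continuous_on UNIV \<phi>'"
      unfolding \<phi>'_def by (intro continuous_on_sum continuous_on_mult continuous_on_const cont) simp
    have [measurable]: "(\<lambda>y. ?f z y) \<in> borel_measurable borel" "\<phi>' \<in> borel_measurable borel"
      using cont' contf by (auto intro!: borel_measurable_continuous_onI)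
    have int: "integrable M (\<lambda>\<omega>. ?d k z (Y \<omega>))" if "k < n" for k
      using borel_measurable_continuous_onI[OF cont[OF that]] B'[OF that]
      by (intro integrable_const_bound[where B="B' k"]) auto
    have "expectation (\<lambda>\<omega>. ?f z (Y \<omega>) * Y \<omega>) = (\<integral>y. normal_density 0 \<sigma> y * (?f z y * y) \<partial>lborel)"
      using distributed_integral[OF Y, of "\<lambda>y. ?f z y * y"] by simp
    also have "\<dots> = \<sigma>\<^sup>2 * (\<integral>y. normal_density 0 \<sigma> y * \<phi>' y \<partial>lborel)"
    proof (rule gaussian_integration_by_parts[OF \<sigma>])
      show "((\<lambda>y. ?f z y) has_real_derivative \<phi>' y) (at y)" for y
        unfolding \<phi>'_def by (rule C1b_chain_rule[OF f])
      show "continuous_on UNIV \<phi>'" by (rule cont')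
      show "\<bar>\<phi>' y\<bar> \<le> (\<Sum>k<n. \<bar>a k\<bar> * B' k)" for y
        unfolding \<phi>'_def by (rule order_trans[OF sum_abs sum_mono]) (auto simp: abs_mult B' intro: mult_left_mono)
    qed (rule B)
    also have "(\<integral>y. normal_density 0 \<sigma> y * \<phi>' y \<partial>lborel) = expectation (\<lambda>\<omega>. \<phi>' (Y \<omega>))"
      using distributed_integral[OF Y, of \<phi>'] by simp
    also have "\<dots> = (\<Sum>k<n. a k * expectation (\<lambda>\<omega>. ?d k z (Y \<omega>)))"
      unfolding \<phi>'_def using int by (subst Bochner_Integration.integral_sum) auto
    finally show ?thesis .
  qed
  have bound_int: "integrable M (\<lambda>\<omega>. ?f (Z \<omega>) (Y \<omega>) * Y \<omega>)"
  proof (rule Bochner_Integration.integrable_bound)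
    show "integrable M (\<lambda>\<omega>. B * Y \<omega>)" using Yint by simp
    show "(\<lambda>\<omega>. ?f (Z \<omega>) (Y \<omega>) * Y \<omega>) \<in> borel_measurable M"
      using measurable_compose[OF measurable_Pair fm, of Z M Y] by simp
    show "AE \<omega> in M. norm (?f (Z \<omega>) (Y \<omega>) * Y \<omega>) \<le> norm (B * Y \<omega>)"
      using B by (intro AE_I2) (auto simp: abs_mult intro!: mult_right_mono order_trans[OF B abs_ge_self])
  qed
  have dint: "integrable M (\<lambda>\<omega>. ?d k (Z \<omega>) (Y \<omega>))" if "k < n" for k
    using measurable_compose[OF measurable_Pair dm[OF that], of Z M Y] B'[OF that]
    by (intro integrable_const_bound[where B="B' k"]) auto
  have dint': "integrable (distr M S Z) (\<lambda>z. expectation (\<lambda>\<omega>. ?d k z (Y \<omega>)))" if k: "k < n" for k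
  proof -
    have "integrable (distr M S Z \<Otimes>\<^sub>M distr M borel Y) (\<lambda>x. ?d k (fst x) (snd x))"
      unfolding prod[symmetric] by (subst integrable_distr_eq) (use dint[OF k] dm[OF k] in auto)
    from P.integrable_fst'[OF this]
    have "integrable (distr M S Z) (\<lambda>z. \<integral>y. ?d k z y \<partial>distr M borel Y)" by simp
    moreover have "(\<integral>y. ?d k z y \<partial>distr M borel Y) = expectation (\<lambda>\<omega>. ?d k z (Y \<omega>))" for z
    proof (subst integral_distr)
      show "(\<lambda>y. ?d k z y) \<in> borel_measurable borel"
        by (rule borel_measurable_continuous_onI, rule continuous_on_compose2[OF C1b_partial_continuous[OF f k]])
          (auto intro!: continuous_on_coordinatewise_then_product continuous_intros)
    qed auto
    ultimately show ?thesis by simp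
  qed
  have "expectation (\<lambda>\<omega>. ?f (Z \<omega>) (Y \<omega>) * Y \<omega>) = (\<integral>z. expectation (\<lambda>\<omega>. ?f z (Y \<omega>) * Y \<omega>) \<partial>distr M S Z)"
    by (intro split bound_int borel_measurable_times fm) measurable
  also have "\<dots> = \<sigma>\<^sup>2 * (\<Sum>k<n. a k * (\<integral>z. expectation (\<lambda>\<omega>. ?d k z (Y \<omega>)) \<partial>distr M S Z))"
    unfolding inner using dint' by simp
  also have "\<dots> = \<sigma>\<^sup>2 * (\<Sum>k<n. a k * expectation (\<lambda>\<omega>. ?d k (Z \<omega>) (Y \<omega>)))"
    using split[OF dm dint] by simp
  finally show ?thesis .
qed


context brownian
begin

text \<open>
  The integration-by-parts formula for \<open>Y\<close> against functions of \<open>X 0, \<dots>, X (n - 1)\<close>. Being linear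
  in \<open>Y\<close> and stable under mean-square limits, it passes from independent increments to Wiener
  integrals.
\<close>

definition ibp :: "nat \<Rightarrow> (nat \<Rightarrow> 'a \<Rightarrow> real) \<Rightarrow> ('a \<Rightarrow> real) \<Rightarrow> bool" where
  "ibp n X Y \<longleftrightarrow> (\<forall>f\<in>C1b n. expectation (\<lambda>\<omega>. f (\<lambda>i. X i \<omega>) * Y \<omega>)
     = (\<Sum>i<n. expectation (\<lambda>\<omega>. X i \<omega> * Y \<omega>) * expectation (\<lambda>\<omega>. partial_deriv i f (\<lambda>k. X k \<omega>))))"

lemma C1b_Lp2:
  assumes f: "f \<in> C1b n" and X: "\<And>i. i < n \<Longrightarrow> X i \<in> borel_measurable M"
  shows "(\<lambda>\<omega>. f (\<lambda>i. X i \<omega>)) \<in> Lp 2 M"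
    "k < n \<Longrightarrow> (\<lambda>\<omega>. partial_deriv k f (\<lambda>i. X i \<omega>)) \<in> Lp 2 M"
proof -
  have m: "(\<lambda>\<omega>. f (\<lambda>i. X i \<omega>)) \<in> borel_measurable M" by (rule C1b_measurable[OF f X])
  obtain B where "\<And>x. \<bar>f x\<bar> \<le> B" using C1b_bounded[OF f] by auto
  then show "(\<lambda>\<omega>. f (\<lambda>i. X i \<omega>)) \<in> Lp 2 M"
    using Lp2_bounded_mult[OF Lp2_const[of 1] m, of B] by simp
  assume k: "k < n"
  have m: "(\<lambda>\<omega>. partial_deriv k f (\<lambda>i. X i \<omega>)) \<in> borel_measurable M"
    by (rule C1b_partial_measurable[OF f X k])
  obtain B where "\<And>x. \<bar>partial_deriv k f x\<bar> \<le> B" using C1b_partial_bounded[OF f k] by auto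
  then show "(\<lambda>\<omega>. partial_deriv k f (\<lambda>i. X i \<omega>)) \<in> Lp 2 M"
    using Lp2_bounded_mult[OF Lp2_const[of 1] m, of B] by simp
qed

lemma ibp_linear:
  assumes X: "\<And>i. i < n \<Longrightarrow> X i \<in> Lp 2 M" and Y: "\<And>k. k \<in> I \<Longrightarrow> Y k \<in> Lp 2 M" "\<And>k. k \<in> I \<Longrightarrow> ibp n X (Y k)"
  shows "ibp n X (\<lambda>\<omega>. \<Sum>k\<in>I. b k * Y k \<omega>)"
  unfolding ibp_def
proof
  fix f assume f: "f \<in> C1b n"
  have fL: "(\<lambda>\<omega>. f (\<lambda>i. X i \<omega>)) \<in> Lp 2 M" using X by (intro C1b_Lp2[OF f] Lp2_measurable)
  have lin: "expectation (\<lambda>\<omega>. Z \<omega> * (\<Sum>k\<in>I. b k * Y k \<omega>)) = (\<Sum>k\<in>I. b k * expectation (\<lambda>\<omega>. Z \<omega> * Y k \<omega>))"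
    if Z: "Z \<in> Lp 2 M" for Z
  proof -
    have "expectation (\<lambda>\<omega>. Z \<omega> * (\<Sum>k\<in>I. b k * Y k \<omega>)) = expectation (\<lambda>\<omega>. \<Sum>k\<in>I. b k * (Z \<omega> * Y k \<omega>))"
      by (simp add: sum_distrib_left mult_ac)
    also have "\<dots> = (\<Sum>k\<in>I. b k * expectation (\<lambda>\<omega>. Z \<omega> * Y k \<omega>))"
      using Y(1) Z by (subst Bochner_Integration.integral_sum) (auto intro!: integrable_mult_right Lp2_mult_integrable)
    finally show ?thesis .
  qed
  have "expectation (\<lambda>\<omega>. f (\<lambda>i. X i \<omega>) * (\<Sum>k\<in>I. b k * Y k \<omega>))
    = (\<Sum>k\<in>I. b k * (\<Sum>i<n. expectation (\<lambda>\<omega>. X i \<omega> * Y k \<omega>) * expectation (\<lambda>\<omega>. partial_deriv i f (\<lambda>k. X k \<omega>))))"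
    using Y(2) f by (simp add: lin[OF fL] ibp_def)
  also have "\<dots> = (\<Sum>i<n. (\<Sum>k\<in>I. b k * expectation (\<lambda>\<omega>. X i \<omega> * Y k \<omega>)) * expectation (\<lambda>\<omega>. partial_deriv i f (\<lambda>k. X k \<omega>)))"
    unfolding sum_distrib_left sum_distrib_right by (subst sum.swap) (simp add: mult_ac)
  also have "\<dots> = (\<Sum>i<n. expectation (\<lambda>\<omega>. X i \<omega> * (\<Sum>k\<in>I. b k * Y k \<omega>)) * expectation (\<lambda>\<omega>. partial_deriv i f (\<lambda>k. X k \<omega>)))"
    using X by (intro sum.cong) (auto simp: lin)
  finally show "expectation (\<lambda>\<omega>. f (\<lambda>i. X i \<omega>) * (\<Sum>k\<in>I. b k * Y k \<omega>))
    = (\<Sum>i<n. expectation (\<lambda>\<omega>. X i \<omega> * (\<Sum>k\<in>I. b k * Y k \<omega>)) * expectation (\<lambda>\<omega>. partial_deriv i f (\<lambda>k. X k \<omega>)))" .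
qed

lemma ibp_limit:
  assumes X: "\<And>i. i < n \<Longrightarrow> conv2 M (\<lambda>m. X m i) (X' i) sequentially"
    and Y: "conv2 M Y Y' sequentially" and ibp: "\<And>m. ibp n (X m) (Y m)"
  shows "ibp n X' Y'"
  unfolding ibp_def
proof
  fix f assume f: "f \<in> C1b n"
  obtain r where r: "strict_mono r" "AE \<omega> in M. \<forall>i<n. (\<lambda>m. X (r m) i \<omega>) \<longlonglongrightarrow> X' i \<omega>"
    using conv2_AE_subseq[of n M "\<lambda>i m. X m i" X'] X by blast
  have Xm: "X m i \<in> borel_measurable M" "X' i \<in> borel_measurable M" if "i < n" for m i
    using conv2D(1,2)[OF X[OF that]] by (auto intro: Lp2_measurable)
  obtain B where B: "\<And>x. \<bar>f x\<bar> \<le> B" using C1b_bounded[OF f] by auto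
  have cf: "conv2 M (\<lambda>m \<omega>. f (\<lambda>i. X (r m) i \<omega>)) (\<lambda>\<omega>. f (\<lambda>i. X' i \<omega>)) sequentially"
  proof (rule conv2_dominated[where B = "\<lambda>_. B"])
    show "AE \<omega> in M. (\<lambda>m. f (\<lambda>i. X (r m) i \<omega>)) \<longlonglongrightarrow> f (\<lambda>i. X' i \<omega>)"
      using r(2) by eventually_elim (rule C1b_tendsto[OF f], simp)
  qed (use B Xm in \<open>auto intro!: C1b_measurable[OF f]\<close>)
  have cd: "conv2 M (\<lambda>m \<omega>. partial_deriv k f (\<lambda>i. X (r m) i \<omega>)) (\<lambda>\<omega>. partial_deriv k f (\<lambda>i. X' i \<omega>)) sequentially"
    if k: "k < n" for k
  proof -
    obtain B where B: "\<And>x. \<bar>partial_deriv k f x\<bar> \<le> B" using C1b_partial_bounded[OF f k] by auto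
    show ?thesis
    proof (rule conv2_dominated[where B = "\<lambda>_. B"])
      show "AE \<omega> in M. (\<lambda>m. partial_deriv k f (\<lambda>i. X (r m) i \<omega>)) \<longlonglongrightarrow> partial_deriv k f (\<lambda>i. X' i \<omega>)"
        using r(2) by eventually_elim (rule C1b_tendsto(2)[OF f _ k], simp)
    qed (use B Xm k in \<open>auto intro!: C1b_partial_measurable[OF f]\<close>)
  qed
  have one: "conv2 M (\<lambda>_ _. 1) (\<lambda>_. 1) sequentially" by (rule conv2_const) simp
  have "(\<lambda>m. expectation (\<lambda>\<omega>. f (\<lambda>i. X (r m) i \<omega>) * Y (r m) \<omega>)) \<longlonglongrightarrow> expectation (\<lambda>\<omega>. f (\<lambda>i. X' i \<omega>) * Y' \<omega>)"
    by (rule conv2_inner[OF cf conv2_subseq[OF Y r(1)]])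
  moreover have "(\<lambda>m. \<Sum>i<n. expectation (\<lambda>\<omega>. X (r m) i \<omega> * Y (r m) \<omega>) * expectation (\<lambda>\<omega>. partial_deriv i f (\<lambda>k. X (r m) k \<omega>)))
     \<longlonglongrightarrow> (\<Sum>i<n. expectation (\<lambda>\<omega>. X' i \<omega> * Y' \<omega>) * expectation (\<lambda>\<omega>. partial_deriv i f (\<lambda>k. X' k \<omega>)))"
    using conv2_inner[OF cd one]
    by (intro tendsto_sum tendsto_mult conv2_inner[OF conv2_subseq[OF X r(1)] conv2_subseq[OF Y r(1)]]) auto
  ultimately show "expectation (\<lambda>\<omega>. f (\<lambda>i. X' i \<omega>) * Y' \<omega>)
    = (\<Sum>i<n. expectation (\<lambda>\<omega>. X' i \<omega> * Y' \<omega>) * expectation (\<lambda>\<omega>. partial_deriv i f (\<lambda>k. X' k \<omega>)))"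
    using ibp f unfolding ibp_def by (simp add: LIMSEQ_unique)
qed

text \<open>
  Each increment is independent of the past, which contains all earlier increments; induction over
  the partition gives joint independence.
\<close>

lemma partition_increments_indep:
  fixes \<tau> :: "nat \<Rightarrow> real"
  assumes \<tau>: "0 \<le> \<tau> 0" "\<And>k. k < m \<Longrightarrow> \<tau> k < \<tau> (Suc k)" "\<tau> m \<le> T"
  shows "indep_vars (\<lambda>_. borel) (\<lambda>k \<omega>. W (\<tau> (Suc k)) \<omega> - W (\<tau> k) \<omega>) {..<m}"
proof (cases "m = 0")
  case True
  then show ?thesis by (simp add: indep_vars_def indep_sets_def)
next
  case m: False
  have mono: "\<tau> i \<le> \<tau> j" if "i \<le> j" "j \<le> m" for i j
    using that
  proof (induction j rule: dec_induct)
    case (step j) then show ?case using \<tau>(2)[of j] by simp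
  qed simp
  have range: "0 \<le> \<tau> k" "\<tau> k \<le> T" if "k \<le> m" for k
    using mono[of 0 k] mono[of k m] that \<tau> by auto
  have rv: "random_variable borel (\<lambda>\<omega>. W (\<tau> (Suc k)) \<omega> - W (\<tau> k) \<omega>)" if "k < m" for k
    using range[of k] range[of "Suc k"] that by auto
  define F where "F k = {(\<lambda>\<omega>. W (\<tau> (Suc k)) \<omega> - W (\<tau> k) \<omega>) -` A \<inter> space M |A. A \<in> sets borel}" for k
  have Fev: "F k \<subseteq> events" if "k < m" for k
    using measurable_sets[OF rv[OF that]] by (auto simp: F_def)
  have Fsp: "space M \<in> F k" for k unfolding F_def by (auto intro!: exI[of _ UNIV])
  have "indep_sets F {..<m}"
  proof (subst indep_sets_finite)
    show "\<forall>A\<in>Pi {..<m} F. prob (\<Inter>j\<in>{..<m}. A j) = (\<Prod>j<m. prob (A j))"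
    proof
      fix A assume A: "A \<in> Pi {..<m} F"
      have "k \<le> m \<Longrightarrow> space M \<inter> (\<Inter>j\<in>{..<k}. A j) \<in> sets (\<F> (\<tau> k)) \<and>
        prob (space M \<inter> (\<Inter>j\<in>{..<k}. A j)) = (\<Prod>j<k. prob (A j))" for k
      proof (induction k)
        case 0
        then show ?case using sets.top[of "\<F> (\<tau> 0)"] by (simp add: prob_space)
      next
        case (Suc k)
        then have k: "k < m" and IH: "space M \<inter> (\<Inter>j\<in>{..<k}. A j) \<in> sets (\<F> (\<tau> k))"
          "prob (space M \<inter> (\<Inter>j\<in>{..<k}. A j)) = (\<Prod>j<k. prob (A j))" by auto
        have Ak: "A k \<in> F k" using A k by auto
        have eq: "space M \<inter> (\<Inter>j\<in>{..<Suc k}. A j) = (space M \<inter> (\<Inter>j\<in>{..<k}. A j)) \<inter> A k"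
          by (auto simp: lessThan_Suc)
        have "W (\<tau> (Suc k)) \<in> borel_measurable (\<F> (\<tau> (Suc k)))" "W (\<tau> k) \<in> borel_measurable (\<F> (\<tau> (Suc k)))"
          using range[of k] range[of "Suc k"] \<tau>(2)[OF k] k by (auto intro: W_filtration)
        then have "(\<lambda>\<omega>. W (\<tau> (Suc k)) \<omega> - W (\<tau> k) \<omega>) \<in> borel_measurable (\<F> (\<tau> (Suc k)))" by measurable
        from measurable_sets[OF this] have "A k \<in> sets (\<F> (\<tau> (Suc k)))"
          using Ak by (auto simp: F_def)
        moreover have "space M \<inter> (\<Inter>j\<in>{..<k}. A j) \<in> sets (\<F> (\<tau> (Suc k)))"
          using IH(1) filtration_mono[OF less_imp_le[OF \<tau>(2)[OF k]]] by blast
        moreover have "prob ((space M \<inter> (\<Inter>j\<in>{..<k}. A j)) \<inter> A k) = prob (space M \<inter> (\<Inter>j\<in>{..<k}. A j)) * prob (A k)"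
          using Ak range[of k] range[of "Suc k"] k
          by (intro indep_setD[OF increment_indep[OF _ \<tau>(2)[OF k]] IH(1)]) (auto simp: F_def)
        ultimately show ?case unfolding eq using IH(2) by (auto simp: mult.commute)
      qed
      from this[of m] have "prob (space M \<inter> (\<Inter>j\<in>{..<m}. A j)) = (\<Prod>j<m. prob (A j))" by simp
      moreover have "(\<Inter>j\<in>{..<m}. A j) \<subseteq> space M"
      proof -
        have "A 0 \<in> events" using A m Fev[of 0] by (auto simp: Pi_iff)
        then have "A 0 \<subseteq> space M" by (rule sets.sets_into_space)
        then show ?thesis using m by auto
      qed
      ultimately show "prob (\<Inter>j\<in>{..<m}. A j) = (\<Prod>j<m. prob (A j))" by (simp add: Int_absorb1)
    qed
  qed (use m Fev Fsp in auto)
  then show ?thesis unfolding indep_vars_def2 F_def using rv by simp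
qed

text \<open>
  One increment of the partition is singled out; the remaining ones are independent of it and
  enter the variables \<open>\<Sum>\<^sub>l c\<^sub>i\<^sub>l \<xi>\<^sub>l\<close> as the frozen part.
\<close>

lemma ibp_partition:
  fixes \<tau> :: "nat \<Rightarrow> real"
  assumes \<tau>: "0 \<le> \<tau> 0" "\<And>k. k < m \<Longrightarrow> \<tau> k < \<tau> (Suc k)" "\<tau> m \<le> T" and k: "k < m"
  defines "\<xi> \<equiv> \<lambda>k \<omega>. W (\<tau> (Suc k)) \<omega> - W (\<tau> k) \<omega>"
  shows "ibp n (\<lambda>i \<omega>. \<Sum>l<m. c i l * \<xi> l \<omega>) (\<xi> k)"
  unfolding ibp_def
proof
  fix f assume f: "f \<in> C1b n"
  have mono: "\<tau> i \<le> \<tau> j" if "i \<le> j" "j \<le> m" for i j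
    using that
  proof (induction j rule: dec_induct)
    case (step j) then show ?case using \<tau>(2)[of j] by simp
  qed simp
  have range: "0 \<le> \<tau> k" "\<tau> k \<le> T" if "k \<le> m" for k
    using mono[of 0 k] mono[of k m] that \<tau> by auto
  have L: "\<xi> l \<in> Lp 2 M" if "l < m" for l
    unfolding \<xi>_def using range[of l] range[of "Suc l"] \<tau>(2)[OF that] that by (intro increment_moments) auto
  have cov: "expectation (\<lambda>\<omega>. \<xi> l \<omega> * \<xi> k \<omega>) = (if l = k then \<tau> (Suc k) - \<tau> k else 0)" if l: "l < m" for l
  proof -
    have "expectation (\<lambda>\<omega>. \<xi> l \<omega> * \<xi> k \<omega>) = min (\<tau> (Suc l)) (\<tau> (Suc k)) - min (\<tau> (Suc l)) (\<tau> k)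
        - min (\<tau> l) (\<tau> (Suc k)) + min (\<tau> l) (\<tau> k)"
      unfolding \<xi>_def using range[of l] range[of "Suc l"] \<tau>(2)[OF l] l range[of k] range[of "Suc k"] \<tau>(2)[OF k] k
      by (intro covariance_increments) auto
    then show ?thesis
      using \<tau>(2)[OF l] \<tau>(2)[OF k] mono[of "Suc l" k] mono[of "Suc k" l] l k
      by (cases l k rule: linorder_cases) (auto simp: min_def)
  qed
  let ?J = "{..<m} - {k}"
  have ind: "indep_var (PiM ?J (\<lambda>_. borel)) (\<lambda>\<omega>. restrict (\<lambda>l. \<xi> l \<omega>) ?J) (PiM {k} (\<lambda>_. borel)) (\<lambda>\<omega>. restrict (\<lambda>l. \<xi> l \<omega>) {k})"
    using partition_increments_indep[OF \<tau>] k unfolding \<xi>_def[symmetric] by (intro indep_var_restrict) auto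
  have "(\<lambda>x. x k) \<in> borel_measurable (PiM {k} (\<lambda>_. borel))" by measurable
  from indep_var_product_law[OF ind this]
  have prod: "distr M (PiM ?J (\<lambda>_. borel) \<Otimes>\<^sub>M borel) (\<lambda>x. (restrict (\<lambda>l. \<xi> l x) ?J, \<xi> k x))
      = distr M (PiM ?J (\<lambda>_. borel)) (\<lambda>\<omega>. restrict (\<lambda>l. \<xi> l \<omega>) ?J) \<Otimes>\<^sub>M distr M borel (\<xi> k)"
    by simp
  have dist: "distributed M lborel (\<xi> k) (normal_density 0 (sqrt (\<tau> (Suc k) - \<tau> k)))"
    unfolding \<xi>_def using range[of k] range[of "Suc k"] k by (intro increment_normal \<tau>(2)) auto
  have X: "(\<Sum>l\<in>?J. c i l * restrict (\<lambda>l. \<xi> l \<omega>) ?J l) + c i k * \<xi> k \<omega> = (\<Sum>l<m. c i l * \<xi> l \<omega>)" for i \<omega>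
  proof -
    have "(\<Sum>l\<in>?J. c i l * restrict (\<lambda>l. \<xi> l \<omega>) ?J l) = (\<Sum>l\<in>?J. c i l * \<xi> l \<omega>)" by (intro sum.cong) auto
    then show ?thesis using k by (subst (2) sum.remove[of _ k]) auto
  qed
  have *: "expectation (\<lambda>\<omega>. f (\<lambda>i. (\<Sum>l\<in>?J. c i l * restrict (\<lambda>l. \<xi> l \<omega>) ?J l) + c i k * \<xi> k \<omega>) * \<xi> k \<omega>)
    = (sqrt (\<tau> (Suc k) - \<tau> k))\<^sup>2 * (\<Sum>i<n. c i k * expectation (\<lambda>\<omega>. partial_deriv i f
        (\<lambda>i. (\<Sum>l\<in>?J. c i l * restrict (\<lambda>l. \<xi> l \<omega>) ?J l) + c i k * \<xi> k \<omega>)))"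
    by (rule gaussian_ibp_independent[OF _ dist indep_var_rv1[OF ind] Lp2_measurable[OF L[OF k]] prod _ f, where r = "\<lambda>i x. \<Sum>l\<in>?J. c i l * x l" and a = "\<lambda>i. c i k"])
      (use \<tau>(2)[OF k] in auto)
  have cX: "expectation (\<lambda>\<omega>. (\<Sum>l<m. c i l * \<xi> l \<omega>) * \<xi> k \<omega>) = (\<tau> (Suc k) - \<tau> k) * c i k" for i
  proof -
    have "expectation (\<lambda>\<omega>. (\<Sum>l<m. c i l * \<xi> l \<omega>) * \<xi> k \<omega>) = expectation (\<lambda>\<omega>. \<Sum>l<m. c i l * (\<xi> l \<omega> * \<xi> k \<omega>))"
      by (simp add: sum_distrib_left mult_ac)
    also have "\<dots> = (\<Sum>l<m. c i l * expectation (\<lambda>\<omega>. \<xi> l \<omega> * \<xi> k \<omega>))"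
      using L k by (subst Bochner_Integration.integral_sum) (auto intro!: integrable_mult_right Lp2_mult_integrable)
    also have "\<dots> = (\<Sum>l<m. if l = k then c i k * (\<tau> (Suc k) - \<tau> k) else 0)"
      by (intro sum.cong) (auto simp: cov)
    also have "\<dots> = (\<tau> (Suc k) - \<tau> k) * c i k" using k by (simp add: mult.commute)
    finally show ?thesis .
  qed
  show "expectation (\<lambda>\<omega>. f (\<lambda>i. \<Sum>l<m. c i l * \<xi> l \<omega>) * \<xi> k \<omega>)
    = (\<Sum>i<n. expectation (\<lambda>\<omega>. (\<Sum>l<m. c i l * \<xi> l \<omega>) * \<xi> k \<omega>) *
        expectation (\<lambda>\<omega>. partial_deriv i f (\<lambda>i. \<Sum>l<m. c i l * \<xi> l \<omega>)))"
    using * \<tau>(2)[OF k] unfolding X cX by (simp add: sum_distrib_left mult_ac)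
qed

definition endpoints :: "(real \<times> real \<times> real) list \<Rightarrow> real set" where
  "endpoints xs = (\<Union>(a, s, t)\<in>set xs. {s, t})"

lemma step_integral_partition:
  fixes \<tau> :: "nat \<Rightarrow> real"
  assumes \<tau>: "\<And>k. k < m \<Longrightarrow> \<tau> k < \<tau> (Suc k)" and xs: "valid_steps T xs" "endpoints xs \<subseteq> \<tau> ` {..m}"
  shows "\<exists>c. \<forall>\<omega>. step_integral W xs \<omega> = (\<Sum>l<m. c l * (W (\<tau> (Suc l)) \<omega> - W (\<tau> l) \<omega>))"
  using xs
proof (induction xs)
  case Nil
  then show ?case by (intro exI[of _ "\<lambda>_. 0"]) simp
next
  case (Cons x xs)
  obtain a s t where x: "x = (a, s, t)" by (cases x)
  have mono: "\<tau> i < \<tau> j" if "i < j" "j \<le> m" for i j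
    using that
  proof (induction j)
    case (Suc j) then show ?case using \<tau>[of j] by (cases "i = j") auto
  qed simp
  have "endpoints (x # xs) = {s, t} \<union> endpoints xs" by (simp add: endpoints_def x)
  then obtain i j where ij: "i \<le> m" "s = \<tau> i" "j \<le> m" "t = \<tau> j" and xs: "endpoints xs \<subseteq> \<tau> ` {..m}"
    using Cons.prems(2) by auto
  have "i \<le> j" using Cons.prems(1) ij mono[of j i] by (cases "i \<le> j") (auto simp: x)
  from Cons.IH xs Cons.prems(1) x obtain c
    where c: "\<And>\<omega>. step_integral W xs \<omega> = (\<Sum>l<m. c l * (W (\<tau> (Suc l)) \<omega> - W (\<tau> l) \<omega>))" by auto
  have "W t \<omega> - W s \<omega> = (\<Sum>l<m. (if l \<in> {i..<j} then 1 else 0) * (W (\<tau> (Suc l)) \<omega> - W (\<tau> l) \<omega>))" for \<omega>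
  proof -
    have "W t \<omega> - W s \<omega> = (\<Sum>l = i..<j. W (\<tau> (Suc l)) \<omega> - W (\<tau> l) \<omega>)"
      using sum_Suc_diff'[OF \<open>i \<le> j\<close>, of "\<lambda>l. W (\<tau> l) \<omega>"] ij by simp
    also have "\<dots> = (\<Sum>l<m. (if l \<in> {i..<j} then 1 else 0) * (W (\<tau> (Suc l)) \<omega> - W (\<tau> l) \<omega>))"
      using ij by (intro sum.mono_neutral_cong_left) auto
    finally show ?thesis .
  qed
  then have "step_integral W (x # xs) \<omega> = (\<Sum>l<m. (a * (if l \<in> {i..<j} then 1 else 0) + c l) * (W (\<tau> (Suc l)) \<omega> - W (\<tau> l) \<omega>))" for \<omega>
    by (simp only: x step_integral_simps c distrib_right sum.distrib mult.assoc sum_distrib_left)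
  then show ?case by (intro exI[of _ "\<lambda>l. a * (if l \<in> {i..<j} then 1 else 0) + c l"] allI)
qed

lemma ibp_cong:
  assumes eq: "\<And>i. i < n \<Longrightarrow> X i = X' i" and ibp: "ibp n X' Y"
  shows "ibp n X Y"
proof -
  have "(\<lambda>\<omega>. f (\<lambda>i. X i \<omega>)) = (\<lambda>\<omega>. f (\<lambda>i. X' i \<omega>))"
    "\<And>i. i < n \<Longrightarrow> (\<lambda>\<omega>. partial_deriv i f (\<lambda>k. X k \<omega>)) = (\<lambda>\<omega>. partial_deriv i f (\<lambda>k. X' k \<omega>))"
    if f: "f \<in> C1b n" for f
    using eq by (auto intro!: C1b_cong[OF f] C1b_partial_cong[OF f])
  note e = this
  show ?thesis unfolding ibp_def
  proof
    fix f assume f: "f \<in> C1b n"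
    have "expectation (\<lambda>\<omega>. f (\<lambda>i. X i \<omega>) * Y \<omega>) = expectation (\<lambda>\<omega>. f (\<lambda>i. X' i \<omega>) * Y \<omega>)"
      by (rule arg_cong[where f = "integral\<^sup>L M"]) (use fun_cong[OF e(1)[OF f]] in auto)
    also have "\<dots> = (\<Sum>i<n. expectation (\<lambda>\<omega>. X' i \<omega> * Y \<omega>) * expectation (\<lambda>\<omega>. partial_deriv i f (\<lambda>k. X' k \<omega>)))"
      using ibp f by (simp add: ibp_def)
    also have "\<dots> = (\<Sum>i<n. expectation (\<lambda>\<omega>. X i \<omega> * Y \<omega>) * expectation (\<lambda>\<omega>. partial_deriv i f (\<lambda>k. X k \<omega>)))"
      by (rule sum.cong) (simp_all add: eq e(2)[OF f])
    finally show "expectation (\<lambda>\<omega>. f (\<lambda>i. X i \<omega>) * Y \<omega>) = \<dots>" .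
  qed
qed

text \<open>
  All step functions involved are refined to one common partition of \<open>[0,T]\<close>.
\<close>

lemma ibp_steps:
  assumes xs: "\<And>i. i < n \<Longrightarrow> valid_steps T (xs i)" and ys: "valid_steps T ys"
  shows "ibp n (\<lambda>i. step_integral W (xs i)) (step_integral W ys)"
proof -
  \<comment> \<open>the points \<open>0\<close> and \<open>T\<close> keep the partition nonempty when there are no steps\<close>
  define P where "P = {0, T} \<union> endpoints ys \<union> (\<Union>i<n. endpoints (xs i))"
  have fin: "finite P" by (auto simp: P_def endpoints_def)
  have sub: "endpoints zs \<subseteq> {0..T}" if "valid_steps T zs" for zs
    using that by (fastforce simp: endpoints_def valid_steps_def)
  have P: "P \<subseteq> {0..T}" using sub[OF ys] sub[OF xs] T_pos by (auto simp: P_def)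
  define L where "L = sorted_list_of_set P"
  have L: "set L = P" "sorted L" "distinct L" using fin by (auto simp: L_def)
  have "L \<noteq> []" using L(1) by (auto simp: P_def)
  define m where "m = length L - 1"
  define \<tau> where "\<tau> k = L ! k" for k
  have len: "length L = Suc m" using \<open>L \<noteq> []\<close> by (simp add: m_def)
  have \<tau>2: "\<tau> k < \<tau> (Suc k)" if "k < m" for k
  proof -
    have "sorted_wrt (<) L" using L(2,3) unfolding strict_sorted_iff by simp
    from sorted_wrt_nth_less[OF this, of k "Suc k"] show ?thesis using that len by (simp add: \<tau>_def)
  qed
  have im: "\<tau> ` {..m} = P"
    unfolding L(1)[symmetric] set_conv_nth len by (auto simp: \<tau>_def less_Suc_eq_le)
  then have \<tau>1: "0 \<le> \<tau> 0" "\<tau> m \<le> T" using P by auto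
  have "\<exists>c. \<forall>\<omega>. step_integral W (xs i) \<omega> = (\<Sum>l<m. c l * (W (\<tau> (Suc l)) \<omega> - W (\<tau> l) \<omega>))" if "i < n" for i
    using that by (intro step_integral_partition xs \<tau>2) (auto simp: im P_def)
  then obtain c where c: "\<And>i \<omega>. i < n \<Longrightarrow> step_integral W (xs i) \<omega> = (\<Sum>l<m. c i l * (W (\<tau> (Suc l)) \<omega> - W (\<tau> l) \<omega>))"
    by metis
  have "\<exists>c. \<forall>\<omega>. step_integral W ys \<omega> = (\<Sum>l<m. c l * (W (\<tau> (Suc l)) \<omega> - W (\<tau> l) \<omega>))"
    by (intro step_integral_partition ys \<tau>2) (auto simp: im P_def)
  then obtain b where b: "\<And>\<omega>. step_integral W ys \<omega> = (\<Sum>l<m. b l * (W (\<tau> (Suc l)) \<omega> - W (\<tau> l) \<omega>))" by blast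
  have range: "\<tau> k \<in> {0..T}" if "k \<le> m" for k using P im that by auto
  have "ibp n (\<lambda>i \<omega>. \<Sum>l<m. c i l * (W (\<tau> (Suc l)) \<omega> - W (\<tau> l) \<omega>)) (\<lambda>\<omega>. \<Sum>l<m. b l * (W (\<tau> (Suc l)) \<omega> - W (\<tau> l) \<omega>))"
  proof (rule ibp_linear)
    have L2: "(\<lambda>\<omega>. W (\<tau> (Suc l)) \<omega> - W (\<tau> l) \<omega>) \<in> Lp 2 M" if "l < m" for l
      using range[of l] range[of "Suc l"] \<tau>2[OF that] that by (intro increment_moments) auto
    then show "l \<in> {..<m} \<Longrightarrow> (\<lambda>\<omega>. W (\<tau> (Suc l)) \<omega> - W (\<tau> l) \<omega>) \<in> Lp 2 M" for l by simp
    show "(\<lambda>\<omega>. \<Sum>l<m. c i l * (W (\<tau> (Suc l)) \<omega> - W (\<tau> l) \<omega>)) \<in> Lp 2 M" for i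
      using L2 by (intro Lp2_sum Lp2_cmult) auto
  qed (use ibp_partition[OF \<tau>1(1) \<tau>2 \<tau>1(2)] in auto)
  then have "ibp n (\<lambda>i \<omega>. \<Sum>l<m. c i l * (W (\<tau> (Suc l)) \<omega> - W (\<tau> l) \<omega>)) (step_integral W ys)"
    by (simp only: b[abs_def])
  moreover have "step_integral W (xs i) = (\<lambda>\<omega>. \<Sum>l<m. c i l * (W (\<tau> (Suc l)) \<omega> - W (\<tau> l) \<omega>))" if "i < n" for i
    using c[OF that] by (simp add: fun_eq_iff)
  ultimately show ?thesis by (rule ibp_cong[rotated])
qed

text \<open>
  The formula for step functions passes to the limit, because the covariance of Wiener integrals
  is the inner product of the integrands.
\<close>

theorem gaussian_ibp:
  assumes X: "\<And>i. i < n \<Longrightarrow> wiener (h i) (X i)" and Y: "wiener g Y" and f: "f \<in> C1b n"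
  shows "expectation (\<lambda>\<omega>. f (\<lambda>i. X i \<omega>) * Y \<omega>)
    = (\<Sum>i<n. (\<integral>s. h i s * g s \<partial>\<mu>) * expectation (\<lambda>\<omega>. partial_deriv i f (\<lambda>k. X k \<omega>)))"
proof -
  have "\<exists>xs. (\<forall>m. valid_steps T (xs m)) \<and> conv2 M (\<lambda>m. step_integral W (xs m)) (X i) sequentially" if "i < n" for i
    using X[OF that] unfolding wiener_integral_iff by blast
  then obtain xs where xs: "\<And>i m. i < n \<Longrightarrow> valid_steps T (xs i m)"
    "\<And>i. i < n \<Longrightarrow> conv2 M (\<lambda>m. step_integral W (xs i m)) (X i) sequentially" by metis
  obtain ys where ys: "\<And>m. valid_steps T (ys m)" "conv2 M (\<lambda>m. step_integral W (ys m)) Y sequentially"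
    using Y unfolding wiener_integral_iff by blast
  have "ibp n X Y"
    by (rule ibp_limit[where X = "\<lambda>m i. step_integral W (xs i m)" and Y = "\<lambda>m. step_integral W (ys m)"])
      (use xs ys in \<open>auto intro: ibp_steps\<close>)
  then have "expectation (\<lambda>\<omega>. f (\<lambda>i. X i \<omega>) * Y \<omega>)
    = (\<Sum>i<n. expectation (\<lambda>\<omega>. X i \<omega> * Y \<omega>) * expectation (\<lambda>\<omega>. partial_deriv i f (\<lambda>k. X k \<omega>)))"
    using f by (simp add: ibp_def)
  also have "\<dots> = (\<Sum>i<n. (\<integral>s. h i s * g s \<partial>\<mu>) * expectation (\<lambda>\<omega>. partial_deriv i f (\<lambda>k. X k \<omega>)))"
    by (intro sum.cong) (auto simp: wiener_isometry[OF X Y])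
  finally show ?thesis .
qed

end

section \<open>Products and second derivatives of functionals\<close>

lemma C1bI:
  assumes cong: "\<And>x y. (\<And>i. i < n \<Longrightarrow> x i = y i) \<Longrightarrow> f x = f y" and B: "\<And>x. \<bar>f x\<bar> \<le> B"
    and c: "continuous_on UNIV f"
    and d: "\<And>i x. i < n \<Longrightarrow> ((\<lambda>y. f (x(i := y))) has_real_derivative d i x) (at (x i))"
    and Bd: "\<And>i x. i < n \<Longrightarrow> \<bar>d i x\<bar> \<le> Bd i" and cd: "\<And>i. i < n \<Longrightarrow> continuous_on UNIV (d i)"
  shows "f \<in> C1b n" "\<And>i. i < n \<Longrightarrow> partial_deriv i f = d i"
proof -
  show eq: "partial_deriv i f = d i" if "i < n" for i
    using DERIV_imp_deriv[OF d[OF that]] by (simp add: fun_eq_iff partial_deriv_def)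
  have "bounded (range (d i))" if "i < n" for i
    unfolding bounded_iff using Bd[OF that] by auto
  moreover have "bounded (range f)" unfolding bounded_iff using B by auto
  moreover have "(\<lambda>y. f (x(i := y))) field_differentiable at (x i)" if "i < n" for x i
    using d[OF that] unfolding field_differentiable_def by blast
  moreover have "f x = f y" if "\<forall>i<n. x i = y i" for x y using cong that by blast
  ultimately show "f \<in> C1b n" using c cd by (auto simp: C1b_def eq)
qed

lemma C1b_partial_has_derivative:
  "f \<in> C1b n \<Longrightarrow> i < n \<Longrightarrow> ((\<lambda>y. f (x(i := y))) has_real_derivative partial_deriv i f x) (at (x i))"
  using C1b_has_derivative[of f n i x "x i"] by simp

lemma C1b_linear:
  assumes f: "\<And>j. j \<in> J \<Longrightarrow> f j \<in> C1b n"
  shows "(\<lambda>x. \<Sum>j\<in>J. c j * f j x) \<in> C1b n"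
    "i < n \<Longrightarrow> partial_deriv i (\<lambda>x. \<Sum>j\<in>J. c j * f j x) = (\<lambda>x. \<Sum>j\<in>J. c j * partial_deriv i (f j) x)"
proof -
  have "\<forall>j\<in>J. \<exists>B. \<forall>x. \<bar>f j x\<bar> \<le> B" using C1b_bounded[OF f] by blast
  then obtain B where B: "\<And>j x. j \<in> J \<Longrightarrow> \<bar>f j x\<bar> \<le> B j" by metis
  have "\<forall>i j. \<exists>B. i < n \<longrightarrow> j \<in> J \<longrightarrow> (\<forall>x. \<bar>partial_deriv i (f j) x\<bar> \<le> B)"
    using C1b_partial_bounded[OF f] by blast
  then obtain D where D: "\<And>i j x. i < n \<Longrightarrow> j \<in> J \<Longrightarrow> \<bar>partial_deriv i (f j) x\<bar> \<le> D i j" by metis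
  have le: "\<bar>\<Sum>j\<in>J. c j * a j\<bar> \<le> (\<Sum>j\<in>J. \<bar>c j\<bar> * b j)" if "\<And>j. j \<in> J \<Longrightarrow> \<bar>a j\<bar> \<le> b j" for a b :: "_ \<Rightarrow> real"
    by (rule order_trans[OF sum_abs sum_mono]) (use that in \<open>auto simp: abs_mult intro: mult_left_mono\<close>)
  have 1: "(\<Sum>j\<in>J. c j * f j x) = (\<Sum>j\<in>J. c j * f j y)" if "\<And>i. i < n \<Longrightarrow> x i = y i" for x y
    using C1b_cong[OF f that] by (intro sum.cong) auto
  have 2: "((\<lambda>y. \<Sum>j\<in>J. c j * f j (x(i := y))) has_real_derivative (\<Sum>j\<in>J. c j * partial_deriv i (f j) x)) (at (x i))"
    if "i < n" for i x
    using C1b_partial_has_derivative[OF f that] by (intro DERIV_sum DERIV_cmult) auto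
  show "(\<lambda>x. \<Sum>j\<in>J. c j * f j x) \<in> C1b n"
    "i < n \<Longrightarrow> partial_deriv i (\<lambda>x. \<Sum>j\<in>J. c j * f j x) = (\<lambda>x. \<Sum>j\<in>J. c j * partial_deriv i (f j) x)"
    by (rule C1bI[OF 1 le[OF B] _ 2 le[OF D]];
        auto intro!: continuous_intros C1b_continuous[OF f] C1b_partial_continuous[OF f])+
qed

text \<open>
  The two factors use disjoint blocks of variables, so functionals built from different families
  of Wiener integrals can be multiplied without identifying common ones.
\<close>

lemma C1b_product:
  assumes f: "f \<in> C1b n" and g: "g \<in> C1b m"
  defines "sh \<equiv> \<lambda>x i. x (n + i)"
  shows "(\<lambda>x. f x * g (sh x)) \<in> C1b (n + m)"
    "i < n + m \<Longrightarrow> partial_deriv i (\<lambda>x. f x * g (sh x))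
      = (\<lambda>x. if i < n then partial_deriv i f x * g (sh x) else f x * partial_deriv (i - n) g (sh x))"
proof -
  obtain B where B: "\<And>x. \<bar>f x\<bar> \<le> B" using C1b_bounded[OF f] by blast
  obtain B' where B': "\<And>x. \<bar>g x\<bar> \<le> B'" using C1b_bounded[OF g] by blast
  have "\<forall>i. \<exists>B. i < n \<longrightarrow> (\<forall>x. \<bar>partial_deriv i f x\<bar> \<le> B)" using C1b_partial_bounded[OF f] by blast
  then obtain D where D: "\<And>i x. i < n \<Longrightarrow> \<bar>partial_deriv i f x\<bar> \<le> D i" by metis
  have "\<forall>i. \<exists>B. i < m \<longrightarrow> (\<forall>x. \<bar>partial_deriv i g x\<bar> \<le> B)" using C1b_partial_bounded[OF g] by blast
  then obtain D' where D': "\<And>i x. i < m \<Longrightarrow> \<bar>partial_deriv i g x\<bar> \<le> D' i" by metis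
  have shc: "continuous_on UNIV sh" unfolding sh_def
    by (intro continuous_on_coordinatewise_then_product continuous_on_product_coordinates)
  have gc: "continuous_on UNIV (\<lambda>x. g (sh x))" "\<And>i. i < m \<Longrightarrow> continuous_on UNIV (\<lambda>x. partial_deriv i g (sh x))"
    by (rule continuous_on_compose2[OF C1b_continuous[OF g] shc] continuous_on_compose2[OF C1b_partial_continuous[OF g] shc]; simp)+
  let ?d = "\<lambda>i x. if i < n then partial_deriv i f x * g (sh x) else f x * partial_deriv (i - n) g (sh x)"
  have 1: "f x * g (sh x) = f y * g (sh y)" if xy: "\<And>i. i < n + m \<Longrightarrow> x i = y i" for x y
  proof -
    have "f x = f y" by (rule C1b_cong[OF f]) (use xy in auto)
    moreover have "g (sh x) = g (sh y)" by (rule C1b_cong[OF g]) (use xy in \<open>auto simp: sh_def\<close>)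
    ultimately show ?thesis by simp
  qed
  have 2: "\<bar>f x * g (sh x)\<bar> \<le> B * B'" for x
    unfolding abs_mult by (rule mult_mono'[OF B B']) auto
  have 3: "((\<lambda>y. f (x(i := y)) * g (sh (x(i := y)))) has_real_derivative ?d i x) (at (x i))" if i: "i < n + m" for i x
  proof (cases "i < n")
    case True
    have "sh (x(i := y)) = sh x" for y using True by (auto simp: sh_def fun_eq_iff)
    then show ?thesis using DERIV_cmult_right[OF C1b_partial_has_derivative[OF f True], of x "g (sh x)"] True by simp
  next
    case False
    have "f (x(i := y)) = f x" for y by (rule C1b_cong[OF f]) (use False in auto)
    moreover have "sh (x(i := y)) = (sh x)(i - n := y)" for y using False by (auto simp: sh_def fun_eq_iff)
    moreover have "sh x (i - n) = x i" using False by (simp add: sh_def)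
    moreover have "i - n < m" using i False by simp
    ultimately show ?thesis
      using DERIV_cmult[OF C1b_partial_has_derivative[OF g, of "i - n" "sh x"], of "f x"] False by simp
  qed
  have 4: "\<bar>?d i x\<bar> \<le> (if i < n then D i * B' else B * D' (i - n))" if i: "i < n + m" for i x
    using i mult_mono'[OF D[of i x] B'[of "sh x"]] mult_mono'[OF B[of x] D'[of "i - n" "sh x"]] by (auto simp: abs_mult)
  have 5: "continuous_on UNIV (?d i)" if i: "i < n + m" for i
    using i by (cases "i < n")
      (auto intro!: continuous_on_mult gc C1b_continuous[OF f] C1b_partial_continuous[OF f])
  have 6: "continuous_on UNIV (\<lambda>x. f x * g (sh x))" by (intro continuous_on_mult gc C1b_continuous[OF f])
  show "(\<lambda>x. f x * g (sh x)) \<in> C1b (n + m)" by (rule C1bI(1)[OF 1 2 6 3 4 5])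
  show "i < n + m \<Longrightarrow> partial_deriv i (\<lambda>x. f x * g (sh x)) = ?d i" by (rule C1bI(2)[OF 1 2 6 3 4 5])
qed

lemma C1b_one_variable:
  assumes B: "\<And>z. \<bar>\<phi> z\<bar> \<le> B" and d: "\<And>z. (\<phi> has_real_derivative \<phi>' z) (at z)"
    and B': "\<And>z. \<bar>\<phi>' z\<bar> \<le> B'" and c: "continuous_on UNIV \<phi>'"
  shows "(\<lambda>x. \<phi> (x 0)) \<in> C1b 1" "partial_deriv 0 (\<lambda>x. \<phi> (x 0)) = (\<lambda>x. \<phi>' (x 0))"
proof -
  have "continuous_on UNIV \<phi>" by (rule DERIV_continuous_on) (use d in \<open>auto intro: DERIV_subset\<close>)
  then have c': "continuous_on UNIV (\<lambda>x. \<phi> (x (0::nat)))"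
    by (rule continuous_on_compose2[OF _ continuous_on_product_coordinates]) simp
  have c1: "continuous_on UNIV (\<lambda>x. \<phi>' (x (0::nat)))"
    by (rule continuous_on_compose2[OF c continuous_on_product_coordinates]) simp
  have 1: "((\<lambda>y. \<phi> ((x(i := y)) 0)) has_real_derivative \<phi>' (x 0)) (at (x i))" if "i < 1" for i :: nat and x
    using d[of "x 0"] that by simp
  show "(\<lambda>x. \<phi> (x 0)) \<in> C1b 1"
    by (rule C1bI(1)[where d = "\<lambda>i x. \<phi>' (x 0)", OF _ B c' 1 B' c1]) auto
  show "partial_deriv 0 (\<lambda>x. \<phi> (x 0)) = (\<lambda>x. \<phi>' (x 0))"
    by (rule C1bI(2)[where d = "\<lambda>i x. \<phi>' (x 0)" and n = 1, OF _ B c' 1 B' c1]) auto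
qed

text \<open>
  Both mixed derivatives are limits of the same second difference quotient, evaluated by applying
  the mean value theorem in either order.
\<close>

lemma mixed_partials_equal:
  fixes g gx gy gxy gyx :: "real \<Rightarrow> real \<Rightarrow> real"
  assumes gx: "\<And>a b. ((\<lambda>a. g a b) has_real_derivative gx a b) (at a)"
    and gy: "\<And>a b. ((\<lambda>b. g a b) has_real_derivative gy a b) (at b)"
    and gxy: "\<And>a b. ((\<lambda>b. gx a b) has_real_derivative gxy a b) (at b)"
    and gyx: "\<And>a b. ((\<lambda>a. gy a b) has_real_derivative gyx a b) (at a)"
    and c1: "continuous_on UNIV (\<lambda>p. gxy (fst p) (snd p))" and c2: "continuous_on UNIV (\<lambda>p. gyx (fst p) (snd p))"
  shows "gxy a b = gyx a b"
proof -
  define h where "h n = inverse (real (Suc n))" for n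
  have h: "h n > 0" for n by (simp add: h_def)
  have h0: "h \<longlonglongrightarrow> 0" unfolding h_def by (rule LIMSEQ_inverse_real_of_nat)
  have ex1: "\<exists>p. \<bar>fst p - a\<bar> \<le> h n \<and> \<bar>snd p - b\<bar> \<le> h n \<and>
     (g (a + h n) (b + h n) - g (a + h n) b) - (g a (b + h n) - g a b) = h n * (h n * gxy (fst p) (snd p))" for n
  proof -
    have "((\<lambda>a. g a (b + h n) - g a b) has_real_derivative (gx x (b + h n) - gx x b)) (at x)" for x
      by (intro DERIV_diff gx)
    from mvt_unordered[OF this, of a "a + h n"] obtain \<xi> where \<xi>: "\<bar>\<xi> - a\<bar> \<le> \<bar>h n\<bar>"
      "(g (a + h n) (b + h n) - g (a + h n) b) - (g a (b + h n) - g a b) = h n * (gx \<xi> (b + h n) - gx \<xi> b)" by auto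
    from mvt_unordered[OF gxy, of b "b + h n" \<xi>] obtain \<eta> where \<eta>: "\<bar>\<eta> - b\<bar> \<le> \<bar>h n\<bar>"
      "gx \<xi> (b + h n) - gx \<xi> b = h n * gxy \<xi> \<eta>" by auto
    show ?thesis using \<xi> \<eta> h[of n] by (intro exI[of _ "(\<xi>, \<eta>)"]) auto
  qed
  have ex2: "\<exists>p. \<bar>fst p - a\<bar> \<le> h n \<and> \<bar>snd p - b\<bar> \<le> h n \<and>
     (g (a + h n) (b + h n) - g a (b + h n)) - (g (a + h n) b - g a b) = h n * (h n * gyx (fst p) (snd p))" for n
  proof -
    have "((\<lambda>b. g (a + h n) b - g a b) has_real_derivative (gy (a + h n) x - gy a x)) (at x)" for x
      by (intro DERIV_diff gy)
    from mvt_unordered[OF this, of b "b + h n"] obtain \<eta> where \<eta>: "\<bar>\<eta> - b\<bar> \<le> \<bar>h n\<bar>"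
      "(g (a + h n) (b + h n) - g a (b + h n)) - (g (a + h n) b - g a b) = h n * (gy (a + h n) \<eta> - gy a \<eta>)" by auto
    from mvt_unordered[OF gyx, of a "a + h n" \<eta>] obtain \<xi> where \<xi>: "\<bar>\<xi> - a\<bar> \<le> \<bar>h n\<bar>"
      "gy (a + h n) \<eta> - gy a \<eta> = h n * gyx \<xi> \<eta>" by auto
    show ?thesis using \<xi> \<eta> h[of n] by (intro exI[of _ "(\<xi>, \<eta>)"]) auto
  qed
  obtain p where p: "\<And>n. \<bar>fst (p n) - a\<bar> \<le> h n" "\<And>n. \<bar>snd (p n) - b\<bar> \<le> h n"
    "\<And>n. (g (a + h n) (b + h n) - g (a + h n) b) - (g a (b + h n) - g a b) = h n * (h n * gxy (fst (p n)) (snd (p n)))"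
  proof -
    have "\<exists>p. \<forall>n. \<bar>fst (p n) - a\<bar> \<le> h n \<and> \<bar>snd (p n) - b\<bar> \<le> h n \<and>
       (g (a + h n) (b + h n) - g (a + h n) b) - (g a (b + h n) - g a b) = h n * (h n * gxy (fst (p n)) (snd (p n)))"
      by (rule choice, rule allI, rule ex1)
    then show ?thesis using that by blast
  qed
  obtain q where q: "\<And>n. \<bar>fst (q n) - a\<bar> \<le> h n" "\<And>n. \<bar>snd (q n) - b\<bar> \<le> h n"
    "\<And>n. (g (a + h n) (b + h n) - g a (b + h n)) - (g (a + h n) b - g a b) = h n * (h n * gyx (fst (q n)) (snd (q n)))"
  proof -
    have "\<exists>q. \<forall>n. \<bar>fst (q n) - a\<bar> \<le> h n \<and> \<bar>snd (q n) - b\<bar> \<le> h n \<and>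
       (g (a + h n) (b + h n) - g a (b + h n)) - (g (a + h n) b - g a b) = h n * (h n * gyx (fst (q n)) (snd (q n)))"
      by (rule choice, rule allI, rule ex2)
    then show ?thesis using that by blast
  qed
  have lim: "r \<longlonglongrightarrow> (a, b)" if "\<And>n. \<bar>fst (r n) - a\<bar> \<le> h n" "\<And>n. \<bar>snd (r n) - b\<bar> \<le> h n" for r
  proof -
    have "(\<lambda>n. fst (r n) - a) \<longlonglongrightarrow> 0" "(\<lambda>n. snd (r n) - b) \<longlonglongrightarrow> 0"
      using that by (auto intro!: Lim_null_comparison[OF always_eventually h0])
    then have "(\<lambda>n. fst (r n)) \<longlonglongrightarrow> a" "(\<lambda>n. snd (r n)) \<longlonglongrightarrow> b" by (simp_all add: LIM_zero_iff)
    from tendsto_Pair[OF this] show ?thesis by simp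
  qed
  have "(\<lambda>n. gxy (fst (p n)) (snd (p n))) \<longlonglongrightarrow> gxy a b"
    using continuous_on_tendsto_compose[OF c1 lim[OF p(1,2)]] by simp
  moreover have "(\<lambda>n. gyx (fst (q n)) (snd (q n))) \<longlonglongrightarrow> gyx a b"
    using continuous_on_tendsto_compose[OF c2 lim[OF q(1,2)]] by simp
  moreover have "gxy (fst (p n)) (snd (p n)) = gyx (fst (q n)) (snd (q n))" for n
  proof -
    have "h n * (h n * gxy (fst (p n)) (snd (p n))) = h n * (h n * gyx (fst (q n)) (snd (q n)))"
      using p(3)[of n] q(3)[of n] by linarith
    then show ?thesis using h[of n] by simp
  qed
  ultimately show ?thesis by (simp add: LIMSEQ_unique)
qed

lemma Cb_infinityD:
  assumes "f \<in> Cb_infinity n" "set js \<subseteq> {..<n}"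
  shows "bounded (range (foldr partial_deriv js f))" "continuous_on UNIV (foldr partial_deriv js f)"
    "\<forall>i<n. \<forall>x. (\<lambda>y. foldr partial_deriv js f (x(i := y))) field_differentiable at (x i)"
proof -
  have "\<forall>js. set js \<subseteq> {..<n} \<longrightarrow> bounded (range (foldr partial_deriv js f)) \<and>
      continuous_on UNIV (foldr partial_deriv js f) \<and>
      (\<forall>i<n. \<forall>x. (\<lambda>y. foldr partial_deriv js f (x(i := y))) field_differentiable at (x i))"
    using assms(1) unfolding Cb_infinity_def mem_Collect_eq by (rule conjunct2)
  from this[rule_format, OF assms(2)]
  show "bounded (range (foldr partial_deriv js f))" "continuous_on UNIV (foldr partial_deriv js f)"
    "\<forall>i<n. \<forall>x. (\<lambda>y. foldr partial_deriv js f (x(i := y))) field_differentiable at (x i)" by blast+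
qed

lemma Cb_infinity_C1b:
  assumes f: "f \<in> Cb_infinity n"
  shows "f \<in> C1b n"
proof -
  have c: "\<forall>x y. (\<forall>i<n. x i = y i) \<longrightarrow> f x = f y" using f unfolding Cb_infinity_def by simp
  have 1: "bounded (range (partial_deriv i f))" "continuous_on UNIV (partial_deriv i f)" if "i < n" for i
    using Cb_infinityD(1,2)[OF f, of "[i]"] that by simp_all
  show ?thesis using c Cb_infinityD[OF f, of "[]"] 1 unfolding C1b_def by simp
qed

lemma Cb_infinity_partial:
  assumes f: "f \<in> Cb_infinity n" and i: "i < n"
  shows "partial_deriv i f \<in> Cb_infinity n"
proof -
  have eq: "foldr partial_deriv js (partial_deriv i f) = foldr partial_deriv (js @ [i]) f" for js by simp
  have "set (js @ [i]) \<subseteq> {..<n}" if "set js \<subseteq> {..<n}" for js using that i by simp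
  note js = Cb_infinityD[OF f this]
  have c: "\<forall>x y. (\<forall>i<n. x i = y i) \<longrightarrow> partial_deriv i f x = partial_deriv i f y"
    using C1b_partial_cong[OF Cb_infinity_C1b[OF f] i] by blast
  show ?thesis
    unfolding Cb_infinity_def mem_Collect_eq eq using c js by (intro conjI allI impI) simp_all
qed

lemma Cb_infinity_mixed_partials:
  assumes f: "f \<in> Cb_infinity n" and ij: "i < n" "j < n"
  shows "partial_deriv i (partial_deriv j f) x = partial_deriv j (partial_deriv i f) x"
proof (cases "i = j")
  case False
  note C = Cb_infinity_C1b
  let ?u = "\<lambda>a b. x(i := a, j := b)"
  have tw: "?u a b = (x(j := b))(i := a)" for a b using False by (simp add: fun_upd_twist)
  have cu: "continuous_on UNIV (\<lambda>p. ?u (fst p) (snd p))"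
  proof (rule continuous_on_coordinatewise_then_product)
    fix k show "continuous_on UNIV (\<lambda>p. ?u (fst p) (snd p) k)"
      by (cases "k = j"; cases "k = i") (auto intro!: continuous_intros)
  qed
  have Di: "((\<lambda>a. g (?u a b)) has_real_derivative partial_deriv i g (?u a b)) (at a)" if "g \<in> Cb_infinity n" for g a b
    unfolding tw by (rule C1b_has_derivative[OF C[OF that] ij(1)])
  have Dj: "((\<lambda>b. g (?u a b)) has_real_derivative partial_deriv j g (?u a b)) (at b)" if "g \<in> Cb_infinity n" for g a b
    by (rule C1b_has_derivative[OF C[OF that] ij(2)])
  have "(\<lambda>a b. partial_deriv j (partial_deriv i f) (?u a b)) (x i) (x j)
      = (\<lambda>a b. partial_deriv i (partial_deriv j f) (?u a b)) (x i) (x j)"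
  proof (rule mixed_partials_equal[of "\<lambda>a b. f (?u a b)" "\<lambda>a b. partial_deriv i f (?u a b)" "\<lambda>a b. partial_deriv j f (?u a b)"
        "\<lambda>a b. partial_deriv j (partial_deriv i f) (?u a b)" "\<lambda>a b. partial_deriv i (partial_deriv j f) (?u a b)" "x i" "x j"])
    show "continuous_on UNIV (\<lambda>p. partial_deriv j (partial_deriv i f) (?u (fst p) (snd p)))"
      by (rule continuous_on_compose2[OF C1b_partial_continuous[OF C[OF Cb_infinity_partial[OF f ij(1)]] ij(2)] cu]) simp
    show "continuous_on UNIV (\<lambda>p. partial_deriv i (partial_deriv j f) (?u (fst p) (snd p)))"
      by (rule continuous_on_compose2[OF C1b_partial_continuous[OF C[OF Cb_infinity_partial[OF f ij(2)]] ij(1)] cu]) simp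
  qed (intro Di Dj f Cb_infinity_partial ij)+
  then show ?thesis by simp
qed simp

text \<open>
  The directional derivative \<open>\<langle>DF, g\<rangle>\<close> of a functional in the direction \<open>g\<close> of the Cameron--Martin
  space.
\<close>

definition along :: "real \<Rightarrow> (real \<Rightarrow> 'a \<Rightarrow> real) \<Rightarrow> (real \<Rightarrow> real) \<Rightarrow> 'a \<Rightarrow> real" where
  "along T DF g \<omega> = (\<integral>s. DF s \<omega> * g s \<partial>time_measure T)"

context brownian
begin

text \<open>
  The smooth functionals with the profile taken from \<open>C1b\<close>. This class contains products and
  bounded transforms of Wiener integrals, and integration by parts holds on all of it.
\<close>

definition C1_deriv :: "('a \<Rightarrow> real) \<Rightarrow> (real \<Rightarrow> 'a \<Rightarrow> real) \<Rightarrow> bool" where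
  "C1_deriv F DF \<longleftrightarrow> (\<exists>n f h X. f \<in> C1b n \<and> (\<forall>i<n. wiener (h i) (X i)) \<and>
     F = (\<lambda>\<omega>. f (\<lambda>i. X i \<omega>)) \<and> DF = (\<lambda>s \<omega>. \<Sum>i<n. partial_deriv i f (\<lambda>k. X k \<omega>) * h i s))"

lemma smooth_deriv_C1: "smooth_deriv T M W F DF \<Longrightarrow> C1_deriv F DF"
  unfolding smooth_deriv_def C1_deriv_def using Cb_infinity_C1b by blast

lemma along_sum:
  assumes h: "\<And>i. i \<in> I \<Longrightarrow> h i \<in> Lp 2 \<mu>" and g: "g \<in> Lp 2 \<mu>"
  shows "along T (\<lambda>s \<omega>. \<Sum>i\<in>I. a i \<omega> * h i s) g \<omega> = (\<Sum>i\<in>I. a i \<omega> * (\<integral>s. h i s * g s \<partial>\<mu>))"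
proof -
  have "along T (\<lambda>s \<omega>. \<Sum>i\<in>I. a i \<omega> * h i s) g \<omega> = (\<integral>s. (\<Sum>i\<in>I. a i \<omega> * (h i s * g s)) \<partial>\<mu>)"
    unfolding along_def by (simp add: sum_distrib_right mult.assoc)
  also have "\<dots> = (\<Sum>i\<in>I. a i \<omega> * (\<integral>s. h i s * g s \<partial>\<mu>))"
    using Lp2_mult_integrable[OF h g] by (subst Bochner_Integration.integral_sum) auto
  finally show ?thesis .
qed

lemma C1_deriv_time_Lp2: "C1_deriv F DF \<Longrightarrow> (\<lambda>s. DF s \<omega>) \<in> Lp 2 \<mu>"
  unfolding C1_deriv_def by (auto intro!: Lp2_sum Lp2_cmult dest: wiener_Lp2)

lemma C1_bounded:
  assumes "C1_deriv F DF"
  shows "F \<in> borel_measurable M" "\<exists>B. \<forall>\<omega>. \<bar>F \<omega>\<bar> \<le> B" "F \<in> Lp 2 M"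
proof -
  obtain n f h X where a: "f \<in> C1b n" "\<And>i. i < n \<Longrightarrow> wiener (h i) (X i)" "F = (\<lambda>\<omega>. f (\<lambda>i. X i \<omega>))"
    using assms unfolding C1_deriv_def by blast
  have X: "X i \<in> borel_measurable M" if "i < n" for i by (rule Lp2_measurable[OF wiener_Lp2(2)[OF a(2)[OF that]]])
  show "F \<in> borel_measurable M" unfolding a(3) by (rule C1b_measurable[OF a(1) X])
  show "\<exists>B. \<forall>\<omega>. \<bar>F \<omega>\<bar> \<le> B" unfolding a(3) using C1b_bounded[OF a(1)] by blast
  show "F \<in> Lp 2 M" unfolding a(3) by (rule C1b_Lp2(1)[OF a(1) X])
qed

lemma along_bounded:
  assumes "C1_deriv F DF" and g: "g \<in> Lp 2 \<mu>"
  shows "along T DF g \<in> borel_measurable M" "\<exists>B. \<forall>\<omega>. \<bar>along T DF g \<omega>\<bar> \<le> B" "along T DF g \<in> Lp 2 M"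
proof -
  obtain n f h X where a: "f \<in> C1b n" "\<And>i. i < n \<Longrightarrow> wiener (h i) (X i)"
    "DF = (\<lambda>s \<omega>. \<Sum>i<n. partial_deriv i f (\<lambda>k. X k \<omega>) * h i s)"
    using assms unfolding C1_deriv_def by blast
  have X: "X i \<in> borel_measurable M" if "i < n" for i by (rule Lp2_measurable[OF wiener_Lp2(2)[OF a(2)[OF that]]])
  have eq: "along T DF g = (\<lambda>\<omega>. \<Sum>i<n. partial_deriv i f (\<lambda>k. X k \<omega>) * (\<integral>s. h i s * g s \<partial>\<mu>))"
    unfolding a(3) using a(2) g by (auto simp: fun_eq_iff intro!: along_sum wiener_Lp2(1))
  show 1: "along T DF g \<in> borel_measurable M" unfolding eq
    by (intro borel_measurable_sum borel_measurable_times borel_measurable_const C1b_partial_measurable[OF a(1) X]) auto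
  have "\<forall>i. \<exists>B. i < n \<longrightarrow> (\<forall>x. \<bar>partial_deriv i f x\<bar> \<le> B)" using C1b_partial_bounded[OF a(1)] by blast
  then obtain B where B: "\<And>i x. i < n \<Longrightarrow> \<bar>partial_deriv i f x\<bar> \<le> B i" by metis
  have "\<bar>along T DF g \<omega>\<bar> \<le> (\<Sum>i<n. B i * \<bar>\<integral>s. h i s * g s \<partial>\<mu>\<bar>)" for \<omega>
    unfolding eq by (rule order_trans[OF sum_abs sum_mono]) (auto simp: abs_mult intro!: mult_right_mono B)
  then show 2: "\<exists>B. \<forall>\<omega>. \<bar>along T DF g \<omega>\<bar> \<le> B" by blast
  then obtain B where "\<And>\<omega>. \<bar>along T DF g \<omega>\<bar> \<le> B" by blast
  then show "along T DF g \<in> Lp 2 M" using Lp2_bounded_mult[OF Lp2_const[of 1] 1, of B] by simp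
qed

text \<open>
  This is duality with the deterministic process \<open>g\<close>, whose Skorohod integral is the Wiener
  integral \<open>Y\<close>.
\<close>

lemma C1_ibp:
  assumes "C1_deriv F DF" and Y: "wiener g Y"
  shows "expectation (\<lambda>\<omega>. F \<omega> * Y \<omega>) = expectation (along T DF g)"
proof -
  obtain n f h X where a: "f \<in> C1b n" "\<And>i. i < n \<Longrightarrow> wiener (h i) (X i)" "F = (\<lambda>\<omega>. f (\<lambda>i. X i \<omega>))"
    "DF = (\<lambda>s \<omega>. \<Sum>i<n. partial_deriv i f (\<lambda>k. X k \<omega>) * h i s)"
    using assms unfolding C1_deriv_def by blast
  have X: "X i \<in> borel_measurable M" if "i < n" for i by (rule Lp2_measurable[OF wiener_Lp2(2)[OF a(2)[OF that]]])
  have eq: "along T DF g = (\<lambda>\<omega>. \<Sum>i<n. partial_deriv i f (\<lambda>k. X k \<omega>) * (\<integral>s. h i s * g s \<partial>\<mu>))"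
    unfolding a(4) using a(2) wiener_Lp2(1)[OF Y] by (auto simp: fun_eq_iff intro!: along_sum wiener_Lp2(1))
  have "expectation (along T DF g) = (\<Sum>i<n. expectation (\<lambda>\<omega>. partial_deriv i f (\<lambda>k. X k \<omega>)) * (\<integral>s. h i s * g s \<partial>\<mu>))"
    unfolding eq using Lp2_integrable[OF C1b_Lp2(2)[OF a(1) X]]
    by (subst Bochner_Integration.integral_sum) auto
  also have "\<dots> = (\<Sum>i<n. (\<integral>s. h i s * g s \<partial>\<mu>) * expectation (\<lambda>\<omega>. partial_deriv i f (\<lambda>k. X k \<omega>)))"
    by (rule sum.cong[OF refl]) (rule mult.commute)
  finally show ?thesis unfolding a(3) using gaussian_ibp[OF a(2) Y a(1)] by simp
qed

lemma C1_product:
  assumes "C1_deriv F DF" "C1_deriv G DG"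
  shows "C1_deriv (\<lambda>\<omega>. F \<omega> * G \<omega>) (\<lambda>s \<omega>. F \<omega> * DG s \<omega> + G \<omega> * DF s \<omega>)"
proof -
  obtain n f h X where a: "f \<in> C1b n" "\<And>i. i < n \<Longrightarrow> wiener (h i) (X i)" "F = (\<lambda>\<omega>. f (\<lambda>i. X i \<omega>))"
    "DF = (\<lambda>s \<omega>. \<Sum>i<n. partial_deriv i f (\<lambda>k. X k \<omega>) * h i s)"
    using assms(1) unfolding C1_deriv_def by blast
  obtain m g k Y where b: "g \<in> C1b m" "\<And>i. i < m \<Longrightarrow> wiener (k i) (Y i)" "G = (\<lambda>\<omega>. g (\<lambda>i. Y i \<omega>))"
    "DG = (\<lambda>s \<omega>. \<Sum>i<m. partial_deriv i g (\<lambda>k. Y k \<omega>) * k i s)"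
    using assms(2) unfolding C1_deriv_def by blast
  define p where "p x = f x * g (\<lambda>i. x (n + i))" for x
  define Z where "Z i = (if i < n then X i else Y (i - n))" for i
  define l where "l i = (if i < n then h i else k (i - n))" for i
  have p: "p \<in> C1b (n + m)" "\<And>i. i < n + m \<Longrightarrow> partial_deriv i p
      = (\<lambda>x. if i < n then partial_deriv i f x * g (\<lambda>i. x (n + i)) else f x * partial_deriv (i - n) g (\<lambda>i. x (n + i)))"
    unfolding p_def by (rule C1b_product[OF a(1) b(1)])+
  have Z: "(\<lambda>i. Z (n + i) \<omega>) = (\<lambda>i. Y i \<omega>)" for \<omega> by (simp add: Z_def)
  have fZ: "f (\<lambda>i. Z i \<omega>) = F \<omega>" for \<omega> unfolding a(3) by (rule C1b_cong[OF a(1)]) (simp add: Z_def)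
  have dZ: "partial_deriv i f (\<lambda>i. Z i \<omega>) = partial_deriv i f (\<lambda>i. X i \<omega>)" if "i < n" for i \<omega>
    by (rule C1b_partial_cong[OF a(1) that]) (simp add: Z_def)
  have "F \<omega> * DG s \<omega> + G \<omega> * DF s \<omega> = (\<Sum>i<n + m. partial_deriv i p (\<lambda>k. Z k \<omega>) * l i s)" for s \<omega>
  proof -
    have "(\<Sum>i<n + m. partial_deriv i p (\<lambda>k. Z k \<omega>) * l i s)
      = (\<Sum>i<n. partial_deriv i p (\<lambda>k. Z k \<omega>) * l i s) + (\<Sum>i<m. partial_deriv (n + i) p (\<lambda>k. Z k \<omega>) * l (n + i) s)"
      by (induction m) (simp_all add: add.assoc)
    also have "(\<Sum>i<n. partial_deriv i p (\<lambda>k. Z k \<omega>) * l i s) = G \<omega> * DF s \<omega>"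
      unfolding a(4) b(3) sum_distrib_left by (intro sum.cong) (auto simp: p(2) Z dZ l_def)
    also have "(\<Sum>i<m. partial_deriv (n + i) p (\<lambda>k. Z k \<omega>) * l (n + i) s) = F \<omega> * DG s \<omega>"
      unfolding b(4) sum_distrib_left by (intro sum.cong) (auto simp: p(2) Z fZ l_def)
    finally show ?thesis by simp
  qed
  moreover have "wiener (l i) (Z i)" if "i < n + m" for i
    using that a(2)[of i] b(2)[of "i - n"] by (auto simp: l_def Z_def)
  moreover have "F \<omega> * G \<omega> = p (\<lambda>i. Z i \<omega>)" for \<omega> unfolding p_def Z fZ b(3) by simp
  ultimately show ?thesis unfolding C1_deriv_def using p(1)
    by (intro exI[of _ "n + m"] exI[of _ p] exI[of _ l] exI[of _ Z]) (simp add: fun_eq_iff)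
qed

lemma along_product:
  assumes "C1_deriv F DF" "C1_deriv G DG" and g: "g \<in> Lp 2 \<mu>"
  shows "along T (\<lambda>s \<omega>. F \<omega> * DG s \<omega> + G \<omega> * DF s \<omega>) g \<omega> = F \<omega> * along T DG g \<omega> + G \<omega> * along T DF g \<omega>"
proof -
  note i = Lp2_mult_integrable[OF C1_deriv_time_Lp2[OF assms(1)] g, of \<omega>] Lp2_mult_integrable[OF C1_deriv_time_Lp2[OF assms(2)] g, of \<omega>]
  have "along T (\<lambda>s \<omega>. F \<omega> * DG s \<omega> + G \<omega> * DF s \<omega>) g \<omega>
    = (\<integral>s. F \<omega> * (DG s \<omega> * g s) + G \<omega> * (DF s \<omega> * g s) \<partial>\<mu>)"
    unfolding along_def by (simp add: algebra_simps)
  then show ?thesis using i unfolding along_def by simp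
qed

lemma C1_bounded_transform:
  assumes Z: "wiener g Z" and "\<And>z. \<bar>\<phi> z\<bar> \<le> B" "\<And>z. (\<phi> has_real_derivative \<phi>' z) (at z)"
    "\<And>z. \<bar>\<phi>' z\<bar> \<le> B'" "continuous_on UNIV \<phi>'"
  shows "C1_deriv (\<lambda>\<omega>. \<phi> (Z \<omega>)) (\<lambda>s \<omega>. \<phi>' (Z \<omega>) * g s)"
  unfolding C1_deriv_def
  by (intro exI[of _ 1] exI[of _ "\<lambda>x. \<phi> (x 0)"] exI[of _ "\<lambda>_. g"] exI[of _ "\<lambda>_. Z"])
    (use Z C1b_one_variable[of \<phi> B \<phi>' B'] assms in auto)

text \<open>
  Integration by parts for the product \<open>F Z\<close>, in which the Wiener integral \<open>Z\<close> is unbounded and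
  has derivative \<open>g'\<close>; it is approximated by bounded transforms.
\<close>

lemma C1_ibp_product:
  assumes F: "C1_deriv F DF" and Y: "wiener g Y" and Z: "wiener g' Z"
  shows "expectation (\<lambda>\<omega>. F \<omega> * Z \<omega> * Y \<omega>)
    = expectation (\<lambda>\<omega>. along T DF g \<omega> * Z \<omega>) + (\<integral>s. g' s * g s \<partial>\<mu>) * expectation F"
proof -
  define c where "c k = real (Suc k)" for k
  have c: "c k > 0" for k by (simp add: c_def)
  \<comment> \<open>\<open>c sin (z / c)\<close> is bounded with derivative bounded by 1, is dominated by \<open>\<bar>z\<bar>\<close> and tends
    to \<open>z\<close>\<close>
  define \<phi> where "\<phi> k z = c k * sin (z / c k)" for k :: nat and z :: real
  define \<phi>' where "\<phi>' k z = cos (z / c k)" for k :: nat and z :: real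
  note gL = wiener_Lp2(1)[OF Y] and g'L = wiener_Lp2(1)[OF Z] and YL = wiener_Lp2(2)[OF Y] and ZL = wiener_Lp2(2)[OF Z]
  have [measurable]: "F \<in> borel_measurable M" "Y \<in> borel_measurable M" "Z \<in> borel_measurable M" "along T DF g \<in> borel_measurable M"
    using C1_bounded(1)[OF F] YL ZL along_bounded(1)[OF F gL] by (auto intro: Lp2_measurable)
  obtain B where B: "\<And>\<omega>. \<bar>F \<omega>\<bar> \<le> B" using C1_bounded(2)[OF F] by blast
  obtain B' where B': "\<And>\<omega>. \<bar>along T DF g \<omega>\<bar> \<le> B'" using along_bounded(2)[OF F gL] by blast
  have \<phi>le: "\<bar>\<phi> k z\<bar> \<le> \<bar>z\<bar>" for k z
  proof -
    have "\<bar>c k * sin (z / c k)\<bar> \<le> c k * \<bar>z / c k\<bar>"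
      using abs_sin_x_le_abs_x[of "z / c k"] c[of k] by (simp add: abs_mult pos_le_divide_eq mult.commute)
    then show ?thesis using c[of k] by (simp add: \<phi>_def)
  qed
  have zc: "(\<lambda>k. z / c k) \<longlonglongrightarrow> 0" for z unfolding c_def
    using tendsto_mult[OF tendsto_const[of z] LIMSEQ_inverse_real_of_nat] by (simp add: divide_inverse)
  have \<phi>lim': "(\<lambda>k. \<phi>' k z) \<longlonglongrightarrow> 1" for z
    unfolding \<phi>'_def using tendsto_cos[OF zc[of z]] by simp
  have \<phi>lim: "(\<lambda>k. \<phi> k z) \<longlonglongrightarrow> z" for z
  proof -
    have "\<phi> k z = z * sinc (z / c k)" for k using c[of k] by (simp add: \<phi>_def)
    moreover have "(\<lambda>k. z * sinc (z / c k)) \<longlonglongrightarrow> z * sinc 0"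
      by (intro tendsto_mult tendsto_const isCont_tendsto_compose[OF isCont_sinc zc])
    ultimately show ?thesis by simp
  qed
  have C: "C1_deriv (\<lambda>\<omega>. \<phi> k (Z \<omega>)) (\<lambda>s \<omega>. \<phi>' k (Z \<omega>) * g' s)" for k
  proof (rule C1_bounded_transform[OF Z])
    show "\<bar>\<phi> k z\<bar> \<le> c k" for z using c[of k] by (simp add: \<phi>_def abs_mult mult_left_le)
    show "(\<phi> k has_real_derivative \<phi>' k z) (at z)" for z
      unfolding \<phi>_def[abs_def] \<phi>'_def using c[of k] by (auto intro!: derivative_eq_intros)
    show "\<bar>\<phi>' k z\<bar> \<le> 1" for z by (simp add: \<phi>'_def)
    show "continuous_on UNIV (\<phi>' k)" unfolding \<phi>'_def[abs_def] using c[of k] by (intro continuous_intros) auto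
  qed
  have al: "along T (\<lambda>s \<omega>. \<phi>' k (Z \<omega>) * g' s) g \<omega> = \<phi>' k (Z \<omega>) * (\<integral>s. g' s * g s \<partial>\<mu>)" for k \<omega>
    using along_sum[of "{()}" "\<lambda>_. g'" g "\<lambda>_ \<omega>. \<phi>' k (Z \<omega>)" \<omega>] gL g'L by simp
  have step: "expectation (\<lambda>\<omega>. F \<omega> * \<phi> k (Z \<omega>) * Y \<omega>)
     = expectation (\<lambda>\<omega>. (\<integral>s. g' s * g s \<partial>\<mu>) * (F \<omega> * \<phi>' k (Z \<omega>)) + along T DF g \<omega> * \<phi> k (Z \<omega>))" for k
    unfolding C1_ibp[OF C1_product[OF F C[of k]] Y] along_product[OF F C[of k] gL, abs_def] al
    by (simp add: mult_ac)
  have [measurable]: "\<phi> k \<in> borel_measurable borel" "\<phi>' k \<in> borel_measurable borel" for k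
    unfolding \<phi>_def[abs_def] \<phi>'_def[abs_def] by measurable
  have "(\<lambda>k. expectation (\<lambda>\<omega>. F \<omega> * \<phi> k (Z \<omega>) * Y \<omega>)) \<longlonglongrightarrow> expectation (\<lambda>\<omega>. F \<omega> * Z \<omega> * Y \<omega>)"
  proof (rule integral_dominated_convergence[where w = "\<lambda>\<omega>. B * \<bar>Z \<omega> * Y \<omega>\<bar>"])
    show "integrable M (\<lambda>\<omega>. B * \<bar>Z \<omega> * Y \<omega>\<bar>)" using Lp2_mult_integrable[OF ZL YL] by auto
    show "AE \<omega> in M. (\<lambda>k. F \<omega> * \<phi> k (Z \<omega>) * Y \<omega>) \<longlonglongrightarrow> F \<omega> * Z \<omega> * Y \<omega>"
      by (intro AE_I2 tendsto_intros \<phi>lim)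
    show "AE \<omega> in M. norm (F \<omega> * \<phi> k (Z \<omega>) * Y \<omega>) \<le> B * \<bar>Z \<omega> * Y \<omega>\<bar>" for k
    proof (rule AE_I2)
      fix \<omega>
      have "\<bar>F \<omega>\<bar> * (\<bar>\<phi> k (Z \<omega>)\<bar> * \<bar>Y \<omega>\<bar>) \<le> B * (\<bar>Z \<omega>\<bar> * \<bar>Y \<omega>\<bar>)"
        by (intro mult_mono' mult_right_mono B \<phi>le) auto
      then show "norm (F \<omega> * \<phi> k (Z \<omega>) * Y \<omega>) \<le> B * \<bar>Z \<omega> * Y \<omega>\<bar>" by (simp add: abs_mult mult.assoc)
    qed
  qed measurable
  moreover have "(\<lambda>k. expectation (\<lambda>\<omega>. (\<integral>s. g' s * g s \<partial>\<mu>) * (F \<omega> * \<phi>' k (Z \<omega>)) + along T DF g \<omega> * \<phi> k (Z \<omega>)))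
    \<longlonglongrightarrow> expectation (\<lambda>\<omega>. (\<integral>s. g' s * g s \<partial>\<mu>) * (F \<omega> * 1) + along T DF g \<omega> * Z \<omega>)"
  proof (rule integral_dominated_convergence[where w = "\<lambda>\<omega>. \<bar>\<integral>s. g' s * g s \<partial>\<mu>\<bar> * B + B' * \<bar>Z \<omega>\<bar>"])
    show "integrable M (\<lambda>\<omega>. \<bar>\<integral>s. g' s * g s \<partial>\<mu>\<bar> * B + B' * \<bar>Z \<omega>\<bar>)"
      using Lp2_integrable[OF ZL] by simp
    show "AE \<omega> in M. (\<lambda>k. (\<integral>s. g' s * g s \<partial>\<mu>) * (F \<omega> * \<phi>' k (Z \<omega>)) + along T DF g \<omega> * \<phi> k (Z \<omega>))
       \<longlonglongrightarrow> (\<integral>s. g' s * g s \<partial>\<mu>) * (F \<omega> * 1) + along T DF g \<omega> * Z \<omega>"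
      by (intro AE_I2 tendsto_intros \<phi>lim \<phi>lim')
    show "AE \<omega> in M. norm ((\<integral>s. g' s * g s \<partial>\<mu>) * (F \<omega> * \<phi>' k (Z \<omega>)) + along T DF g \<omega> * \<phi> k (Z \<omega>))
       \<le> \<bar>\<integral>s. g' s * g s \<partial>\<mu>\<bar> * B + B' * \<bar>Z \<omega>\<bar>" for k
    proof (rule AE_I2)
      fix \<omega>
      have "\<bar>F \<omega>\<bar> * \<bar>\<phi>' k (Z \<omega>)\<bar> \<le> B * 1" by (rule mult_mono'[OF B]) (auto simp: \<phi>'_def)
      then have "\<bar>(\<integral>s. g' s * g s \<partial>\<mu>) * (F \<omega> * \<phi>' k (Z \<omega>))\<bar> \<le> \<bar>\<integral>s. g' s * g s \<partial>\<mu>\<bar> * B"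
        unfolding abs_mult by (intro mult_left_mono) auto
      moreover have "\<bar>along T DF g \<omega> * \<phi> k (Z \<omega>)\<bar> \<le> B' * \<bar>Z \<omega>\<bar>"
        unfolding abs_mult by (rule mult_mono'[OF B' \<phi>le]) auto
      ultimately show "norm ((\<integral>s. g' s * g s \<partial>\<mu>) * (F \<omega> * \<phi>' k (Z \<omega>)) + along T DF g \<omega> * \<phi> k (Z \<omega>))
       \<le> \<bar>\<integral>s. g' s * g s \<partial>\<mu>\<bar> * B + B' * \<bar>Z \<omega>\<bar>"
        unfolding real_norm_def by linarith
    qed
  qed measurable
  ultimately have "expectation (\<lambda>\<omega>. F \<omega> * Z \<omega> * Y \<omega>)
    = expectation (\<lambda>\<omega>. (\<integral>s. g' s * g s \<partial>\<mu>) * (F \<omega> * 1) + along T DF g \<omega> * Z \<omega>)"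
    unfolding step by (rule LIMSEQ_unique)
  then show ?thesis
    using Lp2_integrable[OF C1_bounded(3)[OF F]] Lp2_mult_integrable[OF along_bounded(3)[OF F gL] ZL] by simp
qed

text \<open>
  \<open>D2 g\<close> is the derivative of the directional derivative along \<open>g\<close>. The symmetry is Schwarz's
  theorem for the profile; it is what makes the correction term of the Skorohod isometry
  computable.
\<close>

lemma smooth_second_deriv:
  assumes "smooth_deriv T M W F DF"
  shows "\<exists>D2. (\<forall>g\<in>Lp 2 \<mu>. C1_deriv (along T DF g) (D2 g)) \<and>
    (\<forall>g\<in>Lp 2 \<mu>. \<forall>g'\<in>Lp 2 \<mu>. along T (D2 g) g' = along T (D2 g') g)"
proof -
  obtain n f h X where f: "f \<in> Cb_infinity n" and X: "\<And>i. i < n \<Longrightarrow> wiener (h i) (X i)"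
    and DF: "DF = (\<lambda>s \<omega>. \<Sum>i<n. partial_deriv i f (\<lambda>k. X k \<omega>) * h i s)"
    using assms unfolding smooth_deriv_def by blast
  let ?c = "\<lambda>g i. \<integral>s. h i s * g s \<partial>\<mu>"
  have hL: "h i \<in> Lp 2 \<mu>" if "i < n" for i by (rule wiener_Lp2(1)[OF X[OF that]])
  define f2 where "f2 g x = (\<Sum>i\<in>{..<n}. ?c g i * partial_deriv i f x)" for g x
  have pf: "partial_deriv i f \<in> C1b n" if "i \<in> {..<n}" for i
    using Cb_infinity_C1b[OF Cb_infinity_partial[OF f]] that by simp
  have f2: "f2 g \<in> C1b n" "i < n \<Longrightarrow> partial_deriv i (f2 g) = (\<lambda>x. \<Sum>j\<in>{..<n}. ?c g j * partial_deriv i (partial_deriv j f) x)" for g i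
    unfolding f2_def by (rule C1b_linear[OF pf]; assumption)+
  define D2 where "D2 g = (\<lambda>s \<omega>. \<Sum>i<n. partial_deriv i (f2 g) (\<lambda>k. X k \<omega>) * h i s)" for g
  have "C1_deriv (along T DF g) (D2 g)" if g: "g \<in> Lp 2 \<mu>" for g
  proof -
    have "along T DF g = (\<lambda>\<omega>. f2 g (\<lambda>i. X i \<omega>))"
    proof
      fix \<omega>
      have "along T DF g \<omega> = (\<Sum>i<n. partial_deriv i f (\<lambda>k. X k \<omega>) * ?c g i)"
        unfolding DF using hL g by (intro along_sum) auto
      also have "\<dots> = f2 g (\<lambda>i. X i \<omega>)"
        unfolding f2_def by (rule sum.cong[OF refl]) (rule mult.commute)
      finally show "along T DF g \<omega> = f2 g (\<lambda>i. X i \<omega>)" .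
    qed
    then show ?thesis unfolding C1_deriv_def D2_def using f2(1)[of g] X
      by (intro exI[of _ n] exI[of _ "f2 g"] exI[of _ h] exI[of _ X]) simp
  qed
  moreover have "along T (D2 g) g' = along T (D2 g') g"
    if g: "g \<in> Lp 2 \<mu>" "g' \<in> Lp 2 \<mu>" for g g'
  proof
    fix \<omega>
    have e: "along T (D2 g) g' \<omega> = (\<Sum>i<n. \<Sum>j<n. ?c g j * ?c g' i * partial_deriv i (partial_deriv j f) (\<lambda>k. X k \<omega>))"
      if "g \<in> Lp 2 \<mu>" "g' \<in> Lp 2 \<mu>" for g g'
    proof -
      have "along T (D2 g) g' \<omega> = (\<Sum>i<n. partial_deriv i (f2 g) (\<lambda>k. X k \<omega>) * ?c g' i)"
        unfolding D2_def using hL that by (intro along_sum) auto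
      also have "\<dots> = (\<Sum>i<n. \<Sum>j<n. ?c g j * ?c g' i * partial_deriv i (partial_deriv j f) (\<lambda>k. X k \<omega>))"
      proof (rule sum.cong[OF refl])
        fix i assume "i \<in> {..<n}"
        then have "i < n" by simp
        show "partial_deriv i (f2 g) (\<lambda>k. X k \<omega>) * ?c g' i
          = (\<Sum>j<n. ?c g j * ?c g' i * partial_deriv i (partial_deriv j f) (\<lambda>k. X k \<omega>))"
          unfolding f2(2)[OF \<open>i < n\<close>] sum_distrib_right by (rule sum.cong[OF refl]) (simp only: mult_ac)
      qed
      finally show ?thesis .
    qed
    show "along T (D2 g) g' \<omega> = along T (D2 g') g \<omega>"
      unfolding e[OF g] e[OF g(2,1)]
      by (subst sum.swap) (auto intro!: sum.cong simp: Cb_infinity_mixed_partials[OF f] mult_ac)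
  qed
  ultimately show ?thesis by blast
qed

text \<open>
  The covariance form of the Skorohod isometry for elementary processes \<open>F g\<close> and \<open>F' g'\<close>.
  Expanding the product and integrating by parts, first with respect to \<open>Z\<close> and then with respect
  to \<open>Z'\<close>, produces second derivatives of \<open>F'\<close> in the directions \<open>g\<close> and \<open>g'\<close> in either order,
  which cancel by symmetry.
\<close>

lemma skorohod_covariance:
  assumes F: "C1_deriv F DF" and F': "smooth_deriv T M W F' DF'"
    and Z: "wiener g Z" and Z': "wiener g' Z'"
  shows "expectation (\<lambda>\<omega>. (F \<omega> * Z \<omega> - along T DF g \<omega>) * (F' \<omega> * Z' \<omega> - along T DF' g' \<omega>))
    = (\<integral>s. g s * g' s \<partial>\<mu>) * expectation (\<lambda>\<omega>. F \<omega> * F' \<omega>)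
      + expectation (\<lambda>\<omega>. along T DF g' \<omega> * along T DF' g \<omega>)"
proof -
  note gL = wiener_Lp2(1)[OF Z] and g'L = wiener_Lp2(1)[OF Z'] and ZL = wiener_Lp2(2)[OF Z] and Z'L = wiener_Lp2(2)[OF Z']
  note F'1 = smooth_deriv_C1[OF F']
  obtain D2 where D2: "\<And>g. g \<in> Lp 2 \<mu> \<Longrightarrow> C1_deriv (along T DF' g) (D2 g)"
    "along T (D2 g) g' = along T (D2 g') g"
    using smooth_second_deriv[OF F'] gL g'L by blast
  let ?a = "along T DF g" and ?a' = "along T DF' g'" and ?b = "along T DF g'" and ?b' = "along T DF' g"
  have bm: "(\<lambda>\<omega>. G \<omega> * X \<omega>) \<in> Lp 2 M" if "C1_deriv G DG" "X \<in> Lp 2 M" for G DG X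
    using C1_bounded(1,2)[OF that(1)] that(2) by (auto intro: Lp2_bounded_mult)
  have L: "?a \<in> Lp 2 M" "?a' \<in> Lp 2 M" "?b \<in> Lp 2 M" "?b' \<in> Lp 2 M" "F \<in> Lp 2 M" "F' \<in> Lp 2 M"
    using along_bounded(3)[OF F gL] along_bounded(3)[OF F g'L] along_bounded(3)[OF F'1 gL] along_bounded(3)[OF F'1 g'L]
      C1_bounded(3)[OF F] C1_bounded(3)[OF F'1] by auto
  have I: "integrable M (\<lambda>\<omega>. (F \<omega> * Z \<omega>) * (F' \<omega> * Z' \<omega>))" "integrable M (\<lambda>\<omega>. (F \<omega> * Z \<omega>) * ?a' \<omega>)"
    "integrable M (\<lambda>\<omega>. ?a \<omega> * (F' \<omega> * Z' \<omega>))" "integrable M (\<lambda>\<omega>. ?a \<omega> * ?a' \<omega>)"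
    "integrable M (\<lambda>\<omega>. F' \<omega> * (?a \<omega> * Z' \<omega>))" "integrable M (\<lambda>\<omega>. F \<omega> * (?b' \<omega> * Z' \<omega>))"
    "integrable M (\<lambda>\<omega>. F \<omega> * along T (D2 g') g \<omega>)" "integrable M (\<lambda>\<omega>. ?b \<omega> * ?b' \<omega>)"
    using Lp2_mult_integrable[OF bm[OF F ZL] bm[OF F'1 Z'L]] Lp2_mult_integrable[OF bm[OF F ZL] L(2)]
      Lp2_mult_integrable[OF L(1) bm[OF F'1 Z'L]] Lp2_mult_integrable[OF L(1,2)]
      Lp2_mult_integrable[OF L(1) bm[OF F'1 Z'L]] Lp2_mult_integrable[OF L(4) bm[OF F Z'L]]
      Lp2_mult_integrable[OF L(5) along_bounded(3)[OF D2(1)[OF g'L] gL]] Lp2_mult_integrable[OF L(3,4)]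
    by (simp_all add: mult_ac)
  have 1: "expectation (\<lambda>\<omega>. (F \<omega> * Z \<omega>) * (F' \<omega> * Z' \<omega>)) = expectation (\<lambda>\<omega>. F \<omega> * (?b' \<omega> * Z' \<omega>))
     + expectation (\<lambda>\<omega>. F' \<omega> * (?a \<omega> * Z' \<omega>)) + (\<integral>s. g s * g' s \<partial>\<mu>) * expectation (\<lambda>\<omega>. F \<omega> * F' \<omega>)"
  proof -
    have "expectation (\<lambda>\<omega>. (F \<omega> * Z \<omega>) * (F' \<omega> * Z' \<omega>)) = expectation (\<lambda>\<omega>. (F \<omega> * F' \<omega>) * Z' \<omega> * Z \<omega>)"
      by (simp add: mult_ac)
    also have "\<dots> = expectation (\<lambda>\<omega>. F \<omega> * (?b' \<omega> * Z' \<omega>) + F' \<omega> * (?a \<omega> * Z' \<omega>))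
        + (\<integral>s. g' s * g s \<partial>\<mu>) * expectation (\<lambda>\<omega>. F \<omega> * F' \<omega>)"
      unfolding C1_ibp_product[OF C1_product[OF F F'1] Z Z'] along_product[OF F F'1 gL]
      by (simp add: algebra_simps)
    finally show ?thesis using I(5,6) by (simp add: mult.commute)
  qed
  have 2: "expectation (\<lambda>\<omega>. (F \<omega> * Z \<omega>) * ?a' \<omega>) = expectation (\<lambda>\<omega>. F \<omega> * along T (D2 g') g \<omega>) + expectation (\<lambda>\<omega>. ?a \<omega> * ?a' \<omega>)"
  proof -
    have "expectation (\<lambda>\<omega>. (F \<omega> * Z \<omega>) * ?a' \<omega>) = expectation (\<lambda>\<omega>. (F \<omega> * ?a' \<omega>) * Z \<omega>)" by (simp add: mult_ac)
    also have "\<dots> = expectation (\<lambda>\<omega>. F \<omega> * along T (D2 g') g \<omega> + ?a' \<omega> * ?a \<omega>)"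
      unfolding C1_ibp[OF C1_product[OF F D2(1)[OF g'L]] Z] by (simp add: along_product[OF F D2(1)[OF g'L] gL, abs_def])
    finally show ?thesis using I(4,7) by (simp add: mult.commute)
  qed
  have 3: "expectation (\<lambda>\<omega>. F \<omega> * (?b' \<omega> * Z' \<omega>)) = expectation (\<lambda>\<omega>. F \<omega> * along T (D2 g') g \<omega>) + expectation (\<lambda>\<omega>. ?b \<omega> * ?b' \<omega>)"
  proof -
    have "expectation (\<lambda>\<omega>. F \<omega> * (?b' \<omega> * Z' \<omega>)) = expectation (\<lambda>\<omega>. (F \<omega> * ?b' \<omega>) * Z' \<omega>)" by (simp add: mult_ac)
    also have "\<dots> = expectation (\<lambda>\<omega>. F \<omega> * along T (D2 g') g \<omega> + ?b' \<omega> * ?b \<omega>)"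
      unfolding C1_ibp[OF C1_product[OF F D2(1)[OF gL]] Z'] D2(2)[symmetric]
      by (simp add: along_product[OF F D2(1)[OF gL] g'L, abs_def])
    finally show ?thesis using I(7,8) by (simp add: mult.commute)
  qed
  have "expectation (\<lambda>\<omega>. (F \<omega> * Z \<omega> - ?a \<omega>) * (F' \<omega> * Z' \<omega> - ?a' \<omega>))
    = expectation (\<lambda>\<omega>. (F \<omega> * Z \<omega>) * (F' \<omega> * Z' \<omega>) - (F \<omega> * Z \<omega>) * ?a' \<omega> - ?a \<omega> * (F' \<omega> * Z' \<omega>) + ?a \<omega> * ?a' \<omega>)"
    by (simp add: algebra_simps)
  also have "\<dots> = expectation (\<lambda>\<omega>. (F \<omega> * Z \<omega>) * (F' \<omega> * Z' \<omega>)) - expectation (\<lambda>\<omega>. (F \<omega> * Z \<omega>) * ?a' \<omega>)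
     - expectation (\<lambda>\<omega>. ?a \<omega> * (F' \<omega> * Z' \<omega>)) + expectation (\<lambda>\<omega>. ?a \<omega> * ?a' \<omega>)"
    using I(1-4) by simp
  also have "expectation (\<lambda>\<omega>. ?a \<omega> * (F' \<omega> * Z' \<omega>)) = expectation (\<lambda>\<omega>. F' \<omega> * (?a \<omega> * Z' \<omega>))"
    by (simp add: mult_ac)
  finally show ?thesis using 1 2 3 by simp
qed

end

section \<open>The Skorohod integral and its norm bound\<close>

lemma norm2_inner: "(norm2 N f)\<^sup>2 = (\<integral>x. f x * f x \<partial>N)"
  unfolding norm2_square by (simp add: power2_eq_square)

lemma integral_double_sum:
  fixes f :: "'p \<Rightarrow> 'q \<Rightarrow> 'b \<Rightarrow> real"
  assumes "\<And>p q. p \<in> P \<Longrightarrow> q \<in> R \<Longrightarrow> integrable N (f p q)"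
  shows "(\<integral>x. (\<Sum>p\<in>P. \<Sum>q\<in>R. f p q x) \<partial>N) = (\<Sum>p\<in>P. \<Sum>q\<in>R. \<integral>x. f p q x \<partial>N)"
proof -
  have "(\<integral>x. (\<Sum>p\<in>P. \<Sum>q\<in>R. f p q x) \<partial>N) = (\<Sum>p\<in>P. \<integral>x. (\<Sum>q\<in>R. f p q x) \<partial>N)"
    using assms by (intro Bochner_Integration.integral_sum Bochner_Integration.integrable_sum) auto
  also have "\<dots> = (\<Sum>p\<in>P. \<Sum>q\<in>R. \<integral>x. f p q x \<partial>N)"
    using assms by (intro sum.cong refl Bochner_Integration.integral_sum) auto
  finally show ?thesis .
qed

lemma (in pair_sigma_finite) tensor_integral:
  fixes f :: "'a \<Rightarrow> real" and g :: "'b \<Rightarrow> real"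
  assumes f: "integrable M1 f" and g: "integrable M2 g"
  shows "integrable (M1 \<Otimes>\<^sub>M M2) (\<lambda>(x, y). f x * g y)"
    "(\<integral>(x, y). f x * g y \<partial>(M1 \<Otimes>\<^sub>M M2)) = (\<integral>x. f x \<partial>M1) * (\<integral>y. g y \<partial>M2)"
proof -
  have [measurable]: "f \<in> borel_measurable M1" "g \<in> borel_measurable M2" using f g by auto
  show i: "integrable (M1 \<Otimes>\<^sub>M M2) (\<lambda>(x, y). f x * g y)"
  proof (rule Fubini_integrable)
    show "integrable M1 (\<lambda>x. \<integral>y. norm (case (x, y) of (x, y) \<Rightarrow> f x * g y) \<partial>M2)"
      using f by (simp add: abs_mult)
  qed (use g in auto)
  show "(\<integral>(x, y). f x * g y \<partial>(M1 \<Otimes>\<^sub>M M2)) = (\<integral>x. f x \<partial>M1) * (\<integral>y. g y \<partial>M2)"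
    using integral_fst'[OF i] by simp
qed

lemma (in pair_sigma_finite) tensor_Lp2:
  assumes f: "f \<in> Lp 2 M1" and g: "g \<in> Lp 2 M2"
  shows "(\<lambda>(x, y). f x * g y) \<in> Lp 2 (M1 \<Otimes>\<^sub>M M2)"
proof -
  have [measurable]: "f \<in> borel_measurable M1" "g \<in> borel_measurable M2" using f g by (auto intro: Lp2_measurable)
  have "integrable (M1 \<Otimes>\<^sub>M M2) (\<lambda>(x, y). (f x)\<^sup>2 * (g y)\<^sup>2)"
    using f g by (intro tensor_integral Lp2_square)
  moreover have "(\<lambda>(x, y). (f x)\<^sup>2 * (g y)\<^sup>2) = (\<lambda>x. (case x of (x, y) \<Rightarrow> f x * g y)\<^sup>2)"
    by (auto simp: fun_eq_iff power_mult_distrib)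
  ultimately show ?thesis unfolding Lp2_iff by simp
qed

context brownian
begin

sublocale tm: finite_measure \<mu> by (rule finite_measure_time)

sublocale Q: pair_sigma_finite \<mu> M ..

lemma process_measure_eq: "Q = \<mu> \<Otimes>\<^sub>M M"
  by (simp add: process_measure_def)

sublocale Qs: sigma_finite_measure Q
  unfolding process_measure_eq by (rule Q.P.sigma_finite_measure_axioms)

sublocale QQ: pair_sigma_finite \<mu> Q ..

text \<open>
  Finite sums of elementary tensors: integrals of products reduce to sums over pairs of products
  of one-dimensional integrals.
\<close>

definition tensors2 :: "'p set \<Rightarrow> ('p \<Rightarrow> real \<Rightarrow> real) \<Rightarrow> ('p \<Rightarrow> 'a \<Rightarrow> real) \<Rightarrow> real \<times> 'a \<Rightarrow> real" where
  "tensors2 P g a = (\<lambda>(t, \<omega>). \<Sum>p\<in>P. g p t * a p \<omega>)"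

definition tensors3 :: "'p set \<Rightarrow> ('p \<Rightarrow> real \<Rightarrow> real) \<Rightarrow> ('p \<Rightarrow> real \<Rightarrow> real) \<Rightarrow> ('p \<Rightarrow> 'a \<Rightarrow> real) \<Rightarrow> real \<times> real \<times> 'a \<Rightarrow> real" where
  "tensors3 P h g a = (\<lambda>(s, t, \<omega>). \<Sum>p\<in>P. h p s * (g p t * a p \<omega>))"

lemma tensors2_Lp2:
  assumes "\<And>p. p \<in> P \<Longrightarrow> g p \<in> Lp 2 \<mu>" "\<And>p. p \<in> P \<Longrightarrow> a p \<in> Lp 2 M"
  shows "tensors2 P g a \<in> Lp 2 Q"
proof -
  have "(\<lambda>x. \<Sum>p\<in>P. (\<lambda>(t, \<omega>). g p t * a p \<omega>) x) \<in> Lp 2 Q"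
    unfolding process_measure_eq using assms by (intro Lp2_sum Q.tensor_Lp2)
  then show ?thesis unfolding tensors2_def by (simp add: case_prod_beta')
qed

lemma tensors2_inner:
  assumes "\<And>p. p \<in> P \<Longrightarrow> g p \<in> Lp 2 \<mu>" "\<And>p. p \<in> P \<Longrightarrow> a p \<in> Lp 2 M"
    "\<And>p. p \<in> P' \<Longrightarrow> g' p \<in> Lp 2 \<mu>" "\<And>p. p \<in> P' \<Longrightarrow> a' p \<in> Lp 2 M"
  shows "(\<integral>x. tensors2 P g a x * tensors2 P' g' a' x \<partial>Q)
    = (\<Sum>p\<in>P. \<Sum>q\<in>P'. (\<integral>t. g p t * g' q t \<partial>\<mu>) * expectation (\<lambda>\<omega>. a p \<omega> * a' q \<omega>))"
proof -
  have i: "integrable Q (\<lambda>(t, \<omega>). (g p t * g' q t) * (a p \<omega> * a' q \<omega>))"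
    "(\<integral>(t, \<omega>). (g p t * g' q t) * (a p \<omega> * a' q \<omega>) \<partial>Q)
      = (\<integral>t. g p t * g' q t \<partial>\<mu>) * expectation (\<lambda>\<omega>. a p \<omega> * a' q \<omega>)" if "p \<in> P" "q \<in> P'" for p q
    unfolding process_measure_eq using assms that by (intro Q.tensor_integral Lp2_mult_integrable; blast)+
  have "(\<integral>x. tensors2 P g a x * tensors2 P' g' a' x \<partial>Q)
     = (\<integral>x. (\<Sum>p\<in>P. \<Sum>q\<in>P'. (\<lambda>(t, \<omega>). (g p t * g' q t) * (a p \<omega> * a' q \<omega>)) x) \<partial>Q)"
    unfolding tensors2_def by (intro Bochner_Integration.integral_cong) (auto simp: sum_product mult_ac)
  also have "\<dots> = (\<Sum>p\<in>P. \<Sum>q\<in>P'. (\<integral>x. (\<lambda>(t, \<omega>). (g p t * g' q t) * (a p \<omega> * a' q \<omega>)) x \<partial>Q))"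
    by (rule integral_double_sum[OF i(1)])
  also have "\<dots> = (\<Sum>p\<in>P. \<Sum>q\<in>P'. (\<integral>t. g p t * g' q t \<partial>\<mu>) * expectation (\<lambda>\<omega>. a p \<omega> * a' q \<omega>))"
    using i(2) by (intro sum.cong) auto
  finally show ?thesis .
qed

lemma tensors3_Lp2:
  assumes "\<And>p. p \<in> P \<Longrightarrow> h p \<in> Lp 2 \<mu>" "\<And>p. p \<in> P \<Longrightarrow> g p \<in> Lp 2 \<mu>" "\<And>p. p \<in> P \<Longrightarrow> a p \<in> Lp 2 M"
  shows "tensors3 P h g a \<in> Lp 2 (\<mu> \<Otimes>\<^sub>M Q)"
proof -
  have "(\<lambda>(t, \<omega>). g p t * a p \<omega>) \<in> Lp 2 Q" if "p \<in> P" for p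
    unfolding process_measure_eq using assms that by (intro Q.tensor_Lp2)
  then have "(\<lambda>x. \<Sum>p\<in>P. (\<lambda>(s, y). h p s * (\<lambda>(t, \<omega>). g p t * a p \<omega>) y) x) \<in> Lp 2 (\<mu> \<Otimes>\<^sub>M Q)"
    using assms(1) by (intro Lp2_sum QQ.tensor_Lp2)
  then show ?thesis unfolding tensors3_def by (simp add: case_prod_beta')
qed

lemma tensors3_inner:
  assumes "\<And>p. p \<in> P \<Longrightarrow> h p \<in> Lp 2 \<mu>" "\<And>p. p \<in> P \<Longrightarrow> g p \<in> Lp 2 \<mu>" "\<And>p. p \<in> P \<Longrightarrow> a p \<in> Lp 2 M"
    "\<And>p. p \<in> P' \<Longrightarrow> h' p \<in> Lp 2 \<mu>" "\<And>p. p \<in> P' \<Longrightarrow> g' p \<in> Lp 2 \<mu>" "\<And>p. p \<in> P' \<Longrightarrow> a' p \<in> Lp 2 M"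
  shows "(\<integral>x. tensors3 P h g a x * tensors3 P' h' g' a' x \<partial>(\<mu> \<Otimes>\<^sub>M Q))
    = (\<Sum>p\<in>P. \<Sum>q\<in>P'. (\<integral>t. h p t * h' q t \<partial>\<mu>) *
        ((\<integral>t. g p t * g' q t \<partial>\<mu>) * expectation (\<lambda>\<omega>. a p \<omega> * a' q \<omega>)))"
proof -
  let ?N = "\<mu> \<Otimes>\<^sub>M Q"
  have i2: "integrable Q (\<lambda>(t, \<omega>). (g p t * g' q t) * (a p \<omega> * a' q \<omega>))"
    "(\<integral>(t, \<omega>). (g p t * g' q t) * (a p \<omega> * a' q \<omega>) \<partial>Q)
      = (\<integral>t. g p t * g' q t \<partial>\<mu>) * expectation (\<lambda>\<omega>. a p \<omega> * a' q \<omega>)" if "p \<in> P" "q \<in> P'" for p q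
    unfolding process_measure_eq using assms that by (intro Q.tensor_integral Lp2_mult_integrable; blast)+
  have i: "integrable ?N (\<lambda>(s, y). (h p s * h' q s) * (\<lambda>(t, \<omega>). (g p t * g' q t) * (a p \<omega> * a' q \<omega>)) y)"
    "(\<integral>(s, y). (h p s * h' q s) * (\<lambda>(t, \<omega>). (g p t * g' q t) * (a p \<omega> * a' q \<omega>)) y \<partial>?N)
      = (\<integral>t. h p t * h' q t \<partial>\<mu>) *
        ((\<integral>t. g p t * g' q t \<partial>\<mu>) * expectation (\<lambda>\<omega>. a p \<omega> * a' q \<omega>))" if "p \<in> P" "q \<in> P'" for p q
    unfolding i2(2)[OF that, symmetric] using assms that i2(1)[OF that] by (intro QQ.tensor_integral Lp2_mult_integrable; blast)+
  have "(\<integral>x. tensors3 P h g a x * tensors3 P' h' g' a' x \<partial>?N)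
     = (\<integral>x. (\<Sum>p\<in>P. \<Sum>q\<in>P'. (\<lambda>(s, y). (h p s * h' q s) * (\<lambda>(t, \<omega>). (g p t * g' q t) * (a p \<omega> * a' q \<omega>)) y) x) \<partial>?N)"
    unfolding tensors3_def by (intro Bochner_Integration.integral_cong) (auto simp: sum_product mult_ac)
  also have "\<dots> = (\<Sum>p\<in>P. \<Sum>q\<in>P'. (\<integral>x. (\<lambda>(s, y). (h p s * h' q s) * (\<lambda>(t, \<omega>). (g p t * g' q t) * (a p \<omega> * a' q \<omega>)) y) x \<partial>?N))"
    by (rule integral_double_sum[OF i(1)])
  also have "\<dots> = (\<Sum>p\<in>P. \<Sum>q\<in>P'. (\<integral>t. h p t * h' q t \<partial>\<mu>) *
        ((\<integral>t. g p t * g' q t \<partial>\<mu>) * expectation (\<lambda>\<omega>. a p \<omega> * a' q \<omega>)))"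
    using i(2) by (intro sum.cong) auto
  finally show ?thesis .
qed

text \<open>
  The Skorohod integral of a smooth process through the explicit formula
  \<open>\<delta>(F g) = F W(g) - \<langle>DF, g\<rangle>\<close>; the relation carries the derivative along.
\<close>

definition smooth_skorohod :: "(real \<Rightarrow> 'a \<Rightarrow> real) \<Rightarrow> (real \<Rightarrow> real \<Rightarrow> 'a \<Rightarrow> real) \<Rightarrow> ('a \<Rightarrow> real) \<Rightarrow> bool" where
  "smooth_skorohod v Dv X \<longleftrightarrow> (\<exists>(m::nat) F DF g Z.
     (\<forall>j<m. smooth_deriv T M W (F j) (DF j) \<and> wiener (g j) (Z j)) \<and>
     v = (\<lambda>t \<omega>. \<Sum>j<m. F j \<omega> * g j t) \<and> Dv = (\<lambda>s t \<omega>. \<Sum>j<m. DF j s \<omega> * g j t) \<and>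
     X = (\<lambda>\<omega>. \<Sum>j<m. F j \<omega> * Z j \<omega> - along T (DF j) (g j) \<omega>))"

lemma smooth_skorohodI:
  fixes m :: nat
  assumes "\<And>j. j < m \<Longrightarrow> smooth_deriv T M W (F j) (DF j)" "\<And>j. j < m \<Longrightarrow> wiener (g j) (Z j)"
    "v = (\<lambda>t \<omega>. \<Sum>j<m. F j \<omega> * g j t)" "Dv = (\<lambda>s t \<omega>. \<Sum>j<m. DF j s \<omega> * g j t)"
    "X = (\<lambda>\<omega>. \<Sum>j<m. F j \<omega> * Z j \<omega> - along T (DF j) (g j) \<omega>)"
  shows "smooth_skorohod v Dv X"
  unfolding smooth_skorohod_def
  by (rule exI[of _ m], rule exI[of _ F], rule exI[of _ DF], rule exI[of _ g], rule exI[of _ Z]) (simp add: assms)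

lemma smooth_skorohod_exists:
  assumes "smooth_process_deriv T M W v Dv"
  shows "\<exists>X. smooth_skorohod v Dv X"
proof -
  obtain m :: nat and F DF g where a: "\<forall>j<m. smooth_deriv T M W (F j) (DF j) \<and> g j \<in> Lp 2 \<mu>"
    "v = (\<lambda>t \<omega>. \<Sum>j<m. F j \<omega> * g j t)" "Dv = (\<lambda>s t \<omega>. \<Sum>j<m. DF j s \<omega> * g j t)"
    using assms unfolding smooth_process_deriv_def by blast
  have "\<forall>j. \<exists>Z. j < m \<longrightarrow> wiener (g j) Z" 
  proof
    fix j show "\<exists>Z. j < m \<longrightarrow> wiener (g j) Z"
      using a(1) wiener_exists[of "g j"] by (cases "j < m") auto
  qed
  from choice[OF this] obtain Z where "\<forall>j. j < m \<longrightarrow> wiener (g j) (Z j)" ..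
  then have Z: "wiener (g j) (Z j)" if "j < m" for j using that by blast
  then have "smooth_skorohod v Dv (\<lambda>\<omega>. \<Sum>j<m. F j \<omega> * Z j \<omega> - along T (DF j) (g j) \<omega>)"
    using a(1) Z by (intro smooth_skorohodI[of m F DF g Z, OF _ _ a(2,3) refl]) simp_all
  then show ?thesis by blast
qed

lemma smooth_skorohod_diff:
  assumes "smooth_skorohod v Dv X" "smooth_skorohod w Dw Y"
  shows "smooth_skorohod (\<lambda>t \<omega>. v t \<omega> - w t \<omega>) (\<lambda>s t \<omega>. Dv s t \<omega> - Dw s t \<omega>) (\<lambda>\<omega>. X \<omega> - Y \<omega>)"
proof -
  obtain m :: nat and F DF g Z where a: "\<And>j. j < m \<Longrightarrow> smooth_deriv T M W (F j) (DF j)" "\<And>j. j < m \<Longrightarrow> wiener (g j) (Z j)"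
     "v = (\<lambda>t \<omega>. \<Sum>j<m. F j \<omega> * g j t)" "Dv = (\<lambda>s t \<omega>. \<Sum>j<m. DF j s \<omega> * g j t)"
     "X = (\<lambda>\<omega>. \<Sum>j<m. F j \<omega> * Z j \<omega> - along T (DF j) (g j) \<omega>)"
    using assms(1) unfolding smooth_skorohod_def by blast
  obtain n :: nat and G DG h U where b: "\<And>j. j < n \<Longrightarrow> smooth_deriv T M W (G j) (DG j)" "\<And>j. j < n \<Longrightarrow> wiener (h j) (U j)"
     "w = (\<lambda>t \<omega>. \<Sum>j<n. G j \<omega> * h j t)" "Dw = (\<lambda>s t \<omega>. \<Sum>j<n. DG j s \<omega> * h j t)"
     "Y = (\<lambda>\<omega>. \<Sum>j<n. G j \<omega> * U j \<omega> - along T (DG j) (h j) \<omega>)"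
    using assms(2) unfolding smooth_skorohod_def by blast
  have split: "(\<Sum>i<m + n. q i) = (\<Sum>i<m. q i) + (\<Sum>i<n. q (m + i))" for q :: "nat \<Rightarrow> real"
    by (induction n) (simp_all add: add.assoc)
  have neg: "wiener (\<lambda>t. - h j t) (\<lambda>\<omega>. - U j \<omega>)" if j: "j < n" for j
  proof -
    obtain xs where xs: "\<forall>n. valid_steps T (xs n)" "conv2 \<mu> (\<lambda>n. step_function (xs n)) (h j) sequentially"
      "conv2 M (\<lambda>n. step_integral W (xs n)) (U j) sequentially"
      using b(2)[OF j] unfolding wiener_integral_iff by blast
    then show ?thesis unfolding wiener_integral_iff
      using conv2_cmult[OF xs(2), of "-1"] conv2_cmult[OF xs(3), of "-1"]
      by (intro exI[of _ "\<lambda>n. scale_steps (-1) (xs n)"]) (simp add: fun_eq_iff flip: step_function_simps(4) step_integral_simps(4))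
  qed
  have al: "along T DF (\<lambda>t. - h t) \<omega> = - along T DF h \<omega>" for DF h \<omega> by (simp add: along_def)
  show ?thesis
    by (rule smooth_skorohodI[where m = "m + n" and F = "\<lambda>j. if j < m then F j else G (j - m)"
        and DF = "\<lambda>j. if j < m then DF j else DG (j - m)" and g = "\<lambda>j. if j < m then g j else (\<lambda>t. - h (j - m) t)"
        and Z = "\<lambda>j. if j < m then Z j else (\<lambda>\<omega>. - U (j - m) \<omega>)"])
      (auto simp: split a(3-5) b(3-5) al sum_negf sum_subtractf intro!: a(1,2) b(1) neg)
qed

text \<open>
  The form in which derivatives enter the computations with elementary tensors.
\<close>

lemma smooth_deriv_tensors:
  assumes "smooth_deriv T M W F DF"
  shows "\<exists>n h a. (\<forall>k<n. h k \<in> Lp 2 \<mu> \<and> a k \<in> Lp 2 M) \<and> DF = (\<lambda>s \<omega>. \<Sum>k<(n::nat). a k \<omega> * h k s)"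
proof -
  obtain n f h X where f: "f \<in> Cb_infinity n" and X: "\<And>i. i < n \<Longrightarrow> wiener (h i) (X i)"
    and DF: "DF = (\<lambda>s \<omega>. \<Sum>i<n. partial_deriv i f (\<lambda>k. X k \<omega>) * h i s)"
    using assms unfolding smooth_deriv_def by blast
  show ?thesis
    by (intro exI[of _ n] exI[of _ h] exI[of _ "\<lambda>i \<omega>. partial_deriv i f (\<lambda>k. X k \<omega>)"])
      (auto simp: DF intro!: C1b_Lp2(2)[OF Cb_infinity_C1b[OF f]] Lp2_measurable wiener_Lp2(1)[OF X] wiener_Lp2(2)[OF X])
qed

lemma smooth_deriv_process_Lp2:
  assumes "smooth_deriv T M W F DF"
  shows "case_prod DF \<in> Lp 2 Q"
proof -
  obtain n h a where *: "\<And>k. k < (n::nat) \<Longrightarrow> h k \<in> Lp 2 \<mu>" "\<And>k. k < n \<Longrightarrow> a k \<in> Lp 2 M"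
    "DF = (\<lambda>s \<omega>. \<Sum>k<n. a k \<omega> * h k s)"
    using smooth_deriv_tensors[OF assms] by blast
  have "tensors2 {..<n} h a \<in> Lp 2 Q" using * by (intro tensors2_Lp2) auto
  also have "tensors2 {..<n} h a = case_prod DF" by (auto simp: tensors2_def *(3) fun_eq_iff mult.commute)
  finally show ?thesis .
qed

text \<open>
  By the covariance formula, \<open>E(X\<^sup>2)\<close> is \<open>\<parallel>v\<parallel>\<^sup>2\<close> plus the integral of \<open>D\<^sub>s v\<^sub>t D\<^sub>t v\<^sub>s\<close>, that is, of the
  derivative against its transpose in \<open>(s, t)\<close>. The transpose has the same norm, so
  Cauchy--Schwarz bounds the second term by \<open>\<parallel>Dv\<parallel>\<^sup>2\<close>.
\<close>

theorem smooth_skorohod_bound: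
  assumes "smooth_skorohod v Dv X"
  shows "X \<in> Lp 2 M" "case_prod v \<in> Lp 2 Q"
    "(\<lambda>(s, t, \<omega>). Dv s t \<omega>) \<in> Lp 2 (\<mu> \<Otimes>\<^sub>M Q)"
    "(norm2 M X)\<^sup>2 \<le> (norm2 Q (case_prod v))\<^sup>2
      + (norm2 (\<mu> \<Otimes>\<^sub>M Q) (\<lambda>(s, t, \<omega>). Dv s t \<omega>))\<^sup>2"
proof -
  obtain m :: nat and F DF g Z where S: "\<And>j. j < m \<Longrightarrow> smooth_deriv T M W (F j) (DF j)" "\<And>j. j < m \<Longrightarrow> wiener (g j) (Z j)"
     and v: "v = (\<lambda>t \<omega>. \<Sum>j<m. F j \<omega> * g j t)" and Dv: "Dv = (\<lambda>s t \<omega>. \<Sum>j<m. DF j s \<omega> * g j t)"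
     and X: "X = (\<lambda>\<omega>. \<Sum>j<m. F j \<omega> * Z j \<omega> - along T (DF j) (g j) \<omega>)"
    using assms unfolding smooth_skorohod_def by blast
  note C = smooth_deriv_C1[OF S(1)]
  have gL: "g j \<in> Lp 2 \<mu>" if "j < m" for j by (rule wiener_Lp2(1)[OF S(2)[OF that]])
  have FL: "F j \<in> Lp 2 M" if "j < m" for j by (rule C1_bounded(3)[OF C[OF that]])
  have "\<exists>q. \<forall>j. j < m \<longrightarrow> (\<forall>k<fst (q j). fst (snd (q j)) k \<in> Lp 2 \<mu> \<and> snd (snd (q j)) k \<in> Lp 2 M)
      \<and> DF j = (\<lambda>s \<omega>. \<Sum>k<(fst (q j) :: nat). snd (snd (q j)) k \<omega> * fst (snd (q j)) k s)"
  proof (rule choice, rule allI)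
    fix j
    show "\<exists>q. j < m \<longrightarrow> (\<forall>k<fst q. fst (snd q) k \<in> Lp 2 \<mu> \<and> snd (snd q) k \<in> Lp 2 M)
      \<and> DF j = (\<lambda>s \<omega>. \<Sum>k<(fst q :: nat). snd (snd q) k \<omega> * fst (snd q) k s)"
    proof (cases "j < m")
      case True
      obtain n h a where "(\<forall>k<n. h k \<in> Lp 2 \<mu> \<and> a k \<in> Lp 2 M) \<and> DF j = (\<lambda>s \<omega>. \<Sum>k<(n::nat). a k \<omega> * h k s)"
        using smooth_deriv_tensors[OF S(1)[OF True]] by blast
      then show ?thesis by (intro exI[of _ "(n, h, a)"]) simp
    qed simp
  qed
  then obtain q where q: "\<forall>j. j < m \<longrightarrow> (\<forall>k<fst (q j). fst (snd (q j)) k \<in> Lp 2 \<mu> \<and> snd (snd (q j)) k \<in> Lp 2 M)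
      \<and> DF j = (\<lambda>s \<omega>. \<Sum>k<(fst (q j) :: nat). snd (snd (q j)) k \<omega> * fst (snd (q j)) k s)" ..
  define n h a where "n j = fst (q j)" and "h j = fst (snd (q j))" and "a j = snd (snd (q j))" for j
  have *: "(\<forall>k<n j. h j k \<in> Lp 2 \<mu> \<and> a j k \<in> Lp 2 M) \<and> DF j = (\<lambda>s \<omega>. \<Sum>k<n j. a j k \<omega> * h j k s)"
    if "j < m" for j
    using q that unfolding n_def h_def a_def by simp
  have hL: "h j k \<in> Lp 2 \<mu>" and aL: "a j k \<in> Lp 2 M" if "j < m" "k < n j" for j k
    using *[OF that(1)] that(2) by simp_all
  have DF: "DF j = (\<lambda>s \<omega>. \<Sum>k<n j. a j k \<omega> * h j k s)" if "j < m" for j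
    using *[OF that] by simp
  define P where "P = Sigma {..<m} (\<lambda>j. {..<n j})"
  define h' where "h' p = h (fst p) (snd p)" for p
  define g' where "g' p = g (fst p)" for p :: "nat \<times> nat"
  define a' where "a' p = a (fst p) (snd p)" for p
  have PL: "h' p \<in> Lp 2 \<mu>" "g' p \<in> Lp 2 \<mu>" "a' p \<in> Lp 2 M" if "p \<in> P" for p
    using that hL gL aL by (auto simp: P_def h'_def g'_def a'_def)
  have vt: "case_prod v = tensors2 {..<m} g F" by (auto simp: tensors2_def v fun_eq_iff mult.commute)
  have Dvt: "(\<lambda>(s, t, \<omega>). Dv s t \<omega>) = tensors3 P h' g' a'"
  proof -
    have "(\<Sum>j<m. DF j s \<omega> * g j t) = (\<Sum>p\<in>P. h' p s * (g' p t * a' p \<omega>))" for s t \<omega>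
    proof -
      have "(\<Sum>j<m. DF j s \<omega> * g j t) = (\<Sum>j<m. \<Sum>k<n j. h j k s * (g j t * a j k \<omega>))"
        by (intro sum.cong) (auto simp: DF sum_distrib_left mult_ac)
      also have "\<dots> = (\<Sum>p\<in>P. h' p s * (g' p t * a' p \<omega>))"
        unfolding P_def h'_def g'_def a'_def by (subst sum.Sigma) (auto simp: case_prod_beta)
      finally show ?thesis .
    qed
    then show ?thesis by (auto simp: tensors3_def Dv fun_eq_iff)
  qed
  show vL: "case_prod v \<in> Lp 2 Q" unfolding vt using gL FL by (intro tensors2_Lp2) auto
  show DvL: "(\<lambda>(s, t, \<omega>). Dv s t \<omega>) \<in> Lp 2 (\<mu> \<Otimes>\<^sub>M Q)"
    unfolding Dvt by (intro tensors3_Lp2 PL)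
  define d where "d j \<omega> = F j \<omega> * Z j \<omega> - along T (DF j) (g j) \<omega>" for j \<omega>
  have dL: "d j \<in> Lp 2 M" if "j < m" for j
    unfolding d_def[abs_def]
    using C1_bounded(1,2)[OF C[OF that]] wiener_Lp2(2)[OF S(2)[OF that]] along_bounded(3)[OF C[OF that] gL[OF that]]
    by (auto intro!: Lp2_diff Lp2_bounded_mult)
  have Xd: "X = (\<lambda>\<omega>. \<Sum>j<m. d j \<omega>)" by (simp add: X d_def)
  show XL: "X \<in> Lp 2 M" unfolding Xd using dL by (intro Lp2_sum) auto
  have al: "along T (DF i) (g j) = (\<lambda>\<omega>. \<Sum>k<n i. a i k \<omega> * (\<integral>s. h i k s * g j s \<partial>\<mu>))" if "i < m" "j < m" for i j
    unfolding DF[OF that(1)] using hL that gL by (intro ext along_sum) auto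
  have cross: "expectation (\<lambda>\<omega>. along T (DF i) (g j) \<omega> * along T (DF j) (g i) \<omega>)
     = (\<Sum>k<n i. \<Sum>l<n j. (\<integral>s. h i k s * g j s \<partial>\<mu>) * ((\<integral>s. g i s * h j l s \<partial>\<mu>) * expectation (\<lambda>\<omega>. a i k \<omega> * a j l \<omega>)))"
    if ij: "i < m" "j < m" for i j
  proof -
    have int: "integrable M (\<lambda>\<omega>. a i k \<omega> * a j l \<omega>)" if "k < n i" "l < n j" for k l
      using aL ij that by (intro Lp2_mult_integrable) auto
    have "expectation (\<lambda>\<omega>. along T (DF i) (g j) \<omega> * along T (DF j) (g i) \<omega>)
       = expectation (\<lambda>\<omega>. \<Sum>k<n i. \<Sum>l<n j. (\<integral>s. h i k s * g j s \<partial>\<mu>) * ((\<integral>s. g i s * h j l s \<partial>\<mu>) * (a i k \<omega> * a j l \<omega>)))"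
      unfolding al[OF ij] al[OF ij(2,1)] sum_product
      by (intro Bochner_Integration.integral_cong refl sum.cong) (simp add: mult_ac)
    also have "\<dots> = (\<Sum>k<n i. expectation (\<lambda>\<omega>. \<Sum>l<n j. (\<integral>s. h i k s * g j s \<partial>\<mu>) * ((\<integral>s. g i s * h j l s \<partial>\<mu>) * (a i k \<omega> * a j l \<omega>))))"
      using int by (intro Bochner_Integration.integral_sum Bochner_Integration.integrable_sum integrable_mult_right) auto
    also have "\<dots> = (\<Sum>k<n i. \<Sum>l<n j. expectation (\<lambda>\<omega>. (\<integral>s. h i k s * g j s \<partial>\<mu>) * ((\<integral>s. g i s * h j l s \<partial>\<mu>) * (a i k \<omega> * a j l \<omega>))))"
      using int by (intro sum.cong refl Bochner_Integration.integral_sum integrable_mult_right) auto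
    finally show ?thesis by simp
  qed
  have "(norm2 M X)\<^sup>2 = expectation (\<lambda>\<omega>. \<Sum>i<m. \<Sum>j<m. d i \<omega> * d j \<omega>)"
    unfolding norm2_square Xd by (simp add: power2_eq_square sum_product)
  also have "\<dots> = (\<Sum>i<m. expectation (\<lambda>\<omega>. \<Sum>j<m. d i \<omega> * d j \<omega>))"
    using dL by (intro Bochner_Integration.integral_sum Bochner_Integration.integrable_sum Lp2_mult_integrable) auto
  also have "\<dots> = (\<Sum>i<m. \<Sum>j<m. expectation (\<lambda>\<omega>. d i \<omega> * d j \<omega>))"
    using dL by (intro sum.cong refl Bochner_Integration.integral_sum Lp2_mult_integrable) auto
  also have "\<dots> = (\<Sum>i<m. \<Sum>j<m. (\<integral>s. g i s * g j s \<partial>\<mu>) * expectation (\<lambda>\<omega>. F i \<omega> * F j \<omega>)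
      + expectation (\<lambda>\<omega>. along T (DF i) (g j) \<omega> * along T (DF j) (g i) \<omega>))"
    unfolding d_def using C S by (intro sum.cong refl skorohod_covariance) auto
  also have "\<dots> = (\<Sum>i<m. \<Sum>j<m. (\<integral>s. g i s * g j s \<partial>\<mu>) * expectation (\<lambda>\<omega>. F i \<omega> * F j \<omega>))
      + (\<Sum>i<m. \<Sum>j<m. expectation (\<lambda>\<omega>. along T (DF i) (g j) \<omega> * along T (DF j) (g i) \<omega>))"
    by (simp add: sum.distrib)
  also have "(\<Sum>i<m. \<Sum>j<m. (\<integral>s. g i s * g j s \<partial>\<mu>) * expectation (\<lambda>\<omega>. F i \<omega> * F j \<omega>))
      = (norm2 Q (case_prod v))\<^sup>2"
    unfolding norm2_inner vt using gL FL by (intro tensors2_inner[symmetric]) auto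
  also have "(\<Sum>i<m. \<Sum>j<m. expectation (\<lambda>\<omega>. along T (DF i) (g j) \<omega> * along T (DF j) (g i) \<omega>))
     = (\<Sum>i<m. \<Sum>j<m. \<Sum>k<n i. \<Sum>l<n j. (\<integral>s. h i k s * g j s \<partial>\<mu>) * ((\<integral>s. g i s * h j l s \<partial>\<mu>) * expectation (\<lambda>\<omega>. a i k \<omega> * a j l \<omega>)))"
    using cross by (intro sum.cong refl) auto
  also have "\<dots> = (\<Sum>i<m. \<Sum>k<n i. \<Sum>j<m. \<Sum>l<n j. (\<integral>s. h i k s * g j s \<partial>\<mu>) * ((\<integral>s. g i s * h j l s \<partial>\<mu>) * expectation (\<lambda>\<omega>. a i k \<omega> * a j l \<omega>)))"
    by (intro sum.cong refl sum.swap)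
  also have "\<dots> = (\<Sum>p\<in>P. \<Sum>q\<in>P. (\<integral>s. h' p s * g' q s \<partial>\<mu>) * ((\<integral>s. g' p s * h' q s \<partial>\<mu>) * expectation (\<lambda>\<omega>. a' p \<omega> * a' q \<omega>)))"
    unfolding P_def h'_def g'_def a'_def by (subst (1 2) sum.Sigma) (auto simp: case_prod_beta)
  \<comment> \<open>exchanging \<open>h'\<close> and \<open>g'\<close> transposes the two time arguments\<close>
  also have "\<dots> = (\<integral>x. tensors3 P h' g' a' x * tensors3 P g' h' a' x \<partial>(\<mu> \<Otimes>\<^sub>M Q))"
    by (intro tensors3_inner[symmetric] PL)
  also have "\<dots> \<le> norm2 (\<mu> \<Otimes>\<^sub>M Q) (tensors3 P h' g' a')
      * norm2 (\<mu> \<Otimes>\<^sub>M Q) (tensors3 P g' h' a')"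
    by (rule order_trans[OF abs_ge_self norm2_cauchy_schwarz]) (rule tensors3_Lp2; rule PL; assumption)+
  also have "norm2 (\<mu> \<Otimes>\<^sub>M Q) (tensors3 P g' h' a')
      = norm2 (\<mu> \<Otimes>\<^sub>M Q) (tensors3 P h' g' a')"
  proof -
    have "(\<integral>x. tensors3 P g' h' a' x * tensors3 P g' h' a' x \<partial>(\<mu> \<Otimes>\<^sub>M Q))
        = (\<integral>x. tensors3 P h' g' a' x * tensors3 P h' g' a' x \<partial>(\<mu> \<Otimes>\<^sub>M Q))"
      using PL by (simp add: tensors3_inner mult.left_commute)
    then show ?thesis by (simp add: norm2_def power2_eq_square)
  qed
  finally show "(norm2 M X)\<^sup>2 \<le> (norm2 Q (case_prod v))\<^sup>2
      + (norm2 (\<mu> \<Otimes>\<^sub>M Q) (\<lambda>(s, t, \<omega>). Dv s t \<omega>))\<^sup>2"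
    unfolding Dvt by (simp add: power2_eq_square)
qed

text \<open>
  Integrating \<open>G F W(g)\<close> by parts, the product rule yields the correction \<open>\<langle>DF, g\<rangle>\<close>, which
  cancels, and the pairing of \<open>DG\<close> with the process.
\<close>

lemma smooth_skorohod_duality:
  assumes "smooth_skorohod v Dv X" and G: "smooth_deriv T M W G DG"
  shows "expectation (\<lambda>\<omega>. G \<omega> * X \<omega>) = (\<integral>x. case_prod DG x * case_prod v x \<partial>Q)"
proof -
  obtain m :: nat and F DF g Z where S: "\<And>j. j < m \<Longrightarrow> smooth_deriv T M W (F j) (DF j)" "\<And>j. j < m \<Longrightarrow> wiener (g j) (Z j)"
     and v: "v = (\<lambda>t \<omega>. \<Sum>j<m. F j \<omega> * g j t)"
     and X: "X = (\<lambda>\<omega>. \<Sum>j<m. F j \<omega> * Z j \<omega> - along T (DF j) (g j) \<omega>)"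
    using assms(1) unfolding smooth_skorohod_def by blast
  note C = smooth_deriv_C1[OF S(1)] and CG = smooth_deriv_C1[OF G]
  have gL: "g j \<in> Lp 2 \<mu>" if "j < m" for j by (rule wiener_Lp2(1)[OF S(2)[OF that]])
  have aL: "along T (DF j) (g j) \<in> Lp 2 M" "along T DG (g j) \<in> Lp 2 M" if "j < m" for j
    using along_bounded(3)[OF C[OF that] gL[OF that]] along_bounded(3)[OF CG gL[OF that]] by auto
  have FZ: "(\<lambda>\<omega>. F j \<omega> * Z j \<omega>) \<in> Lp 2 M" if "j < m" for j
    using C1_bounded(1,2)[OF C[OF that]] wiener_Lp2(2)[OF S(2)[OF that]] by (auto intro!: Lp2_bounded_mult)
  have GL: "G \<in> Lp 2 M" by (rule C1_bounded(3)[OF CG])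
  have FL: "F j \<in> Lp 2 M" if "j < m" for j by (rule C1_bounded(3)[OF C[OF that]])
  have summand: "expectation (\<lambda>\<omega>. G \<omega> * (F j \<omega> * Z j \<omega> - along T (DF j) (g j) \<omega>)) = expectation (\<lambda>\<omega>. F j \<omega> * along T DG (g j) \<omega>)"
    if j: "j < m" for j
  proof -
    have "expectation (\<lambda>\<omega>. G \<omega> * (F j \<omega> * Z j \<omega>)) = expectation (\<lambda>\<omega>. (G \<omega> * F j \<omega>) * Z j \<omega>)"
      by (simp add: mult.assoc)
    also have "\<dots> = expectation (\<lambda>\<omega>. G \<omega> * along T (DF j) (g j) \<omega> + F j \<omega> * along T DG (g j) \<omega>)"
      unfolding C1_ibp[OF C1_product[OF CG C[OF j]] S(2)[OF j]]
      by (simp add: along_product[OF CG C[OF j] gL[OF j], abs_def])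
    also have "\<dots> = expectation (\<lambda>\<omega>. G \<omega> * along T (DF j) (g j) \<omega>) + expectation (\<lambda>\<omega>. F j \<omega> * along T DG (g j) \<omega>)"
      using GL FL[OF j] aL[OF j] by (intro Bochner_Integration.integral_add Lp2_mult_integrable)
    finally show ?thesis
      using Lp2_mult_integrable[OF GL FZ[OF j]] Lp2_mult_integrable[OF GL aL(1)[OF j]] by (simp add: right_diff_distrib)
  qed
  have "expectation (\<lambda>\<omega>. G \<omega> * X \<omega>) = expectation (\<lambda>\<omega>. \<Sum>j<m. G \<omega> * (F j \<omega> * Z j \<omega> - along T (DF j) (g j) \<omega>))"
    by (simp add: X sum_distrib_left)
  also have "\<dots> = (\<Sum>j<m. expectation (\<lambda>\<omega>. G \<omega> * (F j \<omega> * Z j \<omega> - along T (DF j) (g j) \<omega>)))"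
    using GL FZ aL by (intro Bochner_Integration.integral_sum Lp2_mult_integrable Lp2_diff) auto
  also have "\<dots> = (\<Sum>j<m. expectation (\<lambda>\<omega>. F j \<omega> * along T DG (g j) \<omega>))"
    using summand by (intro sum.cong) auto
  also have "\<dots> = (\<integral>x. case_prod DG x * case_prod v x \<partial>Q)"
  proof -
    obtain n h a where *: "\<And>k. k < (n::nat) \<Longrightarrow> h k \<in> Lp 2 \<mu>" "\<And>k. k < n \<Longrightarrow> a k \<in> Lp 2 M"
      "DG = (\<lambda>s \<omega>. \<Sum>k<n. a k \<omega> * h k s)"
      using smooth_deriv_tensors[OF G] by blast
    have D: "case_prod DG = tensors2 {..<n} h a" and vt: "case_prod v = tensors2 {..<m} g F"
      by (auto simp: tensors2_def *(3) v fun_eq_iff mult.commute)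
    have "expectation (\<lambda>\<omega>. F j \<omega> * along T DG (g j) \<omega>)
      = (\<Sum>k<n. (\<integral>s. h k s * g j s \<partial>\<mu>) * expectation (\<lambda>\<omega>. a k \<omega> * F j \<omega>))" if j: "j < m" for j
    proof -
      have al: "along T DG (g j) \<omega> = (\<Sum>k<n. a k \<omega> * (\<integral>s. h k s * g j s \<partial>\<mu>))" for \<omega>
        unfolding *(3) using * gL[OF j] by (intro along_sum) auto
      have "expectation (\<lambda>\<omega>. F j \<omega> * along T DG (g j) \<omega>) = expectation (\<lambda>\<omega>. \<Sum>k<n. (\<integral>s. h k s * g j s \<partial>\<mu>) * (a k \<omega> * F j \<omega>))"
        unfolding al by (simp add: sum_distrib_left mult_ac)
      also have "\<dots> = (\<Sum>k<n. expectation (\<lambda>\<omega>. (\<integral>s. h k s * g j s \<partial>\<mu>) * (a k \<omega> * F j \<omega>)))"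
        using * FL[OF j] by (intro Bochner_Integration.integral_sum integrable_mult_right Lp2_mult_integrable) auto
      finally show ?thesis by simp
    qed
    then have "(\<Sum>j<m. expectation (\<lambda>\<omega>. F j \<omega> * along T DG (g j) \<omega>))
      = (\<Sum>k<n. \<Sum>j<m. (\<integral>s. h k s * g j s \<partial>\<mu>) * expectation (\<lambda>\<omega>. a k \<omega> * F j \<omega>))"
      by (subst sum.swap) (intro sum.cong refl, auto)
    also have "\<dots> = (\<integral>x. tensors2 {..<n} h a x * tensors2 {..<m} g F x \<partial>Q)"
      using * gL FL by (intro tensors2_inner[symmetric]) auto
    finally show ?thesis unfolding D vt .
  qed
  finally show ?thesis .
qed

text \<open>
  The norm bound makes the integrals of an approximating sequence Cauchy, and duality passes to
  the limit. The sequence itself is kept, since the forward approximations are compared along it.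
\<close>

theorem L12_skorohod:
  assumes "process_deriv T M W u Du"
  shows "\<exists>v Dv X Y. (\<forall>n::nat. smooth_skorohod (v n) (Dv n) (X n)) \<and>
    conv2 Q (\<lambda>n. case_prod (v n)) (case_prod u) sequentially \<and>
    conv2 (\<mu> \<Otimes>\<^sub>M Q) (\<lambda>n (s, t, \<omega>). Dv n s t \<omega>) (\<lambda>(s, t, \<omega>). Du s t \<omega>) sequentially \<and>
    conv2 M X Y sequentially \<and> is_skorohod_integral T M W u Y"
proof -
  let ?N = "\<mu> \<Otimes>\<^sub>M Q"
  obtain v Dv where uL: "case_prod u \<in> Lp 2 Q" and DuL: "(\<lambda>(s, t, \<omega>). Du s t \<omega>) \<in> Lp 2 ?N"
    and s: "\<And>n::nat. smooth_process_deriv T M W (v n) (Dv n)"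
    and c: "tendsto_Lp 2 Q (\<lambda>n. case_prod (v n)) (case_prod u) sequentially"
      "tendsto_Lp 2 ?N (\<lambda>n (s, t, \<omega>). Dv n s t \<omega>) (\<lambda>(s, t, \<omega>). Du s t \<omega>) sequentially"
    using assms unfolding process_deriv_def by blast
  have "\<forall>n. \<exists>X. smooth_skorohod (v n) (Dv n) X" using smooth_skorohod_exists[OF s] by blast
  then obtain X where X: "\<And>n. smooth_skorohod (v n) (Dv n) (X n)" by metis
  have cv: "conv2 Q (\<lambda>n. case_prod (v n)) (case_prod u) sequentially"
    by (rule tendsto_Lp2_iff[THEN iffD1, OF _ uL c(1)]) (rule smooth_skorohod_bound(2)[OF X])
  have cDv: "conv2 ?N (\<lambda>n (s, t, \<omega>). Dv n s t \<omega>) (\<lambda>(s, t, \<omega>). Du s t \<omega>) sequentially"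
    by (rule tendsto_Lp2_iff[THEN iffD1, OF _ DuL c(2)]) (rule smooth_skorohod_bound(3)[OF X])
  have "\<exists>Y. conv2 M X Y sequentially"
  proof (rule conv2_complete)
    show "X i \<in> Lp 2 M" for i by (rule smooth_skorohod_bound(1)[OF X])
    fix e :: real assume e: "e > 0"
    obtain m1 where m1: "\<And>i j. i \<ge> m1 \<Longrightarrow> j \<ge> m1 \<Longrightarrow> norm2 Q (\<lambda>x. case_prod (v i) x - case_prod (v j) x) < e / 2"
      using conv2_Cauchy[OF cv, of "e/2"] e by auto
    obtain m2 where m2: "\<And>i j. i \<ge> m2 \<Longrightarrow> j \<ge> m2 \<Longrightarrow>
        norm2 ?N (\<lambda>x. (\<lambda>(s, t, \<omega>). Dv i s t \<omega>) x - (\<lambda>(s, t, \<omega>). Dv j s t \<omega>) x) < e / 2"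
      using conv2_Cauchy[OF cDv, of "e/2"] e by auto
    show "\<exists>m. \<forall>i\<ge>m. \<forall>j\<ge>m. norm2 M (\<lambda>x. X i x - X j x) < e"
    proof (intro exI[of _ "max m1 m2"] allI impI)
      fix i j assume ij: "max m1 m2 \<le> i" "max m1 m2 \<le> j"
      note b = smooth_skorohod_bound(4)[OF smooth_skorohod_diff[OF X[of i] X[of j]]]
      have e1: "(\<lambda>x. case_prod (v i) x - case_prod (v j) x) = (\<lambda>(t, \<omega>). v i t \<omega> - v j t \<omega>)"
        and e2: "(\<lambda>x. (\<lambda>(s, t, \<omega>). Dv i s t \<omega>) x - (\<lambda>(s, t, \<omega>). Dv j s t \<omega>) x) = (\<lambda>(s, t, \<omega>). Dv i s t \<omega> - Dv j s t \<omega>)"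
        by (auto simp: fun_eq_iff)
      have "norm2 Q (\<lambda>(t, \<omega>). v i t \<omega> - v j t \<omega>) < e / 2" using m1[of i j] ij unfolding e1 by simp
      then have a1: "(norm2 Q (\<lambda>(t, \<omega>). v i t \<omega> - v j t \<omega>))\<^sup>2 < (e/2)\<^sup>2" by (intro power_strict_mono) auto
      have "norm2 ?N (\<lambda>(s, t, \<omega>). Dv i s t \<omega> - Dv j s t \<omega>) < e / 2" using m2[of i j] ij unfolding e2 by simp
      then have a2: "(norm2 ?N (\<lambda>(s, t, \<omega>). Dv i s t \<omega> - Dv j s t \<omega>))\<^sup>2 < (e/2)\<^sup>2" by (intro power_strict_mono) auto
      have "(e/2)\<^sup>2 + (e/2)\<^sup>2 \<le> e\<^sup>2" by (simp add: power2_eq_square)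
      then have "(norm2 M (\<lambda>\<omega>. X i \<omega> - X j \<omega>))\<^sup>2 < e\<^sup>2" using a1 a2 b by linarith
      then show "norm2 M (\<lambda>x. X i x - X j x) < e" using e by (simp add: power2_less_imp_less)
    qed
  qed
  then obtain Y where Y: "conv2 M X Y sequentially" by blast
  have "is_skorohod_integral T M W u Y"
    unfolding is_skorohod_integral_def
  proof (intro conjI allI impI)
    show "case_prod u \<in> Lp 2 Q" by (rule uL)
    show "Y \<in> Lp 2 M" by (rule conv2D(2)[OF Y])
    fix F DF assume "malliavin_deriv T M W F DF"
    then obtain G DG where FL: "F \<in> Lp 2 M" "case_prod DF \<in> Lp 2 Q" and G: "\<And>n::nat. smooth_deriv T M W (G n) (DG n)"
      and t: "tendsto_Lp 2 M G F sequentially" "tendsto_Lp 2 Q (\<lambda>n. case_prod (DG n)) (case_prod DF) sequentially"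
      unfolding malliavin_deriv_def by blast
    have GL: "G n \<in> Lp 2 M" "case_prod (DG n) \<in> Lp 2 Q" for n
      using C1_bounded(3)[OF smooth_deriv_C1[OF G]] smooth_deriv_process_Lp2[OF G] by auto
    have cG: "conv2 M G F sequentially" by (rule tendsto_Lp2_iff[THEN iffD1, OF GL(1) FL(1) t(1)])
    have cDG: "conv2 Q (\<lambda>n. case_prod (DG n)) (case_prod DF) sequentially" by (rule tendsto_Lp2_iff[THEN iffD1, OF GL(2) FL(2) t(2)])
    have "(\<lambda>n. expectation (\<lambda>\<omega>. G n \<omega> * X n \<omega>)) \<longlonglongrightarrow> expectation (\<lambda>\<omega>. F \<omega> * Y \<omega>)"
      by (rule conv2_inner[OF cG Y])
    moreover have "(\<lambda>n. expectation (\<lambda>\<omega>. G n \<omega> * X n \<omega>)) \<longlonglongrightarrow> (\<integral>x. case_prod DF x * case_prod u x \<partial>Q)"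
      unfolding smooth_skorohod_duality[OF X G] by (rule conv2_inner[OF cDG cv])
    ultimately have "expectation (\<lambda>\<omega>. F \<omega> * Y \<omega>) = (\<integral>x. case_prod DF x * case_prod u x \<partial>Q)" by (rule LIMSEQ_unique)
    then show "expectation (\<lambda>\<omega>. F \<omega> * Y \<omega>) = (\<integral>(s, \<omega>). DF s \<omega> * u s \<omega> \<partial>Q)" by (simp add: case_prod_beta')
  qed
  then show ?thesis using X cv cDv Y by blast
qed

end

section \<open>Totality of the smooth functionals\<close>

text \<open>
  A family inside \<open>Cb_infinity\<close> that is closed under partial derivatives, because the derivative
  of a polynomial in \<open>tanh\<close> is again a polynomial in \<open>tanh\<close>, and that approximates indicators of
  orthants.
\<close>

definition tanh_product :: "nat \<Rightarrow> (nat \<Rightarrow> real poly) \<Rightarrow> (nat \<Rightarrow> real) \<Rightarrow> (nat \<Rightarrow> real) \<Rightarrow> (nat \<Rightarrow> real) \<Rightarrow> real" where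
  "tanh_product n p \<alpha> \<beta> x = (\<Prod>i<n. poly (p i) (tanh (\<alpha> i * x i + \<beta> i)))"

lemma tanh_product_bounded: "bounded (range (tanh_product n p \<alpha> \<beta>))"
proof -
  have "\<exists>B. \<forall>y. \<bar>poly (p i) (tanh y)\<bar> \<le> B" for i
  proof -
    have "bounded (poly (p i) ` {-1..1})"
      by (intro compact_imp_bounded compact_continuous_image continuous_intros) auto
    then obtain B where B: "\<forall>z\<in>{-1..1}. \<bar>poly (p i) z\<bar> \<le> B" by (auto simp: bounded_iff)
    have "tanh y \<in> {-1..1}" for y :: real
      using tanh_real_lt_1[of y] tanh_real_gt_neg1[of y] by auto
    then show ?thesis using B by blast
  qed
  then have "\<exists>B. \<forall>i y. \<bar>poly (p i) (tanh y)\<bar> \<le> B i" by (intro choice allI)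
  then obtain B where B: "\<And>i y. \<bar>poly (p i) (tanh y)\<bar> \<le> B i" by blast
  have "\<bar>tanh_product n p \<alpha> \<beta> x\<bar> \<le> (\<Prod>i<n. B i)" for x
    unfolding tanh_product_def abs_prod by (intro prod_mono) (auto simp: B)
  then show ?thesis unfolding bounded_iff by auto
qed

lemma tanh_product_continuous: "continuous_on UNIV (tanh_product n p \<alpha> \<beta>)"
proof -
  have "continuous_on UNIV (\<lambda>x :: nat \<Rightarrow> real. poly (p i) (tanh (\<alpha> i * x i + \<beta> i)))" for i
    by (intro continuous_intros continuous_on_product_coordinates) (auto simp: cosh_real_nonzero)
  then show ?thesis unfolding tanh_product_def[abs_def] by (intro continuous_intros) auto
qed

text \<open>
  The polynomial \<open>[:1, 0, -1:]\<close> is \<open>1 - z\<^sup>2\<close>, from \<open>tanh' = 1 - tanh\<^sup>2\<close>.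
\<close>

lemma tanh_product_derivative:
  assumes j: "j < n"
  shows "((\<lambda>y. tanh_product n p \<alpha> \<beta> (x(j := y))) has_real_derivative
    tanh_product n (p(j := smult (\<alpha> j) (pderiv (p j) * [:1, 0, -1:]))) \<alpha> \<beta> x) (at (x j))"
proof -
  have split: "tanh_product n q \<alpha> \<beta> z = poly (q j) (tanh (\<alpha> j * z j + \<beta> j)) * (\<Prod>i\<in>{..<n} - {j}. poly (q i) (tanh (\<alpha> i * z i + \<beta> i)))"
    for q z unfolding tanh_product_def using j by (subst prod.remove[of _ j]) auto
  have e: "(\<Prod>i\<in>{..<n} - {j}. poly (p i) (tanh (\<alpha> i * (x(j := y)) i + \<beta> i))) = (\<Prod>i\<in>{..<n} - {j}. poly (p i) (tanh (\<alpha> i * x i + \<beta> i)))"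
    "(\<Prod>i\<in>{..<n} - {j}. poly ((p(j := q)) i) (tanh (\<alpha> i * x i + \<beta> i))) = (\<Prod>i\<in>{..<n} - {j}. poly (p i) (tanh (\<alpha> i * x i + \<beta> i)))"
    for y q by (intro prod.cong; simp)+
  have "((\<lambda>y. poly (p j) (tanh (\<alpha> j * y + \<beta> j))) has_real_derivative
     poly (pderiv (p j)) (tanh (\<alpha> j * x j + \<beta> j)) * ((1 - (tanh (\<alpha> j * x j + \<beta> j))\<^sup>2) * \<alpha> j)) (at (x j))"
    by (rule DERIV_chain2[where f = "poly (p j)", OF poly_DERIV])
      (auto intro!: derivative_eq_intros simp: cosh_real_nonzero)
  from DERIV_cmult_right[OF this, of "\<Prod>i\<in>{..<n} - {j}. poly (p i) (tanh (\<alpha> i * x i + \<beta> i))"]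
  show ?thesis unfolding split e by (simp add: power2_eq_square algebra_simps)
qed

lemma tanh_product_Cb_infinity: "tanh_product n p \<alpha> \<beta> \<in> Cb_infinity n"
proof -
  have pd: "partial_deriv j (tanh_product n p \<alpha> \<beta>) = tanh_product n (p(j := smult (\<alpha> j) (pderiv (p j) * [:1, 0, -1:]))) \<alpha> \<beta>"
    if "j < n" for j p
    using DERIV_imp_deriv[OF tanh_product_derivative[OF that]] by (simp add: partial_deriv_def fun_eq_iff)
  have it: "\<exists>q. foldr partial_deriv js (tanh_product n p \<alpha> \<beta>) = tanh_product n q \<alpha> \<beta>" if "set js \<subseteq> {..<n}" for js
    using that
  proof (induction js)
    case (Cons j js)
    then obtain q where "foldr partial_deriv js (tanh_product n p \<alpha> \<beta>) = tanh_product n q \<alpha> \<beta>" by auto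
    then show ?case using pd[of j q] Cons.prems by auto
  qed auto
  have fd: "(\<lambda>y. tanh_product n q \<alpha> \<beta> (x(i := y))) field_differentiable at (x i)" if "i < n" for i q x
    using tanh_product_derivative[OF that] unfolding field_differentiable_def by blast
  show ?thesis unfolding Cb_infinity_def mem_Collect_eq
  proof (intro conjI allI impI)
    show "tanh_product n p \<alpha> \<beta> x = tanh_product n p \<alpha> \<beta> y" if "\<forall>i<n. x i = y i" for x y
      using that by (simp add: tanh_product_def)
    fix js assume "set js \<subseteq> {..<n}"
    then obtain q where q: "foldr partial_deriv js (tanh_product n p \<alpha> \<beta>) = tanh_product n q \<alpha> \<beta>" using it by blast
    show "bounded (range (foldr partial_deriv js (tanh_product n p \<alpha> \<beta>)))" unfolding q by (rule tanh_product_bounded)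
    show "continuous_on UNIV (foldr partial_deriv js (tanh_product n p \<alpha> \<beta>))" unfolding q by (rule tanh_product_continuous)
    show "(\<lambda>y. foldr partial_deriv js (tanh_product n p \<alpha> \<beta>) (x(i := y))) field_differentiable at (x i)" if "i < n" for i x
      unfolding q by (rule fd[OF that])
  qed
qed

text \<open>
  The shift by \<open>- k\<close> decides the boundary case: at \<open>x = a\<close> the argument still tends to \<open>- \<infinity>\<close>,
  while for \<open>x > a\<close> the factor \<open>k\<^sup>2\<close> wins.
\<close>

lemma tanh_tendsto_indicator:
  "(\<lambda>k. (1 + tanh ((real k)\<^sup>2 * (x - a) - real k)) / 2) \<longlonglongrightarrow> indicator {a<..} x"
proof (cases "a < x")
  case True
  have "filterlim (\<lambda>k. real k) at_top sequentially" by (rule filterlim_real_sequentially)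
  then have "filterlim (\<lambda>k. (real k)\<^sup>2 * (x - a) - real k) at_top sequentially"
  proof (rule filterlim_at_top_mono)
    show "\<forall>\<^sub>F k in sequentially. real k \<le> (real k)\<^sup>2 * (x - a) - real k"
      using eventually_ge_at_top[of "nat \<lceil>2 / (x - a)\<rceil>"]
    proof eventually_elim
      case (elim k)
      then have "2 / (x - a) \<le> real k" by linarith
      then have "2 \<le> real k * (x - a)" using True by (simp add: pos_divide_le_eq)
      then have "real k * 2 \<le> real k * (real k * (x - a))" by (intro mult_left_mono) auto
      then show ?case by (simp add: power2_eq_square mult.assoc)
    qed
  qed
  from filterlim_compose[OF tanh_real_at_top this]
  have "(\<lambda>k. (1 + tanh ((real k)\<^sup>2 * (x - a) - real k)) / 2) \<longlonglongrightarrow> (1 + 1) / 2"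
    by (intro tendsto_intros) auto
  then show ?thesis using True by simp
next
  case False
  have "filterlim (\<lambda>k. - real k) at_bot sequentially"
    using filterlim_real_sequentially by (simp add: filterlim_uminus_at_bot)
  then have "filterlim (\<lambda>k. (real k)\<^sup>2 * (x - a) - real k) at_bot sequentially"
  proof (rule filterlim_at_bot_mono)
    show "\<forall>\<^sub>F k in sequentially. (real k)\<^sup>2 * (x - a) - real k \<le> - real k"
      using False by (intro always_eventually allI) (simp add: mult_nonneg_nonpos)
  qed
  from filterlim_compose[OF tanh_real_at_bot this]
  have "(\<lambda>k. (1 + tanh ((real k)\<^sup>2 * (x - a) - real k)) / 2) \<longlonglongrightarrow> (1 + (- 1)) / 2"
    by (intro tendsto_intros) auto
  then show ?thesis using False by simp
qed

context brownian
begin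

lemma smooth_malliavin:
  assumes "smooth_deriv T M W F DF" shows "malliavin_deriv T M W F DF"
proof -
  note F = C1_bounded(3)[OF smooth_deriv_C1[OF assms]] and D = smooth_deriv_process_Lp2[OF assms]
  show ?thesis unfolding malliavin_deriv_def
    by (intro conjI F D exI[of _ "\<lambda>_. F"] exI[of _ "\<lambda>_. DF"] allI assms)
      (simp_all add: tendsto_Lp2_iff F D conv2_const)
qed

lemma wiener_W: "t \<in> {0..T} \<Longrightarrow> wiener (step_function [(1, 0, t)]) (W t)"
proof (rule wiener_cong_AE)
  assume t: "t \<in> {0..T}"
  then show "wiener (step_function [(1, 0, t)]) (step_integral W [(1, 0, t)])"
    by (intro wiener_step) simp
  show "AE \<omega> in M. step_integral W [(1, 0, t)] \<omega> = W t \<omega>" using W_zero by eventually_elim simp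
  show "W t \<in> borel_measurable M" using t by simp
qed

text \<open>
  Strict lower bounds, as indicators of open half-lines are the limits obtained from \<open>tanh\<close>.
\<close>

definition cylinders :: "'a set set" where
  "cylinders = {{\<omega>\<in>space M. \<forall>i<n. a i < W (t i) \<omega>} | (n::nat) a t. \<forall>i<n. t i \<in> {0..T}}"

definition nulls :: "'a set set" where
  "nulls = {N. \<exists>G \<in> sets (natural_filtration M W T). emeasure M G = 0 \<and> N \<subseteq> G}"

lemma natural_subset: "sets (natural_filtration M W T) \<subseteq> sets M" and nulls_subset: "nulls \<subseteq> sets M"
  unfolding sets_M sets_filtration nulls_def by auto

lemma cylinder_measurable: "A \<in> cylinders \<Longrightarrow> A \<in> sets M"
  unfolding cylinders_def by auto

lemma sets_M_generated: "sets M = sigma_sets (space M) (cylinders \<union> nulls)"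
proof
  show "sigma_sets (space M) (cylinders \<union> nulls) \<subseteq> sets M"
    using cylinder_measurable nulls_subset by (intro sets.sigma_sets_subset) auto
  have sub: "cylinders \<union> nulls \<subseteq> Pow (space M)"
    using cylinder_measurable nulls_subset sets.sets_into_space by blast
  define N where "N = sigma (space M) (cylinders \<union> nulls)"
  have N: "sets N = sigma_sets (space M) (cylinders \<union> nulls)" "space N = space M"
    unfolding N_def using sub by (auto simp: sets_measure_of space_measure_of)
  have "W t \<in> borel_measurable N" if t: "t \<in> {0..T}" for t
  proof (rule borel_measurable_iff_greater[THEN iffD2], intro allI)
    fix a
    have "{\<omega>\<in>space M. \<forall>i<1::nat. a < W t \<omega>} \<in> cylinders"
      unfolding cylinders_def using t
      by (intro CollectI exI[of _ 1] exI[of _ "\<lambda>_. a"] exI[of _ "\<lambda>_. t"]) auto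
    then have "{\<omega>\<in>space M. a < W t \<omega>} \<in> cylinders" by simp
    then show "{w \<in> space N. a < W t w} \<in> sets N" unfolding N by auto
  qed
  then have "sets (natural_filtration M W T) \<subseteq> sets N"
    unfolding sets_natural_filtration N(2)[symmetric]
    by (intro sets.sigma_sets_subset) (auto intro: measurable_sets)
  moreover have "nulls \<subseteq> sets N" unfolding N by auto
  ultimately show "sets M \<subseteq> sigma_sets (space M) (cylinders \<union> nulls)"
    unfolding sets_M sets_filtration nulls_def[symmetric] N(1)[symmetric]
    using sets.sigma_sets_subset[of "sets (natural_filtration M W T) \<union> nulls" N] by (simp add: N(2))
qed

lemma cylinders_Int_stable: "Int_stable (cylinders \<union> nulls)"
proof (rule Int_stableI)
  fix A B assume AB: "A \<in> cylinders \<union> nulls" "B \<in> cylinders \<union> nulls"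
  show "A \<inter> B \<in> cylinders \<union> nulls"
  proof (cases "A \<in> nulls \<or> B \<in> nulls")
    case True
    then show ?thesis unfolding nulls_def by blast
  next
    case False
    then obtain n m :: nat and a t b s where *: "A = {\<omega>\<in>space M. \<forall>i<n. a i < W (t i) \<omega>}" "\<forall>i<n. t i \<in> {0..T}"
      "B = {\<omega>\<in>space M. \<forall>i<m. b i < W (s i) \<omega>}" "\<forall>i<m. s i \<in> {0..T}"
      using AB unfolding cylinders_def by blast
    let ?a = "\<lambda>i. if i < n then a i else b (i - n)" and ?t = "\<lambda>i. if i < n then t i else s (i - n)"
    have eq: "(\<forall>i<n + m. ?a i < W (?t i) \<omega>) \<longleftrightarrow> (\<forall>i<n. a i < W (t i) \<omega>) \<and> (\<forall>i<m. b i < W (s i) \<omega>)" for \<omega>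
    proof safe
      fix i assume h: "\<forall>i<n + m. ?a i < W (?t i) \<omega>" and "i < n"
      then show "a i < W (t i) \<omega>" using h[rule_format, of i] by simp
    next
      fix i assume h: "\<forall>i<n + m. ?a i < W (?t i) \<omega>" and "i < m"
      then show "b i < W (s i) \<omega>" using h[rule_format, of "n + i"] by simp
    qed auto
    have "A \<inter> B = {\<omega>\<in>space M. \<forall>i<n + m. ?a i < W (?t i) \<omega>}" unfolding eq *(1,3) by auto
    moreover have "\<forall>i<n + m. ?t i \<in> {0..T}" using *(2,4) by auto
    ultimately have "A \<inter> B \<in> cylinders" unfolding cylinders_def
      by (intro CollectI exI[of _ "n + m"] exI[of _ ?a] exI[of _ ?t] conjI)
    then show ?thesis by blast
  qed
qed

lemma zero_on_cylinder:
  assumes Z: "integrable M Z" and zero: "\<And>F DF. smooth_deriv T M W F DF \<Longrightarrow> expectation (\<lambda>\<omega>. F \<omega> * Z \<omega>) = 0"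
    and A: "A \<in> cylinders"
  shows "expectation (\<lambda>\<omega>. indicator A \<omega> * Z \<omega>) = 0"
proof -
  obtain n a t where A: "A = {\<omega>\<in>space M. \<forall>i<n. a i < W (t i) \<omega>}" and t: "\<And>i. i < (n::nat) \<Longrightarrow> t i \<in> {0..T}"
    using A unfolding cylinders_def by blast
  define f where "f k = tanh_product n (\<lambda>_. [:1/2, 1/2:]) (\<lambda>_. (real k)\<^sup>2) (\<lambda>i. - (real k)\<^sup>2 * a i - real k)" for k
  have f_eq: "f k (\<lambda>i. W (t i) \<omega>) = (\<Prod>i<n. (1 + tanh ((real k)\<^sup>2 * (W (t i) \<omega> - a i) - real k)) / 2)" for k \<omega>
    unfolding f_def tanh_product_def by (intro prod.cong) (auto simp: algebra_simps)
  have f: "f k \<in> Cb_infinity n" for k unfolding f_def by (rule tanh_product_Cb_infinity)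
  have "smooth_deriv T M W (\<lambda>\<omega>. f k (\<lambda>i. W (t i) \<omega>))
      (\<lambda>s \<omega>. \<Sum>i<n. partial_deriv i (f k) (\<lambda>l. W (t l) \<omega>) * step_function [(1, 0, t i)] s)" for k
    unfolding smooth_deriv_def
    by (rule exI[of _ n], rule exI[of _ "f k"], rule exI[of _ "\<lambda>i. step_function [(1, 0, t i)]"], rule exI[of _ "\<lambda>i. W (t i)"])
      (use f t in \<open>auto intro!: wiener_W\<close>)
  then have z: "expectation (\<lambda>\<omega>. f k (\<lambda>i. W (t i) \<omega>) * Z \<omega>) = 0" for k by (rule zero)
  have [measurable]: "Z \<in> borel_measurable M" using Z by simp
  have fm: "(\<lambda>\<omega>. f k (\<lambda>i. W (t i) \<omega>)) \<in> borel_measurable M" for k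
    by (rule C1b_measurable[OF Cb_infinity_C1b[OF f]]) (use t in auto)
  have "(\<lambda>k. expectation (\<lambda>\<omega>. f k (\<lambda>i. W (t i) \<omega>) * Z \<omega>)) \<longlonglongrightarrow> expectation (\<lambda>\<omega>. indicator A \<omega> * Z \<omega>)"
  proof (rule integral_dominated_convergence[where w = "\<lambda>\<omega>. \<bar>Z \<omega>\<bar>"])
    show "(\<lambda>\<omega>. indicator A \<omega> * Z \<omega>) \<in> borel_measurable M"
      using cylinder_measurable[OF assms(3)] by measurable
    show "(\<lambda>\<omega>. f k (\<lambda>i. W (t i) \<omega>) * Z \<omega>) \<in> borel_measurable M" for k using fm[of k] by measurable
    show "integrable M (\<lambda>\<omega>. \<bar>Z \<omega>\<bar>)" using Z by simp
    show "AE \<omega> in M. (\<lambda>k. f k (\<lambda>i. W (t i) \<omega>) * Z \<omega>) \<longlonglongrightarrow> indicator A \<omega> * Z \<omega>"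
    proof (rule AE_I2)
      fix \<omega> assume "\<omega> \<in> space M"
      then have "(\<Prod>i<n. indicator {a i<..} (W (t i) \<omega>)) = (indicator A \<omega> :: real)"
        unfolding A by (auto simp: indicator_def prod_zero_iff)
      moreover have "(\<lambda>k. f k (\<lambda>i. W (t i) \<omega>)) \<longlonglongrightarrow> (\<Prod>i<n. indicator {a i<..} (W (t i) \<omega>))"
        unfolding f_eq by (intro tendsto_prod tanh_tendsto_indicator)
      ultimately show "(\<lambda>k. f k (\<lambda>i. W (t i) \<omega>) * Z \<omega>) \<longlonglongrightarrow> indicator A \<omega> * Z \<omega>"
        by (intro tendsto_mult tendsto_const) simp
    qed
    show "AE \<omega> in M. norm (f k (\<lambda>i. W (t i) \<omega>) * Z \<omega>) \<le> \<bar>Z \<omega>\<bar>" for k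
    proof (rule AE_I2)
      fix \<omega>
      have th: "\<bar>(1 + tanh y) / 2\<bar> \<le> 1" for y :: real
        using tanh_real_lt_1[of y] tanh_real_gt_neg1[of y] by auto
      have "\<bar>f k (\<lambda>i. W (t i) \<omega>)\<bar> \<le> (\<Prod>i<n. 1)" unfolding f_eq abs_prod by (rule prod_mono) (use th in auto)
      then have "\<bar>f k (\<lambda>i. W (t i) \<omega>)\<bar> * \<bar>Z \<omega>\<bar> \<le> 1 * \<bar>Z \<omega>\<bar>" by (intro mult_right_mono) auto
      then show "norm (f k (\<lambda>i. W (t i) \<omega>) * Z \<omega>) \<le> \<bar>Z \<omega>\<bar>" by (simp add: abs_mult)
    qed
  qed
  then show ?thesis unfolding z by (simp add: LIMSEQ_const_iff)
qed

text \<open>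
  Bounded pointwise limits of smooth functionals include indicators of cylinders. Together with
  the null sets these form an intersection-stable generator of the events, so \<open>Z\<close> integrates to
  zero over every event.
\<close>

theorem smooth_functionals_total:
  assumes Z: "integrable M Z" and zero: "\<And>F DF. smooth_deriv T M W F DF \<Longrightarrow> expectation (\<lambda>\<omega>. F \<omega> * Z \<omega>) = 0"
  shows "AE \<omega> in M. Z \<omega> = 0"
proof -
  have [measurable]: "Z \<in> borel_measurable M" using Z by simp
  have int: "integrable M (\<lambda>\<omega>. indicator A \<omega> * Z \<omega>)" if [measurable]: "A \<in> sets M" for A
    by (rule Bochner_Integration.integrable_bound[OF Z]) (auto split: split_indicator)
  have all: "expectation (\<lambda>\<omega>. indicator A \<omega> * Z \<omega>) = 0" if A: "A \<in> sets M" for A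
  proof -
    have Ag: "A \<in> sigma_sets (space M) (cylinders \<union> nulls)" using A sets_M_generated by simp
    have "cylinders \<union> nulls \<subseteq> Pow (space M)"
      using cylinder_measurable nulls_subset sets.sets_into_space by blast
    from cylinders_Int_stable this Ag show ?thesis
    proof (induction rule: sigma_sets_induct_disjoint)
      case (basic A)
      show ?case
      proof (cases "A \<in> cylinders")
        case True
        show ?thesis by (rule zero_on_cylinder[OF Z _ True]) (rule zero)
      next
        case False
        then obtain G where G: "G \<in> sets (natural_filtration M W T)" "emeasure M G = 0" "A \<subseteq> G"
          using basic by (auto simp: nulls_def)
        then have "AE \<omega> in M. \<omega> \<notin> G" using natural_subset by (intro AE_not_in) auto
        then have "AE \<omega> in M. indicator A \<omega> * Z \<omega> = 0" by eventually_elim (use G(3) in \<open>auto simp: indicator_def\<close>)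
        then show ?thesis by (rule integral_eq_zero_AE)
      qed
    next
      case empty
      show ?case by simp
    next
      case (compl A)
      have Am: "A \<in> sets M" using compl(1) sets_M_generated by simp
      have e: "expectation (\<lambda>\<omega>. indicator (space M) \<omega> * Z \<omega>) = 0"
      proof (rule zero_on_cylinder[OF Z zero])
        show "space M \<in> cylinders" unfolding cylinders_def by (intro CollectI exI[of _ 0]) auto
      qed
      have "expectation (\<lambda>\<omega>. indicator (space M - A) \<omega> * Z \<omega>)
        = expectation (\<lambda>\<omega>. indicator (space M) \<omega> * Z \<omega> - indicator A \<omega> * Z \<omega>)"
        using sets.sets_into_space[OF Am] by (intro Bochner_Integration.integral_cong) (auto split: split_indicator)
      then show ?case using int[OF Am] int[of "space M"] e compl(2) by simp
    next
      case (union A)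
      have Am[measurable]: "A i \<in> sets M" for i using union(2) sets_M_generated by auto
      have "(\<lambda>k. expectation (\<lambda>\<omega>. indicator (\<Union>i<k. A i) \<omega> * Z \<omega>)) \<longlonglongrightarrow> expectation (\<lambda>\<omega>. indicator (\<Union>i. A i) \<omega> * Z \<omega>)"
      proof (rule integral_dominated_convergence[where w = "\<lambda>\<omega>. \<bar>Z \<omega>\<bar>"])
        show "AE \<omega> in M. (\<lambda>k. indicator (\<Union>i<k. A i) \<omega> * Z \<omega>) \<longlonglongrightarrow> indicator (\<Union>i. A i) \<omega> * Z \<omega>"
          by (intro AE_I2 tendsto_mult tendsto_const LIMSEQ_indicator_UN)
      qed (use Z in \<open>auto split: split_indicator\<close>)
      moreover have "expectation (\<lambda>\<omega>. indicator (\<Union>i<k. A i) \<omega> * Z \<omega>) = 0" for k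
      proof -
        have "indicator (\<Union>i<k. A i) \<omega> = (\<Sum>i<k. indicator (A i) \<omega> :: real)" for \<omega>
          by (rule indicator_UN_disjoint) (use union(1) in \<open>auto simp: disjoint_family_on_def\<close>)
        then have "expectation (\<lambda>\<omega>. indicator (\<Union>i<k. A i) \<omega> * Z \<omega>) = expectation (\<lambda>\<omega>. \<Sum>i<k. indicator (A i) \<omega> * Z \<omega>)"
          by (simp add: sum_distrib_right)
        also have "\<dots> = 0" using int[OF Am] union(3) by (subst Bochner_Integration.integral_sum) auto
        finally show ?thesis .
      qed
      ultimately show ?case by (simp add: LIMSEQ_const_iff)
    qed
  qed
  have pos: "AE \<omega> in M. indicator A \<omega> * Z \<omega> = 0"
    if A: "A \<in> sets M" and s: "\<And>\<omega>. 0 \<le> c * (indicator A \<omega> * Z \<omega>)" and c: "c \<noteq> 0" for A and c :: real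
  proof -
    have "expectation (\<lambda>\<omega>. c * (indicator A \<omega> * Z \<omega>)) = 0" using all[OF A] by simp
    then have "AE \<omega> in M. c * (indicator A \<omega> * Z \<omega>) = 0"
      using int[OF A] s by (subst (asm) integral_nonneg_eq_0_iff_AE) auto
    then show ?thesis using c by simp
  qed
  have "AE \<omega> in M. indicator {\<omega>\<in>space M. 0 < Z \<omega>} \<omega> * Z \<omega> = 0"
    by (rule pos[of _ 1]) (auto split: split_indicator)
  moreover have "AE \<omega> in M. indicator {\<omega>\<in>space M. Z \<omega> < 0} \<omega> * Z \<omega> = 0"
    by (rule pos[of _ "-1"]) (auto split: split_indicator)
  ultimately show ?thesis using AE_space
    by eventually_elim (auto split: split_indicator_asm)
qed

text \<open>
  Smooth functionals are test functions for the adjoint and determine an integrable random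
  variable.
\<close>

theorem skorohod_unique:
  assumes "is_skorohod_integral T M W u X" "is_skorohod_integral T M W u Y"
  shows "AE \<omega> in M. X \<omega> = Y \<omega>"
proof -
  have L: "X \<in> Lp 2 M" "Y \<in> Lp 2 M" using assms by (auto simp: is_skorohod_integral_def)
  have "AE \<omega> in M. X \<omega> - Y \<omega> = 0"
  proof (rule smooth_functionals_total)
    show "integrable M (\<lambda>\<omega>. X \<omega> - Y \<omega>)" using L by (intro Lp2_integrable Lp2_diff)
    fix F DF assume S: "smooth_deriv T M W F DF"
    have FL: "F \<in> Lp 2 M" by (rule C1_bounded(3)[OF smooth_deriv_C1[OF S]])
    have "expectation (\<lambda>\<omega>. F \<omega> * X \<omega>) = expectation (\<lambda>\<omega>. F \<omega> * Y \<omega>)"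
      using assms smooth_malliavin[OF S] unfolding is_skorohod_integral_def by simp
    then show "expectation (\<lambda>\<omega>. F \<omega> * (X \<omega> - Y \<omega>)) = 0"
      using Lp2_mult_integrable[OF FL L(1)] Lp2_mult_integrable[OF FL L(2)] by (simp add: right_diff_distrib)
  qed
  then show ?thesis by eventually_elim simp
qed

end

section \<open>Backward averages and forward increments\<close>

text \<open>
  The density of the uniform distribution on \<open>[s - \<epsilon>, s)\<close>; as a function of \<open>s\<close> it is the uniform
  density on \<open>(t, t + \<epsilon>]\<close>, which is what exchanges averages of integrands with increments of \<open>W\<close>.
\<close>

definition ker :: "real \<Rightarrow> real \<Rightarrow> real \<Rightarrow> real" where
  "ker \<epsilon> s t = (if s - \<epsilon> \<le> t \<and> t < s then inverse \<epsilon> else 0)"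

definition avg :: "real \<Rightarrow> real \<Rightarrow> (real \<Rightarrow> real) \<Rightarrow> real \<Rightarrow> real" where
  "avg T \<epsilon> g s = (\<integral>t. ker \<epsilon> s t * g t \<partial>time_measure T)"

lemma ker_nonneg: "0 < \<epsilon> \<Longrightarrow> 0 \<le> ker \<epsilon> s t"
  and ker_le: "0 < \<epsilon> \<Longrightarrow> ker \<epsilon> s t \<le> inverse \<epsilon>"
  and abs_ker_le: "0 < \<epsilon> \<Longrightarrow> \<bar>ker \<epsilon> s t\<bar> \<le> inverse \<epsilon>"
  by (auto simp: ker_def)

lemma ker_measurable [measurable]:
  assumes [measurable]: "f \<in> borel_measurable N" "g \<in> borel_measurable N"
  shows "(\<lambda>x. ker \<epsilon> (f x) (g x)) \<in> borel_measurable N"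
  unfolding ker_def by measurable

lemma time_id_measurable [measurable]: "(\<lambda>x. x) \<in> borel_measurable (time_measure T)"
  by (rule time_measurable_borel) simp

lemma time_fst_measurable [measurable]: "fst \<in> borel_measurable (time_measure T \<Otimes>\<^sub>M N)"
  by (rule measurable_compose[OF measurable_fst time_id_measurable])

lemma time_snd_measurable [measurable]: "snd \<in> borel_measurable (N \<Otimes>\<^sub>M time_measure T)"
  by (rule measurable_compose[OF measurable_snd time_id_measurable])

lemma time_integral_le:
  fixes f :: "real \<Rightarrow> real"
  assumes f: "integrable lborel f" and nn: "\<And>x. 0 \<le> f x"
  shows "(\<integral>x. f x \<partial>time_measure T) \<le> (\<integral>x. f x \<partial>lborel)" "integrable (time_measure T) f"
proof -
  have i: "integrable lborel (\<lambda>x. indicator {0..T} x *\<^sub>R f x)"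
    using integrable_mult_indicator[OF _ f, of "{0..T}"] by simp
  show "(\<integral>x. f x \<partial>time_measure T) \<le> (\<integral>x. f x \<partial>lborel)"
    unfolding time_integral set_lebesgue_integral_def
    by (intro integral_mono i f) (auto split: split_indicator intro: nn)
  show "integrable (time_measure T) f"
    unfolding time_measure_def using i by (subst integrable_restrict_space) auto
qed

lemma ker_integral_lborel:
  assumes "0 < \<epsilon>"
  shows "integrable lborel (\<lambda>t. ker \<epsilon> s t)" "(\<integral>t. ker \<epsilon> s t \<partial>lborel) = 1"
    "integrable lborel (\<lambda>s. ker \<epsilon> s t)" "(\<integral>s. ker \<epsilon> s t \<partial>lborel) = 1"
proof -
  have 1: "(\<lambda>t. ker \<epsilon> s t) = (\<lambda>t. inverse \<epsilon> * indicator {s - \<epsilon>..<s} t)"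
    by (auto simp: ker_def fun_eq_iff indicator_def)
  have 2: "(\<lambda>s. ker \<epsilon> s t) = (\<lambda>s. inverse \<epsilon> * indicator {t<..t + \<epsilon>} s)"
    by (auto simp: ker_def fun_eq_iff indicator_def)
  show "integrable lborel (\<lambda>t. ker \<epsilon> s t)" "(\<integral>t. ker \<epsilon> s t \<partial>lborel) = 1"
    "integrable lborel (\<lambda>s. ker \<epsilon> s t)" "(\<integral>s. ker \<epsilon> s t \<partial>lborel) = 1"
    unfolding 1 2 using assms by simp_all
qed

lemma ker_time:
  assumes "0 < \<epsilon>"
  shows "integrable (time_measure T) (\<lambda>t. ker \<epsilon> s t)" "(\<integral>t. ker \<epsilon> s t \<partial>time_measure T) \<le> 1"
    "integrable (time_measure T) (\<lambda>s. ker \<epsilon> s t)" "(\<integral>s. ker \<epsilon> s t \<partial>time_measure T) \<le> 1"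
  using time_integral_le[OF ker_integral_lborel(1)[OF assms] ker_nonneg[OF assms], of T s]
    time_integral_le[OF ker_integral_lborel(3)[OF assms] ker_nonneg[OF assms], of T t]
  by (simp_all add: ker_integral_lborel[OF assms])

text \<open>
  Near the left end of the time interval, for \<open>s < \<epsilon>\<close>, part of the mass is lost.
\<close>

lemma ker_time_inner:
  assumes "0 < \<epsilon>" "\<epsilon> \<le> s" "s \<le> T"
  shows "(\<integral>t. ker \<epsilon> s t \<partial>time_measure T) = 1"
proof -
  have "(\<integral>t. ker \<epsilon> s t \<partial>time_measure T) = (\<integral>t. ker \<epsilon> s t \<partial>lborel)"
    unfolding time_integral set_lebesgue_integral_def
    using assms by (intro Bochner_Integration.integral_cong) (auto simp: ker_def indicator_def)
  then show ?thesis using ker_integral_lborel[OF assms(1)] by simp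
qed

lemma ker_mult_Lp2: "0 < \<epsilon> \<Longrightarrow> g \<in> Lp 2 (time_measure T) \<Longrightarrow> (\<lambda>t. ker \<epsilon> s t * g t) \<in> Lp 2 (time_measure T)"
  by (rule Lp2_bounded_mult[where B = "inverse \<epsilon>"]) (auto intro: abs_ker_le ker_measurable)

lemma time_Lp2_integrable: "g \<in> Lp 2 (time_measure T) \<Longrightarrow> integrable (time_measure T) g"
proof -
  interpret finite_measure "time_measure T" by (rule finite_measure_time)
  assume "g \<in> Lp 2 (time_measure T)"
  moreover have "(\<lambda>_. 1) \<in> Lp 2 (time_measure T)" by (simp add: Lp2_iff)
  ultimately show "integrable (time_measure T) g" using Lp2_mult_integrable[of g "time_measure T" "\<lambda>_. 1"] by simp
qed

lemma avg_add_scaled: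
  assumes "0 < \<epsilon>" "f \<in> Lp 2 (time_measure T)" "g \<in> Lp 2 (time_measure T)"
  shows "avg T \<epsilon> (\<lambda>t. a * f t + b * g t) s = a * avg T \<epsilon> f s + b * avg T \<epsilon> g s"
proof -
  note i = time_Lp2_integrable[OF ker_mult_Lp2[OF assms(1,2), of s]] time_Lp2_integrable[OF ker_mult_Lp2[OF assms(1,3), of s]]
  have "avg T \<epsilon> (\<lambda>t. a * f t + b * g t) s = (\<integral>t. a * (ker \<epsilon> s t * f t) + b * (ker \<epsilon> s t * g t) \<partial>time_measure T)"
    unfolding avg_def by (simp add: algebra_simps)
  then show ?thesis using i by (simp add: avg_def)
qed

lemma avg_sum:
  assumes "0 < \<epsilon>" "\<And>j. j \<in> J \<Longrightarrow> f j \<in> Lp 2 (time_measure T)"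
  shows "avg T \<epsilon> (\<lambda>t. \<Sum>j\<in>J. a j * f j t) s = (\<Sum>j\<in>J. a j * avg T \<epsilon> (f j) s)"
proof -
  have "avg T \<epsilon> (\<lambda>t. \<Sum>j\<in>J. a j * f j t) s = (\<integral>t. (\<Sum>j\<in>J. a j * (ker \<epsilon> s t * f j t)) \<partial>time_measure T)"
    unfolding avg_def by (simp add: sum_distrib_left mult_ac)
  also have "\<dots> = (\<Sum>j\<in>J. a j * avg T \<epsilon> (f j) s)"
    unfolding avg_def using time_Lp2_integrable[OF ker_mult_Lp2[OF assms]]
    by (subst Bochner_Integration.integral_sum) auto
  finally show ?thesis .
qed

text \<open>
  Jensen's inequality in \<open>t\<close>, then Fubini's theorem and the fact that the kernel has mass at most
  one in each variable.
\<close>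

lemma avg_contraction:
  assumes \<epsilon>: "0 < \<epsilon>" and g: "g \<in> Lp 2 (time_measure T)"
  shows "avg T \<epsilon> g \<in> Lp 2 (time_measure T)" "norm2 (time_measure T) (avg T \<epsilon> g) \<le> norm2 (time_measure T) g"
proof -
  interpret tm: finite_measure "time_measure T" by (rule finite_measure_time)
  interpret P: pair_sigma_finite "time_measure T" "time_measure T" ..
  have [measurable]: "g \<in> borel_measurable (time_measure T)" using g by measurable
  have am[measurable]: "avg T \<epsilon> g \<in> borel_measurable (time_measure T)"
    unfolding avg_def[abs_def] by measurable
  have jensen: "(avg T \<epsilon> g s)\<^sup>2 \<le> (\<integral>t. ker \<epsilon> s t * (g t)\<^sup>2 \<partial>time_measure T)" for s
  proof -
    define c where "c t = sqrt (ker \<epsilon> s t)" for t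
    have cc: "c t * c t = ker \<epsilon> s t" for t using ker_nonneg[OF \<epsilon>] by (simp add: c_def)
    have [measurable]: "c \<in> borel_measurable (time_measure T)" unfolding c_def[abs_def] by measurable
    have cb: "\<bar>c t\<bar> \<le> sqrt (inverse \<epsilon>)" for t unfolding c_def using ker_le[OF \<epsilon>] ker_nonneg[OF \<epsilon>] by simp
    have c: "c \<in> Lp 2 (time_measure T)" by (rule bounded_time_Lp2[OF _ cb]) measurable
    have cg: "(\<lambda>t. c t * g t) \<in> Lp 2 (time_measure T)" by (rule Lp2_bounded_mult[OF g _ cb]) measurable
    have n1: "(norm2 (time_measure T) c)\<^sup>2 \<le> 1"
      unfolding norm2_inner cc by (rule ker_time(2)[OF \<epsilon>])
    have n2: "(norm2 (time_measure T) (\<lambda>t. c t * g t))\<^sup>2 = (\<integral>t. ker \<epsilon> s t * (g t)\<^sup>2 \<partial>time_measure T)"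
      unfolding norm2_inner cc[symmetric] by (simp add: power2_eq_square mult_ac)
    have "\<bar>avg T \<epsilon> g s\<bar> \<le> norm2 (time_measure T) c * norm2 (time_measure T) (\<lambda>t. c t * g t)"
      using norm2_cauchy_schwarz[OF c cg] by (simp add: avg_def cc[symmetric] mult.assoc)
    then have "\<bar>avg T \<epsilon> g s\<bar>\<^sup>2 \<le> (norm2 (time_measure T) c * norm2 (time_measure T) (\<lambda>t. c t * g t))\<^sup>2"
      by (intro power_mono) auto
    also have "\<dots> \<le> 1 * (norm2 (time_measure T) (\<lambda>t. c t * g t))\<^sup>2"
      unfolding power_mult_distrib by (intro mult_right_mono n1) auto
    finally show ?thesis using n2 by simp
  qed
  have ik: "integrable (time_measure T \<Otimes>\<^sub>M time_measure T) (\<lambda>(s, t). ker \<epsilon> s t * (g t)\<^sup>2)"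
  proof (rule Bochner_Integration.integrable_bound)
    show "integrable (time_measure T \<Otimes>\<^sub>M time_measure T) (\<lambda>(s, t). inverse \<epsilon> * (g t)\<^sup>2)"
      using Lp2_square[OF g] by (intro P.tensor_integral) auto
    show "AE x in time_measure T \<Otimes>\<^sub>M time_measure T. norm (case x of (s, t) \<Rightarrow> ker \<epsilon> s t * (g t)\<^sup>2) \<le> norm (case x of (s, t) \<Rightarrow> inverse \<epsilon> * (g t)\<^sup>2)"
      using abs_ker_le[OF \<epsilon>] \<epsilon> by (intro AE_I2) (auto simp: abs_mult intro!: mult_right_mono)
  qed measurable
  have i1: "integrable (time_measure T) (\<lambda>s. \<integral>t. ker \<epsilon> s t * (g t)\<^sup>2 \<partial>time_measure T)"
    using P.integrable_fst[OF ik] .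
  have ia: "integrable (time_measure T) (\<lambda>s. (avg T \<epsilon> g s)\<^sup>2)"
  proof (rule Bochner_Integration.integrable_bound[OF i1])
    show "AE s in time_measure T. norm ((avg T \<epsilon> g s)\<^sup>2) \<le> norm (\<integral>t. ker \<epsilon> s t * (g t)\<^sup>2 \<partial>time_measure T)"
      using jensen by (intro AE_I2) (auto intro: order_trans[OF jensen abs_ge_self])
  qed measurable
  show "avg T \<epsilon> g \<in> Lp 2 (time_measure T)" using ia by (simp add: Lp2_iff)
  have "(\<integral>s. (avg T \<epsilon> g s)\<^sup>2 \<partial>time_measure T) \<le> (\<integral>s. \<integral>t. ker \<epsilon> s t * (g t)\<^sup>2 \<partial>time_measure T \<partial>time_measure T)"
    by (intro integral_mono ia i1 jensen)
  also have "\<dots> = (\<integral>t. \<integral>s. ker \<epsilon> s t * (g t)\<^sup>2 \<partial>time_measure T \<partial>time_measure T)"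
    using P.Fubini_integral[OF ik] by simp
  also have "\<dots> \<le> (\<integral>t. (g t)\<^sup>2 \<partial>time_measure T)"
  proof (intro integral_mono)
    show "integrable (time_measure T) (\<lambda>t. \<integral>s. ker \<epsilon> s t * (g t)\<^sup>2 \<partial>time_measure T)" by (rule P.integrable_snd[OF ik])
    show "integrable (time_measure T) (\<lambda>t. (g t)\<^sup>2)" by (rule Lp2_square[OF g])
    fix t
    have "(\<integral>s. ker \<epsilon> s t * (g t)\<^sup>2 \<partial>time_measure T) = (\<integral>s. ker \<epsilon> s t \<partial>time_measure T) * (g t)\<^sup>2" by simp
    also have "\<dots> \<le> 1 * (g t)\<^sup>2" by (intro mult_right_mono ker_time(4)[OF \<epsilon>]) auto
    finally show "(\<integral>s. ker \<epsilon> s t * (g t)\<^sup>2 \<partial>time_measure T) \<le> (g t)\<^sup>2" by simp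
  qed
  finally show "norm2 (time_measure T) (avg T \<epsilon> g) \<le> norm2 (time_measure T) g"
    unfolding norm2_def by simp
qed

text \<open>
  The averages are contractions, so it suffices to treat a dense set; for the indicator of an
  interval they are eventually exact at every point.
\<close>

lemma avg_conv:
  fixes \<epsilon> :: "nat \<Rightarrow> real"
  assumes T: "0 < T" and \<epsilon>: "\<And>n. 0 < \<epsilon> n" "\<epsilon> \<longlonglongrightarrow> 0" and g: "g \<in> Lp 2 (time_measure T)"
  shows "conv2 (time_measure T) (\<lambda>n. avg T (\<epsilon> n) g) g sequentially"
proof -
  have interval: "conv2 (time_measure T) (\<lambda>n. avg T (\<epsilon> n) (indicator {a<..b})) (indicator {a<..b}) sequentially"
    if ab: "0 \<le> a" "a \<le> b" "b \<le> T" for a b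
  proof (rule conv2_dominated)
    show "(indicator UNIV :: real \<Rightarrow> real) \<in> Lp 2 (time_measure T)" by (rule indicator_time_Lp2) simp
    have iL: "indicator {a<..b} \<in> Lp 2 (time_measure T)" by (rule indicator_time_Lp2) simp
    show "avg T (\<epsilon> n) (indicator {a<..b}) \<in> borel_measurable (time_measure T)" for n
      by (rule Lp2_measurable[OF avg_contraction(1)[OF \<epsilon>(1) iL]])
    show "indicat_real {a<..b} \<in> borel_measurable (time_measure T)" using iL by (rule Lp2_measurable)
    show "AE x in time_measure T. \<bar>avg T (\<epsilon> n) (indicator {a<..b}) x\<bar> \<le> indicator UNIV x" for n
    proof (rule AE_I2)
      fix s
      have "\<bar>avg T (\<epsilon> n) (indicator {a<..b}) s\<bar> \<le> (\<integral>t. \<bar>ker (\<epsilon> n) s t * indicator {a<..b} t\<bar> \<partial>time_measure T)"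
        unfolding avg_def by (rule integral_abs_bound)
      also have "\<dots> \<le> (\<integral>t. ker (\<epsilon> n) s t \<partial>time_measure T)"
        using ker_nonneg[OF \<epsilon>(1)[of n]]
        by (intro integral_mono integrable_abs time_Lp2_integrable[OF ker_mult_Lp2[OF \<epsilon>(1) iL]] ker_time(1)[OF \<epsilon>(1)])
          (auto split: split_indicator)
      also have "\<dots> \<le> 1" by (rule ker_time(2)[OF \<epsilon>(1)])
      finally show "\<bar>avg T (\<epsilon> n) (indicator {a<..b}) s\<bar> \<le> indicator UNIV s" by simp
    qed
    show "AE s in time_measure T. (\<lambda>n. avg T (\<epsilon> n) (indicator {a<..b}) s) \<longlonglongrightarrow> indicator {a<..b} s"
    proof (rule AE_I2)
      fix s assume s: "s \<in> space (time_measure T)"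
      \<comment> \<open>a window length at which \<open>[s - d, s)\<close> does not reach across the next endpoint on the left\<close>
      define d where "d = (if s \<le> a then 1 else if s \<le> b then s - a else s - b)"
      have d: "d > 0" by (auto simp: d_def)
      have "\<forall>\<^sub>F n in sequentially. avg T (\<epsilon> n) (indicator {a<..b}) s = indicator {a<..b} s"
        using order_tendstoD(2)[OF \<epsilon>(2) d]
      proof eventually_elim
        case (elim n)
        consider "s \<le> a" | "a < s" "s \<le> b" | "b < s" by linarith
        then show ?case
        proof cases
          case 1
          then have e: "ker (\<epsilon> n) s t * indicator {a<..b} t = 0" for t by (auto simp: ker_def indicator_def)
          show ?thesis unfolding avg_def e using 1 by simp
        next
          case 2
          then have e: "ker (\<epsilon> n) s t * indicator {a<..b} t = ker (\<epsilon> n) s t" for t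
            using elim by (auto simp: ker_def indicator_def d_def)
          have "\<epsilon> n \<le> s" "s \<le> T" using 2 elim ab by (auto simp: d_def)
          then show ?thesis unfolding avg_def e using 2 by (simp add: ker_time_inner[OF \<epsilon>(1)])
        next
          case 3
          then have e: "ker (\<epsilon> n) s t * indicator {a<..b} t = 0" for t
            using elim ab by (auto simp: ker_def indicator_def d_def)
          show ?thesis unfolding avg_def e using 3 by simp
        qed
      qed
      then show "(\<lambda>n. avg T (\<epsilon> n) (indicator {a<..b}) s) \<longlonglongrightarrow> indicator {a<..b} s" by (rule tendsto_eventually)
    qed
  qed
  have steps: "conv2 (time_measure T) (\<lambda>n. avg T (\<epsilon> n) (step_function xs)) (step_function xs) sequentially"
    if "valid_steps T xs" for xs
    using that
  proof (induction xs)
    case Nil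
    have "avg T (\<epsilon> n) (step_function []) = step_function []" for n by (simp add: avg_def fun_eq_iff)
    then show ?case by (simp only: conv2_const step_function_Lp2)
  next
    case (Cons x xs)
    obtain a s t where x: "x = (a, s, t)" by (cases x)
    have 1: "step_function (x # xs) = (\<lambda>r. a * indicator {s<..t} r + 1 * step_function xs r)" by (simp add: x fun_eq_iff)
    have 2: "avg T (\<epsilon> n) (step_function (x # xs)) = (\<lambda>r. a * avg T (\<epsilon> n) (indicator {s<..t}) r + 1 * avg T (\<epsilon> n) (step_function xs) r)" for n
      unfolding 1 by (rule ext, rule avg_add_scaled[OF \<epsilon>(1)]) auto
    show ?case unfolding 2 unfolding 1 using Cons x by (intro conv2_add conv2_cmult interval) auto
  qed
  have "(\<lambda>n. norm2 (time_measure T) (\<lambda>x. avg T (\<epsilon> n) g x - g x)) \<longlonglongrightarrow> 0"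
  proof (rule LIMSEQ_I)
    fix e :: real assume e: "e > 0"
    obtain xs where xs: "valid_steps T xs" "norm2 (time_measure T) (\<lambda>r. g r - step_function xs r) < e / 3"
      using steps_dense[OF T g] e unfolding step_dense_def by (meson divide_pos_pos zero_less_numeral)
    let ?f = "step_function xs"
    obtain m where m: "\<And>n. n \<ge> m \<Longrightarrow> norm2 (time_measure T) (\<lambda>x. avg T (\<epsilon> n) ?f x - ?f x) < e / 3"
      using LIMSEQ_D[OF conv2D(3)[OF steps[OF xs(1)]], of "e/3"] e by auto
    show "\<exists>m. \<forall>n\<ge>m. norm (norm2 (time_measure T) (\<lambda>x. avg T (\<epsilon> n) g x - g x) - 0) < e"
    proof (intro exI[of _ m] allI impI)
      fix n assume n: "m \<le> n"
      note L = avg_contraction(1)[OF \<epsilon>(1)[of n] g] avg_contraction(1)[OF \<epsilon>(1)[of n] step_function_Lp2[of xs T]]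
      have "(\<lambda>s. avg T (\<epsilon> n) g s - avg T (\<epsilon> n) ?f s) = avg T (\<epsilon> n) (\<lambda>t. g t - ?f t)"
        using avg_add_scaled[OF \<epsilon>(1)[of n] g step_function_Lp2, of 1 "-1" xs] by (simp add: fun_eq_iff)
      then have "norm2 (time_measure T) (\<lambda>s. avg T (\<epsilon> n) g s - avg T (\<epsilon> n) ?f s) < e / 3"
        using avg_contraction(2)[OF \<epsilon>(1)[of n] Lp2_diff[OF g step_function_Lp2[of xs]]] xs(2) by simp
      moreover have "norm2 (time_measure T) (\<lambda>s. ?f s - g s) < e / 3" using xs(2) norm2_minus[of "time_measure T" g ?f] by simp
      moreover note m[OF n] norm2_triangle3[OF L(1,2) g] norm2_triangle3[OF L(2) step_function_Lp2[of xs] g]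
      ultimately show "norm (norm2 (time_measure T) (\<lambda>x. avg T (\<epsilon> n) g x - g x) - 0) < e" by simp
    qed
  qed
  then show ?thesis unfolding conv2_def using g avg_contraction(1)[OF \<epsilon>(1) g] by simp
qed

context brownian
begin

definition good :: "'a set" where
  "good = (SOME A. A \<in> sets M \<and> (AE \<omega> in M. \<omega> \<in> A) \<and> (\<forall>\<omega>\<in>A. continuous_on {0..T} (\<lambda>t. W t \<omega>)))"

lemma good: "good \<in> sets M" "AE \<omega> in M. \<omega> \<in> good" "\<And>\<omega>. \<omega> \<in> good \<Longrightarrow> continuous_on {0..T} (\<lambda>t. W t \<omega>)"
proof -
  obtain N where N: "{\<omega>\<in>space M. \<not> continuous_on {0..T} (\<lambda>t. W t \<omega>)} \<subseteq> N" "emeasure M N = 0" "N \<in> sets M"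
    using AE_E[OF W_continuous] by blast
  have "\<exists>A. A \<in> sets M \<and> (AE \<omega> in M. \<omega> \<in> A) \<and> (\<forall>\<omega>\<in>A. continuous_on {0..T} (\<lambda>t. W t \<omega>))"
  proof (intro exI[of _ "space M - N"] conjI ballI)
    show "AE \<omega> in M. \<omega> \<in> space M - N"
      using AE_not_in[of N M] N AE_space by (auto simp: null_sets_def elim: eventually_elim2)
  qed (use N in auto)
  from someI_ex[OF this] show "good \<in> sets M" "AE \<omega> in M. \<omega> \<in> good"
    "\<And>\<omega>. \<omega> \<in> good \<Longrightarrow> continuous_on {0..T} (\<lambda>t. W t \<omega>)" unfolding good_def[symmetric] by auto
qed

text \<open>
  The paths of \<open>W\<close>, held constant outside \<open>[0,T]\<close> and replaced by \<open>0\<close> off a set of full measure: a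
  version all of whose paths are continuous, hence jointly measurable.
\<close>

definition Wc :: "real \<Rightarrow> 'a \<Rightarrow> real" where
  "Wc t \<omega> = (if \<omega> \<in> good then W (max 0 (min t T)) \<omega> else 0)"

lemma clamp_in: "max 0 (min t T) \<in> {0..T}"
  using T_pos by auto

lemma Wc_continuous: "continuous_on UNIV (\<lambda>t. Wc t \<omega>)"
proof (cases "\<omega> \<in> good")
  case True
  have "continuous_on UNIV (\<lambda>t. W (max 0 (min t T)) \<omega>)"
    by (rule continuous_on_compose2[OF good(3)[OF True]]) (use clamp_in in \<open>auto intro!: continuous_intros\<close>)
  then show ?thesis using True by (simp add: Wc_def)
qed (simp add: Wc_def)

lemma Wc_measurable [measurable]: "Wc t \<in> borel_measurable M"
proof -
  have [measurable]: "W (max 0 (min t T)) \<in> borel_measurable M" by (rule W_measurable[OF clamp_in])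
  have [measurable]: "good \<in> sets M" by (rule good)
  show ?thesis unfolding Wc_def[abs_def] by measurable
qed

lemma Wc_joint: "(\<lambda>x. Wc (fst x) (snd x)) \<in> borel_measurable (borel \<Otimes>\<^sub>M M)"
proof (rule borel_measurable_LIMSEQ_real)
  \<comment> \<open>by continuity of the paths, time may be rounded to a grid of mesh \<open>1 / (n + 1)\<close>\<close>
  let ?r = "\<lambda>n (t::real). real_of_int \<lfloor>t * real (Suc n)\<rfloor> / real (Suc n)"
  show "(\<lambda>x. Wc (?r n (fst x)) (snd x)) \<in> borel_measurable (borel \<Otimes>\<^sub>M M)" for n
  proof (rule measurable_compose_countable[where f = "\<lambda>k x. Wc (real_of_int k / real (Suc n)) (snd x)" and g = "\<lambda>x. \<lfloor>fst x * real (Suc n)\<rfloor>"])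
    show "(\<lambda>x. Wc (real_of_int k / real (Suc n)) (snd x)) \<in> borel_measurable (borel \<Otimes>\<^sub>M M)" for k by measurable
    show "(\<lambda>x. \<lfloor>fst x * real (Suc n)\<rfloor>) \<in> borel \<Otimes>\<^sub>M M \<rightarrow>\<^sub>M count_space UNIV" by measurable
  qed
  fix x :: "real \<times> 'a"
  have "(\<lambda>n. ?r n (fst x)) \<longlonglongrightarrow> fst x"
  proof (rule LIM_zero_cancel, rule Lim_null_comparison[OF always_eventually[OF allI] LIMSEQ_inverse_real_of_nat])
    fix n
    have "\<bar>real_of_int \<lfloor>fst x * real (Suc n)\<rfloor> - fst x * real (Suc n)\<bar> \<le> 1" by linarith
    then have "\<bar>real_of_int \<lfloor>fst x * real (Suc n)\<rfloor> - fst x * real (Suc n)\<bar> / real (Suc n) \<le> 1 / real (Suc n)"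
      by (intro divide_right_mono) auto
    moreover have "?r n (fst x) - fst x = (real_of_int \<lfloor>fst x * real (Suc n)\<rfloor> - fst x * real (Suc n)) / real (Suc n)"
      by (simp add: diff_divide_distrib)
    ultimately show "norm (?r n (fst x) - fst x) \<le> inverse (real (Suc n))"
      by (simp only: real_norm_def abs_divide) (simp add: inverse_eq_divide)
  qed
  then show "(\<lambda>n. Wc (?r n (fst x)) (snd x)) \<longlonglongrightarrow> Wc (fst x) (snd x)"
    by (rule continuous_on_tendsto_compose[OF Wc_continuous]) auto
qed

definition dW :: "real \<Rightarrow> real \<Rightarrow> 'a \<Rightarrow> real" where
  "dW \<epsilon> t \<omega> = Wc (min (t + \<epsilon>) T) \<omega> - Wc t \<omega>"

lemma dW_AE: "AE \<omega> in M. \<forall>t\<in>{0..T}. \<forall>\<epsilon>>0. dW \<epsilon> t \<omega> = W (min (t + \<epsilon>) T) \<omega> - W t \<omega>"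
  using good(2)
proof eventually_elim
  case (elim \<omega>)
  show ?case
  proof (intro ballI allI impI)
    fix t \<epsilon> :: real assume "t \<in> {0..T}" "0 < \<epsilon>"
    then have "max 0 (min (min (t + \<epsilon>) T) T) = min (t + \<epsilon>) T" "max 0 (min t T) = t" using T_pos by auto
    then show "dW \<epsilon> t \<omega> = W (min (t + \<epsilon>) T) \<omega> - W t \<omega>" using elim by (simp add: dW_def Wc_def)
  qed
qed

lemma dW_joint: "(\<lambda>x. dW \<epsilon> (fst x) (snd x)) \<in> borel_measurable Q"
proof -
  have f[measurable]: "fst \<in> borel_measurable Q" unfolding process_measure_eq by (rule time_fst_measurable)
  have s[measurable]: "snd \<in> measurable Q M" unfolding process_measure_eq by (rule measurable_snd)
  have "(\<lambda>x. (min (fst x + \<epsilon>) T, snd x)) \<in> measurable Q (borel \<Otimes>\<^sub>M M)"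
    "(\<lambda>x. (fst x, snd x)) \<in> measurable Q (borel \<Otimes>\<^sub>M M)" by measurable
  from measurable_compose[OF this(1) Wc_joint] measurable_compose[OF this(2) Wc_joint]
  show ?thesis unfolding dW_def by simp
qed

lemma dW_moments:
  assumes "t \<in> {0..T}" "0 < \<epsilon>"
  shows "dW \<epsilon> t \<in> Lp 2 M" "expectation (\<lambda>\<omega>. (dW \<epsilon> t \<omega>)\<^sup>2) \<le> T"
    "wiener (step_function [(1, t, min (t + \<epsilon>) T)]) (dW \<epsilon> t)"
proof -
  have m: "dW \<epsilon> t \<in> borel_measurable M" unfolding dW_def[abs_def] by measurable
  have ae: "AE \<omega> in M. W (min (t + \<epsilon>) T) \<omega> - W t \<omega> = dW \<epsilon> t \<omega>" using dW_AE by eventually_elim (use assms in auto)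
  have r: "0 \<le> t" "t \<le> min (t + \<epsilon>) T" "min (t + \<epsilon>) T \<le> T" using assms by auto
  note i = increment_moments[OF r]
  show "dW \<epsilon> t \<in> Lp 2 M" by (rule Lp2_cong_AE[OF i(1) m ae])
  have "expectation (\<lambda>\<omega>. (dW \<epsilon> t \<omega>)\<^sup>2) = expectation (\<lambda>\<omega>. (W (min (t + \<epsilon>) T) \<omega> - W t \<omega>)\<^sup>2)"
    using ae m Lp2_measurable[OF i(1)] by (intro integral_cong_AE) auto
  then show "expectation (\<lambda>\<omega>. (dW \<epsilon> t \<omega>)\<^sup>2) \<le> T" using i(3) assms by auto
  show "wiener (step_function [(1, t, min (t + \<epsilon>) T)]) (dW \<epsilon> t)"
  proof (rule wiener_cong_AE[OF wiener_step _ m])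
    show "AE \<omega> in M. step_integral W [(1, t, min (t + \<epsilon>) T)] \<omega> = dW \<epsilon> t \<omega>" using ae by eventually_elim simp
  qed (use r in simp)
qed

lemma dW_Lp2:
  assumes "0 < \<epsilon>" shows "(\<lambda>(t, \<omega>). dW \<epsilon> t \<omega>) \<in> Lp 2 Q"
proof -
  have m: "(\<lambda>(t, \<omega>). dW \<epsilon> t \<omega>) \<in> borel_measurable (\<mu> \<Otimes>\<^sub>M M)"
    using dW_joint[of \<epsilon>] by (simp add: case_prod_beta' process_measure_eq)
  have "integrable (\<mu> \<Otimes>\<^sub>M M) (\<lambda>x. ((\<lambda>(t, \<omega>). dW \<epsilon> t \<omega>) x)\<^sup>2)"
  proof (rule Q.Fubini_integrable)
    show "(\<lambda>x. ((\<lambda>(t, \<omega>). dW \<epsilon> t \<omega>) x)\<^sup>2) \<in> borel_measurable (\<mu> \<Otimes>\<^sub>M M)" using m by measurable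
    have e: "(\<integral>y. norm ((case (x, y) of (t, \<omega>) \<Rightarrow> dW \<epsilon> t \<omega>)\<^sup>2) \<partial>M) = expectation (\<lambda>\<omega>. (dW \<epsilon> x \<omega>)\<^sup>2)" for x by simp
    show "integrable \<mu> (\<lambda>x. \<integral>y. norm ((case (x, y) of (t, \<omega>) \<Rightarrow> dW \<epsilon> t \<omega>)\<^sup>2) \<partial>M)"
    proof (rule tm.integrable_const_bound[where B = T])
      show "AE x in \<mu>. norm (\<integral>y. norm ((case (x, y) of (t, \<omega>) \<Rightarrow> dW \<epsilon> t \<omega>)\<^sup>2) \<partial>M) \<le> T"
        unfolding e using dW_moments(2)[OF _ assms] by (intro AE_I2) (simp add: integral_nonneg_AE)
      show "(\<lambda>x. \<integral>y. norm ((case (x, y) of (t, \<omega>) \<Rightarrow> dW \<epsilon> t \<omega>)\<^sup>2) \<partial>M) \<in> borel_measurable \<mu>"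
        by (rule borel_measurable_lebesgue_integral) (use m in measurable)
    qed
    show "AE x in \<mu>. integrable M (\<lambda>y. ((\<lambda>(t, \<omega>). dW \<epsilon> t \<omega>) (x, y))\<^sup>2)"
      using Lp2_square[OF dW_moments(1)[OF _ assms]] by (intro AE_I2) simp
  qed
  then show ?thesis using m by (simp add: Lp2_iff process_measure_eq)
qed

lemma dW_path: "(\<lambda>t. dW \<epsilon> t \<omega>) \<in> Lp 2 \<mu>"
proof -
  have c: "continuous_on UNIV (\<lambda>t. dW \<epsilon> t \<omega>)" unfolding dW_def
    by (intro continuous_intros continuous_on_compose2[OF Wc_continuous]) auto
  have "bounded ((\<lambda>t. dW \<epsilon> t \<omega>) ` {0..T})"
    by (intro compact_imp_bounded compact_continuous_image continuous_on_subset[OF c]) auto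
  then obtain B where "\<forall>t\<in>{0..T}. \<bar>dW \<epsilon> t \<omega>\<bar> \<le> B" by (auto simp: bounded_iff)
  then show ?thesis
    by (intro bounded_time_Lp2[of _ _ B] time_measurable_borel borel_measurable_continuous_onI[OF c]) auto
qed

text \<open>
  The forward approximation of a deterministic integrand.
\<close>

definition pairing :: "real \<Rightarrow> (real \<Rightarrow> real) \<Rightarrow> 'a \<Rightarrow> real" where
  "pairing \<epsilon> g \<omega> = inverse \<epsilon> * (\<integral>t. g t * dW \<epsilon> t \<omega> \<partial>\<mu>)"

lemma pairing_Lp2:
  assumes \<epsilon>: "0 < \<epsilon>" and g: "g \<in> Lp 2 \<mu>"
  shows "pairing \<epsilon> g \<in> Lp 2 M"
proof -
  have [measurable]: "g \<in> borel_measurable \<mu>" using g by measurable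
  have dj: "(\<lambda>(t, \<omega>). dW \<epsilon> t \<omega>) \<in> borel_measurable (\<mu> \<Otimes>\<^sub>M M)"
    using Lp2_measurable[OF dW_Lp2[OF \<epsilon>]] by (simp add: process_measure_eq)
  have sw[measurable]: "(\<lambda>(\<omega>, t). dW \<epsilon> t \<omega>) \<in> borel_measurable (M \<Otimes>\<^sub>M \<mu>)"
    using measurable_compose[OF measurable_pair_swap' dj] by (simp add: case_prod_beta')
  have m: "pairing \<epsilon> g \<in> borel_measurable M" unfolding pairing_def[abs_def]
    by (intro borel_measurable_times borel_measurable_const tm.borel_measurable_lebesgue_integral) measurable
  have i: "integrable M (\<lambda>\<omega>. \<integral>t. (dW \<epsilon> t \<omega>)\<^sup>2 \<partial>\<mu>)"
    using Q.integrable_snd[of "\<lambda>t \<omega>. (dW \<epsilon> t \<omega>)\<^sup>2"] Lp2_square[OF dW_Lp2[OF \<epsilon>]] by (simp add: process_measure_eq case_prod_beta')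
  have b: "(pairing \<epsilon> g \<omega>)\<^sup>2 \<le> (inverse \<epsilon>)\<^sup>2 * (norm2 \<mu> g)\<^sup>2 * (\<integral>t. (dW \<epsilon> t \<omega>)\<^sup>2 \<partial>\<mu>)" for \<omega>
  proof -
    have "\<bar>\<integral>t. g t * dW \<epsilon> t \<omega> \<partial>\<mu>\<bar>\<^sup>2 \<le> (norm2 \<mu> g * norm2 \<mu> (\<lambda>t. dW \<epsilon> t \<omega>))\<^sup>2"
      by (intro power_mono norm2_cauchy_schwarz[OF g dW_path]) auto
    then show ?thesis unfolding pairing_def power_mult_distrib norm2_square[of _ "\<lambda>t. dW \<epsilon> t \<omega>"]
      by (simp add: mult.assoc mult_left_mono)
  qed
  have "integrable M (\<lambda>\<omega>. (pairing \<epsilon> g \<omega>)\<^sup>2)"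
  proof (rule Bochner_Integration.integrable_bound)
    show "integrable M (\<lambda>\<omega>. (inverse \<epsilon>)\<^sup>2 * (norm2 \<mu> g)\<^sup>2 * (\<integral>t. (dW \<epsilon> t \<omega>)\<^sup>2 \<partial>\<mu>))"
      using i by (intro integrable_mult_right)
    show "AE \<omega> in M. norm ((pairing \<epsilon> g \<omega>)\<^sup>2) \<le> norm ((inverse \<epsilon>)\<^sup>2 * (norm2 \<mu> g)\<^sup>2 * (\<integral>t. (dW \<epsilon> t \<omega>)\<^sup>2 \<partial>\<mu>))"
      using b by (intro AE_I2) (auto intro: order_trans[OF b abs_ge_self])
  qed (use m in measurable)
  then show ?thesis using m by (simp add: Lp2_iff)
qed

text \<open>
  Fubini's theorem against a test variable \<open>Y\<close> that pairs with increments like the Wiener integral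
  of \<open>h\<close>. It is applied first to Wiener integrals and then to \<open>pairing \<epsilon> g\<close> itself.
\<close>

lemma pairing_inner:
  assumes \<epsilon>: "0 < \<epsilon>" and g: "g \<in> Lp 2 \<mu>" and h: "h \<in> Lp 2 \<mu>" and Y: "Y \<in> Lp 2 M"
    and inc: "\<And>t. t \<in> {0..T} \<Longrightarrow> expectation (\<lambda>\<omega>. dW \<epsilon> t \<omega> * Y \<omega>)
        = (\<integral>s. step_function [(1, t, min (t + \<epsilon>) T)] s * h s \<partial>\<mu>)"
  shows "expectation (\<lambda>\<omega>. pairing \<epsilon> g \<omega> * Y \<omega>) = (\<integral>s. avg T \<epsilon> g s * h s \<partial>\<mu>)"
proof -
  interpret P: pair_sigma_finite \<mu> \<mu> ..
  have gm[measurable]: "g \<in> borel_measurable \<mu>" using g by measurable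
  have hm[measurable]: "h \<in> borel_measurable \<mu>" using h by measurable
  have i: "integrable (\<mu> \<Otimes>\<^sub>M M) (\<lambda>(t, \<omega>). (g t * Y \<omega>) * dW \<epsilon> t \<omega>)"
    using Lp2_mult_integrable[OF Q.tensor_Lp2[OF g Y] dW_Lp2[OF \<epsilon>, unfolded process_measure_eq]] by (simp add: case_prod_beta')
  have "expectation (\<lambda>\<omega>. pairing \<epsilon> g \<omega> * Y \<omega>) = inverse \<epsilon> * expectation (\<lambda>\<omega>. \<integral>t. (g t * Y \<omega>) * dW \<epsilon> t \<omega> \<partial>\<mu>)"
  proof -
    have "pairing \<epsilon> g \<omega> * Y \<omega> = inverse \<epsilon> * (\<integral>t. (g t * Y \<omega>) * dW \<epsilon> t \<omega> \<partial>\<mu>)" for \<omega>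
    proof -
      have "(\<integral>t. (g t * Y \<omega>) * dW \<epsilon> t \<omega> \<partial>\<mu>) = (\<integral>t. Y \<omega> * (g t * dW \<epsilon> t \<omega>) \<partial>\<mu>)"
        by (simp add: mult_ac)
      then show ?thesis by (simp add: pairing_def)
    qed
    then show ?thesis by simp
  qed
  also have "expectation (\<lambda>\<omega>. \<integral>t. (g t * Y \<omega>) * dW \<epsilon> t \<omega> \<partial>\<mu>)
      = (\<integral>t. expectation (\<lambda>\<omega>. (g t * Y \<omega>) * dW \<epsilon> t \<omega>) \<partial>\<mu>)"
    using Q.Fubini_integral[OF i] .
  also have "\<dots> = (\<integral>t. g t * (\<integral>s. step_function [(1, t, min (t + \<epsilon>) T)] s * h s \<partial>\<mu>) \<partial>\<mu>)"
  proof (rule Bochner_Integration.integral_cong[OF refl])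
    fix t assume "t \<in> space \<mu>"
    then have "expectation (\<lambda>\<omega>. dW \<epsilon> t \<omega> * Y \<omega>) = (\<integral>s. step_function [(1, t, min (t + \<epsilon>) T)] s * h s \<partial>\<mu>)"
      using inc by simp
    moreover have "expectation (\<lambda>\<omega>. (g t * Y \<omega>) * dW \<epsilon> t \<omega>) = g t * expectation (\<lambda>\<omega>. dW \<epsilon> t \<omega> * Y \<omega>)"
      unfolding Bochner_Integration.integral_mult_right_zero[symmetric] by (simp add: mult_ac)
    ultimately show "expectation (\<lambda>\<omega>. (g t * Y \<omega>) * dW \<epsilon> t \<omega>) = g t * (\<integral>s. step_function [(1, t, min (t + \<epsilon>) T)] s * h s \<partial>\<mu>)"
      by simp
  qed
  also have "inverse \<epsilon> * \<dots> = (\<integral>t. \<integral>s. ker \<epsilon> s t * (g t * h s) \<partial>\<mu> \<partial>\<mu>)"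
  proof -
    have "(\<integral>s. ker \<epsilon> s t * (g t * h s) \<partial>\<mu>) = inverse \<epsilon> * (g t * (\<integral>s. step_function [(1, t, min (t + \<epsilon>) T)] s * h s \<partial>\<mu>))" for t
    proof -
      have "(\<integral>s. ker \<epsilon> s t * (g t * h s) \<partial>\<mu>)
          = (\<integral>s. inverse \<epsilon> * (g t * (step_function [(1, t, min (t + \<epsilon>) T)] s * h s)) \<partial>\<mu>)"
        by (intro Bochner_Integration.integral_cong refl) (auto simp: ker_def indicator_def)
      then show ?thesis by simp
    qed
    then show ?thesis by simp
  qed
  also have "\<dots> = (\<integral>s. \<integral>t. ker \<epsilon> s t * (g t * h s) \<partial>\<mu> \<partial>\<mu>)"
  proof -
    have "integrable (\<mu> \<Otimes>\<^sub>M \<mu>) (\<lambda>(s, t). ker \<epsilon> s t * (g t * h s))"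
    proof (rule Bochner_Integration.integrable_bound)
      show "integrable (\<mu> \<Otimes>\<^sub>M \<mu>) (\<lambda>x. inverse \<epsilon> * (\<lambda>(s, t). h s * g t) x)"
        by (intro integrable_mult_right P.tensor_integral time_Lp2_integrable g h)
      show "AE x in \<mu> \<Otimes>\<^sub>M \<mu>. norm (case x of (s, t) \<Rightarrow> ker \<epsilon> s t * (g t * h s))
          \<le> norm (inverse \<epsilon> * (\<lambda>(s, t). h s * g t) x)"
        using abs_ker_le[OF \<epsilon>] \<epsilon> by (intro AE_I2) (auto simp: abs_mult mult.commute intro!: mult_right_mono mult_left_mono)
    qed measurable
    from P.Fubini_integral[OF this] show ?thesis by simp
  qed
  also have "\<dots> = (\<integral>s. avg T \<epsilon> g s * h s \<partial>\<mu>)"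
    unfolding avg_def Bochner_Integration.integral_mult_left_zero[symmetric] by (simp add: mult_ac)
  finally show ?thesis .
qed

text \<open>
  The stochastic Fubini theorem \<open>\<epsilon>\<^sup>-\<^sup>1 \<integral> g(t) (W(t + \<epsilon>) - W(t)) dt = W(avg g)\<close>, without exchanging
  integrals pathwise: the pairing and the Wiener integral of the average have the same inner
  products with each other and with themselves, so their difference has norm zero.
\<close>

theorem wiener_pairing:
  assumes \<epsilon>: "0 < \<epsilon>" and g: "g \<in> Lp 2 \<mu>"
  shows "wiener (avg T \<epsilon> g) (pairing \<epsilon> g)"
proof -
  note aL = avg_contraction(1)[OF \<epsilon> g] and pL = pairing_Lp2[OF \<epsilon> g]
  obtain Z where Z: "wiener (avg T \<epsilon> g) Z" using wiener_exists[OF aL] by blast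
  note ZL = wiener_Lp2(2)[OF Z]
  have wie: "expectation (\<lambda>\<omega>. pairing \<epsilon> g \<omega> * Y \<omega>) = (\<integral>s. avg T \<epsilon> g s * h s \<partial>\<mu>)"
    if Y: "wiener h Y" for h Y
    by (rule pairing_inner[OF \<epsilon> g wiener_Lp2[OF Y]]) (rule wiener_isometry[OF dW_moments(3)[OF _ \<epsilon>] Y])
  have pp: "expectation (\<lambda>\<omega>. pairing \<epsilon> g \<omega> * pairing \<epsilon> g \<omega>) = (\<integral>s. avg T \<epsilon> g s * avg T \<epsilon> g s \<partial>\<mu>)"
  proof (rule pairing_inner[OF \<epsilon> g aL pL])
    fix t assume t: "t \<in> {0..T}"
    show "expectation (\<lambda>\<omega>. dW \<epsilon> t \<omega> * pairing \<epsilon> g \<omega>) = (\<integral>s. step_function [(1, t, min (t + \<epsilon>) T)] s * avg T \<epsilon> g s \<partial>\<mu>)"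
      using wie[OF dW_moments(3)[OF t \<epsilon>]] by (simp add: mult.commute)
  qed
  have ZZ: "expectation (\<lambda>\<omega>. Z \<omega> * Z \<omega>) = (\<integral>s. avg T \<epsilon> g s * avg T \<epsilon> g s \<partial>\<mu>)" by (rule wiener_isometry[OF Z Z])
  have "(norm2 M (\<lambda>\<omega>. Z \<omega> - pairing \<epsilon> g \<omega>))\<^sup>2 = expectation (\<lambda>\<omega>. Z \<omega> * Z \<omega> - 2 * (pairing \<epsilon> g \<omega> * Z \<omega>) + pairing \<epsilon> g \<omega> * pairing \<epsilon> g \<omega>)"
    unfolding norm2_inner by (simp add: algebra_simps)
  also have "\<dots> = 0"
    using Lp2_mult_integrable[OF ZL ZL] Lp2_mult_integrable[OF pL ZL] Lp2_mult_integrable[OF pL pL] ZZ wie[OF Z] pp by simp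
  finally have "norm2 M (\<lambda>\<omega>. Z \<omega> - pairing \<epsilon> g \<omega>) = 0" by simp
  from norm2_eq_0_AE[OF Lp2_diff[OF ZL pL] this] have "AE \<omega> in M. Z \<omega> = pairing \<epsilon> g \<omega>" by simp
  then show ?thesis by (rule wiener_cong_AE[OF Z _ Lp2_measurable[OF pL]])
qed

end

section \<open>Forward approximation, averaged trace and Skorohod integral\<close>

lemma (in pair_sigma_finite) fst_integral_contraction:
  fixes f g :: "'a \<times> 'b \<Rightarrow> real"
  assumes f: "integrable (M1 \<Otimes>\<^sub>M M2) f" and g: "integrable (M1 \<Otimes>\<^sub>M M2) g"
  shows "(\<integral>x. \<bar>(\<integral>y. f (x, y) \<partial>M2) - (\<integral>y. g (x, y) \<partial>M2)\<bar> \<partial>M1) \<le> (\<integral>z. \<bar>f z - g z\<bar> \<partial>(M1 \<Otimes>\<^sub>M M2))"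
proof -
  have d: "integrable (M1 \<Otimes>\<^sub>M M2) (\<lambda>z. \<bar>f z - g z\<bar>)" using f g by simp
  have "(\<integral>x. \<bar>(\<integral>y. f (x, y) \<partial>M2) - (\<integral>y. g (x, y) \<partial>M2)\<bar> \<partial>M1) \<le> (\<integral>x. (\<integral>y. \<bar>f (x, y) - g (x, y)\<bar> \<partial>M2) \<partial>M1)"
  proof (rule integral_mono_AE)
    show "integrable M1 (\<lambda>x. \<bar>(\<integral>y. f (x, y) \<partial>M2) - (\<integral>y. g (x, y) \<partial>M2)\<bar>)"
      using integrable_fst'[OF f] integrable_fst'[OF g] by simp
    show "integrable M1 (\<lambda>x. \<integral>y. \<bar>f (x, y) - g (x, y)\<bar> \<partial>M2)" using integrable_fst'[OF d] .
    show "AE x in M1. \<bar>(\<integral>y. f (x, y) \<partial>M2) - (\<integral>y. g (x, y) \<partial>M2)\<bar> \<le> (\<integral>y. \<bar>f (x, y) - g (x, y)\<bar> \<partial>M2)"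
      using AE_integrable_fst'[OF f] AE_integrable_fst'[OF g]
    proof eventually_elim
      case (elim x)
      then show ?case using integral_abs_bound[of M2 "\<lambda>y. f (x, y) - g (x, y)"] by simp
    qed
  qed
  also have "\<dots> = (\<integral>z. \<bar>f z - g z\<bar> \<partial>(M1 \<Otimes>\<^sub>M M2))" using integral_fst'[OF d] .
  finally show ?thesis .
qed

lemma (in pair_sigma_finite) snd_integral_contraction:
  fixes f g :: "'a \<Rightarrow> 'b \<Rightarrow> real"
  assumes f: "integrable (M1 \<Otimes>\<^sub>M M2) (case_prod f)" and g: "integrable (M1 \<Otimes>\<^sub>M M2) (case_prod g)"
  shows "(\<integral>y. \<bar>(\<integral>x. f x y \<partial>M1) - (\<integral>x. g x y \<partial>M1)\<bar> \<partial>M2) \<le> (\<integral>z. \<bar>case_prod f z - case_prod g z\<bar> \<partial>(M1 \<Otimes>\<^sub>M M2))"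
proof -
  have d: "integrable (M1 \<Otimes>\<^sub>M M2) (\<lambda>(x, y). \<bar>f x y - g x y\<bar>)" using f g by (simp add: case_prod_beta')
  have "(\<integral>y. \<bar>(\<integral>x. f x y \<partial>M1) - (\<integral>x. g x y \<partial>M1)\<bar> \<partial>M2) \<le> (\<integral>y. (\<integral>x. \<bar>f x y - g x y\<bar> \<partial>M1) \<partial>M2)"
  proof (rule integral_mono_AE)
    show "integrable M2 (\<lambda>y. \<bar>(\<integral>x. f x y \<partial>M1) - (\<integral>x. g x y \<partial>M1)\<bar>)"
      using integrable_snd[OF f] integrable_snd[OF g] by simp
    show "integrable M2 (\<lambda>y. \<integral>x. \<bar>f x y - g x y\<bar> \<partial>M1)" using integrable_snd[OF d] .
    show "AE y in M2. \<bar>(\<integral>x. f x y \<partial>M1) - (\<integral>x. g x y \<partial>M1)\<bar> \<le> (\<integral>x. \<bar>f x y - g x y\<bar> \<partial>M1)"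
      using AE_integrable_snd[OF f] AE_integrable_snd[OF g]
    proof eventually_elim
      case (elim y)
      then show ?case using integral_abs_bound[of M1 "\<lambda>x. f x y - g x y"] by simp
    qed
  qed
  also have "\<dots> = (\<integral>z. \<bar>case_prod f z - case_prod g z\<bar> \<partial>(M1 \<Otimes>\<^sub>M M2))"
    using integral_snd[OF d] by (simp add: case_prod_beta')
  finally show ?thesis .
qed

lemma (in pair_sigma_finite) swap_Lp2:
  assumes f: "f \<in> Lp 2 (M1 \<Otimes>\<^sub>M M2)"
  shows "(\<lambda>(y, x). f (x, y)) \<in> Lp 2 (M2 \<Otimes>\<^sub>M M1)" "norm2 (M2 \<Otimes>\<^sub>M M1) (\<lambda>(y, x). f (x, y)) = norm2 (M1 \<Otimes>\<^sub>M M2) f"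
proof -
  have [measurable]: "f \<in> borel_measurable (M1 \<Otimes>\<^sub>M M2)" using f by measurable
  have e: "(\<lambda>z. (case z of (y, x) \<Rightarrow> f (x, y))\<^sup>2) = (\<lambda>(y, x). (f (x, y))\<^sup>2)" by (auto simp: fun_eq_iff)
  have "integrable (M2 \<Otimes>\<^sub>M M1) (\<lambda>(y, x). (f (x, y))\<^sup>2)"
    using integrable_product_swap[OF Lp2_square[OF f]] .
  then show "(\<lambda>(y, x). f (x, y)) \<in> Lp 2 (M2 \<Otimes>\<^sub>M M1)" unfolding Lp2_iff e
    using measurable_compose[OF measurable_pair_swap' \<open>f \<in> borel_measurable (M1 \<Otimes>\<^sub>M M2)\<close>] by (simp add: case_prod_beta')
  show "norm2 (M2 \<Otimes>\<^sub>M M1) (\<lambda>(y, x). f (x, y)) = norm2 (M1 \<Otimes>\<^sub>M M2) f"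
    unfolding norm2_def e using integral_product_swap[of "\<lambda>z. (f z)\<^sup>2"] by simp
qed

lemma (in pair_sigma_finite) norm2_fst:
  assumes f: "f \<in> Lp 2 (M1 \<Otimes>\<^sub>M M2)"
  shows "(norm2 (M1 \<Otimes>\<^sub>M M2) f)\<^sup>2 = (\<integral>x. (norm2 M2 (\<lambda>y. f (x, y)))\<^sup>2 \<partial>M1)"
    "integrable M1 (\<lambda>x. (norm2 M2 (\<lambda>y. f (x, y)))\<^sup>2)"
  unfolding norm2_square using integral_fst'[OF Lp2_square[OF f]] integrable_fst'[OF Lp2_square[OF f]] by simp_all

text \<open>
  Averaging in the last variable of a product space inherits contraction and convergence from the
  sections; the squared norms of the sections are dominated, so convergence survives integration
  over the first factor.
\<close>

lemma avg_product:
  assumes P: "pair_sigma_finite N (time_measure T)" and f: "f \<in> Lp 2 (N \<Otimes>\<^sub>M time_measure T)"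
    and path: "\<And>x. (\<lambda>t. f (x, t)) \<in> Lp 2 (time_measure T)"
    and a: "\<And>\<epsilon>. 0 < \<epsilon> \<Longrightarrow> (\<lambda>(x, t). avg T \<epsilon> (\<lambda>r. f (x, r)) t) \<in> Lp 2 (N \<Otimes>\<^sub>M time_measure T)"
  shows "0 < \<epsilon> \<Longrightarrow> norm2 (N \<Otimes>\<^sub>M time_measure T) (\<lambda>(x, t). avg T \<epsilon> (\<lambda>r. f (x, r)) t) \<le> norm2 (N \<Otimes>\<^sub>M time_measure T) f"
    "0 < T \<Longrightarrow> (\<And>k. 0 < e k) \<Longrightarrow> e \<longlonglongrightarrow> 0 \<Longrightarrow>
      (\<lambda>k. norm2 (N \<Otimes>\<^sub>M time_measure T) (\<lambda>z. (\<lambda>(x, t). avg T (e k) (\<lambda>r. f (x, r)) t) z - f z)) \<longlonglongrightarrow> 0"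
proof -
  interpret pair_sigma_finite N "time_measure T" by (rule P)
  { assume \<epsilon>: "0 < \<epsilon>"
    have "(norm2 (N \<Otimes>\<^sub>M time_measure T) (\<lambda>(x, t). avg T \<epsilon> (\<lambda>r. f (x, r)) t))\<^sup>2 \<le> (norm2 (N \<Otimes>\<^sub>M time_measure T) f)\<^sup>2"
      unfolding norm2_fst(1)[OF f] norm2_fst(1)[OF a[OF \<epsilon>]] using norm2_fst(2)[OF f] norm2_fst(2)[OF a[OF \<epsilon>]]
      by (intro integral_mono) (auto intro!: power_mono avg_contraction(2)[OF \<epsilon> path])
    then show "norm2 (N \<Otimes>\<^sub>M time_measure T) (\<lambda>(x, t). avg T \<epsilon> (\<lambda>r. f (x, r)) t) \<le> norm2 (N \<Otimes>\<^sub>M time_measure T) f"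
      by (rule power2_le_imp_le) simp }
  { assume T: "0 < T" and e: "\<And>k. 0 < e k" "e \<longlonglongrightarrow> 0"
    have d: "(\<lambda>z. (\<lambda>(x, t). avg T (e k) (\<lambda>r. f (x, r)) t) z - f z) \<in> Lp 2 (N \<Otimes>\<^sub>M time_measure T)" for k
      using a[OF e(1)] f by (rule Lp2_diff)
    have "(\<lambda>k. \<integral>x. (norm2 (time_measure T) (\<lambda>t. avg T (e k) (\<lambda>r. f (x, r)) t - f (x, t)))\<^sup>2 \<partial>N) \<longlonglongrightarrow> (\<integral>x. 0 \<partial>N)"
    proof (rule integral_dominated_convergence[where w = "\<lambda>x. 4 * (norm2 (time_measure T) (\<lambda>t. f (x, t)))\<^sup>2"])
      show "integrable N (\<lambda>x. 4 * (norm2 (time_measure T) (\<lambda>t. f (x, t)))\<^sup>2)" using norm2_fst(2)[OF f] by simp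
      show "(\<lambda>x. (norm2 (time_measure T) (\<lambda>t. avg T (e k) (\<lambda>r. f (x, r)) t - f (x, t)))\<^sup>2) \<in> borel_measurable N" for k
        using norm2_fst(2)[OF d[of k]] by (simp add: borel_measurable_integrable)
      show "AE x in N. (\<lambda>k. (norm2 (time_measure T) (\<lambda>t. avg T (e k) (\<lambda>r. f (x, r)) t - f (x, t)))\<^sup>2) \<longlonglongrightarrow> 0"
      proof (rule AE_I2)
        fix x
        from tendsto_power[OF conv2D(3)[OF avg_conv[OF T e path[of x]]], of 2]
        show "(\<lambda>k. (norm2 (time_measure T) (\<lambda>t. avg T (e k) (\<lambda>r. f (x, r)) t - f (x, t)))\<^sup>2) \<longlonglongrightarrow> 0" by simp
      qed
      show "AE x in N. norm ((norm2 (time_measure T) (\<lambda>t. avg T (e k) (\<lambda>r. f (x, r)) t - f (x, t)))\<^sup>2)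
          \<le> 4 * (norm2 (time_measure T) (\<lambda>t. f (x, t)))\<^sup>2" for k
      proof (rule AE_I2)
        fix x
        have "norm2 (time_measure T) (\<lambda>t. avg T (e k) (\<lambda>r. f (x, r)) t - f (x, t)) \<le> 2 * norm2 (time_measure T) (\<lambda>t. f (x, t))"
          using norm2_triangle_diff[OF avg_contraction(1)[OF e(1)[of k] path[of x]] path[of x]] avg_contraction(2)[OF e(1)[of k] path[of x]] by simp
        then have "(norm2 (time_measure T) (\<lambda>t. avg T (e k) (\<lambda>r. f (x, r)) t - f (x, t)))\<^sup>2 \<le> (2 * norm2 (time_measure T) (\<lambda>t. f (x, t)))\<^sup>2"
          by (intro power_mono) auto
        then show "norm ((norm2 (time_measure T) (\<lambda>t. avg T (e k) (\<lambda>r. f (x, r)) t - f (x, t)))\<^sup>2)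
          \<le> 4 * (norm2 (time_measure T) (\<lambda>t. f (x, t)))\<^sup>2" by (simp add: power_mult_distrib)
      qed
    qed simp
    then have "(\<lambda>k. (norm2 (N \<Otimes>\<^sub>M time_measure T) (\<lambda>z. (\<lambda>(x, t). avg T (e k) (\<lambda>r. f (x, r)) t) z - f z))\<^sup>2) \<longlonglongrightarrow> 0"
      unfolding norm2_fst(1)[OF d] by simp
    from tendsto_real_sqrt[OF this]
    show "(\<lambda>k. norm2 (N \<Otimes>\<^sub>M time_measure T) (\<lambda>z. (\<lambda>(x, t). avg T (e k) (\<lambda>r. f (x, r)) t) z - f z)) \<longlonglongrightarrow> 0" by simp }
qed

lemma norm2_mult_le:
  assumes f: "f \<in> Lp 2 N" and b: "b \<in> borel_measurable N" "\<And>x. x \<in> space N \<Longrightarrow> \<bar>b x\<bar> \<le> (1::real)"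
  shows "norm2 N (\<lambda>x. b x * f x) \<le> norm2 N f"
proof -
  have L: "(\<lambda>x. b x * f x) \<in> Lp 2 N" by (rule Lp2_bounded_mult[OF f b])
  have "(\<integral>x. (b x * f x)\<^sup>2 \<partial>N) \<le> (\<integral>x. (f x)\<^sup>2 \<partial>N)"
  proof (rule integral_mono[OF Lp2_square[OF L] Lp2_square[OF f]])
    fix x assume "x \<in> space N"
    then have "\<bar>b x\<bar>\<^sup>2 \<le> 1\<^sup>2" by (intro power_mono b) auto
    then show "(b x * f x)\<^sup>2 \<le> (f x)\<^sup>2" by (simp add: power_mult_distrib mult_left_le_one_le)
  qed
  then show ?thesis by (simp add: norm2_def)
qed

lemma norm2_mult_diff_le:
  assumes f: "f \<in> Lp 2 N" and g: "g \<in> Lp 2 N" and b: "b \<in> borel_measurable N" "\<And>x. x \<in> space N \<Longrightarrow> \<bar>b x\<bar> \<le> (1::real)"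
  shows "norm2 N (\<lambda>x. b x * f x - b x * g x) \<le> norm2 N (\<lambda>x. f x - g x)"
  unfolding right_diff_distrib[symmetric] by (rule norm2_mult_le[OF Lp2_diff[OF f g] b])

context brownian
begin

lemma norm1_le_norm2: "Z \<in> Lp 2 M \<Longrightarrow> expectation (\<lambda>\<omega>. \<bar>Z \<omega>\<bar>) \<le> norm2 M Z"
  using norm2_cauchy_schwarz_abs[of Z M "\<lambda>_. 1"] by (simp add: norm2_def prob_space)

sublocale Qf: finite_measure Q
  unfolding process_measure_eq by (rule finite_measure_pair_measure) unfold_locales

sublocale QT: pair_sigma_finite Q \<mu> ..

sublocale MT: pair_sigma_finite M \<mu> ..

sublocale QTf: finite_measure "Q \<Otimes>\<^sub>M \<mu>"
  by (rule finite_measure_pair_measure) unfold_locales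

text \<open>
  The derivative acts on \<open>\<omega>\<close> only, so it commutes with multiplication by an indicator of the time
  variable \<open>t\<close>, and multiplication by an indicator is a contraction.
\<close>

lemma cutoff_process_deriv:
  assumes "process_deriv T M W u Du"
  shows "process_deriv T M W (cutoff u r) (\<lambda>s t \<omega>. Du s t \<omega> * indicator {0..r} t)"
proof -
  let ?N = "\<mu> \<Otimes>\<^sub>M Q"
  obtain v Dv where uL: "case_prod u \<in> Lp 2 Q" and DuL: "(\<lambda>(s, t, \<omega>). Du s t \<omega>) \<in> Lp 2 ?N"
    and s: "\<And>n::nat. smooth_process_deriv T M W (v n) (Dv n)"
    and c: "tendsto_Lp 2 Q (\<lambda>n. case_prod (v n)) (case_prod u) sequentially"
      "tendsto_Lp 2 ?N (\<lambda>n (s, t, \<omega>). Dv n s t \<omega>) (\<lambda>(s, t, \<omega>). Du s t \<omega>) sequentially"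
    using assms unfolding process_deriv_def by blast
  have smooth: "smooth_process_deriv T M W (cutoff v r) (\<lambda>s t \<omega>. Dv s t \<omega> * indicator {0..r} t)"
    if vD: "smooth_process_deriv T M W v Dv" for v Dv
  proof -
    obtain m :: nat and F DF g where a: "\<And>j. j < m \<Longrightarrow> smooth_deriv T M W (F j) (DF j)" "\<And>j. j < m \<Longrightarrow> g j \<in> Lp 2 \<mu>"
      "v = (\<lambda>t \<omega>. \<Sum>j<m. F j \<omega> * g j t)" "Dv = (\<lambda>s t \<omega>. \<Sum>j<m. DF j s \<omega> * g j t)"
      using vD unfolding smooth_process_deriv_def by blast
    have L: "(\<lambda>t. g j t * indicator {0..r} t) \<in> Lp 2 \<mu>" if "j < m" for j
      by (subst mult.commute, rule Lp2_bounded_mult[OF a(2)[OF that], where B = 1]) (auto intro: time_measurable_borel split: split_indicator)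
    have "cutoff v r = (\<lambda>t \<omega>. \<Sum>j<m. F j \<omega> * (g j t * indicator {0..r} t))"
      "(\<lambda>s t \<omega>. Dv s t \<omega> * indicator {0..r} t) = (\<lambda>s t \<omega>. \<Sum>j<m. DF j s \<omega> * (g j t * indicator {0..r} t))"
      unfolding a(3,4) by (simp_all add: cutoff_def sum_distrib_right mult.assoc fun_eq_iff)
    then show ?thesis unfolding smooth_process_deriv_def
      by (intro exI[of _ m] exI[of _ F] exI[of _ DF] exI[of _ "\<lambda>j t. g j t * indicator {0..r} t"]) (simp add: a(1) L)
  qed
  have bQ: "(\<lambda>x. indicator {0..r} (fst x) :: real) \<in> borel_measurable Q"
    unfolding process_measure_eq by (rule measurable_compose[OF time_fst_measurable]) simp
  have bN: "(\<lambda>x. indicator {0..r} (fst (snd x)) :: real) \<in> borel_measurable ?N"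
    by (rule measurable_compose[OF measurable_snd bQ])
  have eQ: "case_prod (cutoff v r) = (\<lambda>x. indicator {0..r} (fst x) * case_prod v x)" for v
    by (auto simp: cutoff_def fun_eq_iff)
  have eN: "(\<lambda>(s, t, \<omega>). Dv s t \<omega> * indicator {0..r} t) = (\<lambda>x. indicator {0..r} (fst (snd x)) * (\<lambda>(s, t, \<omega>). Dv s t \<omega>) x)"
    for Dv :: "real \<Rightarrow> real \<Rightarrow> 'a \<Rightarrow> real" by (auto simp: fun_eq_iff)
  have LQ: "case_prod (cutoff v r) \<in> Lp 2 Q" if "case_prod v \<in> Lp 2 Q" for v
    unfolding eQ by (rule Lp2_bounded_mult[OF that bQ, where B = 1]) (simp split: split_indicator)
  have LN: "(\<lambda>(s, t, \<omega>). Dv s t \<omega> * indicator {0..r} t) \<in> Lp 2 ?N" if "(\<lambda>(s, t, \<omega>). Dv s t \<omega>) \<in> Lp 2 ?N"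
    for Dv :: "real \<Rightarrow> real \<Rightarrow> 'a \<Rightarrow> real"
    unfolding eN by (rule Lp2_bounded_mult[OF that bN, where B = 1]) (simp split: split_indicator)
  have vL: "case_prod (v n) \<in> Lp 2 Q" "(\<lambda>(s, t, \<omega>). Dv n s t \<omega>) \<in> Lp 2 ?N" for n
    using smooth_skorohod_exists[OF s[of n]] smooth_skorohod_bound(2,3) by blast+
  have cv: "conv2 Q (\<lambda>n. case_prod (v n)) (case_prod u) sequentially" by (rule tendsto_Lp2_iff[THEN iffD1, OF vL(1) uL c(1)])
  have cDv: "conv2 ?N (\<lambda>n (s, t, \<omega>). Dv n s t \<omega>) (\<lambda>(s, t, \<omega>). Du s t \<omega>) sequentially"
    by (rule tendsto_Lp2_iff[THEN iffD1, OF vL(2) DuL c(2)])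
  have 1: "conv2 Q (\<lambda>n. case_prod (cutoff (v n) r)) (case_prod (cutoff u r)) sequentially"
  proof (rule conv2_bound[OF LQ[OF vL(1)] LQ[OF uL] conv2D(3)[OF cv]])
    fix n
    show "norm2 Q (\<lambda>x. case_prod (cutoff (v n) r) x - case_prod (cutoff u r) x) \<le> norm2 Q (\<lambda>x. case_prod (v n) x - case_prod u x)"
      unfolding eQ by (rule norm2_mult_diff_le[OF vL(1) uL bQ]) (simp split: split_indicator)
  qed
  have 2: "conv2 ?N (\<lambda>n (s, t, \<omega>). Dv n s t \<omega> * indicator {0..r} t) (\<lambda>(s, t, \<omega>). Du s t \<omega> * indicator {0..r} t) sequentially"
  proof (rule conv2_bound[OF LN[OF vL(2)] LN[OF DuL] conv2D(3)[OF cDv]])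
    fix n
    show "norm2 ?N (\<lambda>x. (\<lambda>(s, t, \<omega>). Dv n s t \<omega> * indicator {0..r} t) x - (\<lambda>(s, t, \<omega>). Du s t \<omega> * indicator {0..r} t) x)
       \<le> norm2 ?N (\<lambda>x. (\<lambda>(s, t, \<omega>). Dv n s t \<omega>) x - (\<lambda>(s, t, \<omega>). Du s t \<omega>) x)"
      unfolding eN by (rule norm2_mult_diff_le[OF vL(2) DuL bN]) (simp split: split_indicator)
  qed
  show ?thesis unfolding process_deriv_def
  proof (intro conjI exI[of _ "\<lambda>n. cutoff (v n) r"] exI[of _ "\<lambda>n s t \<omega>. Dv n s t \<omega> * indicator {0..r} t"] allI)
    show "smooth_process_deriv T M W (cutoff (v n) r) (\<lambda>s t \<omega>. Dv n s t \<omega> * indicator {0..r} t)" for n by (rule smooth[OF s])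
    show "tendsto_Lp 2 Q (\<lambda>n. case_prod (cutoff (v n) r)) (case_prod (cutoff u r)) sequentially"
      by (rule tendsto_Lp2_iff[THEN iffD2, OF LQ[OF vL(1)] LQ[OF uL] 1])
    show "tendsto_Lp 2 ?N (\<lambda>n (s, t, \<omega>). Dv n s t \<omega> * indicator {0..r} t) (\<lambda>(s, t, \<omega>). Du s t \<omega> * indicator {0..r} t) sequentially"
      by (rule tendsto_Lp2_iff[THEN iffD2, OF LN[OF vL(2)] LN[OF DuL] 2])
  qed (rule LQ[OF uL], rule LN[OF DuL])
qed

text \<open>
  The forward approximation computed from the continuous version of the paths.
\<close>

definition fwd :: "real \<Rightarrow> (real \<Rightarrow> 'a \<Rightarrow> real) \<Rightarrow> 'a \<Rightarrow> real" where
  "fwd \<epsilon> u \<omega> = inverse \<epsilon> * (\<integral>t. u t \<omega> * dW \<epsilon> t \<omega> \<partial>\<mu>)"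

text \<open>
  The averaged trace \<open>\<integral> \<epsilon>\<^sup>-\<^sup>1 \<integral>\<^bsub>[s-\<epsilon>,s)\<^esub> D\<^sub>s u\<^sub>t dt ds\<close> that is to converge to the integral of \<open>D\<^sup>-u\<close>.
\<close>

definition trace_avg :: "real \<Rightarrow> (real \<Rightarrow> real \<Rightarrow> 'a \<Rightarrow> real) \<Rightarrow> 'a \<Rightarrow> real" where
  "trace_avg \<epsilon> Du \<omega> = (\<integral>s. avg T \<epsilon> (\<lambda>t. Du s t \<omega>) s \<partial>\<mu>)"

lemma forward_approx_AE:
  assumes "0 < \<epsilon>" shows "AE \<omega> in M. forward_approx T W u \<epsilon> \<omega> = fwd \<epsilon> u \<omega>"
  using dW_AE
proof eventually_elim
  case (elim \<omega>)
  have "(\<integral>t. u t \<omega> * dW \<epsilon> t \<omega> \<partial>\<mu>) = (\<integral>t. u t \<omega> * (W (min (t + \<epsilon>) T) \<omega> - W t \<omega>) \<partial>\<mu>)"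
    using elim assms by (intro Bochner_Integration.integral_cong) auto
  then show ?case by (simp add: forward_approx_def fwd_def time_integral)
qed

text \<open>
  For fixed \<open>\<epsilon>\<close> the forward approximation is continuous from \<open>L\<^sup>2\<close> to \<open>L\<^sup>1\<close>. The constant blows up
  as \<open>\<epsilon>\<close> tends to zero, so this serves only to pass from smooth to general processes at fixed \<open>\<epsilon>\<close>.
\<close>

lemma fwd_contraction:
  assumes \<epsilon>: "0 < \<epsilon>" and u: "case_prod u \<in> Lp 2 Q" and v: "case_prod v \<in> Lp 2 Q"
  shows "integrable M (fwd \<epsilon> u)"
    "expectation (\<lambda>\<omega>. \<bar>fwd \<epsilon> u \<omega> - fwd \<epsilon> v \<omega>\<bar>) \<le> inverse \<epsilon> * (norm2 Q (\<lambda>x. case_prod u x - case_prod v x)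
        * norm2 Q (\<lambda>(t, \<omega>). dW \<epsilon> t \<omega>))"
proof -
  note dL = dW_Lp2[OF \<epsilon>]
  have i: "integrable (\<mu> \<Otimes>\<^sub>M M) (\<lambda>(t, \<omega>). u t \<omega> * dW \<epsilon> t \<omega>)" if "case_prod u \<in> Lp 2 Q" for u
    using Lp2_mult_integrable[OF that dL] by (simp add: process_measure_eq case_prod_beta')
  show "integrable M (fwd \<epsilon> u)" unfolding fwd_def[abs_def] using Q.integrable_snd[OF i[OF u]] by simp
  have "expectation (\<lambda>\<omega>. \<bar>fwd \<epsilon> u \<omega> - fwd \<epsilon> v \<omega>\<bar>)
     = inverse \<epsilon> * expectation (\<lambda>\<omega>. \<bar>(\<integral>t. u t \<omega> * dW \<epsilon> t \<omega> \<partial>\<mu>) - (\<integral>t. v t \<omega> * dW \<epsilon> t \<omega> \<partial>\<mu>)\<bar>)"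
    unfolding fwd_def right_diff_distrib[symmetric] abs_mult using \<epsilon> by simp
  also have "\<dots> \<le> inverse \<epsilon> * (\<integral>z. \<bar>(\<lambda>(t, \<omega>). u t \<omega> * dW \<epsilon> t \<omega>) z - (\<lambda>(t, \<omega>). v t \<omega> * dW \<epsilon> t \<omega>) z\<bar> \<partial>(\<mu> \<Otimes>\<^sub>M M))"
    using \<epsilon> by (intro mult_left_mono Q.snd_integral_contraction i u v) auto
  also have "(\<integral>z. \<bar>(\<lambda>(t, \<omega>). u t \<omega> * dW \<epsilon> t \<omega>) z - (\<lambda>(t, \<omega>). v t \<omega> * dW \<epsilon> t \<omega>) z\<bar> \<partial>(\<mu> \<Otimes>\<^sub>M M))
     = (\<integral>z. \<bar>(case_prod u z - case_prod v z) * (\<lambda>(t, \<omega>). dW \<epsilon> t \<omega>) z\<bar> \<partial>Q)"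
    unfolding process_measure_eq by (intro Bochner_Integration.integral_cong) (auto simp: left_diff_distrib)
  also have "\<dots> \<le> norm2 Q (\<lambda>x. case_prod u x - case_prod v x) * norm2 Q (\<lambda>(t, \<omega>). dW \<epsilon> t \<omega>)"
    by (rule norm2_cauchy_schwarz_abs[OF Lp2_diff[OF u v] dL])
  finally show "expectation (\<lambda>\<omega>. \<bar>fwd \<epsilon> u \<omega> - fwd \<epsilon> v \<omega>\<bar>) \<le> inverse \<epsilon> * (norm2 Q (\<lambda>x. case_prod u x - case_prod v x)
        * norm2 Q (\<lambda>(t, \<omega>). dW \<epsilon> t \<omega>))" using \<epsilon> by (simp add: mult_left_mono)
qed

text \<open>
  The derivative lives on \<open>(s, (t, \<omega>))\<close>, whereas averages act on \<open>t\<close> for fixed \<open>(s, \<omega>)\<close>.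
\<close>

definition regroup :: "(real \<times> real \<times> 'a \<Rightarrow> real) \<Rightarrow> (real \<times> 'a) \<times> real \<Rightarrow> real" where
  "regroup f = (\<lambda>((s, \<omega>), t). f (s, t, \<omega>))"

lemma regroup_map_measurable: "(\<lambda>((s, \<omega>), t). (s, t, \<omega>)) \<in> measurable (Q \<Otimes>\<^sub>M \<mu>) (\<mu> \<Otimes>\<^sub>M Q)"
proof -
  have "(\<lambda>z. (fst (fst z), snd z, snd (fst z))) \<in> measurable (Q \<Otimes>\<^sub>M \<mu>) (\<mu> \<Otimes>\<^sub>M Q)"
    unfolding process_measure_eq
    by (intro measurable_Pair measurable_snd measurable_compose[OF measurable_fst measurable_fst] measurable_compose[OF measurable_fst measurable_snd])
  then show ?thesis by (simp add: case_prod_beta')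
qed

lemma regroup_nn_integral:
  fixes \<phi> :: "real \<times> real \<times> 'a \<Rightarrow> ennreal"
  assumes \<phi>[measurable]: "\<phi> \<in> borel_measurable (\<mu> \<Otimes>\<^sub>M Q)"
  shows "(\<integral>\<^sup>+z. (\<lambda>((s, \<omega>), t). \<phi> (s, t, \<omega>)) z \<partial>(Q \<Otimes>\<^sub>M \<mu>)) = (\<integral>\<^sup>+z. \<phi> z \<partial>(\<mu> \<Otimes>\<^sub>M Q))"
proof -
  have m: "(\<lambda>((s, \<omega>), t). \<phi> (s, t, \<omega>)) \<in> borel_measurable (Q \<Otimes>\<^sub>M \<mu>)"
    using measurable_compose[OF regroup_map_measurable \<phi>] by (simp add: case_prod_beta')
  have m2: "(\<lambda>x. \<integral>\<^sup>+t. \<phi> (fst x, t, snd x) \<partial>\<mu>) \<in> borel_measurable (\<mu> \<Otimes>\<^sub>M M)"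
    using tm.borel_measurable_nn_integral_fst[OF m] by (simp add: process_measure_eq case_prod_beta')
  have "(\<integral>\<^sup>+z. (\<lambda>((s, \<omega>), t). \<phi> (s, t, \<omega>)) z \<partial>(Q \<Otimes>\<^sub>M \<mu>))
    = (\<integral>\<^sup>+x. \<integral>\<^sup>+t. \<phi> (fst x, t, snd x) \<partial>\<mu> \<partial>Q)"
    using tm.nn_integral_fst[OF m] by (simp add: case_prod_beta')
  also have "\<dots> = (\<integral>\<^sup>+s. \<integral>\<^sup>+\<omega>. \<integral>\<^sup>+t. \<phi> (s, t, \<omega>) \<partial>\<mu> \<partial>M \<partial>\<mu>)"
    unfolding process_measure_eq using nn_integral_fst[OF m2] by simp
  also have "\<dots> = (\<integral>\<^sup>+s. \<integral>\<^sup>+y. \<phi> (s, y) \<partial>Q \<partial>\<mu>)"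
  proof (rule nn_integral_cong)
    fix s assume s: "s \<in> space \<mu>"
    have "(\<lambda>y. \<phi> (s, y)) \<in> borel_measurable (\<mu> \<Otimes>\<^sub>M M)"
      using measurable_compose[OF measurable_Pair1'[OF s, of Q] \<phi>] by (simp add: process_measure_eq)
    from Q.nn_integral_snd[of "\<lambda>y. \<phi> (s, y)"] this
    show "(\<integral>\<^sup>+\<omega>. \<integral>\<^sup>+t. \<phi> (s, t, \<omega>) \<partial>\<mu> \<partial>M) = (\<integral>\<^sup>+y. \<phi> (s, y) \<partial>Q)"
      by (simp add: process_measure_eq case_prod_beta')
  qed
  also have "\<dots> = (\<integral>\<^sup>+z. \<phi> z \<partial>(\<mu> \<Otimes>\<^sub>M Q))"
    using Qs.nn_integral_fst[OF \<phi>] .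
  finally show ?thesis .
qed

lemma regroup_Lp2:
  assumes f: "f \<in> Lp 2 (\<mu> \<Otimes>\<^sub>M Q)"
  shows "regroup f \<in> Lp 2 (Q \<Otimes>\<^sub>M \<mu>)"
    "norm2 (Q \<Otimes>\<^sub>M \<mu>) (regroup f) = norm2 (\<mu> \<Otimes>\<^sub>M Q) f"
proof -
  have fm: "f \<in> borel_measurable (\<mu> \<Otimes>\<^sub>M Q)" using f by measurable
  have m: "regroup f \<in> borel_measurable (Q \<Otimes>\<^sub>M \<mu>)"
    unfolding regroup_def using measurable_compose[OF regroup_map_measurable fm] by (simp add: case_prod_beta')
  have nn: "(\<integral>\<^sup>+z. ennreal ((regroup f z)\<^sup>2) \<partial>(Q \<Otimes>\<^sub>M \<mu>))
      = (\<integral>\<^sup>+z. ennreal ((f z)\<^sup>2) \<partial>(\<mu> \<Otimes>\<^sub>M Q))"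
    using regroup_nn_integral[of "\<lambda>z. ennreal ((f z)\<^sup>2)"] fm by (simp add: regroup_def case_prod_beta')
  also have "\<dots> < \<infinity>" using Lp2_square[OF f] by (simp add: nn_integral_eq_integral)
  finally have i: "integrable (Q \<Otimes>\<^sub>M \<mu>) (\<lambda>z. (regroup f z)\<^sup>2)"
    using m by (intro integrableI_nonneg) auto
  then show "regroup f \<in> Lp 2 (Q \<Otimes>\<^sub>M \<mu>)" using m by (simp add: Lp2_iff)
  have "ennreal (\<integral>z. (regroup f z)\<^sup>2 \<partial>(Q \<Otimes>\<^sub>M \<mu>)) = ennreal (\<integral>z. (f z)\<^sup>2 \<partial>(\<mu> \<Otimes>\<^sub>M Q))"
    using nn nn_integral_eq_integral[OF i] nn_integral_eq_integral[OF Lp2_square[OF f]] by simp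
  then show "norm2 (Q \<Otimes>\<^sub>M \<mu>) (regroup f) = norm2 (\<mu> \<Otimes>\<^sub>M Q) f"
    by (simp add: norm2_def)
qed

lemma ker_QT_Lp2:
  assumes "0 < \<epsilon>" shows "(\<lambda>z. ker \<epsilon> (fst (fst z)) (snd z)) \<in> Lp 2 (Q \<Otimes>\<^sub>M \<mu>)"
proof -
  have [measurable]: "fst \<in> borel_measurable Q" unfolding process_measure_eq by (rule time_fst_measurable)
  have m: "(\<lambda>z. ker \<epsilon> (fst (fst z)) (snd z)) \<in> borel_measurable (Q \<Otimes>\<^sub>M \<mu>)" by measurable
  have "(\<lambda>_. 1) \<in> Lp 2 (Q \<Otimes>\<^sub>M \<mu>)" by (simp add: Lp2_iff)
  from Lp2_bounded_mult[OF this m, of "inverse \<epsilon>"] show ?thesis using abs_ker_le[OF assms] by simp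
qed

lemma diagonal_avg_integrable:
  assumes \<epsilon>: "0 < \<epsilon>" and Du: "(\<lambda>(s, t, \<omega>). Du s t \<omega>) \<in> Lp 2 (\<mu> \<Otimes>\<^sub>M Q)"
  shows "integrable (Q \<Otimes>\<^sub>M \<mu>) (\<lambda>((s, \<omega>), t). ker \<epsilon> s t * Du s t \<omega>)"
    "integrable (\<mu> \<Otimes>\<^sub>M M) (\<lambda>(s, \<omega>). avg T \<epsilon> (\<lambda>t. Du s t \<omega>) s)"
proof -
  show i: "integrable (Q \<Otimes>\<^sub>M \<mu>) (\<lambda>((s, \<omega>), t). ker \<epsilon> s t * Du s t \<omega>)"
    using Lp2_mult_integrable[OF ker_QT_Lp2[OF \<epsilon>] regroup_Lp2(1)[OF Du]] by (simp add: regroup_def case_prod_beta')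
  show "integrable (\<mu> \<Otimes>\<^sub>M M) (\<lambda>(s, \<omega>). avg T \<epsilon> (\<lambda>t. Du s t \<omega>) s)"
    using QT.integrable_fst'[OF i] by (simp add: process_measure_eq avg_def case_prod_beta')
qed

lemma trace_avg_contraction:
  assumes \<epsilon>: "0 < \<epsilon>" and Du: "(\<lambda>(s, t, \<omega>). Du s t \<omega>) \<in> Lp 2 (\<mu> \<Otimes>\<^sub>M Q)"
    and Dv: "(\<lambda>(s, t, \<omega>). Dv s t \<omega>) \<in> Lp 2 (\<mu> \<Otimes>\<^sub>M Q)"
  shows "integrable M (trace_avg \<epsilon> Du)"
    "expectation (\<lambda>\<omega>. \<bar>trace_avg \<epsilon> Du \<omega> - trace_avg \<epsilon> Dv \<omega>\<bar>)
      \<le> norm2 (Q \<Otimes>\<^sub>M \<mu>) (\<lambda>z. ker \<epsilon> (fst (fst z)) (snd z))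
        * norm2 (\<mu> \<Otimes>\<^sub>M Q) (\<lambda>x. (\<lambda>(s, t, \<omega>). Du s t \<omega>) x - (\<lambda>(s, t, \<omega>). Dv s t \<omega>) x)"
proof -
  note iu = diagonal_avg_integrable[OF \<epsilon> Du] and iv = diagonal_avg_integrable[OF \<epsilon> Dv]
  show "integrable M (trace_avg \<epsilon> Du)" unfolding trace_avg_def[abs_def] by (rule Q.integrable_snd[OF iu(2)])
  have "expectation (\<lambda>\<omega>. \<bar>trace_avg \<epsilon> Du \<omega> - trace_avg \<epsilon> Dv \<omega>\<bar>)
    \<le> (\<integral>z. \<bar>(\<lambda>(s, \<omega>). avg T \<epsilon> (\<lambda>t. Du s t \<omega>) s) z - (\<lambda>(s, \<omega>). avg T \<epsilon> (\<lambda>t. Dv s t \<omega>) s) z\<bar> \<partial>(\<mu> \<Otimes>\<^sub>M M))"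
    unfolding trace_avg_def by (rule Q.snd_integral_contraction[OF iu(2) iv(2)])
  also have "\<dots> = (\<integral>x. \<bar>(\<integral>t. (\<lambda>((s, \<omega>), t). ker \<epsilon> s t * Du s t \<omega>) (x, t) \<partial>\<mu>)
      - (\<integral>t. (\<lambda>((s, \<omega>), t). ker \<epsilon> s t * Dv s t \<omega>) (x, t) \<partial>\<mu>)\<bar> \<partial>Q)"
    unfolding process_measure_eq by (intro Bochner_Integration.integral_cong) (auto simp: avg_def)
  also have "\<dots> \<le> (\<integral>z. \<bar>(\<lambda>((s, \<omega>), t). ker \<epsilon> s t * Du s t \<omega>) z - (\<lambda>((s, \<omega>), t). ker \<epsilon> s t * Dv s t \<omega>) z\<bar> \<partial>(Q \<Otimes>\<^sub>M \<mu>))"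
    by (rule QT.fst_integral_contraction[OF iu(1) iv(1)])
  also have "\<dots> = (\<integral>z. \<bar>ker \<epsilon> (fst (fst z)) (snd z) * regroup (\<lambda>x. (\<lambda>(s, t, \<omega>). Du s t \<omega>) x - (\<lambda>(s, t, \<omega>). Dv s t \<omega>) x) z\<bar> \<partial>(Q \<Otimes>\<^sub>M \<mu>))"
    by (intro Bochner_Integration.integral_cong) (auto simp: regroup_def right_diff_distrib)
  also have "\<dots> \<le> norm2 (Q \<Otimes>\<^sub>M \<mu>) (\<lambda>z. ker \<epsilon> (fst (fst z)) (snd z))
      * norm2 (Q \<Otimes>\<^sub>M \<mu>) (regroup (\<lambda>x. (\<lambda>(s, t, \<omega>). Du s t \<omega>) x - (\<lambda>(s, t, \<omega>). Dv s t \<omega>) x))"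
    by (rule norm2_cauchy_schwarz_abs[OF ker_QT_Lp2[OF \<epsilon>] regroup_Lp2(1)[OF Lp2_diff[OF Du Dv]]])
  finally show "expectation (\<lambda>\<omega>. \<bar>trace_avg \<epsilon> Du \<omega> - trace_avg \<epsilon> Dv \<omega>\<bar>)
      \<le> norm2 (Q \<Otimes>\<^sub>M \<mu>) (\<lambda>z. ker \<epsilon> (fst (fst z)) (snd z))
        * norm2 (\<mu> \<Otimes>\<^sub>M Q) (\<lambda>x. (\<lambda>(s, t, \<omega>). Du s t \<omega>) x - (\<lambda>(s, t, \<omega>). Dv s t \<omega>) x)"
    unfolding regroup_Lp2(2)[OF Lp2_diff[OF Du Dv]] .
qed

lemma smooth_paths:
  assumes "smooth_skorohod v Dv X"
  shows "(\<lambda>t. v t \<omega>) \<in> Lp 2 \<mu>" "(\<lambda>t. Dv s t \<omega>) \<in> Lp 2 \<mu>"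
proof -
  obtain m :: nat and F DF g Z where S: "\<And>j. j < m \<Longrightarrow> wiener (g j) (Z j)"
     and v: "v = (\<lambda>t \<omega>. \<Sum>j<m. F j \<omega> * g j t)" and Dv: "Dv = (\<lambda>s t \<omega>. \<Sum>j<m. DF j s \<omega> * g j t)"
    using assms unfolding smooth_skorohod_def by blast
  show "(\<lambda>t. v t \<omega>) \<in> Lp 2 \<mu>" "(\<lambda>t. Dv s t \<omega>) \<in> Lp 2 \<mu>"
    unfolding v Dv by (intro Lp2_sum Lp2_cmult wiener_Lp2(1)[OF S]; simp)+
qed

text \<open>
  The key identity: for smooth \<open>v\<close>, the forward approximation minus the averaged trace is the
  Skorohod integral of the averaged process. In \<open>\<delta>(F avg g) = F W(avg g) - \<langle>DF, avg g\<rangle>\<close> the Wiener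
  integral is the pairing of \<open>g\<close> with the forward increments, and the correction is the averaged
  trace.
\<close>

lemma smooth_skorohod_avg:
  assumes "smooth_skorohod v Dv X" and \<epsilon>: "0 < \<epsilon>"
  shows "smooth_skorohod (\<lambda>t \<omega>. avg T \<epsilon> (\<lambda>r. v r \<omega>) t) (\<lambda>s t \<omega>. avg T \<epsilon> (\<lambda>r. Dv s r \<omega>) t)
    (\<lambda>\<omega>. fwd \<epsilon> v \<omega> - trace_avg \<epsilon> Dv \<omega>)"
proof -
  obtain m :: nat and F DF g Z where S: "\<And>j. j < m \<Longrightarrow> smooth_deriv T M W (F j) (DF j)" "\<And>j. j < m \<Longrightarrow> wiener (g j) (Z j)"
     and v: "v = (\<lambda>t \<omega>. \<Sum>j<m. F j \<omega> * g j t)" and Dv: "Dv = (\<lambda>s t \<omega>. \<Sum>j<m. DF j s \<omega> * g j t)"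
    using assms(1) unfolding smooth_skorohod_def by blast
  have gL: "g j \<in> Lp 2 \<mu>" if "j < m" for j by (rule wiener_Lp2(1)[OF S(2)[OF that]])
  have gL': "j \<in> {..<m} \<Longrightarrow> g j \<in> Lp 2 \<mu>" for j using gL by simp
  have as: "avg T \<epsilon> (\<lambda>r. \<Sum>j<m. a j * g j r) t = (\<Sum>j<m. a j * avg T \<epsilon> (g j) t)" for a t
    by (rule avg_sum[OF \<epsilon> gL'])
  have f: "fwd \<epsilon> v \<omega> = (\<Sum>j<m. F j \<omega> * pairing \<epsilon> (g j) \<omega>)" for \<omega>
  proof -
    have "(\<integral>t. v t \<omega> * dW \<epsilon> t \<omega> \<partial>\<mu>) = (\<integral>t. (\<Sum>j<m. F j \<omega> * (g j t * dW \<epsilon> t \<omega>)) \<partial>\<mu>)"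
      unfolding v sum_distrib_right by (simp only: mult.assoc)
    also have "\<dots> = (\<Sum>j<m. F j \<omega> * (\<integral>t. g j t * dW \<epsilon> t \<omega> \<partial>\<mu>))"
      using Lp2_mult_integrable[OF gL dW_path] by (subst Bochner_Integration.integral_sum) auto
    finally show ?thesis by (simp add: fwd_def pairing_def sum_distrib_left mult_ac)
  qed
  have t: "trace_avg \<epsilon> Dv \<omega> = (\<Sum>j<m. along T (DF j) (avg T \<epsilon> (g j)) \<omega>)" for \<omega>
  proof -
    have "trace_avg \<epsilon> Dv \<omega> = (\<integral>s. (\<Sum>j<m. DF j s \<omega> * avg T \<epsilon> (g j) s) \<partial>\<mu>)"
      unfolding trace_avg_def Dv by (simp only: as)
    also have "\<dots> = (\<Sum>j<m. along T (DF j) (avg T \<epsilon> (g j)) \<omega>)" unfolding along_def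
      using Lp2_mult_integrable[OF C1_deriv_time_Lp2[OF smooth_deriv_C1[OF S(1)]] avg_contraction(1)[OF \<epsilon> gL]]
      by (subst Bochner_Integration.integral_sum) auto
    finally show ?thesis .
  qed
  show ?thesis
    by (rule smooth_skorohodI[where m = m and F = F and DF = DF and g = "\<lambda>j. avg T \<epsilon> (g j)" and Z = "\<lambda>j. pairing \<epsilon> (g j)"])
      (simp_all add: S(1) wiener_pairing[OF \<epsilon> gL] f t sum_subtractf, simp_all only: v Dv as)
qed

lemma norm2_process_swap:
  assumes "case_prod v \<in> Lp 2 Q"
  shows "(\<lambda>(\<omega>, t). v t \<omega>) \<in> Lp 2 (M \<Otimes>\<^sub>M \<mu>)"
    "norm2 (M \<Otimes>\<^sub>M \<mu>) (\<lambda>(\<omega>, t). v t \<omega>) = norm2 Q (case_prod v)"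
  using Q.swap_Lp2[OF assms[unfolded process_measure_eq]] by (simp_all add: process_measure_eq)

lemma smooth_avg_contraction:
  assumes S: "smooth_skorohod v Dv X" and \<epsilon>: "0 < \<epsilon>"
  shows "norm2 Q (\<lambda>(t, \<omega>). avg T \<epsilon> (\<lambda>r. v r \<omega>) t) \<le> norm2 Q (case_prod v)"
    "norm2 (\<mu> \<Otimes>\<^sub>M Q) (\<lambda>(s, t, \<omega>). avg T \<epsilon> (\<lambda>r. Dv s r \<omega>) t)
      \<le> norm2 (\<mu> \<Otimes>\<^sub>M Q) (\<lambda>(s, t, \<omega>). Dv s t \<omega>)"
proof -
  note L = smooth_skorohod_bound(2,3)[OF S] and La = smooth_skorohod_bound(2,3)[OF smooth_skorohod_avg[OF S]] and p = smooth_paths[OF S]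
  have "norm2 (M \<Otimes>\<^sub>M \<mu>) (\<lambda>(\<omega>, t). avg T \<epsilon> (\<lambda>r. (\<lambda>(\<omega>, t). v t \<omega>) (\<omega>, r)) t) \<le> norm2 (M \<Otimes>\<^sub>M \<mu>) (\<lambda>(\<omega>, t). v t \<omega>)"
    by (rule avg_product(1)[OF MT.pair_sigma_finite_axioms norm2_process_swap(1)[OF L(1)] _ _ \<epsilon>])
      (use p(1) norm2_process_swap(1)[OF La(1)] in simp_all)
  then show "norm2 Q (\<lambda>(t, \<omega>). avg T \<epsilon> (\<lambda>r. v r \<omega>) t) \<le> norm2 Q (case_prod v)"
    using norm2_process_swap(2)[OF La(1)[OF \<epsilon>]] norm2_process_swap(2)[OF L(1)] by simp
  have e: "regroup (\<lambda>(s, t, \<omega>). avg T \<epsilon> (\<lambda>r. Dv s r \<omega>) t) = (\<lambda>(x, t). avg T \<epsilon> (\<lambda>r. regroup (\<lambda>(s, t, \<omega>). Dv s t \<omega>) (x, r)) t)" for \<epsilon>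
    by (auto simp: regroup_def fun_eq_iff)
  have "norm2 (Q \<Otimes>\<^sub>M \<mu>) (\<lambda>(x, t). avg T \<epsilon> (\<lambda>r. regroup (\<lambda>(s, t, \<omega>). Dv s t \<omega>) (x, r)) t)
     \<le> norm2 (Q \<Otimes>\<^sub>M \<mu>) (regroup (\<lambda>(s, t, \<omega>). Dv s t \<omega>))"
  proof (rule avg_product(1)[OF QT.pair_sigma_finite_axioms regroup_Lp2(1)[OF L(2)] _ _ \<epsilon>])
    show "(\<lambda>t. regroup (\<lambda>(s, t, \<omega>). Dv s t \<omega>) (x, t)) \<in> Lp 2 \<mu>" for x
      using p(2)[of "fst x" "snd x"] by (simp add: regroup_def case_prod_beta')
  qed (unfold e[symmetric], rule regroup_Lp2(1)[OF La(2)])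
  then show "norm2 (\<mu> \<Otimes>\<^sub>M Q) (\<lambda>(s, t, \<omega>). avg T \<epsilon> (\<lambda>r. Dv s r \<omega>) t)
      \<le> norm2 (\<mu> \<Otimes>\<^sub>M Q) (\<lambda>(s, t, \<omega>). Dv s t \<omega>)"
    unfolding e[symmetric] regroup_Lp2(2)[OF La(2)[OF \<epsilon>]] regroup_Lp2(2)[OF L(2)] .
qed

lemma smooth_avg_conv:
  assumes S: "smooth_skorohod v Dv X" and e: "\<And>k. 0 < e k" "e \<longlonglongrightarrow> 0"
  shows "(\<lambda>k. norm2 Q (\<lambda>(t, \<omega>). avg T (e k) (\<lambda>r. v r \<omega>) t - v t \<omega>)) \<longlonglongrightarrow> 0"
    "(\<lambda>k. norm2 (\<mu> \<Otimes>\<^sub>M Q) (\<lambda>(s, t, \<omega>). avg T (e k) (\<lambda>r. Dv s r \<omega>) t - Dv s t \<omega>)) \<longlonglongrightarrow> 0"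
proof -
  note L = smooth_skorohod_bound(2,3)[OF S] and La = smooth_skorohod_bound(2,3)[OF smooth_skorohod_avg[OF S]] and p = smooth_paths[OF S]
  note d = smooth_skorohod_bound(2,3)[OF smooth_skorohod_diff[OF smooth_skorohod_avg[OF S e(1)] S]]
  have "(\<lambda>k. norm2 (M \<Otimes>\<^sub>M \<mu>) (\<lambda>z. (\<lambda>(\<omega>, t). avg T (e k) (\<lambda>r. (\<lambda>(\<omega>, t). v t \<omega>) (\<omega>, r)) t) z - (\<lambda>(\<omega>, t). v t \<omega>) z)) \<longlonglongrightarrow> 0"
    by (rule avg_product(2)[OF MT.pair_sigma_finite_axioms norm2_process_swap(1)[OF L(1)] _ _ T_pos e])
      (use p(1) norm2_process_swap(1)[OF La(1)] in simp_all)
  moreover have "norm2 (M \<Otimes>\<^sub>M \<mu>) (\<lambda>z. (\<lambda>(\<omega>, t). avg T (e k) (\<lambda>r. (\<lambda>(\<omega>, t). v t \<omega>) (\<omega>, r)) t) z - (\<lambda>(\<omega>, t). v t \<omega>) z)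
     = norm2 Q (\<lambda>(t, \<omega>). avg T (e k) (\<lambda>r. v r \<omega>) t - v t \<omega>)" for k
    using norm2_process_swap(2)[OF d(1)] by (simp add: case_prod_beta')
  ultimately show "(\<lambda>k. norm2 Q (\<lambda>(t, \<omega>). avg T (e k) (\<lambda>r. v r \<omega>) t - v t \<omega>)) \<longlonglongrightarrow> 0" by simp
  have eq: "regroup (\<lambda>(s, t, \<omega>). avg T \<epsilon> (\<lambda>r. Dv s r \<omega>) t) = (\<lambda>(x, t). avg T \<epsilon> (\<lambda>r. regroup (\<lambda>(s, t, \<omega>). Dv s t \<omega>) (x, r)) t)" for \<epsilon>
    by (auto simp: regroup_def fun_eq_iff)
  have "(\<lambda>k. norm2 (Q \<Otimes>\<^sub>M \<mu>) (\<lambda>z. (\<lambda>(x, t). avg T (e k) (\<lambda>r. regroup (\<lambda>(s, t, \<omega>). Dv s t \<omega>) (x, r)) t) z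
     - regroup (\<lambda>(s, t, \<omega>). Dv s t \<omega>) z)) \<longlonglongrightarrow> 0"
  proof (rule avg_product(2)[OF QT.pair_sigma_finite_axioms regroup_Lp2(1)[OF L(2)] _ _ T_pos e])
    show "(\<lambda>t. regroup (\<lambda>(s, t, \<omega>). Dv s t \<omega>) (x, t)) \<in> Lp 2 \<mu>" for x
      using p(2)[of "fst x" "snd x"] by (simp add: regroup_def case_prod_beta')
  qed (unfold eq[symmetric], rule regroup_Lp2(1)[OF La(2)])
  moreover have "norm2 (Q \<Otimes>\<^sub>M \<mu>) (\<lambda>z. (\<lambda>(x, t). avg T (e k) (\<lambda>r. regroup (\<lambda>(s, t, \<omega>). Dv s t \<omega>) (x, r)) t) z
     - regroup (\<lambda>(s, t, \<omega>). Dv s t \<omega>) z) = norm2 (\<mu> \<Otimes>\<^sub>M Q) (\<lambda>(s, t, \<omega>). avg T (e k) (\<lambda>r. Dv s r \<omega>) t - Dv s t \<omega>)" for k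
    unfolding regroup_Lp2(2)[OF d(2), symmetric] eq[symmetric] by (simp add: regroup_def case_prod_beta')
  ultimately show "(\<lambda>k. norm2 (\<mu> \<Otimes>\<^sub>M Q) (\<lambda>(s, t, \<omega>). avg T (e k) (\<lambda>r. Dv s r \<omega>) t - Dv s t \<omega>)) \<longlonglongrightarrow> 0" by simp
qed

lemma smooth_skorohod_norm_le:
  assumes "smooth_skorohod v Dv X"
  shows "norm2 M X \<le> norm2 Q (case_prod v) + norm2 (\<mu> \<Otimes>\<^sub>M Q) (\<lambda>(s, t, \<omega>). Dv s t \<omega>)"
proof (rule power2_le_imp_le)
  let ?a = "norm2 Q (case_prod v)" and ?b = "norm2 (\<mu> \<Otimes>\<^sub>M Q) (\<lambda>(s, t, \<omega>). Dv s t \<omega>)"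
  have "0 \<le> ?a * ?b" by (intro mult_nonneg_nonneg) auto
  then show "(norm2 M X)\<^sup>2 \<le> (?a + ?b)\<^sup>2" using smooth_skorohod_bound(4)[OF assms] unfolding power2_sum by linarith
qed (intro add_nonneg_nonneg norm2_nonneg)

text \<open>
  Write \<open>R\<^sub>\<epsilon>\<close> for the forward approximation minus the averaged trace. On smooth processes
  \<open>R\<^sub>\<epsilon>(v) = \<delta>(avg v)\<close>, and averages are contractions, so \<open>R\<^sub>\<epsilon>\<close> is bounded by the \<open>L\<^sup>1\<^sup>,\<^sup>2\<close> norm
  uniformly in \<open>\<epsilon>\<close>. This bound extends to the closure, and \<open>\<delta>(avg v)\<close> tends to \<open>\<delta>(v)\<close> for smooth
  \<open>v\<close>; a three-term estimate gives the limit for \<open>u\<close>.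
\<close>

theorem skorohod_correction:
  assumes u: "process_deriv T M W u Du"
  shows "\<exists>Y. is_skorohod_integral T M W u Y \<and>
    (\<forall>e. (\<forall>k::nat. 0 < e k) \<longrightarrow> e \<longlonglongrightarrow> 0 \<longrightarrow>
      (\<lambda>k. expectation (\<lambda>\<omega>. \<bar>fwd (e k) u \<omega> - trace_avg (e k) Du \<omega> - Y \<omega>\<bar>)) \<longlonglongrightarrow> 0)"
proof -
  let ?N = "\<mu> \<Otimes>\<^sub>M Q"
  obtain v Dv X Y where S: "\<And>n::nat. smooth_skorohod (v n) (Dv n) (X n)"
    and cv: "conv2 Q (\<lambda>n. case_prod (v n)) (case_prod u) sequentially"
    and cDv: "conv2 ?N (\<lambda>n (s, t, \<omega>). Dv n s t \<omega>) (\<lambda>(s, t, \<omega>). Du s t \<omega>) sequentially"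
    and cX: "conv2 M X Y sequentially" and Y: "is_skorohod_integral T M W u Y"
    using L12_skorohod[OF u] by blast
  define R where "R e w Dw \<omega> = fwd e w \<omega> - trace_avg e Dw \<omega>" for e w Dw \<omega>
  have SR: "smooth_skorohod (\<lambda>t \<omega>. avg T e (\<lambda>r. v n r \<omega>) t) (\<lambda>s t \<omega>. avg T e (\<lambda>r. Dv n s r \<omega>) t) (R e (v n) (Dv n))" if "0 < e" for e n
    using smooth_skorohod_avg[OF S that] by (simp add: R_def[abs_def])
  have RL: "R e (v n) (Dv n) \<in> Lp 2 M" if "0 < e" for e n by (rule smooth_skorohod_bound(1)[OF SR[OF that]])
  have Ri: "integrable M (R e w Dw)" if "0 < e" "case_prod w \<in> Lp 2 Q" "(\<lambda>(s, t, \<omega>). Dw s t \<omega>) \<in> Lp 2 ?N" for e w Dw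
    unfolding R_def[abs_def] using fwd_contraction(1)[OF that(1,2,2)] trace_avg_contraction(1)[OF that(1,3,3)] by simp
  note uL = conv2D(2)[OF cv] and DuL = conv2D(2)[OF cDv] and vL = conv2D(1)[OF cv] and DvL = conv2D(1)[OF cDv]
  define c where "c n m = norm2 Q (\<lambda>x. case_prod (v n) x - case_prod (v m) x)
      + norm2 ?N (\<lambda>x. (\<lambda>(s, t, \<omega>). Dv n s t \<omega>) x - (\<lambda>(s, t, \<omega>). Dv m s t \<omega>) x)" for n m
  have RR: "expectation (\<lambda>\<omega>. \<bar>R e (v n) (Dv n) \<omega> - R e (v m) (Dv m) \<omega>\<bar>) \<le> c n m" if e: "0 < e" for e n m
  proof -
    note D = smooth_skorohod_diff[OF S[of n] S[of m]]
    have a1: "(\<lambda>t \<omega>. avg T e (\<lambda>r. v n r \<omega>) t - avg T e (\<lambda>r. v m r \<omega>) t) = (\<lambda>t \<omega>. avg T e (\<lambda>r. v n r \<omega> - v m r \<omega>) t)"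
      using avg_add_scaled[OF e smooth_paths(1)[OF S[of n]] smooth_paths(1)[OF S[of m]], where a = 1 and b = "-1"] by (simp add: fun_eq_iff)
    have a2: "(\<lambda>s t \<omega>. avg T e (\<lambda>r. Dv n s r \<omega>) t - avg T e (\<lambda>r. Dv m s r \<omega>) t) = (\<lambda>s t \<omega>. avg T e (\<lambda>r. Dv n s r \<omega> - Dv m s r \<omega>) t)"
      using avg_add_scaled[OF e smooth_paths(2)[OF S[of n]] smooth_paths(2)[OF S[of m]], where a = 1 and b = "-1"] by (simp add: fun_eq_iff)
    have "expectation (\<lambda>\<omega>. \<bar>R e (v n) (Dv n) \<omega> - R e (v m) (Dv m) \<omega>\<bar>) \<le> norm2 M (\<lambda>\<omega>. R e (v n) (Dv n) \<omega> - R e (v m) (Dv m) \<omega>)"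
      by (rule norm1_le_norm2[OF Lp2_diff[OF RL[OF e] RL[OF e]]])
    also have "\<dots> \<le> norm2 Q (\<lambda>(t, \<omega>). avg T e (\<lambda>r. v n r \<omega> - v m r \<omega>) t) + norm2 ?N (\<lambda>(s, t, \<omega>). avg T e (\<lambda>r. Dv n s r \<omega> - Dv m s r \<omega>) t)"
      by (rule smooth_skorohod_norm_le[OF smooth_skorohod_diff[OF SR[OF e, of n] SR[OF e, of m], unfolded a1 a2]])
    also have "\<dots> \<le> norm2 Q (\<lambda>(t, \<omega>). v n t \<omega> - v m t \<omega>) + norm2 ?N (\<lambda>(s, t, \<omega>). Dv n s t \<omega> - Dv m s t \<omega>)"
      by (rule add_mono[OF smooth_avg_contraction[OF D e]])
    also have "\<dots> = c n m" unfolding c_def by (simp add: case_prod_beta')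
    finally show ?thesis .
  qed
  have approx: "(\<lambda>m. expectation (\<lambda>\<omega>. \<bar>R e u Du \<omega> - R e (v m) (Dv m) \<omega>\<bar>)) \<longlonglongrightarrow> 0" if e: "0 < e" for e
  proof -
    define K where "K = norm2 (Q \<Otimes>\<^sub>M \<mu>) (\<lambda>z. ker e (fst (fst z)) (snd z))"
    define K' where "K' = inverse e * norm2 Q (\<lambda>(t, \<omega>). dW e t \<omega>)"
    have le: "norm (expectation (\<lambda>\<omega>. \<bar>R e u Du \<omega> - R e (v m) (Dv m) \<omega>\<bar>))
       \<le> K' * norm2 Q (\<lambda>x. case_prod (v m) x - case_prod u x) + K * norm2 ?N (\<lambda>x. (\<lambda>(s, t, \<omega>). Dv m s t \<omega>) x - (\<lambda>(s, t, \<omega>). Du s t \<omega>) x)" for m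
    proof -
      note f1 = fwd_contraction[OF e uL vL[of m]] and f2 = fwd_contraction(1)[OF e vL[of m] uL]
        and t1 = trace_avg_contraction[OF e DuL DvL[of m]] and t2 = trace_avg_contraction(1)[OF e DvL[of m] DuL]
      have "expectation (\<lambda>\<omega>. \<bar>R e u Du \<omega> - R e (v m) (Dv m) \<omega>\<bar>)
        \<le> expectation (\<lambda>\<omega>. \<bar>fwd e u \<omega> - fwd e (v m) \<omega>\<bar> + \<bar>trace_avg e Du \<omega> - trace_avg e (Dv m) \<omega>\<bar>)"
        unfolding R_def using f1(1) f2 t1(1) t2 by (intro integral_mono) auto
      also have "\<dots> = expectation (\<lambda>\<omega>. \<bar>fwd e u \<omega> - fwd e (v m) \<omega>\<bar>) + expectation (\<lambda>\<omega>. \<bar>trace_avg e Du \<omega> - trace_avg e (Dv m) \<omega>\<bar>)"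
        using f1(1) f2 t1(1) t2 by simp
      also have "\<dots> \<le> K' * norm2 Q (\<lambda>x. case_prod (v m) x - case_prod u x) + K * norm2 ?N (\<lambda>x. (\<lambda>(s, t, \<omega>). Dv m s t \<omega>) x - (\<lambda>(s, t, \<omega>). Du s t \<omega>) x)"
        unfolding norm2_minus[of Q "case_prod (v m)"] norm2_minus[of ?N "\<lambda>(s, t, \<omega>). Dv m s t \<omega>"]
        using f1(2) t1(2) by (intro add_mono) (simp_all add: K_def K'_def mult_ac)
      finally show ?thesis by simp
    qed
    have "(\<lambda>m. K' * norm2 Q (\<lambda>x. case_prod (v m) x - case_prod u x) + K * norm2 ?N (\<lambda>x. (\<lambda>(s, t, \<omega>). Dv m s t \<omega>) x - (\<lambda>(s, t, \<omega>). Du s t \<omega>) x))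
       \<longlonglongrightarrow> K' * 0 + K * 0"
      by (intro tendsto_add tendsto_mult tendsto_const conv2D(3)[OF cv] conv2D(3)[OF cDv])
    then show ?thesis by (intro Lim_null_comparison[OF always_eventually[OF allI[OF le]]]) simp
  qed
  have "(\<lambda>k. expectation (\<lambda>\<omega>. \<bar>R (e k) u Du \<omega> - Y \<omega>\<bar>)) \<longlonglongrightarrow> 0" if e: "\<And>k::nat. 0 < e k" "e \<longlonglongrightarrow> 0" for e
  proof (rule LIMSEQ_I)
    fix d :: real assume d: "d > 0"
    have YL: "Y \<in> Lp 2 M" and XL: "\<And>n. X n \<in> Lp 2 M" using conv2D[OF cX] by auto
    obtain n1 where n1: "\<And>n m. n \<ge> n1 \<Longrightarrow> m \<ge> n1 \<Longrightarrow> norm2 Q (\<lambda>x. case_prod (v n) x - case_prod (v m) x) < d/6"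
      using conv2_Cauchy[OF cv, of "d/6"] d by auto
    obtain n2 where n2: "\<And>n m. n \<ge> n2 \<Longrightarrow> m \<ge> n2 \<Longrightarrow> norm2 ?N (\<lambda>x. (\<lambda>(s, t, \<omega>). Dv n s t \<omega>) x - (\<lambda>(s, t, \<omega>). Dv m s t \<omega>) x) < d/6"
      using conv2_Cauchy[OF cDv, of "d/6"] d by auto
    obtain n3 where n3: "\<And>n. n \<ge> n3 \<Longrightarrow> norm2 M (\<lambda>x. X n x - Y x) < d/6"
      using LIMSEQ_D[OF conv2D(3)[OF cX], of "d/6"] d by auto
    \<comment> \<open>\<open>n\<close> is fixed before \<open>k\<close>: the bound below holds for all window lengths \<open>e k\<close> at once\<close>
    define n where "n = max n1 (max n2 n3)"
    have nn: "n1 \<le> n" "n2 \<le> n" "n3 \<le> n" by (simp_all add: n_def)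
    have uniform: "expectation (\<lambda>\<omega>. \<bar>R (e k) u Du \<omega> - R (e k) (v n) (Dv n) \<omega>\<bar>) \<le> d/3" for k
    proof -
      have "expectation (\<lambda>\<omega>. \<bar>R (e k) u Du \<omega> - R (e k) (v n) (Dv n) \<omega>\<bar>) \<le> expectation (\<lambda>\<omega>. \<bar>R (e k) u Du \<omega> - R (e k) (v m) (Dv m) \<omega>\<bar>) + d/3"
        if m: "n \<le> m" for m
      proof -
        have cm: "c m n \<le> d/3" using n1[of m n] n2[of m n] m nn unfolding c_def by linarith
        have "expectation (\<lambda>\<omega>. \<bar>R (e k) u Du \<omega> - R (e k) (v n) (Dv n) \<omega>\<bar>)
          \<le> expectation (\<lambda>\<omega>. \<bar>R (e k) u Du \<omega> - R (e k) (v m) (Dv m) \<omega>\<bar> + \<bar>R (e k) (v m) (Dv m) \<omega> - R (e k) (v n) (Dv n) \<omega>\<bar>)"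
          using Ri[OF e(1) uL DuL, of k] Ri[OF e(1) vL DvL, of k] by (intro integral_mono) auto
        also have "\<dots> = expectation (\<lambda>\<omega>. \<bar>R (e k) u Du \<omega> - R (e k) (v m) (Dv m) \<omega>\<bar>) + expectation (\<lambda>\<omega>. \<bar>R (e k) (v m) (Dv m) \<omega> - R (e k) (v n) (Dv n) \<omega>\<bar>)"
          using Ri[OF e(1) uL DuL, of k] Ri[OF e(1) vL DvL, of k] by simp
        finally show ?thesis using RR[OF e(1)[of k], of m n] cm by linarith
      qed
      then have "\<forall>m\<ge>n. expectation (\<lambda>\<omega>. \<bar>R (e k) u Du \<omega> - R (e k) (v n) (Dv n) \<omega>\<bar>) \<le> expectation (\<lambda>\<omega>. \<bar>R (e k) u Du \<omega> - R (e k) (v m) (Dv m) \<omega>\<bar>) + d/3" by blast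
      moreover have "(\<lambda>m. expectation (\<lambda>\<omega>. \<bar>R (e k) u Du \<omega> - R (e k) (v m) (Dv m) \<omega>\<bar>) + d/3) \<longlonglongrightarrow> 0 + d/3"
        by (intro tendsto_add approx e(1) tendsto_const)
      ultimately show ?thesis by (intro LIMSEQ_le_const[of _ "d/3"]) auto
    qed
    have "(\<lambda>k. norm2 Q (\<lambda>(t, \<omega>). avg T (e k) (\<lambda>r. v n r \<omega>) t - v n t \<omega>) + norm2 ?N (\<lambda>(s, t, \<omega>). avg T (e k) (\<lambda>r. Dv n s r \<omega>) t - Dv n s t \<omega>)) \<longlonglongrightarrow> 0 + 0"
      by (intro tendsto_add smooth_avg_conv[OF S e])
    then obtain k0 where k0: "\<And>k. k \<ge> k0 \<Longrightarrow> norm2 Q (\<lambda>(t, \<omega>). avg T (e k) (\<lambda>r. v n r \<omega>) t - v n t \<omega>)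
       + norm2 ?N (\<lambda>(s, t, \<omega>). avg T (e k) (\<lambda>r. Dv n s r \<omega>) t - Dv n s t \<omega>) < d/6"
      using LIMSEQ_D[of _ 0 "d/6"] d by fastforce
    show "\<exists>k0. \<forall>k\<ge>k0. norm (expectation (\<lambda>\<omega>. \<bar>R (e k) u Du \<omega> - Y \<omega>\<bar>) - 0) < d"
    proof (intro exI[of _ k0] allI impI)
      fix k assume k: "k0 \<le> k"
      note RnL = RL[OF e(1)[of k], of n]
      have 1: "expectation (\<lambda>\<omega>. \<bar>R (e k) (v n) (Dv n) \<omega> - X n \<omega>\<bar>) < d/6"
        using norm1_le_norm2[OF Lp2_diff[OF RnL XL[of n]]] smooth_skorohod_norm_le[OF smooth_skorohod_diff[OF SR[OF e(1)[of k], of n] S[of n]]] k0[OF k]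
        by linarith
      have 2: "expectation (\<lambda>\<omega>. \<bar>X n \<omega> - Y \<omega>\<bar>) < d/6"
        using norm1_le_norm2[OF Lp2_diff[OF XL[of n] YL]] n3[OF nn(3)] by linarith
      have "expectation (\<lambda>\<omega>. \<bar>R (e k) u Du \<omega> - Y \<omega>\<bar>)
        \<le> expectation (\<lambda>\<omega>. \<bar>R (e k) u Du \<omega> - R (e k) (v n) (Dv n) \<omega>\<bar> + (\<bar>R (e k) (v n) (Dv n) \<omega> - X n \<omega>\<bar> + \<bar>X n \<omega> - Y \<omega>\<bar>))"
        using Ri[OF e(1) uL DuL, of k] Lp2_integrable[OF RnL] Lp2_integrable[OF XL[of n]] Lp2_integrable[OF YL]
        by (intro integral_mono) auto
      also have "\<dots> = expectation (\<lambda>\<omega>. \<bar>R (e k) u Du \<omega> - R (e k) (v n) (Dv n) \<omega>\<bar>)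
        + (expectation (\<lambda>\<omega>. \<bar>R (e k) (v n) (Dv n) \<omega> - X n \<omega>\<bar>) + expectation (\<lambda>\<omega>. \<bar>X n \<omega> - Y \<omega>\<bar>))"
        using Ri[OF e(1) uL DuL, of k] Lp2_integrable[OF RnL] Lp2_integrable[OF XL[of n]] Lp2_integrable[OF YL] by simp
      also have "\<dots> < d" using uniform[of k] 1 2 d by linarith
      finally show "norm (expectation (\<lambda>\<omega>. \<bar>R (e k) u Du \<omega> - Y \<omega>\<bar>) - 0) < d" by simp
    qed
  qed
  then show ?thesis using Y unfolding R_def by (intro exI[of _ Y]) auto
qed

end

section \<open>The limit of the averaged trace\<close>

lemma Lp1_iff: "f \<in> Lp 1 N \<longleftrightarrow> integrable N f"
  unfolding Lp_def by (auto simp: integrable_abs_iff)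

lemma avg_indicator:
  assumes "0 < \<epsilon>"
  shows "avg T \<epsilon> (indicator {0..r}) \<in> borel_measurable (time_measure T)"
    "0 \<le> avg T \<epsilon> (indicator {0..r}) s" "avg T \<epsilon> (indicator {0..r}) s \<le> 1"
proof -
  have L: "(indicator {0..r} :: real \<Rightarrow> real) \<in> Lp 2 (time_measure T)" by (rule indicator_time_Lp2) simp
  show "avg T \<epsilon> (indicator {0..r}) \<in> borel_measurable (time_measure T)"
    by (rule Lp2_measurable[OF avg_contraction(1)[OF assms L]])
  show "0 \<le> avg T \<epsilon> (indicator {0..r}) s"
    unfolding avg_def using ker_nonneg[OF assms] by (intro integral_nonneg_AE AE_I2) auto
  have "avg T \<epsilon> (indicator {0..r}) s \<le> (\<integral>t. ker \<epsilon> s t \<partial>time_measure T)"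
    unfolding avg_def using ker_nonneg[OF assms]
    by (intro integral_mono time_Lp2_integrable[OF ker_mult_Lp2[OF assms L]] ker_time(1)[OF assms]) (auto split: split_indicator)
  then show "avg T \<epsilon> (indicator {0..r}) s \<le> 1" using ker_time(2)[OF assms, of T s] by linarith
qed

lemma avg_indicator_tendsto:
  assumes \<epsilon>: "\<And>n. 0 < \<epsilon> n" "\<epsilon> \<longlonglongrightarrow> 0" and s: "0 < s" "s \<le> T"
  shows "(\<lambda>n. avg T (\<epsilon> n) (indicator {0..r}) s) \<longlonglongrightarrow> indicator {0..r} s"
proof (rule tendsto_eventually)
  define d where "d = (if s \<le> r then s else s - r)"
  have d: "d > 0" using s by (auto simp: d_def)
  show "\<forall>\<^sub>F n in sequentially. avg T (\<epsilon> n) (indicator {0..r}) s = indicator {0..r} s"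
    using order_tendstoD(2)[OF \<epsilon>(2) d]
  proof eventually_elim
    case (elim n)
    show ?case
    proof (cases "s \<le> r")
      case True
      then have e: "ker (\<epsilon> n) s t * indicator {0..r} t = ker (\<epsilon> n) s t" for t
        using elim s by (auto simp: ker_def indicator_def d_def)
      have "\<epsilon> n \<le> s" using True elim by (auto simp: d_def)
      then show ?thesis unfolding avg_def e using True s by (simp add: ker_time_inner[OF \<epsilon>(1)])
    next
      case False
      then have e: "ker (\<epsilon> n) s t * indicator {0..r} t = 0" for t
        using elim by (auto simp: ker_def indicator_def d_def)
      show ?thesis unfolding avg_def e using False by simp
    qed
  qed
qed

text \<open>
  If both \<open>\<bar>X - Y\<bar>\<close> and \<open>\<bar>X - Z\<bar>\<close> are at most \<open>c\<close>, then \<open>\<bar>Y - Z\<bar>\<close> is at most \<open>2 c\<close>. Measurability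
  of the \<open>X i\<close> is essential: the measure of a nonmeasurable event is \<open>0\<close>, which could make
  convergence vacuous.
\<close>

lemma (in finite_measure) tendsto_prob_unique:
  assumes F: "F \<noteq> bot" and X: "\<forall>\<^sub>F i in F. X i \<in> borel_measurable M"
    and Y[measurable]: "Y \<in> borel_measurable M" and Z[measurable]: "Z \<in> borel_measurable M"
    and c: "tendsto_prob M X Y F" "tendsto_prob M X Z F"
  shows "AE \<omega> in M. Y \<omega> = Z \<omega>"
proof -
  have null: "measure M {\<omega>\<in>space M. 2 * c < \<bar>Y \<omega> - Z \<omega>\<bar>} = 0" if "0 < c" for c
  proof -
    have "((\<lambda>i. measure M {\<omega>\<in>space M. c < \<bar>X i \<omega> - Y \<omega>\<bar>} + measure M {\<omega>\<in>space M. c < \<bar>X i \<omega> - Z \<omega>\<bar>}) \<longlongrightarrow> 0 + 0) F"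
      using c that unfolding tendsto_prob_def by (intro tendsto_add) auto
    moreover have "\<forall>\<^sub>F i in F. measure M {\<omega>\<in>space M. 2 * c < \<bar>Y \<omega> - Z \<omega>\<bar>}
        \<le> measure M {\<omega>\<in>space M. c < \<bar>X i \<omega> - Y \<omega>\<bar>} + measure M {\<omega>\<in>space M. c < \<bar>X i \<omega> - Z \<omega>\<bar>}"
      using X
    proof eventually_elim
      case (elim i)
      note [measurable] = elim
      have s: "{\<omega>\<in>space M. c < \<bar>X i \<omega> - Y \<omega>\<bar>} \<in> sets M" "{\<omega>\<in>space M. c < \<bar>X i \<omega> - Z \<omega>\<bar>} \<in> sets M" by measurable
      have "measure M {\<omega>\<in>space M. 2 * c < \<bar>Y \<omega> - Z \<omega>\<bar>}
        \<le> measure M ({\<omega>\<in>space M. c < \<bar>X i \<omega> - Y \<omega>\<bar>} \<union> {\<omega>\<in>space M. c < \<bar>X i \<omega> - Z \<omega>\<bar>})"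
        using s by (intro finite_measure_mono) (auto simp: abs_if split: if_splits)
      then show ?case using measure_Un_le[OF s] by linarith
    qed
    ultimately have "measure M {\<omega>\<in>space M. 2 * c < \<bar>Y \<omega> - Z \<omega>\<bar>} \<le> 0 + 0"
      by (rule tendsto_lowerbound[OF _ _ F])
    then show ?thesis using measure_nonneg[of M] by (simp add: order_antisym)
  qed
  have "AE \<omega> in M. \<not> 2 * inverse (real (Suc n)) < \<bar>Y \<omega> - Z \<omega>\<bar>" for n
  proof (rule AE_I)
    show "{\<omega>\<in>space M. \<not> \<not> 2 * inverse (real (Suc n)) < \<bar>Y \<omega> - Z \<omega>\<bar>} \<subseteq> {\<omega>\<in>space M. 2 * inverse (real (Suc n)) < \<bar>Y \<omega> - Z \<omega>\<bar>}" by simp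
    show "emeasure M {\<omega>\<in>space M. 2 * inverse (real (Suc n)) < \<bar>Y \<omega> - Z \<omega>\<bar>} = 0"
      using null[of "inverse (real (Suc n))"] by (simp add: emeasure_eq_measure)
  qed measurable
  then have "AE \<omega> in M. \<forall>n. \<not> 2 * inverse (real (Suc n)) < \<bar>Y \<omega> - Z \<omega>\<bar>" by (simp add: AE_all_countable)
  then show ?thesis
  proof eventually_elim
    case (elim \<omega>)
    show ?case
    proof (rule ccontr)
      assume "Y \<omega> \<noteq> Z \<omega>"
      then have "0 < \<bar>Y \<omega> - Z \<omega>\<bar> / 2" by simp
      then obtain n where "inverse (real (Suc n)) < \<bar>Y \<omega> - Z \<omega>\<bar> / 2" using reals_Archimedean by blast
      moreover have "\<bar>Y \<omega> - Z \<omega>\<bar> \<le> 2 * inverse (real (Suc n))" using elim by (simp add: not_less)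
      moreover have "x < a / 2 \<Longrightarrow> a \<le> 2 * x \<Longrightarrow> False" for a x :: real by linarith
      ultimately show False by blast
    qed
  qed
qed

text \<open>
  The function \<open>S\<close> is arbitrary: it will be a supremum over uncountably many times, whose integral
  is a lower integral. Lower integrals are not subadditive, but subtracting the measurable \<open>g\<close>
  from the measurable \<open>L\<close> leaves a measurable function below \<open>S\<close>.
\<close>

lemma nn_integral_le_add:
  assumes L[measurable]: "L \<in> borel_measurable N" and g[measurable]: "g \<in> borel_measurable N"
    and fin: "AE x in N. g x \<noteq> \<infinity>" and le: "AE x in N. L x \<le> S x + (g x :: ennreal)"
  shows "(\<integral>\<^sup>+x. L x \<partial>N) \<le> (\<integral>\<^sup>+x. S x \<partial>N) + (\<integral>\<^sup>+x. g x \<partial>N)"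
proof -
  have "L x \<le> (L x - g x) + g x" for x
    using ennreal_minus_le_iff[of "L x" "g x" "L x - g x"] by (simp add: add.commute)
  then have "(\<integral>\<^sup>+x. L x \<partial>N) \<le> (\<integral>\<^sup>+x. (L x - g x) + g x \<partial>N)" by (intro nn_integral_mono)
  also have "\<dots> = (\<integral>\<^sup>+x. L x - g x \<partial>N) + (\<integral>\<^sup>+x. g x \<partial>N)" by (intro nn_integral_add) measurable
  also have "(\<integral>\<^sup>+x. L x - g x \<partial>N) \<le> (\<integral>\<^sup>+x. S x \<partial>N)"
  proof (rule nn_integral_mono_AE)
    show "AE x in N. L x - g x \<le> S x"
      using fin le by eventually_elim (simp add: ennreal_minus_le_iff add.commute)
  qed
  finally show ?thesis by (simp add: add_right_mono)
qed

context brownian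
begin

text \<open>
  The sets that agree with an event of the natural filtration up to a null event of it form a
  \<open>\<sigma>\<close>-algebra.
\<close>

lemma natural_approx:
  assumes "A \<in> sets M"
  shows "\<exists>G\<in>sets (natural_filtration M W T). \<exists>K\<in>sets (natural_filtration M W T).
    emeasure M K = 0 \<and> A - G \<subseteq> K \<and> G - A \<subseteq> K"
proof -
  let ?N = "natural_filtration M W T"
  have sp: "space ?N = space M" unfolding natural_filtration_def by (rule space_measure_of) auto
  have "A \<in> sigma_sets (space M) (sets ?N \<union> nulls)"
    using assms unfolding sets_M sets_filtration nulls_def .
  then show ?thesis
  proof (induction rule: sigma_sets.induct)
    case (Basic A)
    then show ?case
    proof
      assume "A \<in> sets ?N" then show ?thesis by (intro bexI[of _ A] bexI[of _ "{}"]) auto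
    next
      assume "A \<in> nulls"
      then obtain G where "G \<in> sets ?N" "emeasure M G = 0" "A \<subseteq> G" unfolding nulls_def by blast
      then show ?thesis by (intro bexI[of _ "{}"] bexI[of _ G]) auto
    qed
  next
    case Empty
    show ?case by (intro bexI[of _ "{}"]) auto
  next
    case (Compl A)
    then obtain G K where "G \<in> sets ?N" "K \<in> sets ?N" "emeasure M K = 0" "A - G \<subseteq> K" "G - A \<subseteq> K" by blast
    moreover from this(1) have "space M - G \<in> sets ?N" unfolding sp[symmetric] by (rule sets.compl_sets)
    ultimately show ?case by (intro bexI[of _ "space M - G"] bexI[of _ K]) auto
  next
    case (Union A)
    define P where "P i G K \<longleftrightarrow> G \<in> sets ?N \<and> K \<in> sets ?N \<and> emeasure M K = 0 \<and> A i - G \<subseteq> K \<and> G - A i \<subseteq> K" for i G K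
    have "\<forall>i. \<exists>z. P i (fst z) (snd z)" using Union.IH unfolding P_def by fastforce
    from choice[OF this] obtain z where "\<forall>i. P i (fst (z i)) (snd (z i))" by blast
    then have z: "\<And>i. fst (z i) \<in> sets ?N" "\<And>i. snd (z i) \<in> sets ?N" "\<And>i. emeasure M (snd (z i)) = 0"
      "\<And>i. A i - fst (z i) \<subseteq> snd (z i)" "\<And>i. fst (z i) - A i \<subseteq> snd (z i)" unfolding P_def by auto
    have "(\<Union>i. snd (z i)) \<in> null_sets M"
      using z(2,3) natural_subset by (intro null_sets_UN) (auto simp: null_sets_def)
    then have "emeasure M (\<Union>i. snd (z i)) = 0" by auto
    moreover have "(\<Union>i. A i) - (\<Union>i. fst (z i)) \<subseteq> (\<Union>i. snd (z i))" using z(4) by blast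
    moreover have "(\<Union>i. fst (z i)) - (\<Union>i. A i) \<subseteq> (\<Union>i. snd (z i))" using z(5) by blast
    moreover have "(\<Union>i. fst (z i)) \<in> sets ?N" "(\<Union>i. snd (z i)) \<in> sets ?N" using z(1,2) by auto
    ultimately show ?case by blast
  qed
qed

text \<open>
  The augmentation adds subsets of null events of the natural filtration only. A null event of the
  augmented \<open>\<sigma>\<close>-algebra is covered by such an event, so the probability space is complete.
\<close>

lemma subset_null_measurable:
  assumes "A \<in> null_sets M" "B \<subseteq> A" shows "B \<in> sets M"
proof -
  obtain G K where GK: "G \<in> sets (natural_filtration M W T)" "K \<in> sets (natural_filtration M W T)"
    "emeasure M K = 0" "A - G \<subseteq> K" "G - A \<subseteq> K"
    using natural_approx[OF null_setsD2[OF assms(1)]] by blast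
  have K: "K \<in> null_sets M" using GK natural_subset by auto
  have "G \<in> null_sets M"
    by (rule null_sets_subset[OF null_sets.Un[OF assms(1) K]]) (use GK natural_subset in auto)
  then have "emeasure M (G \<union> K) = 0" using K by (intro null_setsD1 null_sets.Un)
  moreover have "B \<subseteq> G \<union> K" using assms(2) GK(4) by blast
  ultimately have "B \<in> nulls" unfolding nulls_def using GK(1,2) by (intro CollectI bexI[of _ "G \<union> K"]) auto
  then show ?thesis using nulls_subset by blast
qed

lemma measurable_cong_AE_complete:
  fixes f g :: "'a \<Rightarrow> real"
  assumes f: "f \<in> borel_measurable M" and ae: "AE \<omega> in M. g \<omega> = f \<omega>"
  shows "g \<in> borel_measurable M"
proof (rule measurableI)
  obtain N where N: "N \<in> null_sets M" "{\<omega>\<in>space M. g \<omega> \<noteq> f \<omega>} \<subseteq> N" using ae by (auto elim!: AE_E simp: null_sets_def)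
  fix B :: "real set" assume B: "B \<in> sets borel"
  have fB: "f -` B \<inter> space M \<in> sets M" by (rule measurable_sets[OF f B])
  have eq: "g -` B \<inter> space M = ((f -` B \<inter> space M) - N) \<union> (g -` B \<inter> space M \<inter> N)" using N(2) by auto
  have "g -` B \<inter> space M \<inter> N \<in> sets M" by (rule subset_null_measurable[OF N(1)]) auto
  moreover have "(f -` B \<inter> space M) - N \<in> sets M" using fB N(1) by auto
  ultimately show "g -` B \<inter> space M \<in> sets M" by (subst eq, intro sets.Un)
qed simp

text \<open>
  The forward approximation involves paths of \<open>W\<close> that may be irregular on a null set;
  completeness makes it measurable all the same.
\<close>

lemma forward_approx_integrable:
  assumes "0 < \<epsilon>" "case_prod v \<in> Lp 2 Q"
  shows "integrable M (forward_approx T W v \<epsilon>)"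
proof -
  note i = fwd_contraction(1)[OF assms assms(2)] and ae = forward_approx_AE[OF assms(1), of v]
  have m: "forward_approx T W v \<epsilon> \<in> borel_measurable M"
    by (rule measurable_cong_AE_complete[OF borel_measurable_integrable[OF i] ae])
  show ?thesis using i integrable_cong_AE[OF m borel_measurable_integrable[OF i] ae] by simp
qed

text \<open>
  Averaging \<open>d\<close> against the cut-off kernel produces two errors: the oscillation of \<open>d\<close> around \<open>m\<close>
  on the window, and the mass that the cut-off at \<open>r\<close> and the window length take away from the
  constant \<open>m\<close>.
\<close>

lemma trace_error_pointwise:
  assumes \<epsilon>: "0 < \<epsilon>" and i: "integrable \<mu> (\<lambda>t. ker \<epsilon> s t * d t)"
    and [measurable]: "d \<in> borel_measurable \<mu>"
  shows "ennreal \<bar>avg T \<epsilon> (\<lambda>t. d t * indicator {0..r} t) s - m * indicator {0..r} s\<bar>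
    \<le> (\<integral>\<^sup>+t. ennreal (ker \<epsilon> s t) * ennreal (\<bar>d t - m\<bar> powr 1) \<partial>\<mu>)
      + ennreal \<bar>avg T \<epsilon> (indicator {0..r}) s - indicator {0..r} s\<bar> * ennreal \<bar>m\<bar>"
proof -
  define c where "c = avg T \<epsilon> (indicator {0..r}) s"
  have L: "(indicator {0..r} :: real \<Rightarrow> real) \<in> Lp 2 \<mu>" by (rule indicator_time_Lp2) simp
  have [measurable]: "(indicator {0..r} :: real \<Rightarrow> real) \<in> borel_measurable \<mu>" by (rule Lp2_measurable[OF L])
  have k: "integrable \<mu> (\<lambda>t. ker \<epsilon> s t * indicator {0..r} t)"
    by (rule time_Lp2_integrable[OF ker_mult_Lp2[OF \<epsilon> L]])
  have j: "integrable \<mu> (\<lambda>t. ker \<epsilon> s t * (d t * indicator {0..r} t))"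
    by (rule Bochner_Integration.integrable_bound[OF i]) (auto split: split_indicator)
  have l: "integrable \<mu> (\<lambda>t. m * (ker \<epsilon> s t * indicator {0..r} t))" using k by simp
  have "avg T \<epsilon> (\<lambda>t. d t * indicator {0..r} t) s - m * c
     = (\<integral>t. ker \<epsilon> s t * (d t * indicator {0..r} t) - m * (ker \<epsilon> s t * indicator {0..r} t) \<partial>\<mu>)"
    unfolding avg_def c_def using j k l by simp
  then have "ennreal \<bar>avg T \<epsilon> (\<lambda>t. d t * indicator {0..r} t) s - m * c\<bar>
     \<le> (\<integral>\<^sup>+t. ennreal (norm (ker \<epsilon> s t * (d t * indicator {0..r} t) - m * (ker \<epsilon> s t * indicator {0..r} t))) \<partial>\<mu>)"
    using integral_norm_bound_ennreal[OF Bochner_Integration.integrable_diff[OF j l]] by simp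
  also have "\<dots> \<le> (\<integral>\<^sup>+t. ennreal (ker \<epsilon> s t) * ennreal (\<bar>d t - m\<bar> powr 1) \<partial>\<mu>)"
  proof (rule nn_integral_mono)
    fix t
    have "\<bar>ker \<epsilon> s t * (d t * indicator {0..r} t) - m * (ker \<epsilon> s t * indicator {0..r} t)\<bar> \<le> ker \<epsilon> s t * \<bar>d t - m\<bar>"
      using ker_nonneg[OF \<epsilon>, of s t]
      by (simp add: abs_mult right_diff_distrib[symmetric] mult.commute[of m] left_diff_distrib[symmetric] mult.assoc[symmetric] split: split_indicator)
    then show "ennreal (norm (ker \<epsilon> s t * (d t * indicator {0..r} t) - m * (ker \<epsilon> s t * indicator {0..r} t)))
       \<le> ennreal (ker \<epsilon> s t) * ennreal (\<bar>d t - m\<bar> powr 1)"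
      using ker_nonneg[OF \<epsilon>, of s t] by (simp add: ennreal_mult[symmetric] ennreal_leI)
  qed
  finally have 1: "ennreal \<bar>avg T \<epsilon> (\<lambda>t. d t * indicator {0..r} t) s - m * c\<bar>
     \<le> (\<integral>\<^sup>+t. ennreal (ker \<epsilon> s t) * ennreal (\<bar>d t - m\<bar> powr 1) \<partial>\<mu>)" .
  have "\<bar>avg T \<epsilon> (\<lambda>t. d t * indicator {0..r} t) s - m * indicator {0..r} s\<bar>
     \<le> \<bar>avg T \<epsilon> (\<lambda>t. d t * indicator {0..r} t) s - m * c\<bar> + \<bar>m * c - m * indicator {0..r} s\<bar>" by linarith
  also have "\<bar>m * c - m * indicator {0..r} s\<bar> = \<bar>c - indicator {0..r} s\<bar> * \<bar>m\<bar>"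
    unfolding right_diff_distrib[symmetric] abs_mult by (rule mult.commute)
  finally have "ennreal \<bar>avg T \<epsilon> (\<lambda>t. d t * indicator {0..r} t) s - m * indicator {0..r} s\<bar>
     \<le> ennreal \<bar>avg T \<epsilon> (\<lambda>t. d t * indicator {0..r} t) s - m * c\<bar> + ennreal (\<bar>c - indicator {0..r} s\<bar> * \<bar>m\<bar>)"
    unfolding ennreal_plus[OF abs_ge_zero mult_nonneg_nonneg[OF abs_ge_zero abs_ge_zero], symmetric] by (rule ennreal_leI)
  from order_trans[OF this add_mono[OF 1 eq_refl[OF ennreal_mult[OF abs_ge_zero abs_ge_zero]]]]
  show ?thesis unfolding c_def .
qed

lemma L1_sections:
  assumes "integrable (\<mu> \<Otimes>\<^sub>M M) (case_prod D)"
  shows "(\<lambda>s. \<integral>\<^sup>+\<omega>. ennreal \<bar>D s \<omega>\<bar> \<partial>M) \<in> borel_measurable \<mu>"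
    "(\<integral>\<^sup>+s. \<integral>\<^sup>+\<omega>. ennreal \<bar>D s \<omega>\<bar> \<partial>M \<partial>\<mu>) < \<infinity>"
proof -
  have m: "(\<lambda>z. ennreal \<bar>case_prod D z\<bar>) \<in> borel_measurable (\<mu> \<Otimes>\<^sub>M M)"
    using borel_measurable_integrable[OF assms] by measurable
  show "(\<lambda>s. \<integral>\<^sup>+\<omega>. ennreal \<bar>D s \<omega>\<bar> \<partial>M) \<in> borel_measurable \<mu>"
    using borel_measurable_nn_integral_fst[OF m] by simp
  have "(\<integral>\<^sup>+s. \<integral>\<^sup>+\<omega>. ennreal \<bar>D s \<omega>\<bar> \<partial>M \<partial>\<mu>) = (\<integral>\<^sup>+z. ennreal (norm (case_prod D z)) \<partial>(\<mu> \<Otimes>\<^sub>M M))"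
    using nn_integral_fst[OF m] by simp
  also have "\<dots> < \<infinity>" using assms unfolding integrable_iff_bounded by simp
  finally show "(\<integral>\<^sup>+s. \<integral>\<^sup>+\<omega>. ennreal \<bar>D s \<omega>\<bar> \<partial>M \<partial>\<mu>) < \<infinity>" .
qed

lemma L1_cutoff:
  fixes D :: "real \<Rightarrow> 'a \<Rightarrow> real"
  assumes D: "integrable (\<mu> \<Otimes>\<^sub>M M) (case_prod D)"
  shows "integrable (\<mu> \<Otimes>\<^sub>M M) (\<lambda>(s, \<omega>). D s \<omega> * indicator {0..r} s)"
proof (rule Bochner_Integration.integrable_bound[OF D])
  have "(\<lambda>z. indicator {0..r} (fst z) :: real) \<in> borel_measurable (\<mu> \<Otimes>\<^sub>M M)"
    by (rule measurable_compose[OF time_fst_measurable]) simp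
  then show "(\<lambda>(s, \<omega>). D s \<omega> * indicator {0..r} s) \<in> borel_measurable (\<mu> \<Otimes>\<^sub>M M)"
    using borel_measurable_integrable[OF D] by (simp add: case_prod_beta')
qed (auto split: split_indicator)

text \<open>
  Since the kernel lives on \<open>[s - \<epsilon>, s)\<close> and has mass at most one, averaging \<open>E\<bar>D\<^sub>s u\<^sub>t - D\<^sup>-u\<^sub>s\<bar>\<close>
  over the window gives at most its supremum, which is the quantity controlled by the definition
  of \<open>D\<^sup>-u\<close>.
\<close>

lemma trace_error:
  assumes \<epsilon>: "0 < \<epsilon>" and Du: "(\<lambda>(s, t, \<omega>). Du s t \<omega>) \<in> Lp 2 (\<mu> \<Otimes>\<^sub>M Q)"
    and Dur: "(\<lambda>(s, t, \<omega>). Du s t \<omega> * indicator {0..r} t) \<in> Lp 2 (\<mu> \<Otimes>\<^sub>M Q)"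
    and Dm: "integrable (\<mu> \<Otimes>\<^sub>M M) (case_prod Dm)"
  shows "ennreal (expectation (\<lambda>\<omega>. \<bar>trace_avg \<epsilon> (\<lambda>s t \<omega>. Du s t \<omega> * indicator {0..r} t) \<omega>
      - (\<integral>s. Dm s \<omega> * indicator {0..r} s \<partial>\<mu>)\<bar>))
    \<le> (\<integral>\<^sup>+s. (SUP t\<in>{max (s - \<epsilon>) 0..<s}. \<integral>\<^sup>+\<omega>. ennreal (\<bar>Du s t \<omega> - Dm s \<omega>\<bar> powr 1) \<partial>M) \<partial>\<mu>)
      + (\<integral>\<^sup>+s. ennreal \<bar>avg T \<epsilon> (indicator {0..r}) s - indicator {0..r} s\<bar> * (\<integral>\<^sup>+\<omega>. ennreal \<bar>Dm s \<omega>\<bar> \<partial>M) \<partial>\<mu>)"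
proof -
  let ?b = "\<lambda>s. ennreal \<bar>avg T \<epsilon> (indicator {0..r}) s - indicator {0..r} s\<bar>"
  let ?S = "\<lambda>s. SUP t\<in>{max (s - \<epsilon>) 0..<s}. \<integral>\<^sup>+\<omega>. ennreal (\<bar>Du s t \<omega> - Dm s \<omega>\<bar> powr 1) \<partial>M"
  let ?D = "\<lambda>s \<omega>. avg T \<epsilon> (\<lambda>t. Du s t \<omega> * indicator {0..r} t) s - Dm s \<omega> * indicator {0..r} s"
  have Dmm: "case_prod Dm \<in> borel_measurable (\<mu> \<Otimes>\<^sub>M M)" using Dm by simp
  have Dum: "(\<lambda>(s, t, \<omega>). Du s t \<omega>) \<in> borel_measurable (\<mu> \<Otimes>\<^sub>M Q)" using Du by measurable
  note Dmr = L1_cutoff[OF Dm, of r]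
  note a = diagonal_avg_integrable(2)[OF \<epsilon> Dur]
  have d: "integrable (\<mu> \<Otimes>\<^sub>M M) (\<lambda>(s, \<omega>). ?D s \<omega>)" using a Dmr by (simp add: case_prod_beta')
  have "expectation (\<lambda>\<omega>. \<bar>trace_avg \<epsilon> (\<lambda>s t \<omega>. Du s t \<omega> * indicator {0..r} t) \<omega> - (\<integral>s. Dm s \<omega> * indicator {0..r} s \<partial>\<mu>)\<bar>)
    \<le> (\<integral>z. \<bar>(\<lambda>(s, \<omega>). ?D s \<omega>) z\<bar> \<partial>(\<mu> \<Otimes>\<^sub>M M))"
    unfolding trace_avg_def using Q.snd_integral_contraction[OF a Dmr] by (simp add: case_prod_beta')
  then have "ennreal (expectation (\<lambda>\<omega>. \<bar>trace_avg \<epsilon> (\<lambda>s t \<omega>. Du s t \<omega> * indicator {0..r} t) \<omega> - (\<integral>s. Dm s \<omega> * indicator {0..r} s \<partial>\<mu>)\<bar>))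
    \<le> ennreal (\<integral>z. \<bar>(\<lambda>(s, \<omega>). ?D s \<omega>) z\<bar> \<partial>(\<mu> \<Otimes>\<^sub>M M))" by (rule ennreal_leI)
  also have "\<dots> = (\<integral>\<^sup>+z. ennreal \<bar>(\<lambda>(s, \<omega>). ?D s \<omega>) z\<bar> \<partial>(\<mu> \<Otimes>\<^sub>M M))"
    using d by (intro nn_integral_eq_integral[symmetric]) auto
  also have "\<dots> = (\<integral>\<^sup>+s. \<integral>\<^sup>+\<omega>. ennreal \<bar>?D s \<omega>\<bar> \<partial>M \<partial>\<mu>)"
    using nn_integral_fst[of "\<lambda>z. ennreal \<bar>(\<lambda>(s, \<omega>). ?D s \<omega>) z\<bar>" \<mu>] borel_measurable_integrable[OF d]
    by (simp add: case_prod_beta')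
  also have "\<dots> \<le> (\<integral>\<^sup>+s. ?S s \<partial>\<mu>) + (\<integral>\<^sup>+s. ?b s * (\<integral>\<^sup>+\<omega>. ennreal \<bar>Dm s \<omega>\<bar> \<partial>M) \<partial>\<mu>)"
  proof (rule nn_integral_le_add)
    have dm: "(\<lambda>z. ennreal \<bar>(\<lambda>(s, \<omega>). ?D s \<omega>) z\<bar>) \<in> borel_measurable (\<mu> \<Otimes>\<^sub>M M)"
      using borel_measurable_integrable[OF d] by measurable
    show "(\<lambda>s. \<integral>\<^sup>+\<omega>. ennreal \<bar>?D s \<omega>\<bar> \<partial>M) \<in> borel_measurable \<mu>"
      using borel_measurable_nn_integral_fst[OF dm] by simp
    have hm: "(\<lambda>s. \<integral>\<^sup>+\<omega>. ennreal \<bar>Dm s \<omega>\<bar> \<partial>M) \<in> borel_measurable \<mu>" by (rule L1_sections(1)[OF Dm])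
    have [measurable]: "avg T \<epsilon> (indicator {0..r}) \<in> borel_measurable \<mu>"
      "(indicator {0..r} :: real \<Rightarrow> real) \<in> borel_measurable \<mu>"
      by (rule avg_indicator(1)[OF \<epsilon>], rule time_measurable_borel) simp
    show "(\<lambda>s. ?b s * (\<integral>\<^sup>+\<omega>. ennreal \<bar>Dm s \<omega>\<bar> \<partial>M)) \<in> borel_measurable \<mu>"
      using hm by measurable
    have "AE s in \<mu>. (\<integral>\<^sup>+\<omega>. ennreal \<bar>Dm s \<omega>\<bar> \<partial>M) \<noteq> \<infinity>"
      using hm L1_sections(2)[OF Dm] by (intro nn_integral_PInf_AE) auto
    then show "AE s in \<mu>. ?b s * (\<integral>\<^sup>+\<omega>. ennreal \<bar>Dm s \<omega>\<bar> \<partial>M) \<noteq> \<infinity>"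
      by eventually_elim (simp add: ennreal_mult_eq_top_iff)
    have "AE z in \<mu> \<Otimes>\<^sub>M M. integrable \<mu> (\<lambda>t. ker \<epsilon> (fst z) t * Du (fst z) t (snd z))"
      using QT.AE_integrable_fst'[OF diagonal_avg_integrable(1)[OF \<epsilon> Du]] unfolding process_measure_eq by (simp add: case_prod_beta')
    from AE_space Q.AE_pair[OF this]
    show "AE s in \<mu>. (\<integral>\<^sup>+\<omega>. ennreal \<bar>?D s \<omega>\<bar> \<partial>M) \<le> ?S s + ?b s * (\<integral>\<^sup>+\<omega>. ennreal \<bar>Dm s \<omega>\<bar> \<partial>M)"
    proof eventually_elim
      case (elim s)
      note s = elim(1)
      have ds: "(\<lambda>(t, \<omega>). Du s t \<omega>) \<in> borel_measurable (\<mu> \<Otimes>\<^sub>M M)"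
        using measurable_compose[OF measurable_Pair1'[OF s, of Q] Dum] by (simp add: process_measure_eq)
      have ms[measurable]: "Dm s \<in> borel_measurable M"
        using measurable_compose[OF measurable_Pair1'[OF s] Dmm] by simp
      define \<phi> where "\<phi> z = ennreal (ker \<epsilon> s (fst z)) * ennreal (\<bar>Du s (fst z) (snd z) - Dm s (snd z)\<bar> powr 1)" for z
      have \<phi>[measurable]: "\<phi> \<in> borel_measurable (\<mu> \<Otimes>\<^sub>M M)"
      proof -
        have [measurable]: "(\<lambda>z. Du s (fst z) (snd z)) \<in> borel_measurable (\<mu> \<Otimes>\<^sub>M M)"
          using ds by (simp add: case_prod_beta')
        show ?thesis unfolding \<phi>_def[abs_def] by measurable
      qed
      have "(\<integral>\<^sup>+\<omega>. ennreal \<bar>?D s \<omega>\<bar> \<partial>M) \<le> (\<integral>\<^sup>+\<omega>. (\<integral>\<^sup>+t. \<phi> (t, \<omega>) \<partial>\<mu>) + ?b s * ennreal \<bar>Dm s \<omega>\<bar> \<partial>M)"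
      proof (rule nn_integral_mono_AE)
        from AE_space elim(2) show "AE \<omega> in M. ennreal \<bar>?D s \<omega>\<bar> \<le> (\<integral>\<^sup>+t. \<phi> (t, \<omega>) \<partial>\<mu>) + ?b s * ennreal \<bar>Dm s \<omega>\<bar>"
        proof eventually_elim
          case (elim \<omega>)
          have "(\<lambda>t. Du s t \<omega>) \<in> borel_measurable \<mu>"
            using measurable_compose[OF measurable_Pair2'[OF elim(1)] ds] by simp
          from trace_error_pointwise[OF \<epsilon> _ this, of s r "Dm s \<omega>"] elim(2) show ?case unfolding \<phi>_def by simp
        qed
      qed
      also have "\<dots> = (\<integral>\<^sup>+\<omega>. \<integral>\<^sup>+t. \<phi> (t, \<omega>) \<partial>\<mu> \<partial>M) + ?b s * (\<integral>\<^sup>+\<omega>. ennreal \<bar>Dm s \<omega>\<bar> \<partial>M)"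
      proof -
        have "(\<lambda>\<omega>. \<integral>\<^sup>+t. \<phi> (t, \<omega>) \<partial>\<mu>) \<in> borel_measurable M" 
          using tm.borel_measurable_nn_integral_fst[OF measurable_compose[OF measurable_pair_swap' \<phi>]] by simp
        then show ?thesis by (simp add: nn_integral_add nn_integral_cmult)
      qed
      also have "(\<integral>\<^sup>+\<omega>. \<integral>\<^sup>+t. \<phi> (t, \<omega>) \<partial>\<mu> \<partial>M) = (\<integral>\<^sup>+t. \<integral>\<^sup>+\<omega>. \<phi> (t, \<omega>) \<partial>M \<partial>\<mu>)"
        by (rule Q.Fubini[OF \<phi>])
      also have "\<dots> \<le> (\<integral>\<^sup>+t. ?S s * ennreal (ker \<epsilon> s t) \<partial>\<mu>)"
      proof (rule nn_integral_mono)
        fix t assume t: "t \<in> space \<mu>"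
        have [measurable]: "(\<lambda>\<omega>. Du s t \<omega>) \<in> borel_measurable M" using measurable_compose[OF measurable_Pair1'[OF t] ds] by simp
        have e: "(\<integral>\<^sup>+\<omega>. \<phi> (t, \<omega>) \<partial>M) = ennreal (ker \<epsilon> s t) * (\<integral>\<^sup>+\<omega>. ennreal (\<bar>Du s t \<omega> - Dm s \<omega>\<bar> powr 1) \<partial>M)"
          unfolding \<phi>_def fst_conv snd_conv by (rule nn_integral_cmult) measurable
        show "(\<integral>\<^sup>+\<omega>. \<phi> (t, \<omega>) \<partial>M) \<le> ?S s * ennreal (ker \<epsilon> s t)"
        proof (cases "t \<in> {max (s - \<epsilon>) 0..<s}")
          case True
          show ?thesis unfolding e by (subst mult.commute, intro mult_right_mono SUP_upper True) simp
        next
          case False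
          then have "ker \<epsilon> s t = 0" using t by (auto simp: ker_def)
          then show ?thesis unfolding e by simp
        qed
      qed
      also have "\<dots> = ?S s * (\<integral>\<^sup>+t. ennreal (ker \<epsilon> s t) \<partial>\<mu>)"
        by (rule nn_integral_cmult) measurable
      also have "(\<integral>\<^sup>+t. ennreal (ker \<epsilon> s t) \<partial>\<mu>) = ennreal (\<integral>t. ker \<epsilon> s t \<partial>\<mu>)"
        by (rule nn_integral_eq_integral[OF ker_time(1)[OF \<epsilon>]]) (simp add: ker_nonneg[OF \<epsilon>])
      also have "?S s * ennreal (\<integral>t. ker \<epsilon> s t \<partial>\<mu>) \<le> ?S s * 1"
        using ker_time(2)[OF \<epsilon>, of T s] by (intro mult_left_mono) (simp_all add: ennreal_le_1)
      finally show ?case by (simp add: add_right_mono)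
    qed
  qed
  finally show ?thesis .
qed

text \<open>
  The averaged indicator is eventually exact at every \<open>s > 0\<close>, and the error is bounded by one, so
  dominated convergence applies to the integrable function \<open>\<bar>D\<^sup>-u\<bar>\<close>.
\<close>

lemma cutoff_error_tendsto:
  assumes e: "\<And>k::nat. 0 < e k" "e \<longlonglongrightarrow> 0" and Dm: "integrable (\<mu> \<Otimes>\<^sub>M M) (case_prod Dm)"
  shows "(\<lambda>k. \<integral>\<^sup>+s. ennreal \<bar>avg T (e k) (indicator {0..r}) s - indicator {0..r} s\<bar> * (\<integral>\<^sup>+\<omega>. ennreal \<bar>Dm s \<omega>\<bar> \<partial>M) \<partial>\<mu>) \<longlonglongrightarrow> 0"
proof -
  define h where "h s = (\<integral>\<^sup>+\<omega>. ennreal \<bar>Dm s \<omega>\<bar> \<partial>M)" for s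
  have hm[measurable]: "h \<in> borel_measurable \<mu>" and fin: "(\<integral>\<^sup>+s. h s \<partial>\<mu>) < \<infinity>"
    unfolding h_def[abs_def] by (rule L1_sections[OF Dm])+
  have [measurable]: "(indicator {0..r} :: real \<Rightarrow> real) \<in> borel_measurable \<mu>" by (rule time_measurable_borel) simp
  have am[measurable]: "avg T (e k) (indicator {0..r}) \<in> borel_measurable \<mu>" for k by (rule avg_indicator(1)[OF e(1)])
  have "(\<lambda>k. \<integral>\<^sup>+s. ennreal \<bar>avg T (e k) (indicator {0..r}) s - indicator {0..r} s\<bar> * h s \<partial>\<mu>) \<longlonglongrightarrow> (\<integral>\<^sup>+s. 0 \<partial>\<mu>)"
  proof (rule nn_integral_dominated_convergence[where w = h])
    show "AE s in \<mu>. ennreal \<bar>avg T (e k) (indicator {0..r}) s - indicator {0..r} s\<bar> * h s \<le> h s" for k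
    proof (rule AE_I2)
      fix s
      have "\<bar>avg T (e k) (indicator {0..r}) s - indicator {0..r} s\<bar> \<le> 1"
        using avg_indicator(2,3)[OF e(1)[of k], of T r s] by (auto split: split_indicator)
      then have "ennreal \<bar>avg T (e k) (indicator {0..r}) s - indicator {0..r} s\<bar> * h s \<le> 1 * h s"
        by (intro mult_right_mono) (simp_all add: ennreal_le_1)
      then show "ennreal \<bar>avg T (e k) (indicator {0..r}) s - indicator {0..r} s\<bar> * h s \<le> h s" by simp
    qed
    have "AE s in \<mu>. h s \<noteq> \<infinity>" using fin by (intro nn_integral_PInf_AE) auto
    from AE_space AE_time_not_eq[of 0] this
    show "AE s in \<mu>. (\<lambda>k. ennreal \<bar>avg T (e k) (indicator {0..r}) s - indicator {0..r} s\<bar> * h s) \<longlonglongrightarrow> 0"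
    proof eventually_elim
      case (elim s)
      have "(\<lambda>k. \<bar>avg T (e k) (indicator {0..r}) s - indicator {0..r} s\<bar>) \<longlonglongrightarrow> \<bar>indicator {0..r} s - indicator {0..r} s\<bar>"
        using elim by (intro tendsto_rabs tendsto_diff tendsto_const avg_indicator_tendsto e) auto
      then have "(\<lambda>k. ennreal \<bar>avg T (e k) (indicator {0..r}) s - indicator {0..r} s\<bar>) \<longlonglongrightarrow> ennreal 0" by (intro tendsto_ennrealI) simp
      then have "(\<lambda>k. ennreal \<bar>avg T (e k) (indicator {0..r}) s - indicator {0..r} s\<bar> * h s) \<longlonglongrightarrow> ennreal 0 * h s"
        using elim(3) by (intro tendsto_mult_ennreal tendsto_const) auto
      then show ?case by simp
    qed
  qed (use fin in auto)
  then show ?thesis unfolding h_def by simp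
qed

text \<open>
  The forward approximation splits into the part that tends to the Skorohod integral and the
  averaged trace.
\<close>

theorem forward_limit:
  assumes Du: "process_deriv T M W u Du" and Dm: "integrable (\<mu> \<Otimes>\<^sub>M M) (case_prod Dm)"
    and lim: "((\<lambda>\<epsilon>. \<integral>\<^sup>+s. (SUP t\<in>{max (s - \<epsilon>) 0..<s}. \<integral>\<^sup>+\<omega>. ennreal (\<bar>Du s t \<omega> - Dm s \<omega>\<bar> powr 1) \<partial>M) \<partial>\<mu>) \<longlongrightarrow> 0) (at_right 0)"
  shows "\<exists>Y. is_skorohod_integral T M W (cutoff u r) Y \<and> (\<forall>e. (\<forall>k::nat. 0 < e k) \<longrightarrow> e \<longlonglongrightarrow> 0 \<longrightarrow>
    (\<lambda>k. expectation (\<lambda>\<omega>. \<bar>fwd (e k) (cutoff u r) \<omega> - (Y \<omega> + (\<integral>s. Dm s \<omega> * indicator {0..r} s \<partial>\<mu>))\<bar>)) \<longlonglongrightarrow> 0)"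
proof -
  let ?A = "\<lambda>\<epsilon>. (\<integral>\<^sup>+s. (SUP t\<in>{max (s - \<epsilon>) 0..<s}. \<integral>\<^sup>+\<omega>. ennreal (\<bar>Du s t \<omega> - Dm s \<omega>\<bar> powr 1) \<partial>M) \<partial>\<mu>)"
  let ?B = "\<lambda>\<epsilon>. (\<integral>\<^sup>+s. ennreal \<bar>avg T \<epsilon> (indicator {0..r}) s - indicator {0..r} s\<bar> * (\<integral>\<^sup>+\<omega>. ennreal \<bar>Dm s \<omega>\<bar> \<partial>M) \<partial>\<mu>)"
  let ?Dv = "\<lambda>s t \<omega>. Du s t \<omega> * indicator {0..r} t"
  define J where "J \<omega> = (\<integral>s. Dm s \<omega> * indicator {0..r} s \<partial>\<mu>)" for \<omega>
  note v = cutoff_process_deriv[OF Du, of r]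
  have DuL: "(\<lambda>(s, t, \<omega>). Du s t \<omega>) \<in> Lp 2 (\<mu> \<Otimes>\<^sub>M Q)"
    using Du unfolding process_deriv_def by blast
  have vL: "case_prod (cutoff u r) \<in> Lp 2 Q"
    and DvL: "(\<lambda>(s, t, \<omega>). ?Dv s t \<omega>) \<in> Lp 2 (\<mu> \<Otimes>\<^sub>M Q)"
    using v unfolding process_deriv_def by blast+
  obtain Y where Y: "is_skorohod_integral T M W (cutoff u r) Y"
    and lY: "\<And>e. (\<forall>k::nat. 0 < e k) \<Longrightarrow> e \<longlonglongrightarrow> 0 \<Longrightarrow>
      (\<lambda>k. expectation (\<lambda>\<omega>. \<bar>fwd (e k) (cutoff u r) \<omega> - trace_avg (e k) ?Dv \<omega> - Y \<omega>\<bar>)) \<longlonglongrightarrow> 0"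
    using skorohod_correction[OF v] by blast
  have Yi: "integrable M Y" using Y Lp2_integrable unfolding is_skorohod_integral_def by blast
  from Q.integrable_snd[OF L1_cutoff[OF Dm]] have Ji: "integrable M J" unfolding J_def[abs_def] .
  have "(\<lambda>k. expectation (\<lambda>\<omega>. \<bar>fwd (e k) (cutoff u r) \<omega> - (Y \<omega> + J \<omega>)\<bar>)) \<longlonglongrightarrow> 0"
    if e: "\<forall>k::nat. 0 < e k" "e \<longlonglongrightarrow> 0" for e
  proof -
    have e1: "\<And>k. 0 < e k" using e by blast
    have f: "filterlim e (at_right 0) sequentially" 
      by (rule tendsto_imp_filterlim_at_right[OF e(2)]) (simp add: e1)
    have "(\<lambda>k. ennreal (expectation (\<lambda>\<omega>. \<bar>trace_avg (e k) ?Dv \<omega> - J \<omega>\<bar>))) \<longlonglongrightarrow> 0"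
    proof (rule tendsto_sandwich[OF _ _ tendsto_const])
      show "\<forall>\<^sub>F k in sequentially. ennreal (expectation (\<lambda>\<omega>. \<bar>trace_avg (e k) ?Dv \<omega> - J \<omega>\<bar>))
        \<le> ?A (e k) + ?B (e k)"
        unfolding J_def by (intro always_eventually allI trace_error e1 DuL DvL Dm)
      have "(\<lambda>k. ?A (e k) + ?B (e k)) \<longlonglongrightarrow> 0 + 0"
        by (rule tendsto_add[OF filterlim_compose[OF lim f] cutoff_error_tendsto[OF e1 e(2) Dm]])
      then show "(\<lambda>k. ?A (e k) + ?B (e k)) \<longlonglongrightarrow> 0" by simp
    qed simp
    then have "(\<lambda>k. ennreal (expectation (\<lambda>\<omega>. \<bar>trace_avg (e k) ?Dv \<omega> - J \<omega>\<bar>))) \<longlonglongrightarrow> ennreal 0" by simp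
    then have lJ: "(\<lambda>k. expectation (\<lambda>\<omega>. \<bar>trace_avg (e k) ?Dv \<omega> - J \<omega>\<bar>)) \<longlonglongrightarrow> 0"
      by (subst (asm) tendsto_ennreal_iff) (auto intro: integral_nonneg_AE)
    note fi = fwd_contraction(1)[OF e1 vL vL] and ti = trace_avg_contraction(1)[OF e1 DvL DvL]
    have le: "norm (expectation (\<lambda>\<omega>. \<bar>fwd (e k) (cutoff u r) \<omega> - (Y \<omega> + J \<omega>)\<bar>))
      \<le> expectation (\<lambda>\<omega>. \<bar>fwd (e k) (cutoff u r) \<omega> - trace_avg (e k) ?Dv \<omega> - Y \<omega>\<bar>) + expectation (\<lambda>\<omega>. \<bar>trace_avg (e k) ?Dv \<omega> - J \<omega>\<bar>)" for k
    proof -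
      have "expectation (\<lambda>\<omega>. \<bar>fwd (e k) (cutoff u r) \<omega> - (Y \<omega> + J \<omega>)\<bar>)
        \<le> expectation (\<lambda>\<omega>. \<bar>fwd (e k) (cutoff u r) \<omega> - trace_avg (e k) ?Dv \<omega> - Y \<omega>\<bar> + \<bar>trace_avg (e k) ?Dv \<omega> - J \<omega>\<bar>)"
        using fi ti Yi Ji by (intro integral_mono) auto
      also have "\<dots> = expectation (\<lambda>\<omega>. \<bar>fwd (e k) (cutoff u r) \<omega> - trace_avg (e k) ?Dv \<omega> - Y \<omega>\<bar>) + expectation (\<lambda>\<omega>. \<bar>trace_avg (e k) ?Dv \<omega> - J \<omega>\<bar>)"
        using fi ti Yi Ji by (intro Bochner_Integration.integral_add) auto
      finally show ?thesis by (simp add: integral_nonneg_AE)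
    qed
    from tendsto_add[OF lY[OF e] lJ] show ?thesis
      by (intro Lim_null_comparison[OF always_eventually[OF allI[OF le]]]) simp
  qed
  then show ?thesis using Y unfolding J_def by blast
qed

end

theorem proposition2p9:
  fixes T :: real and M :: "'a measure"
    and W u Dm :: "real \<Rightarrow> 'a \<Rightarrow> real"
  assumes "brownian_setting T M W"
    and "u \<in> L12_minus T M W 1"
    and "is_D_minus T M W 1 u Dm"
  shows "\<forall>t\<in>{0..T}.
    cutoff u t \<in> Dom_forward T M W 1 \<and>
    cutoff u t \<in> Dom_skorohod T M W \<and>
    (AE \<omega> in M. forward_integral T M W (cutoff u t) \<omega> =
       skorohod_integral T M W (cutoff u t) \<omega> + (LBINT s:{0..t}. Dm s \<omega>))"
proof
  interpret brownian T M W by unfold_locales (rule assms(1))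
  fix r assume r: "r \<in> {0..T}"
  obtain Du where Du: "process_deriv T M W u Du"
    and lim: "((\<lambda>\<epsilon>. \<integral>\<^sup>+s. (SUP t\<in>{max (s - \<epsilon>) 0..<s}. \<integral>\<^sup>+\<omega>. ennreal (\<bar>Du s t \<omega> - Dm s \<omega>\<bar> powr 1) \<partial>M) \<partial>time_measure T) \<longlongrightarrow> 0) (at_right 0)"
    using assms(3) unfolding is_D_minus_def by blast
  have Dm: "integrable (time_measure T \<Otimes>\<^sub>M M) (case_prod Dm)"
    using assms(3) unfolding is_D_minus_def Lp1_iff process_measure_eq by blast
  define v where "v = cutoff u r"
  have vL: "case_prod v \<in> Lp 2 (process_measure T M)"
    using cutoff_process_deriv[OF Du, of r] unfolding process_deriv_def v_def by blast
  obtain Y where Y: "is_skorohod_integral T M W v Y"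
    and lY: "\<And>e. (\<forall>k::nat. 0 < e k) \<Longrightarrow> e \<longlonglongrightarrow> 0 \<Longrightarrow>
      (\<lambda>k. expectation (\<lambda>\<omega>. \<bar>fwd (e k) v \<omega> - (Y \<omega> + (\<integral>s. Dm s \<omega> * indicator {0..r} s \<partial>time_measure T))\<bar>)) \<longlonglongrightarrow> 0"
    using forward_limit[OF Du Dm lim, of r] unfolding v_def by blast
  have Yi: "integrable M Y" using Y Lp2_integrable unfolding is_skorohod_integral_def by blast
  have J: "(\<integral>s. Dm s \<omega> * indicator {0..r} s \<partial>time_measure T) = (LBINT s:{0..r}. Dm s \<omega>)" for \<omega>
    unfolding time_integral set_lebesgue_integral_def using r by (intro Bochner_Integration.integral_cong) (auto split: split_indicator)
  from Q.integrable_snd[OF L1_cutoff[OF Dm, of r]] have Ji: "integrable M (\<lambda>\<omega>. LBINT s:{0..r}. Dm s \<omega>)" unfolding J .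
  define Z where "Z \<omega> = Y \<omega> + (LBINT s:{0..r}. Dm s \<omega>)" for \<omega>
  have Zi: "integrable M Z" unfolding Z_def[abs_def] using Yi Ji by simp
  have Zm[measurable]: "Z \<in> borel_measurable M" using Zi by simp
  have fi: "integrable M (forward_approx T W v \<epsilon>)" if "0 < \<epsilon>" for \<epsilon> by (rule forward_approx_integrable[OF that vL])
  have pos: "\<forall>\<^sub>F \<epsilon> in at_right 0. (0::real) < \<epsilon>" by (simp add: eventually_at_right_less)
  have L1: "((\<lambda>\<epsilon>. expectation (\<lambda>\<omega>. \<bar>forward_approx T W v \<epsilon> \<omega> - Z \<omega>\<bar>)) \<longlongrightarrow> 0) (at_right 0)"
  \<comment> \<open>the preceding limits are along sequences of window lengths; the bound \<open>1\<close> is arbitrary\<close>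
  proof (rule tendsto_at_right_sequentially[of 0 1])
    fix e :: "nat \<Rightarrow> real" assume e: "\<And>n. 0 < e n" "e \<longlonglongrightarrow> 0"
    have "expectation (\<lambda>\<omega>. \<bar>forward_approx T W v (e n) \<omega> - Z \<omega>\<bar>) = expectation (\<lambda>\<omega>. \<bar>fwd (e n) v \<omega> - Z \<omega>\<bar>)" for n
    proof (rule integral_cong_AE)
      show "AE \<omega> in M. \<bar>forward_approx T W v (e n) \<omega> - Z \<omega>\<bar> = \<bar>fwd (e n) v \<omega> - Z \<omega>\<bar>"
        using forward_approx_AE[OF e(1)[of n], of v] by eventually_elim simp
    qed (use fi[OF e(1)[of n]] fwd_contraction(1)[OF e(1)[of n] vL vL] in simp_all)
    then show "(\<lambda>n. expectation (\<lambda>\<omega>. \<bar>forward_approx T W v (e n) \<omega> - Z \<omega>\<bar>)) \<longlonglongrightarrow> 0"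
      using lY[of e] e unfolding J Z_def by simp
  qed simp
  have conv1: "tendsto_Lp 1 M (forward_approx T W v) Z (at_right 0)"
    unfolding tendsto_Lp_def
  proof (rule Lim_transform_eventually)
    show "((\<lambda>\<epsilon>. ennreal (expectation (\<lambda>\<omega>. \<bar>forward_approx T W v \<epsilon> \<omega> - Z \<omega>\<bar>))) \<longlongrightarrow> 0) (at_right 0)"
      using tendsto_ennrealI[OF L1] by simp
    show "\<forall>\<^sub>F \<epsilon> in at_right 0. ennreal (expectation (\<lambda>\<omega>. \<bar>forward_approx T W v \<epsilon> \<omega> - Z \<omega>\<bar>))
        = (\<integral>\<^sup>+\<omega>. ennreal (\<bar>forward_approx T W v \<epsilon> \<omega> - Z \<omega>\<bar> powr 1) \<partial>M)"
      using pos
    proof eventually_elim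
      case (elim \<epsilon>)
      show ?case using fi[OF elim] Zi by (subst nn_integral_eq_integral[symmetric]) auto
    qed
  qed
  \<comment> \<open>convergence in mean implies convergence in probability by Markov's inequality\<close>
  have prob: "tendsto_prob M (forward_approx T W v) Z (at_right 0)"
    unfolding tendsto_prob_def
  proof (intro allI impI)
    fix c :: real assume c: "0 < c"
    show "((\<lambda>\<epsilon>. measure M {\<omega>\<in>space M. c < \<bar>forward_approx T W v \<epsilon> \<omega> - Z \<omega>\<bar>}) \<longlongrightarrow> 0) (at_right 0)"
    proof (rule tendsto_sandwich[OF _ _ tendsto_const])
      show "((\<lambda>\<epsilon>. 1 / c * expectation (\<lambda>\<omega>. \<bar>forward_approx T W v \<epsilon> \<omega> - Z \<omega>\<bar>)) \<longlongrightarrow> 0) (at_right 0)"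
        using tendsto_mult[OF tendsto_const[of "1/c"] L1] by simp
      show "\<forall>\<^sub>F \<epsilon> in at_right 0. measure M {\<omega>\<in>space M. c < \<bar>forward_approx T W v \<epsilon> \<omega> - Z \<omega>\<bar>}
         \<le> 1 / c * expectation (\<lambda>\<omega>. \<bar>forward_approx T W v \<epsilon> \<omega> - Z \<omega>\<bar>)"
        using pos
      proof eventually_elim
        case (elim \<epsilon>)
        note [measurable] = borel_measurable_integrable[OF fi[OF elim]]
        have "measure M {\<omega>\<in>space M. c < \<bar>forward_approx T W v \<epsilon> \<omega> - Z \<omega>\<bar>} \<le> measure M {\<omega>\<in>space M. c \<le> \<bar>forward_approx T W v \<epsilon> \<omega> - Z \<omega>\<bar>}"
          by (intro finite_measure_mono) auto
        also have "\<dots> \<le> 1 / c * expectation (\<lambda>\<omega>. \<bar>forward_approx T W v \<epsilon> \<omega> - Z \<omega>\<bar>)"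
          using integral_Markov_inequality_measure[of M "\<lambda>\<omega>. \<bar>forward_approx T W v \<epsilon> \<omega> - Z \<omega>\<bar>" "{}" c] fi[OF elim] Zi c by simp
        finally show ?case .
      qed
    qed simp
  qed
  have fwd_int: "is_forward_integral T M W v Z" unfolding is_forward_integral_def using vL Zm prob by blast
  have "is_forward_integral T M W v (forward_integral T M W v)"
    unfolding forward_integral_def 
    using someI[of "is_forward_integral T M W v", OF fwd_int] .
  then have F: "forward_integral T M W v \<in> borel_measurable M" "tendsto_prob M (forward_approx T W v) (forward_integral T M W v) (at_right 0)"
    unfolding is_forward_integral_def by blast+
  have "\<forall>\<^sub>F \<epsilon> in at_right 0. forward_approx T W v \<epsilon> \<in> borel_measurable M"
    using pos by eventually_elim (rule borel_measurable_integrable[OF fi])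
  from tendsto_prob_unique[OF _ this F(1) Zm F(2) prob]
  have FZ: "AE \<omega> in M. forward_integral T M W v \<omega> = Z \<omega>" by simp
  have "is_skorohod_integral T M W v (skorohod_integral T M W v)"
    unfolding skorohod_integral_def 
    using someI[of "is_skorohod_integral T M W v", OF Y] .
  from skorohod_unique[OF this Y] have SY: "AE \<omega> in M. skorohod_integral T M W v \<omega> = Y \<omega>" .
  have "AE \<omega> in M. forward_integral T M W v \<omega> = skorohod_integral T M W v \<omega> + (LBINT s:{0..r}. Dm s \<omega>)"
    using FZ SY by eventually_elim (simp add: Z_def)
  moreover have "v \<in> Dom_forward T M W 1" unfolding Dom_forward_def using fwd_int conv1 Zi by (auto simp: Lp1_iff)
  moreover have "v \<in> Dom_skorohod T M W" unfolding Dom_skorohod_def using Y by blast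
  ultimately show "cutoff u r \<in> Dom_forward T M W 1 \<and> cutoff u r \<in> Dom_skorohod T M W \<and>
    (AE \<omega> in M. forward_integral T M W (cutoff u r) \<omega> = skorohod_integral T M W (cutoff u r) \<omega> + (LBINT s:{0..r}. Dm s \<omega>))"
    unfolding v_def by blast
qed

end
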